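(* Let $0\to E_1\xrightarrow{\alpha}E_2\xrightarrow{\beta}E_3\to0$ be an admissible triple of complete $C_2$-spaces over $\mathbb F_q$, $E_m=(I_m,F_m,V_m)$, with order-preserving maps $\gamma:I_2\to I_3$, $\beta(F_2(i))=F_3(\gamma(i))$, and $\varepsilon:I_2\to I_1$, $F_2(i)\cap V_1=F_1(\varepsilon(i))$, and let $0\to\check E_3\xrightarrow{\check\beta}\check E_2\xrightarrow{\check\alpha}\check E_1\to0$ be the dual admissible triple. Let $o\in I_2$. The Fourier transform $\mathbf F$ and the direct and inverse images satisfy the following (commutative diagrams): 1. If $E_1$ is a $cC_2$-space: $\mathbf F(\beta_*(f\otimes\mu))=\check\beta^*(\mathbf F(f)\otimes\mu)$ in $\mathcal D_{F_3^0(\gamma(o))}(\check E_3)$ for $f\in\mathcal D_{F_2(o)}(E_2)$, $\mu\in\mu(F_1(\varepsilon(o))\mid V_1)=\mu(F_1^0(\varepsilon(o))\mid\{0\})$. 2. If $E_3$ is a $dC_2$-space: $\mathbf F(\alpha^*(f\otimes\nu))=\check\alpha_*(\mathbf F(f)\otimes\nu)$ in $\mathcal D_{F_1^0(\varepsilon(o))}(\check E_1)$ for $f\in\mathcal D_{F_2(o)}(E_2)$, $\nu\in\mu(F_3(\gamma(o))\mid\{0\})=\mu(F_3^0(\gamma(o))\mid\check V_3)$. 3. If $E_1$ is a $cC_2$-space: $\mathbf F(\beta^*(G\otimes\mu))=\check\beta_*(\mathbf F(G)\otimes\mu)$ in $\mathcal D'_{F_2^0(o)}(\check E_2)$ for $G\in\mathcal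 D'_{F_3(\gamma(o))}(E_3)$, $\mu\in\mu(F_1(\varepsilon(o))\mid V_1)$. 4. If $E_3$ is a $dC_2$-space: $\mathbf F(\alpha_*(G\otimes\nu))=\check\alpha^*(\mathbf F(G)\otimes\nu)$ in $\mathcal D'_{F_2^0(o)}(\check E_2)$ for $G\in\mathcal D'_{F_1(\varepsilon(o))}(E_1)$, $\nu\in\mu(F_3(\gamma(o))\mid\{0\})$. 5. If $E_1$ is a $cfC_2$-space: $\mathbf F\circ\beta^*=\check\beta_*\circ\mathbf F$ as maps $\mathcal D_{F_3(\gamma(o))}(E_3)\to\mathcal D_{F_2^0(o)}(\check E_2)$. 6. If $E_3$ is a $dfC_2$-space: $\mathbf F\circ\alpha_*=\check\alpha^*\circ\mathbf F$ as maps $\mathcal D_{F_1(\varepsilon(o))}(E_1)\to\mathcal D_{F_2^0(o)}(\check E_2)$. 7. If $E_1$ is a $cfC_2$-space: $\mathbf F\circ\beta_*=\check\beta^*\circ\mathbf F$ as maps $\mathcal D'_{F_2(o)}(E_2)\to\mathcal D'_{F_3^0(\gamma(o))}(\check E_3)$. 8. If $E_3$ is a $dfC_2$-space: $\mathbf F\circ\alpha^*=\check\alpha_*\circ\mathbf F$ as maps $\mathcal D'_{F_2(o)}(E_2)\to\mathcal D'_{F_1^0(\varepsilon(o))}(\check E_1)$.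
   Context: Fix a finite field $\mathbb F_q$ and a nontrivial character $\psi:\mathbb F_q\to\mathbb C^*$. Vector spaces on which filtrations are considered are over $\mathbb F_q$. **$C_1$-spaces.** A filtered vector space $(I,F,V)$: a vector space $V$, a partially ordered set $I$ such that for all $i,j\in I$ there are $k,l\in I$ with $k\le i\le l$, $k\le j\le l$, and a map $F$ from $I$ to subspaces of $V$ with $F(i)\subset F(j)$ for $i\le j$, $\bigcap F(i)=0$, $\bigcup F(i)=V$. It is a $C_1$-space if all $F(j)/F(i)$, $i\le j$, are finite-dimensional; complete if $V\to\varinjlim_i\varprojlim_{j\le i}F(i)/F(j)$ is an isomorphism; compact if $F(i)=V$ for some $i$; discrete if $F(j)=0$ for some $j$. $(I_1,F_1,V)$ dominates $(I_2,F_2,V)$ if there is an order-preserving $\phi:I_2\to I_1$ with $F_1(\phi(i))=F_2(i)$ and for each $j\in I_1$ there are $i_1,i_2\in I_2$ with $\phi(i_1)\le j\le\phi(i_2)$. An admissible triple $0\to E_1\xrightarrow{\alpha}E_2\xrightarrow{\beta}E_3\to0$ of $C_1$-spaces is an exact sequence of the underlying vector spaces such that $(I_1,F_1,V_1)$ dominates $(I_2,F_1',V_1)$ with $F_1'(i)=F_2(i)\cap V_1$, $(I_3,F_3,V_3)$ dominates $(I_2,F_3',V_3)$ with $F_3'(i)=\beta(F_2(i))$, and the induced sequences of quotients $F_1'(j)/F_1'(i)$, $F_2(j)/F_2(i)$, $F_3'(j)/F_3'(i)$ are exact. Dual: $\check E=(I^0,F^0,\check V)$, $\check V=\bigcup F(i)^\perp\subset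 V^*$, $F^0(i)=F(i)^\perp$, $I^0$ = $I$ with reversed order. For a $C_1$-space $E=(I,F,V)$: $\mathcal D(E)$ = functions $V\to\mathbb C$ supported in some $F(j)$ and invariant under translations by some $F(i)$; $\mathcal D'(E)=\mathcal D(E)^*$; $\mu(E)\subset\mathcal D'(E)$ = one-dimensional space of translation-invariant elements; $\mu(F(i)):=\mu(\mathbf 1_{F(i)})$. Canonically $\mu(E)\otimes\mu(\check E)=\mathbb C$ for $E$ complete, where $\mu^{-1}(F(i)^\perp)=\mu(F(i))^{-1}$. For an admissible triple, $\mu(E_1)\otimes\mu(E_3)=\mu(E_2)$ via $(\mu_1\otimes\mu_3)(F_2(j))=\mu_1(F_2(j)\cap V_1)\mu_3(\beta(F_2(j)))$; $\alpha^*:\mathcal D(E_2)\to\mathcal D(E_1)$ is $f\mapsto f\circ\alpha$; $\beta_*:\mathcal D(E_2)\otimes\mu(E_1)\to\mathcal D(E_3)$ is $\beta_*(f\otimes\mu_1)(w)=\mu_1(v_1\mapsto f(w'+\alpha(v_1)))$, $w'\in\beta^{-1}(w)$; if $E_1$ is compact, $\beta^*:\mathcal D(E_3)\to\mathcal D(E_2)$ is $g\mapsto g\circ\beta$; if $E_3$ is discrete, $\alpha_*:\mathcal D(E_1)\to\mathcal D(E_2)$ is extension by zero. On $\mathcal D'$ one has the conjugate maps. For complete $E$: $\mathbf F_\mu:\mathcal D(E)\to\mathcal D(\check E)$, $\mathbf F_\mu(f)(w)=\mu(v\mapsto f(v)\overline{\psi(w(v))})$; for $\mu\neq0$, $\mathbf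 F_{\mu^{-1}}:\mathcal D'(E)\to\mathcal D'(\check E)$, $\mathbf F_{\mu^{-1}}(G)(f)=G(\mathbf F_{\mu^{-1}}f)$. **$C_2$-spaces.** A $C_2$-space is a filtered vector space $E=(I,F,V)$ together with, for all $i\le j$, a $C_1$-space structure $E_{i,j}$ on $F(j)/F(i)$ such that $0\to E_{i,j}\to E_{i,k}\to E_{j,k}\to0$ is an admissible triple of $C_1$-spaces for all $i\le j\le k$. It is complete if all $E_{i,j}$ are complete and $V=\varinjlim_i\varprojlim_{j\le i}F(i)/F(j)$; a $cC_2$-space if $F(i)=V$ for some $i$; a $dC_2$-space if $F(j)=0$ for some $j$; a $cfC_2$-space if all $E_{i,j}$ are compact; a $dfC_2$-space if all $E_{i,j}$ are discrete. An admissible triple of $C_2$-spaces $0\to E_1\xrightarrow{\alpha}E_2\xrightarrow{\beta}E_3\to 0$ is an exact sequence of vector spaces such that $(I_1,F_1,V_1)$ dominates $(I_2,F_2(i)\cap V_1,V_1)$, $(I_3,F_3,V_3)$ dominates $(I_2,\beta(F_2(i)),V_3)$ (as filtered spaces), giving $\varepsilon$ and $\gamma$, and such that $0\to F_1(\varepsilon(j))/F_1(\varepsilon(i))\to F_2(j)/F_2(i)\to F_3(\gamma(j))/F_3(\gamma(i))\to0$ is an admissible triple of $C_1$-spaces for $i\le j\in I_2$. Dual: $\check E=(I^0,F^0,\check V)$ with $\check V=\varinjlim_{j\in I}\varprojlim_{i\ge j}\check E_{j,i}\subset V^*$, $F^0(j)=\varprojlim_{i\ge j}\check E_{j,i}$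 (the elements of $\check V$ vanishing on $F(j)$), and for $j\le i$ in $I$ the $C_1$-space $F^0(j)/F^0(i)$ is $\check E_{j,i}$. In the dual triple, $\check\alpha(F_2^0(i))=F_1^0(\varepsilon(i))$, $F_2^0(i)\cap\check V_3=F_3^0(\gamma(i))$. Duality interchanges $cC_2$ with $dC_2$ and $cfC_2$ with $dfC_2$. **Virtual measures.** $\mu(F(i)\mid F(j))=\varinjlim_{l\le i,\,l\le j}\mathrm{Hom}_{\mathbb C}(\mu(F(i)/F(l)),\mu(F(j)/F(l)))$, a one-dimensional $\mathbb C$-space; for $l'\le l$ the (iso) transition map sends $f$ to $f'(a\otimes c)=f(a)\otimes c$ using $\mu(F(i)/F(l'))=\mu(F(i)/F(l))\otimes\mu(F(l)/F(l'))$ and likewise for $j$. Composition gives canonical isomorphisms $\mu(F(i)\mid F(j))\otimes\mu(F(j)\mid F(l))=\mu(F(i)\mid F(l))$; also $\mu(F(j)\mid F(i))=\mu(F(i)\mid F(j))^*$, $\mu(F(i)\mid F(j))=\mu(F(j)/F(i))$ for $i\le j$, and canonically $\mu(F(i)\mid F(j))=\mu(F^0(i)\mid F^0(j))$ (from $\mu(E_{i,j})^*=\mu(\check E_{i,j})$). For an admissible triple, (M) $\mu(F_2(i)\mid F_2(j))=\mu(F_1(\varepsilon(i))\mid F_1(\varepsilon(j)))\otimes\mu(F_3(\gamma(i))\mid F_3(\gamma(j)))$. For a $cfC_2$-space (resp. $dfC_2$-space) each $\mu(F(i)\mid F(j))$ is identified with $\mathbb C$ by the multiplicative system which for $i\le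 j$ is the invariant measure on $F(j)/F(i)$ of total mass 1 (resp. giving mass 1 to $\{0\}$). **Spaces.** For $o\in I$: $\mathcal D_{F(o)}(E)=\varprojlim_i\varprojlim_l\mathcal D(F(i)/F(l))\otimes\mu(F(l)\mid F(o))$ over $i\ge l$, with transition maps, for $i\ge j\ge l$, the restriction $\mathcal D(F(i)/F(l))\otimes\mu(F(l)\mid F(o))\to\mathcal D(F(j)/F(l))\otimes\mu(F(l)\mid F(o))$ and the pushforward to $\mathcal D(F(i)/F(j))\otimes\mu(F(j)\mid F(o))$ (using $\mu(F(l)\mid F(o))=\mu(F(j)/F(l))\otimes\mu(F(j)\mid F(o))$). $\mathcal D'_{F(o)}(E)=\varinjlim_i\varinjlim_l\mathcal D'(F(i)/F(l))\otimes\mu(F(o)\mid F(l))$ with the conjugate transition maps. The level-wise pairings induce a nondegenerate pairing between $\mathcal D_{F(o)}(E)$ and $\mathcal D'_{F(o)}(E)$. **Fourier transform** ($E$ complete): $\mathbf F:\mathcal D_{F(o)}(E)\to\mathcal D_{F^0(o)}(\check E)$ is the projective limit of $\mathcal D(F(i)/F(j))\otimes\mu(F(j)\mid F(o))\to\mathcal D(F^0(j)/F^0(i))\otimes\mu(F^0(i)\mid F^0(o))$, $f\otimes(\rho\otimes\lambda)\mapsto\mathbf F_\rho(f)\otimes\lambda$ ($\rho\in\mu(F(i)/F(j))=\mu(F(j)\mid F(i))$, $\lambda\in\mu(F(i)\mid F(o))$); $\mathbf F:\mathcal D'_{F(o)}(E)\to\mathcal D'_{F^0(o)}(\check E)$ is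 the inductive limit of $\mathcal D'(F(i)/F(j))\otimes\mu(F(o)\mid F(j))\to\mathcal D'(F^0(j)/F^0(i))\otimes\mu(F^0(o)\mid F^0(i))$, $G\otimes(\lambda\otimes\rho^{-1})\mapsto\mathbf F_{\rho^{-1}}(G)\otimes\lambda$ ($\lambda\in\mu(F(o)\mid F(i))$, $0\ne\rho\in\mu(F(i)/F(j))$, $\rho^{-1}\in\mu(F(i)\mid F(j))$). **Direct and inverse images for $C_2$-spaces.** Let $o\in I_2$. (a) $E_1$ a $cC_2$-space: $\beta_*:\mathcal D_{F_2(o)}(E_2)\otimes\mu(F_1(\varepsilon(o))\mid V_1)\to\mathcal D_{F_3(\gamma(o))}(E_3)$ is the projective limit over $i\ge k\ge j$ in $I_2$ ($k$ fixed with $F_1(\varepsilon(k))=V_1$) of the one-dimensional $\beta_*$ maps $\mathcal D(F_2(i)/F_2(j))\otimes\mu(F_1(\varepsilon(j))\mid V_1)\to\mathcal D(F_3(\gamma(i))/F_3(\gamma(j)))$ tensored with $\mu(F_3(\gamma(j))\mid F_3(\gamma(o)))$, using that by (M) $\mu(F_1(\varepsilon(j))\mid V_1)\otimes\mu(F_3(\gamma(j))\mid F_3(\gamma(o)))=\mu(F_2(j)\mid F_2(o))\otimes\mu(F_1(\varepsilon(o))\mid V_1)$. $\beta^*:\mathcal D'_{F_3(\gamma(o))}(E_3)\otimes\mu(F_1(\varepsilon(o))\mid V_1)\to\mathcal D'_{F_2(o)}(E_2)$ is its conjugate. (b) $E_3$ a $dC_2$-space: $\alpha^*:\mathcal D_{F_2(o)}(E_2)\otimes\mu(F_3(\gamma(o))\mid\{0\})\to\mathcal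 D_{F_1(\varepsilon(o))}(E_1)$ is the projective limit over $i\ge k\ge j$ ($k$ fixed with $F_3(\gamma(k))=\{0\}$) of the restriction maps $\mathcal D(F_2(i)/F_2(j))\to\mathcal D(F_1(\varepsilon(i))/F_1(\varepsilon(j)))$ tensored with $\mu(F_1(\varepsilon(j))\mid F_1(\varepsilon(o)))=\mu(F_2(j)\mid F_2(o))\otimes\mu(F_3(\gamma(o))\mid\{0\})$. $\alpha_*:\mathcal D'_{F_1(\varepsilon(o))}(E_1)\otimes\mu(F_3(\gamma(o))\mid\{0\})\to\mathcal D'_{F_2(o)}(E_2)$ is its conjugate. (c) $E_1$ a $cfC_2$-space: using $\mu(F_1(\varepsilon(i))\mid F_1(\varepsilon(j)))=\mathbb C$ and (M), $\beta^*:\mathcal D_{F_3(\gamma(o))}(E_3)\to\mathcal D_{F_2(o)}(E_2)$ is the projective limit over $i\ge j$ of the one-dimensional maps $\beta^*:\mathcal D(F_3(\gamma(i))/F_3(\gamma(j)))\to\mathcal D(F_2(i)/F_2(j))$ tensored with $\mu(F_2(j)\mid F_2(o))=\mu(F_3(\gamma(j))\mid F_3(\gamma(o)))$; $\beta_*:\mathcal D'_{F_2(o)}(E_2)\to\mathcal D'_{F_3(\gamma(o))}(E_3)$ is its conjugate. (d) $E_3$ a $dfC_2$-space: using $\mu(F_3(\gamma(i))\mid F_3(\gamma(j)))=\mathbb C$ and (M), $\alpha_*:\mathcal D_{F_1(\varepsilon(o))}(E_1)\to\mathcal D_{F_2(o)}(E_2)$ is the projective limit over $i\ge j$ of the extension-by-zero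 maps $\mathcal D(F_1(\varepsilon(i))/F_1(\varepsilon(j)))\to\mathcal D(F_2(i)/F_2(j))$ tensored with $\mu(F_2(j)\mid F_2(o))=\mu(F_1(\varepsilon(j))\mid F_1(\varepsilon(o)))$; $\alpha^*:\mathcal D'_{F_2(o)}(E_2)\to\mathcal D'_{F_1(\varepsilon(o))}(E_1)$ is its conjugate. The maps $\check\alpha^*,\check\alpha_*,\check\beta^*,\check\beta_*$ are those of the dual triple (in which $\check\beta$ is the monomorphism and $\check\alpha$ the epimorphism). *)

theory Defs
  imports Complex_Main "HOL-Library.Function_Algebras" "HOL-Library.Indicator_Function"
begin

section \<open>Filtered vector spaces\<close>

text \<open>
  Conventions. The finite field is a type \<open>'k::{field,finite}\<close>; a vector space is a type
  \<open>'v::ab_group_add\<close> with a scalar multiplication \<open>s :: 'k \<Rightarrow> 'v \<Rightarrow> 'v\<close> such that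
  \<open>vector_space s\<close>.

  Most filtered spaces in play live on quotients \<open>F(j)/F(i)\<close>. A quotient \<open>A/B\<close> of subspaces of
  an ambient space \<open>'v\<close> is handled through preimages: a subspace of \<open>A/B\<close> is a subspace of \<open>'v\<close>
  between \<open>B\<close> and \<open>A\<close>; a function on \<open>A/B\<close> is a function on \<open>'v\<close> which is \<open>B\<close>-invariant and
  vanishes outside \<open>A\<close>; a linear map \<open>A/B \<rightarrow> A'/B'\<close> is given by a linear map of the ambient spaces.

  The record below is a filtered vector space \<open>(I, F, V)\<close> with \<open>V = carr E / nul E\<close>,
  so that \<open>\<Union>F(i) = V\<close> and \<open>\<Inter>F(i) = 0\<close> hold in \<open>V\<close> by construction.
\<close>

record ('i, 'v) filt =
  idx :: "'i set"
  le :: "'i rel"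
  fil :: "'i \<Rightarrow> 'v set"

definition carr :: "('i, 'v, 'z) filt_scheme \<Rightarrow> 'v set" where
  "carr E = (\<Union>i\<in>idx E. fil E i)"

definition nul :: "('i, 'v, 'z) filt_scheme \<Rightarrow> 'v set" where
  "nul E = (\<Inter>i\<in>idx E. fil E i)"

definition filtered :: "('k::field \<Rightarrow> 'v::ab_group_add \<Rightarrow> 'v) \<Rightarrow> ('i, 'v, 'z) filt_scheme \<Rightarrow> bool" where
  "filtered s E \<longleftrightarrow>
     partial_order_on (idx E) (le E) \<and>
     idx E \<noteq> {} \<and>
     (\<forall>i\<in>idx E. \<forall>j\<in>idx E.
        \<exists>k l. (k, i) \<in> le E \<and> (i, l) \<in> le E \<and> (k, j) \<in> le E \<and> (j, l) \<in> le E) \<and>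
     (\<forall>i\<in>idx E. module.subspace s (fil E i)) \<and>
     (\<forall>(i, j)\<in>le E. fil E i \<subseteq> fil E j)"

definition compact_filt :: "('i, 'v, 'z) filt_scheme \<Rightarrow> bool" where
  "compact_filt E \<longleftrightarrow> (\<exists>i\<in>idx E. fil E i = carr E)"

definition discrete_filt :: "('i, 'v, 'z) filt_scheme \<Rightarrow> bool" where
  "discrete_filt E \<longleftrightarrow> (\<exists>i\<in>idx E. fil E i = nul E)"

text \<open>
  Completeness is bijectivity of \<open>V \<rightarrow> lim\<^sub>i lim\<^sub>j\<^sub>\<le>\<^sub>i F(i)/F(j)\<close> (inductive limit over \<open>i\<close>, projective
  limit over \<open>j\<close>). Injectivity is automatic from \<open>\<Inter>F(i) = 0\<close>; the formula below is surjectivity: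
  \<open>x\<close> represents an element of the projective limit at \<open>i\<close>, and \<open>v \<in> F(i')\<close> has the same image as
  \<open>x\<close> in the projective limit at some \<open>i' \<ge> i\<close>.
\<close>

definition complete_filt :: "('i, 'v::ab_group_add, 'z) filt_scheme \<Rightarrow> bool" where
  "complete_filt E \<longleftrightarrow>
     (\<forall>i\<in>idx E. \<forall>x.
        (\<forall>j. (j, i) \<in> le E \<longrightarrow> x j \<in> fil E i) \<and>
        (\<forall>j k. (j, k) \<in> le E \<and> (k, i) \<in> le E \<longrightarrow> x j - x k \<in> fil E k) \<longrightarrow>
        (\<exists>v\<in>carr E. \<exists>i'. (i, i') \<in> le E \<and> v \<in> fil E i' \<and>
           (\<forall>j k. (j, i') \<in> le E \<and> (k, i) \<in> le E \<and> (k, j) \<in> le E \<longrightarrow> v - x k \<in> fil E j)))"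

definition dominates_via ::
  "('j \<Rightarrow> 'i) \<Rightarrow> ('i, 'v, 'y) filt_scheme \<Rightarrow> ('j, 'v, 'z) filt_scheme \<Rightarrow> bool" where
  "dominates_via \<phi> E1 E2 \<longleftrightarrow>
     (\<forall>i\<in>idx E2. \<phi> i \<in> idx E1 \<and> fil E1 (\<phi> i) = fil E2 i) \<and>
     (\<forall>(i, j)\<in>le E2. (\<phi> i, \<phi> j) \<in> le E1) \<and>
     (\<forall>j\<in>idx E1. \<exists>i1\<in>idx E2. \<exists>i2\<in>idx E2. (\<phi> i1, j) \<in> le E1 \<and> (j, \<phi> i2) \<in> le E1)"

text \<open>The filtrations induced from the middle term on the subspace and on the quotient space.\<close>

definition sub_filt ::
  "('v1 \<Rightarrow> 'v2) \<Rightarrow> ('i, 'v1, 'y) filt_scheme \<Rightarrow> ('j, 'v2, 'z) filt_scheme \<Rightarrow> ('j, 'v1) filt" where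
  "sub_filt \<alpha> E1 E2 = \<lparr>idx = idx E2, le = le E2, fil = (\<lambda>i. {x\<in>carr E1. \<alpha> x \<in> fil E2 i})\<rparr>"

definition quot_filt ::
  "('v2 \<Rightarrow> 'v3::ab_group_add) \<Rightarrow> ('j, 'v2, 'z) filt_scheme \<Rightarrow> ('i, 'v3, 'y) filt_scheme \<Rightarrow>
   ('j, 'v3) filt" where
  "quot_filt \<beta> E2 E3 =
     \<lparr>idx = idx E2, le = le E2, fil = (\<lambda>i. {y\<in>carr E3. \<exists>x\<in>fil E2 i. y - \<beta> x \<in> nul E3})\<rparr>"

text \<open>Exactness of \<open>0 \<rightarrow> A1/B1 \<rightarrow> A2/B2 \<rightarrow> A3/B3 \<rightarrow> 0\<close>.\<close>

definition exact_triple ::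
  "('v1 \<Rightarrow> 'v2::ab_group_add) \<Rightarrow> ('v2 \<Rightarrow> 'v3::ab_group_add) \<Rightarrow> 'v1 set \<Rightarrow> 'v1 set \<Rightarrow>
   'v2 set \<Rightarrow> 'v2 set \<Rightarrow> 'v3 set \<Rightarrow> 'v3 set \<Rightarrow> bool" where
  "exact_triple \<alpha> \<beta> A1 B1 A2 B2 A3 B3 \<longleftrightarrow>
     \<alpha> ` A1 \<subseteq> A2 \<and> (\<forall>x\<in>A1. \<alpha> x \<in> B2 \<longleftrightarrow> x \<in> B1) \<and>
     \<beta> ` A2 \<subseteq> A3 \<and> \<beta> ` B2 \<subseteq> B3 \<and> (\<forall>y\<in>A3. \<exists>x\<in>A2. y - \<beta> x \<in> B3) \<and>
     (\<forall>x\<in>A2. \<beta> x \<in> B3 \<longleftrightarrow> (\<exists>x1\<in>A1. x - \<alpha> x1 \<in> B2))"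

definition annih :: "('k::field \<Rightarrow> 'v::ab_group_add \<Rightarrow> 'v) \<Rightarrow> 'v set \<Rightarrow> ('v \<Rightarrow> 'k) set" where
  "annih s S = {w. Vector_Spaces.linear s (*) w \<and> (\<forall>v\<in>S. w v = 0)}"


section \<open>\<open>C\<^sub>1\<close>-spaces\<close>

definition C1_space :: "('k::field \<Rightarrow> 'v::ab_group_add \<Rightarrow> 'v) \<Rightarrow> ('i, 'v, 'z) filt_scheme \<Rightarrow> bool" where
  "C1_space s E \<longleftrightarrow>
     filtered s E \<and>
     (\<forall>(i, j)\<in>le E. \<exists>S. finite S \<and> fil E j = module.span s (fil E i \<union> S))"

text \<open>
  A triple \<open>sub \<rightarrow> mid \<rightarrow> quo\<close>; \<open>emb\<close> and \<open>epi\<close> are the maps \<open>\<alpha>\<close> and \<open>\<beta>\<close>. The same record serves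
  for \<open>C\<^sub>1\<close>- and \<open>C\<^sub>2\<close>-spaces.
\<close>

record ('e1, 'v1, 'e2, 'v2, 'e3, 'v3) triple =
  emb :: "'v1 \<Rightarrow> 'v2"
  epi :: "'v2 \<Rightarrow> 'v3"
  sub :: 'e1
  mid :: 'e2
  quo :: 'e3

type_synonym ('a1, 'v1, 'a2, 'v2, 'a3, 'v3) c1_triple =
  "(('a1, 'v1) filt, 'v1, ('a2, 'v2) filt, 'v2, ('a3, 'v3) filt, 'v3) triple"

definition admissible1 ::
  "('k::field \<Rightarrow> 'v1::ab_group_add \<Rightarrow> 'v1) \<Rightarrow> ('k \<Rightarrow> 'v2::ab_group_add \<Rightarrow> 'v2) \<Rightarrow>
   ('k \<Rightarrow> 'v3::ab_group_add \<Rightarrow> 'v3) \<Rightarrow> ('a1, 'v1, 'a2, 'v2, 'a3, 'v3) c1_triple \<Rightarrow> bool" where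
  "admissible1 s1 s2 s3 t \<longleftrightarrow>
     C1_space s1 (sub t) \<and> C1_space s2 (mid t) \<and> C1_space s3 (quo t) \<and>
     Vector_Spaces.linear s1 s2 (emb t) \<and> Vector_Spaces.linear s2 s3 (epi t) \<and>
     exact_triple (emb t) (epi t) (carr (sub t)) (nul (sub t))
       (carr (mid t)) (nul (mid t)) (carr (quo t)) (nul (quo t)) \<and>
     (\<exists>\<phi>. dominates_via \<phi> (sub t) (sub_filt (emb t) (sub t) (mid t))) \<and>
     (\<exists>\<phi>. dominates_via \<phi> (quo t) (quot_filt (epi t) (mid t) (quo t))) \<and>
     (\<forall>(i, j)\<in>le (mid t).
        exact_triple (emb t) (epi t)
          (fil (sub_filt (emb t) (sub t) (mid t)) j) (fil (sub_filt (emb t) (sub t) (mid t)) i)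
          (fil (mid t) j) (fil (mid t) i)
          (fil (quot_filt (epi t) (mid t) (quo t)) j) (fil (quot_filt (epi t) (mid t) (quo t)) i))"

text \<open>
  The dual \<open>C\<^sub>1\<close>-space. A functional on \<open>carr E / nul E\<close> is represented by its extensions to the
  ambient space, two extensions being identified when they agree on \<open>carr E\<close>: indeed
  \<open>nul (dual1 s E)\<close> consists of the functionals vanishing on \<open>carr E\<close>.
\<close>

definition dual1 :: "('k::field \<Rightarrow> 'v::ab_group_add \<Rightarrow> 'v) \<Rightarrow> ('i, 'v, 'z) filt_scheme \<Rightarrow>
    ('i, 'v \<Rightarrow> 'k) filt" where
  "dual1 s E = \<lparr>idx = idx E, le = (le E)\<inverse>, fil = (\<lambda>i. annih s (fil E i))\<rparr>"


subsection \<open>Functions, distributions, measures\<close>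

type_synonym 'v dist = "('v \<Rightarrow> complex) \<Rightarrow> complex"

definition test_fun :: "('i, 'v::ab_group_add, 'z) filt_scheme \<Rightarrow> ('v \<Rightarrow> complex) set" where
  "test_fun E =
     {f. (\<exists>j\<in>idx E. \<forall>v. f v \<noteq> 0 \<longrightarrow> v \<in> fil E j) \<and>
         (\<exists>i\<in>idx E. \<forall>v. \<forall>u\<in>fil E i. f (v + u) = f v)}"

text \<open>Linear functionals on \<open>test_fun E\<close>, set to 0 outside \<open>test_fun E\<close>.\<close>

definition distr :: "('i, 'v::ab_group_add, 'z) filt_scheme \<Rightarrow> 'v dist set" where
  "distr E =
     {G. (\<forall>f\<in>test_fun E. \<forall>g\<in>test_fun E. G (f + g) = G f + G g) \<and>
         (\<forall>f\<in>test_fun E. \<forall>c. G (\<lambda>v. c * f v) = c * G f) \<and>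
         (\<forall>f. f \<notin> test_fun E \<longrightarrow> G f = 0)}"

definition meas :: "('i, 'v::ab_group_add, 'z) filt_scheme \<Rightarrow> 'v dist set" where
  "meas E = {m\<in>distr E. \<forall>f\<in>test_fun E. \<forall>a\<in>carr E. m (\<lambda>v. f (v + a)) = m f}"

definition unit_mass :: "('i, 'v::ab_group_add, 'z) filt_scheme \<Rightarrow> 'v set \<Rightarrow> 'v dist" where
  "unit_mass E S = (THE m. m \<in> meas E \<and> m (indicator S) = 1)"

text \<open>The identification \<open>\<mu>(E\<^sub>1) \<otimes> \<mu>(E\<^sub>3) = \<mu>(E\<^sub>2)\<close>.\<close>

definition meas_prod ::
  "('a1, 'v1::ab_group_add, 'a2, 'v2::ab_group_add, 'a3, 'v3::ab_group_add) c1_triple \<Rightarrow>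
   'v1 dist \<Rightarrow> 'v3 dist \<Rightarrow> 'v2 dist" where
  "meas_prod t m1 m3 =
     (THE m. m \<in> meas (mid t) \<and>
        (\<forall>j\<in>idx (mid t). m (indicator (fil (mid t) j)) =
           m1 (indicator (fil (sub_filt (emb t) (sub t) (mid t)) j)) *
           m3 (indicator (fil (quot_filt (epi t) (mid t) (quo t)) j))))"

text \<open>For \<open>0 \<noteq> m \<in> \<mu>(E)\<close>, the inverse \<open>m\<^sup>-\<^sup>1 \<in> \<mu>(E\<^sup>\<or>)\<close>, where \<open>E\<^sup>\<or>\<close> denotes the dual.\<close>

definition meas_inv :: "('k::field \<Rightarrow> 'v::ab_group_add \<Rightarrow> 'v) \<Rightarrow> ('i, 'v, 'z) filt_scheme \<Rightarrow>
    'v dist \<Rightarrow> ('v \<Rightarrow> 'k) dist" where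
  "meas_inv s E m =
     (THE n. n \<in> meas (dual1 s E) \<and>
        (\<forall>i\<in>idx E. n (indicator (annih s (fil E i))) = inverse (m (indicator (fil E i)))))"


subsection \<open>Direct and inverse images, Fourier transform\<close>

text \<open>\<open>\<alpha>\<^sup>*\<close>\<close>
definition mono_pull ::
  "('a1, 'v1, 'a2, 'v2, 'a3, 'v3) c1_triple \<Rightarrow> ('v2 \<Rightarrow> complex) \<Rightarrow> 'v1 \<Rightarrow> complex" where
  "mono_pull t f = (\<lambda>v. if v \<in> carr (sub t) then f (emb t v) else 0)"

text \<open>\<open>\<beta>\<^sub>*\<close>\<close>
definition epi_push ::
  "('a1, 'v1, 'a2, 'v2::ab_group_add, 'a3, 'v3::ab_group_add) c1_triple \<Rightarrow>
   ('v2 \<Rightarrow> complex) \<Rightarrow> 'v1 dist \<Rightarrow> 'v3 \<Rightarrow> complex" where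
  "epi_push t f m = (\<lambda>w. if w \<in> carr (quo t) then
       (let w' = (SOME w'. w' \<in> carr (mid t) \<and> epi t w' - w \<in> nul (quo t))
        in m (\<lambda>v. if v \<in> carr (sub t) then f (w' + emb t v) else 0))
     else 0)"

text \<open>\<open>\<beta>\<^sup>*\<close>, used for compact \<open>E\<^sub>1\<close>\<close>
definition epi_pull ::
  "('a1, 'v1, 'a2, 'v2, 'a3, 'v3) c1_triple \<Rightarrow> ('v3 \<Rightarrow> complex) \<Rightarrow> 'v2 \<Rightarrow> complex" where
  "epi_pull t g = (\<lambda>v. if v \<in> carr (mid t) then g (epi t v) else 0)"

text \<open>\<open>\<alpha>\<^sub>*\<close> (extension by zero), used for discrete \<open>E\<^sub>3\<close>\<close>
definition mono_push ::
  "('a1, 'v1, 'a2, 'v2::ab_group_add, 'a3, 'v3) c1_triple \<Rightarrow> ('v1 \<Rightarrow> complex) \<Rightarrow> 'v2 \<Rightarrow> complex" where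
  "mono_push t f = (\<lambda>v. if \<exists>x\<in>carr (sub t). v - emb t x \<in> nul (mid t)
     then f (SOME x. x \<in> carr (sub t) \<and> v - emb t x \<in> nul (mid t)) else 0)"

definition nontrivial_character :: "('k::field \<Rightarrow> complex) \<Rightarrow> bool" where
  "nontrivial_character \<psi> \<longleftrightarrow>
     (\<forall>x y. \<psi> (x + y) = \<psi> x * \<psi> y) \<and> (\<forall>x. \<psi> x \<noteq> 0) \<and> (\<exists>x. \<psi> x \<noteq> 1)"

definition fourier1 :: "('k::field \<Rightarrow> complex) \<Rightarrow> ('k \<Rightarrow> 'v::ab_group_add \<Rightarrow> 'v) \<Rightarrow>
    ('i, 'v, 'z) filt_scheme \<Rightarrow> 'v dist \<Rightarrow> ('v \<Rightarrow> complex) \<Rightarrow> ('v \<Rightarrow> 'k) \<Rightarrow> complex" where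
  "fourier1 \<psi> s E m f =
     (\<lambda>w. if w \<in> carr (dual1 s E) then m (\<lambda>v. f v * cnj (\<psi> (w v))) else 0)"

text \<open>
  The Fourier transform on the dual of a complete \<open>E\<close>, with values in functions on \<open>E\<close> itself:
  the double dual of \<open>E\<close> is identified with \<open>E\<close> by evaluation.
\<close>

definition fourier1_back :: "('k::field \<Rightarrow> complex) \<Rightarrow> ('i, 'v, 'z) filt_scheme \<Rightarrow>
    ('v \<Rightarrow> 'k) dist \<Rightarrow> (('v \<Rightarrow> 'k) \<Rightarrow> complex) \<Rightarrow> 'v \<Rightarrow> complex" where
  "fourier1_back \<psi> E n f =
     (\<lambda>v. if v \<in> carr E then n (\<lambda>w. f w * cnj (\<psi> (w v))) else 0)"

text \<open>\<open>n\<close> plays the role of \<open>\<mu>\<^sup>-\<^sup>1 \<in> \<mu>(E\<^sup>\<or>)\<close>.\<close>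
definition fourier1_dist :: "('k::field \<Rightarrow> complex) \<Rightarrow> ('k \<Rightarrow> 'v::ab_group_add \<Rightarrow> 'v) \<Rightarrow>
    ('i, 'v, 'z) filt_scheme \<Rightarrow> ('v \<Rightarrow> 'k) dist \<Rightarrow> 'v dist \<Rightarrow> ('v \<Rightarrow> 'k) dist" where
  "fourier1_dist \<psi> s E n G =
     (\<lambda>f. if f \<in> test_fun (dual1 s E) then G (fourier1_back \<psi> E n f) else 0)"


section \<open>\<open>C\<^sub>2\<close>-spaces\<close>

text \<open>\<open>lev E i j\<close>, for \<open>i \<le> j\<close>, is the \<open>C\<^sub>1\<close>-space on \<open>F(j)/F(i)\<close>.\<close>

record ('i, 'a, 'v) c2 = "('i, 'v) filt" +
  lev :: "'i \<Rightarrow> 'i \<Rightarrow> ('a, 'v) filt"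

text \<open>The triple \<open>0 \<rightarrow> E\<^sub>i\<^sub>,\<^sub>j \<rightarrow> E\<^sub>i\<^sub>,\<^sub>k \<rightarrow> E\<^sub>j\<^sub>,\<^sub>k \<rightarrow> 0\<close> for \<open>i \<le> j \<le> k\<close>.\<close>

definition lev_triple :: "('i, 'a, 'v) c2 \<Rightarrow> 'i \<Rightarrow> 'i \<Rightarrow> 'i \<Rightarrow> ('a, 'v, 'a, 'v, 'a, 'v) c1_triple" where
  "lev_triple E i j k = \<lparr>emb = id, epi = id, sub = lev E i j, mid = lev E i k, quo = lev E j k\<rparr>"

text \<open>The vector space \<open>V\<close> of a \<open>C\<^sub>2\<close>-space is the whole type \<open>'v\<close>.\<close>

definition C2_space :: "('k::field \<Rightarrow> 'v::ab_group_add \<Rightarrow> 'v) \<Rightarrow> ('i, 'a, 'v) c2 \<Rightarrow> bool" where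
  "C2_space s E \<longleftrightarrow>
     filtered s E \<and> carr E = UNIV \<and> nul E = {0} \<and>
     (\<forall>(i, j)\<in>le E. C1_space s (lev E i j) \<and>
        carr (lev E i j) = fil E j \<and> nul (lev E i j) = fil E i) \<and>
     (\<forall>i j k. (i, j) \<in> le E \<and> (j, k) \<in> le E \<longrightarrow> admissible1 s s s (lev_triple E i j k))"

definition complete_C2 :: "('i, 'a, 'v::ab_group_add) c2 \<Rightarrow> bool" where
  "complete_C2 E \<longleftrightarrow> (\<forall>(i, j)\<in>le E. complete_filt (lev E i j)) \<and> complete_filt E"

definition cC2 :: "('i, 'a, 'v) c2 \<Rightarrow> bool" where "cC2 E \<longleftrightarrow> compact_filt E"
definition dC2 :: "('i, 'a, 'v) c2 \<Rightarrow> bool" where "dC2 E \<longleftrightarrow> discrete_filt E"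
definition cfC2 :: "('i, 'a, 'v) c2 \<Rightarrow> bool" where
  "cfC2 E \<longleftrightarrow> (\<forall>(i, j)\<in>le E. compact_filt (lev E i j))"
definition dfC2 :: "('i, 'a, 'v) c2 \<Rightarrow> bool" where
  "dfC2 E \<longleftrightarrow> (\<forall>(i, j)\<in>le E. discrete_filt (lev E i j))"

text \<open>
  The dual. \<open>F\<^sup>0(j)\<close> is the projective limit over \<open>i \<ge> j\<close> of the duals of \<open>E\<^sub>j\<^sub>,\<^sub>i\<close>: a functional on
  \<open>V\<close> which for each \<open>i \<ge> j\<close> restricts to an element of the dual of \<open>E\<^sub>j\<^sub>,\<^sub>i\<close>. For \<open>j \<le> i\<close> the
  \<open>C\<^sub>1\<close>-space \<open>F\<^sup>0(j)/F\<^sup>0(i)\<close> is the dual of \<open>E\<^sub>j\<^sub>,\<^sub>i\<close>, which is taken as such: with the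
  representation chosen in \<open>dual1\<close>, the inclusion of \<open>F\<^sup>0(j)\<close> in \<open>carr (dual1 s (lev E j i))\<close> induces
  \<open>F\<^sup>0(j)/F\<^sup>0(i) \<rightarrow> dual of E\<^sub>j\<^sub>,\<^sub>i\<close>, and the maps between the levels are again induced by the identity.
\<close>

definition dual2 :: "('k::field \<Rightarrow> 'v::ab_group_add \<Rightarrow> 'v) \<Rightarrow> ('i, 'a, 'v) c2 \<Rightarrow>
    ('i, 'a, 'v \<Rightarrow> 'k) c2" where
  "dual2 s E =
     \<lparr>idx = idx E, le = (le E)\<inverse>,
      fil = (\<lambda>j. \<Inter>i\<in>{i. (j, i) \<in> le E}. carr (dual1 s (lev E j i))),
      lev = (\<lambda>i j. dual1 s (lev E j i))\<rparr>"


subsection \<open>Admissible triples\<close>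

record ('i1, 'a1, 'v1, 'i2, 'a2, 'v2, 'i3, 'a3, 'v3) c2_triple =
  "(('i1, 'a1, 'v1) c2, 'v1, ('i2, 'a2, 'v2) c2, 'v2, ('i3, 'a3, 'v3) c2, 'v3) triple" +
  eps :: "'i2 \<Rightarrow> 'i1"
  gam :: "'i2 \<Rightarrow> 'i3"

text \<open>For \<open>j \<le> i\<close>, the triple of \<open>C\<^sub>1\<close>-spaces formed by the quotients \<open>F\<^sub>m(i)/F\<^sub>m(j)\<close>.\<close>

definition level :: "('i1, 'a1, 'v1, 'i2, 'a2, 'v2, 'i3, 'a3, 'v3) c2_triple \<Rightarrow> 'i2 \<Rightarrow> 'i2 \<Rightarrow>
    ('a1, 'v1, 'a2, 'v2, 'a3, 'v3) c1_triple" where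
  "level T j i =
     \<lparr>emb = emb T, epi = epi T, sub = lev (sub T) (eps T j) (eps T i),
      mid = lev (mid T) j i, quo = lev (quo T) (gam T j) (gam T i)\<rparr>"

definition admissible2 ::
  "('k::field \<Rightarrow> 'v1::ab_group_add \<Rightarrow> 'v1) \<Rightarrow> ('k \<Rightarrow> 'v2::ab_group_add \<Rightarrow> 'v2) \<Rightarrow>
   ('k \<Rightarrow> 'v3::ab_group_add \<Rightarrow> 'v3) \<Rightarrow>
   ('i1, 'a1, 'v1, 'i2, 'a2, 'v2, 'i3, 'a3, 'v3) c2_triple \<Rightarrow> bool" where
  "admissible2 s1 s2 s3 T \<longleftrightarrow>
     C2_space s1 (sub T) \<and> C2_space s2 (mid T) \<and> C2_space s3 (quo T) \<and>
     Vector_Spaces.linear s1 s2 (emb T) \<and> Vector_Spaces.linear s2 s3 (epi T) \<and>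
     inj (emb T) \<and> surj (epi T) \<and> range (emb T) = {v. epi T v = 0} \<and>
     dominates_via (eps T) (sub T) (sub_filt (emb T) (sub T) (mid T)) \<and>
     dominates_via (gam T) (quo T) (quot_filt (epi T) (mid T) (quo T)) \<and>
     (\<forall>(i, j)\<in>le (mid T). admissible1 s1 s2 s3 (level T i j))"

text \<open>\<open>0 \<rightarrow> E\<^sub>3\<^sup>\<or> \<rightarrow> E\<^sub>2\<^sup>\<or> \<rightarrow> E\<^sub>1\<^sup>\<or> \<rightarrow> 0\<close>; the index maps \<open>\<epsilon>\<close> and \<open>\<gamma>\<close> change roles.\<close>

definition dual_triple ::
  "('k::field \<Rightarrow> 'v1::ab_group_add \<Rightarrow> 'v1) \<Rightarrow> ('k \<Rightarrow> 'v2::ab_group_add \<Rightarrow> 'v2) \<Rightarrow>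
   ('k \<Rightarrow> 'v3::ab_group_add \<Rightarrow> 'v3) \<Rightarrow>
   ('i1, 'a1, 'v1, 'i2, 'a2, 'v2, 'i3, 'a3, 'v3) c2_triple \<Rightarrow>
   ('i3, 'a3, 'v3 \<Rightarrow> 'k, 'i2, 'a2, 'v2 \<Rightarrow> 'k, 'i1, 'a1, 'v1 \<Rightarrow> 'k) c2_triple" where
  "dual_triple s1 s2 s3 T =
     \<lparr>emb = (\<lambda>w. w \<circ> epi T), epi = (\<lambda>w. w \<circ> emb T),
      sub = dual2 s3 (quo T), mid = dual2 s2 (mid T), quo = dual2 s1 (sub T),
      eps = gam T, gam = eps T\<rparr>"


section \<open>Virtual measures\<close>

text \<open>
  Inductive limits are formed as quotients of the disjoint union of the stages by the equivalence
  relation generated by the transition relation \<open>R\<close>.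
\<close>

definition lim_class :: "'x rel \<Rightarrow> 'x \<Rightarrow> 'x set" where
  "lim_class R x = (R \<union> R\<inverse>)\<^sup>* `` {x}"

type_synonym ('i, 'v) vm = "('i \<times> ('v dist \<Rightarrow> 'v dist)) set"

text \<open>\<open>Hom(\<mu>(F(i)/F(l)), \<mu>(F(j)/F(l)))\<close>, maps being set to 0 outside the source.\<close>

definition meas_hom :: "('i, 'a, 'v::ab_group_add) c2 \<Rightarrow> 'i \<Rightarrow> 'i \<Rightarrow> 'i \<Rightarrow> ('v dist \<Rightarrow> 'v dist) set" where
  "meas_hom E i j l =
     {h. (\<forall>a\<in>meas (lev E l i). h a \<in> meas (lev E l j)) \<and>
         (\<forall>a\<in>meas (lev E l i). \<forall>b\<in>meas (lev E l i). h (a + b) = h a + h b) \<and>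
         (\<forall>a\<in>meas (lev E l i). \<forall>c. h (\<lambda>f. c * a f) = (\<lambda>f. c * h a f)) \<and>
         (\<forall>a. a \<notin> meas (lev E l i) \<longrightarrow> h a = 0)}"

definition vm_stage :: "('i, 'a, 'v::ab_group_add) c2 \<Rightarrow> 'i \<Rightarrow> 'i \<Rightarrow>
    ('i \<times> ('v dist \<Rightarrow> 'v dist)) set" where
  "vm_stage E i j = {(l, h). (l, i) \<in> le E \<and> (l, j) \<in> le E \<and> h \<in> meas_hom E i j l}"

definition vm_trans :: "('i, 'a, 'v::ab_group_add) c2 \<Rightarrow> 'i \<Rightarrow> 'i \<Rightarrow>
    ('i \<times> ('v dist \<Rightarrow> 'v dist)) rel" where
  "vm_trans E i j =
     {((l, h), (l', h')).
        (l, h) \<in> vm_stage E i j \<and> (l', h') \<in> vm_stage E i j \<and> (l', l) \<in> le E \<and>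
        (\<forall>a\<in>meas (lev E l i). \<forall>c\<in>meas (lev E l' l).
           h' (meas_prod (lev_triple E l' l i) c a) = meas_prod (lev_triple E l' l j) c (h a))}"

abbreviation vm_class :: "('i, 'a, 'v::ab_group_add) c2 \<Rightarrow> 'i \<Rightarrow> 'i \<Rightarrow> 'i \<Rightarrow>
    ('v dist \<Rightarrow> 'v dist) \<Rightarrow> ('i, 'v) vm" where
  "vm_class E i j l h \<equiv> lim_class (vm_trans E i j) (l, h)"

text \<open>\<open>vmeas E i j\<close> is \<open>\<mu>(F(i) | F(j))\<close>.\<close>

definition vmeas :: "('i, 'a, 'v::ab_group_add) c2 \<Rightarrow> 'i \<Rightarrow> 'i \<Rightarrow> ('i, 'v) vm set" where
  "vmeas E i j = lim_class (vm_trans E i j) ` vm_stage E i j"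

definition vm_scale :: "complex \<Rightarrow> ('i, 'v) vm \<Rightarrow> ('i, 'v) vm" where
  "vm_scale c \<kappa> = (\<lambda>(l, h). (l, \<lambda>a f. c * h a f)) ` \<kappa>"

definition vm_one :: "('i, 'a, 'v::ab_group_add) c2 \<Rightarrow> 'i \<Rightarrow> ('i, 'v) vm" where
  "vm_one E i = vm_class E i i i (\<lambda>a. if a \<in> meas (lev E i i) then a else 0)"

text \<open>Composition \<open>\<mu>(F(i) | F(j)) \<otimes> \<mu>(F(j) | F(k)) = \<mu>(F(i) | F(k))\<close>.\<close>

definition vm_comp :: "('i, 'a, 'v::ab_group_add) c2 \<Rightarrow> 'i \<Rightarrow> 'i \<Rightarrow> 'i \<Rightarrow>
    ('i, 'v) vm \<Rightarrow> ('i, 'v) vm \<Rightarrow> ('i, 'v) vm" where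
  "vm_comp E i j k \<kappa> \<kappa>' =
     (THE \<nu>. \<exists>l h h'. (l, h) \<in> \<kappa> \<and> (l, h') \<in> \<kappa>' \<and> \<nu> = vm_class E i k l (h' \<circ> h))"

text \<open>For \<open>0 \<noteq> \<kappa> \<in> \<mu>(F(i) | F(j))\<close>, the inverse in \<open>\<mu>(F(j) | F(i)) = \<mu>(F(i) | F(j))\<^sup>*\<close>.\<close>

definition vm_inv :: "('i, 'a, 'v::ab_group_add) c2 \<Rightarrow> 'i \<Rightarrow> 'i \<Rightarrow> ('i, 'v) vm \<Rightarrow> ('i, 'v) vm" where
  "vm_inv E i j \<kappa> = (THE \<kappa>'. \<kappa>' \<in> vmeas E j i \<and> vm_comp E i j i \<kappa> \<kappa>' = vm_one E i)"

text \<open>\<open>\<mu>(F(j)/F(i)) = \<mu>(F(i) | F(j))\<close> for \<open>i \<le> j\<close>.\<close>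

definition vm_of :: "('i, 'a, 'v::ab_group_add) c2 \<Rightarrow> 'i \<Rightarrow> 'i \<Rightarrow> 'v dist \<Rightarrow> ('i, 'v) vm" where
  "vm_of E i j \<rho> =
     (THE \<nu>. \<exists>l. (l, i) \<in> le E \<and>
        \<nu> = vm_class E i j l
          (\<lambda>a. if a \<in> meas (lev E l i) then meas_prod (lev_triple E l i j) a \<rho> else 0))"

text \<open>
  \<open>\<mu>(F(i) | F(j)) = \<mu>(F\<^sup>0(i) | F\<^sup>0(j))\<close>: for \<open>l \<le> i, j\<close> an element is a multiple of \<open>\<rho>\<^sup>-\<^sup>1 \<otimes> \<sigma>\<close> with
  nonzero \<open>\<rho> \<in> \<mu>(E\<^sub>l\<^sub>,\<^sub>i)\<close>, \<open>\<sigma> \<in> \<mu>(E\<^sub>l\<^sub>,\<^sub>j)\<close>. By \<open>\<mu>(E\<^sup>\<or>\<^sub>l\<^sub>,\<^sub>i) = \<mu>(E\<^sub>l\<^sub>,\<^sub>i)\<^sup>*\<close>, the element \<open>\<rho>\<^sup>-\<^sup>1\<close> is a measure on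
  \<open>F\<^sup>0(l)/F\<^sup>0(i)\<close>, hence in \<open>\<mu>(F\<^sup>0(i) | F\<^sup>0(l))\<close>; dually \<open>\<sigma>\<close> goes to \<open>\<mu>(F\<^sup>0(l) | F\<^sup>0(j))\<close>.
\<close>

definition vm_dual :: "('k::field \<Rightarrow> 'v::ab_group_add \<Rightarrow> 'v) \<Rightarrow> ('i, 'a, 'v) c2 \<Rightarrow> 'i \<Rightarrow> 'i \<Rightarrow>
    ('i, 'v) vm \<Rightarrow> ('i, 'v \<Rightarrow> 'k) vm" where
  "vm_dual s E i j \<kappa> =
     (THE \<nu>. \<exists>l \<rho> \<sigma> c. (l, i) \<in> le E \<and> (l, j) \<in> le E \<and>
        \<rho> \<in> meas (lev E l i) \<and> \<rho> \<noteq> 0 \<and> \<sigma> \<in> meas (lev E l j) \<and> \<sigma> \<noteq> 0 \<and>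
        \<kappa> = vm_scale c (vm_comp E i l j (vm_inv E l i (vm_of E l i \<rho>)) (vm_of E l j \<sigma>)) \<and>
        \<nu> = vm_scale c (vm_comp (dual2 s E) i l j
              (vm_of (dual2 s E) i l (meas_inv s (lev E l i) \<rho>))
              (vm_inv (dual2 s E) j l (vm_of (dual2 s E) j l (meas_inv s (lev E l j) \<sigma>)))))"

text \<open>
  The multiplicative system trivializing \<open>\<mu>(F(i) | F(j))\<close>: for \<open>i \<le> j\<close> it is the measure on
  \<open>F(j)/F(i)\<close> with mass 1 on \<open>S\<close>, where \<open>S = carr\<close> for \<open>cf\<close> and \<open>S = nul\<close> for \<open>df\<close>.
\<close>

definition vm_triv :: "(('a, 'v) filt \<Rightarrow> 'v set) \<Rightarrow> ('i, 'a, 'v::ab_group_add) c2 \<Rightarrow> 'i \<Rightarrow> 'i \<Rightarrow>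
    ('i, 'v) vm" where
  "vm_triv S E i j =
     (THE \<nu>. \<exists>l. (l, i) \<in> le E \<and> (l, j) \<in> le E \<and>
        \<nu> = vm_comp E i l j
          (vm_inv E l i (vm_of E l i (unit_mass (lev E l i) (S (lev E l i)))))
          (vm_of E l j (unit_mass (lev E l j) (S (lev E l j)))))"

text \<open>
  The isomorphism (M): on homomorphisms at a common stage \<open>l \<le> i, j\<close> of the index set of \<open>E\<^sub>2\<close> it is
  the tensor product.
\<close>

definition vm_prod ::
  "('i1, 'a1, 'v1::ab_group_add, 'i2, 'a2, 'v2::ab_group_add, 'i3, 'a3, 'v3::ab_group_add) c2_triple \<Rightarrow>
   'i2 \<Rightarrow> 'i2 \<Rightarrow> ('i1, 'v1) vm \<Rightarrow> ('i3, 'v3) vm \<Rightarrow> ('i2, 'v2) vm" where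
  "vm_prod T i j \<kappa>1 \<kappa>3 =
     (THE \<nu>. \<exists>l h1 h2 h3. (l, i) \<in> le (mid T) \<and> (l, j) \<in> le (mid T) \<and>
        (eps T l, h1) \<in> \<kappa>1 \<and> (gam T l, h3) \<in> \<kappa>3 \<and> h2 \<in> meas_hom (mid T) i j l \<and>
        (\<forall>a1\<in>meas (lev (sub T) (eps T l) (eps T i)). \<forall>a3\<in>meas (lev (quo T) (gam T l) (gam T i)).
           h2 (meas_prod (level T l i) a1 a3) = meas_prod (level T l j) (h1 a1) (h3 a3)) \<and>
        \<nu> = vm_class (mid T) i j l h2)"


section \<open>The spaces \<open>\<D>\<^sub>F\<^sub>(\<^sub>o\<^sub>)(E)\<close> and \<open>\<D>'\<^sub>F\<^sub>(\<^sub>o\<^sub>)(E)\<close>\<close>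

text \<open>
  The pure tensor \<open>x \<otimes> \<kappa>\<close> of \<open>X \<otimes> L\<close>, for a space \<open>X\<close> of complex functions and a complex line \<open>L\<close> of
  virtual measures, is the class of \<open>(x, \<kappa>)\<close> under \<open>(x, a e) \<sim> (y, b e)\<close> if \<open>a x = b y\<close>. As \<open>L\<close> is
  one-dimensional, every element of \<open>X \<otimes> L\<close> is a pure tensor.
\<close>

type_synonym ('p, 'i, 'v) ten = "(('p \<Rightarrow> complex) \<times> ('i, 'v) vm) set"

definition tens :: "('p \<Rightarrow> complex) set \<Rightarrow> ('i, 'v) vm set \<Rightarrow> ('p \<Rightarrow> complex) \<Rightarrow> ('i, 'v) vm \<Rightarrow>
    ('p, 'i, 'v) ten" where
  "tens X L x \<kappa> =
     {(y, \<kappa>'). y \<in> X \<and> \<kappa>' \<in> L \<and>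
        (\<exists>e\<in>L. \<exists>a b. \<kappa> = vm_scale a e \<and> \<kappa>' = vm_scale b e \<and> (\<forall>p. a * x p = b * y p))}"

text \<open>
  Throughout, the arguments \<open>i l\<close> with \<open>l \<le> i\<close> indicate the level \<open>F(i)/F(l)\<close>, and \<open>b\<close> is the base
  index, written \<open>o\<close> in headings. The level spaces are \<open>\<D>(F(i)/F(l)) \<otimes> \<mu>(F(l) | F(b))\<close> and
  \<open>\<D>'(F(i)/F(l)) \<otimes> \<mu>(F(b) | F(l))\<close>.
\<close>

definition fun_ten :: "('i, 'a, 'v::ab_group_add) c2 \<Rightarrow> 'i \<Rightarrow> 'i \<Rightarrow> 'i \<Rightarrow> ('v \<Rightarrow> complex) \<Rightarrow>
    ('i, 'v) vm \<Rightarrow> ('v, 'i, 'v) ten" where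
  "fun_ten E b i l f \<kappa> = tens (test_fun (lev E l i)) (vmeas E l b) f \<kappa>"

definition fun_level :: "('i, 'a, 'v::ab_group_add) c2 \<Rightarrow> 'i \<Rightarrow> 'i \<Rightarrow> 'i \<Rightarrow> ('v, 'i, 'v) ten set" where
  "fun_level E b i l = {fun_ten E b i l f \<kappa> | f \<kappa>. f \<in> test_fun (lev E l i) \<and> \<kappa> \<in> vmeas E l b}"

definition dist_ten :: "('i, 'a, 'v::ab_group_add) c2 \<Rightarrow> 'i \<Rightarrow> 'i \<Rightarrow> 'i \<Rightarrow> 'v dist \<Rightarrow>
    ('i, 'v) vm \<Rightarrow> ('v \<Rightarrow> complex, 'i, 'v) ten" where
  "dist_ten E b i l G \<kappa> = tens (distr (lev E l i)) (vmeas E b l) G \<kappa>"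

definition dist_level :: "('i, 'a, 'v::ab_group_add) c2 \<Rightarrow> 'i \<Rightarrow> 'i \<Rightarrow> 'i \<Rightarrow>
    ('v \<Rightarrow> complex, 'i, 'v) ten set" where
  "dist_level E b i l = {dist_ten E b i l G \<kappa> | G \<kappa>. G \<in> distr (lev E l i) \<and> \<kappa> \<in> vmeas E b l}"

text \<open>The level-wise pairing, through \<open>\<mu>(F(l) | F(b)) \<otimes> \<mu>(F(b) | F(l)) = \<mu>(F(l) | F(l)) = \<complex>\<close>.\<close>

definition level_pair :: "('i, 'a, 'v::ab_group_add) c2 \<Rightarrow> 'i \<Rightarrow> 'i \<Rightarrow> 'i \<Rightarrow> ('v, 'i, 'v) ten \<Rightarrow>
    ('v \<Rightarrow> complex, 'i, 'v) ten \<Rightarrow> complex" where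
  "level_pair E b i l x y =
     (THE z. \<exists>f \<kappa> G \<kappa>' c.
        f \<in> test_fun (lev E l i) \<and> \<kappa> \<in> vmeas E l b \<and> x = fun_ten E b i l f \<kappa> \<and>
        G \<in> distr (lev E l i) \<and> \<kappa>' \<in> vmeas E b l \<and> y = dist_ten E b i l G \<kappa>' \<and>
        vm_comp E l b l \<kappa> \<kappa>' = vm_scale c (vm_one E l) \<and> z = c * G f)"

text \<open>
  The conjugate of a linear map \<open>\<Phi>\<close> from the level \<open>(i, l)\<close> of \<open>\<D>(E)\<close> to the level \<open>(i', l')\<close> of
  \<open>\<D>(E')\<close>, applied to an element \<open>y\<close> of the level \<open>(i', l')\<close> of \<open>\<D>'(E')\<close>.
\<close>

definition conj_map :: "('i, 'a, 'v::ab_group_add) c2 \<Rightarrow> 'i \<Rightarrow> 'i \<Rightarrow> 'i \<Rightarrow>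
    ('j, 'c, 'w::ab_group_add) c2 \<Rightarrow> 'j \<Rightarrow> 'j \<Rightarrow> 'j \<Rightarrow>
    (('v, 'i, 'v) ten \<Rightarrow> ('w, 'j, 'w) ten) \<Rightarrow>
    ('w \<Rightarrow> complex, 'j, 'w) ten \<Rightarrow> ('v \<Rightarrow> complex, 'i, 'v) ten" where
  "conj_map E b i l E' b' i' l' \<Phi> y =
     (THE z. z \<in> dist_level E b i l \<and>
        (\<forall>x\<in>fun_level E b i l. level_pair E b i l x z = level_pair E' b' i' l' (\<Phi> x) y))"

text \<open>The transition maps from level \<open>(i, l)\<close> to the levels \<open>(j, l)\<close> and \<open>(i, j)\<close>, for \<open>l \<le> j \<le> i\<close>.\<close>

definition trans_restrict :: "('i, 'a, 'v::ab_group_add) c2 \<Rightarrow> 'i \<Rightarrow> 'i \<Rightarrow> 'i \<Rightarrow> 'i \<Rightarrow>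
    ('v, 'i, 'v) ten \<Rightarrow> ('v, 'i, 'v) ten" where
  "trans_restrict E b i j l x =
     (THE y. \<exists>f \<kappa>. f \<in> test_fun (lev E l i) \<and> \<kappa> \<in> vmeas E l b \<and>
        x = fun_ten E b i l f \<kappa> \<and>
        y = fun_ten E b j l (mono_pull (lev_triple E l j i) f) \<kappa>)"

definition trans_push :: "('i, 'a, 'v::ab_group_add) c2 \<Rightarrow> 'i \<Rightarrow> 'i \<Rightarrow> 'i \<Rightarrow> 'i \<Rightarrow>
    ('v, 'i, 'v) ten \<Rightarrow> ('v, 'i, 'v) ten" where
  "trans_push E b i j l x =
     (THE y. \<exists>f \<rho> \<nu>. f \<in> test_fun (lev E l i) \<and> \<rho> \<in> meas (lev E l j) \<and> \<nu> \<in> vmeas E j b \<and>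
        x = fun_ten E b i l f (vm_comp E l j b (vm_of E l j \<rho>) \<nu>) \<and>
        y = fun_ten E b i j (epi_push (lev_triple E l j i) f \<rho>) \<nu>)"

text \<open>Projective limit: compatible families, set to \<open>{}\<close> outside the index range.\<close>

definition D_space :: "('i, 'a, 'v::ab_group_add) c2 \<Rightarrow> 'i \<Rightarrow> ('i \<Rightarrow> 'i \<Rightarrow> ('v, 'i, 'v) ten) set" where
  "D_space E b =
     {x. (\<forall>i l. (l, i) \<in> le E \<longrightarrow> x i l \<in> fun_level E b i l) \<and>
         (\<forall>i l. (l, i) \<notin> le E \<longrightarrow> x i l = {}) \<and>
         (\<forall>i j l. (l, j) \<in> le E \<and> (j, i) \<in> le E \<longrightarrow>
            trans_restrict E b i j l (x i l) = x j l \<and> trans_push E b i j l (x i l) = x i j)}"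

text \<open>Inductive limit with the conjugate transition maps.\<close>

type_synonym ('i, 'v) dist_class = "('i \<times> 'i \<times> ('v \<Rightarrow> complex, 'i, 'v) ten) set"

definition dist_trans :: "('i, 'a, 'v::ab_group_add) c2 \<Rightarrow> 'i \<Rightarrow>
    ('i \<times> 'i \<times> ('v \<Rightarrow> complex, 'i, 'v) ten) rel" where
  "dist_trans E b =
     {((j, l, y), (i, l, conj_map E b i l E b j l (trans_restrict E b i j l) y)) | i j l y.
        (l, j) \<in> le E \<and> (j, i) \<in> le E \<and> y \<in> dist_level E b j l} \<union>
     {((i, j, y), (i, l, conj_map E b i l E b i j (trans_push E b i j l) y)) | i j l y.
        (l, j) \<in> le E \<and> (j, i) \<in> le E \<and> y \<in> dist_level E b i j}"

abbreviation dist_cls :: "('i, 'a, 'v::ab_group_add) c2 \<Rightarrow> 'i \<Rightarrow> 'i \<Rightarrow> 'i \<Rightarrow>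
    ('v \<Rightarrow> complex, 'i, 'v) ten \<Rightarrow> ('i, 'v) dist_class" where
  "dist_cls E b i l y \<equiv> lim_class (dist_trans E b) (i, l, y)"

definition D'_space :: "('i, 'a, 'v::ab_group_add) c2 \<Rightarrow> 'i \<Rightarrow> ('i, 'v) dist_class set" where
  "D'_space E b = {dist_cls E b i l y | i l y. (l, i) \<in> le E \<and> y \<in> dist_level E b i l}"


section \<open>Fourier transform of \<open>C\<^sub>2\<close>-spaces\<close>

text \<open>The level \<open>(i, j)\<close> of \<open>E\<close> goes to the level \<open>(j, i)\<close> of the dual.\<close>

definition fourier_level :: "('k::field \<Rightarrow> complex) \<Rightarrow> ('k \<Rightarrow> 'v::ab_group_add \<Rightarrow> 'v) \<Rightarrow>
    ('i, 'a, 'v) c2 \<Rightarrow> 'i \<Rightarrow> 'i \<Rightarrow> 'i \<Rightarrow> ('v, 'i, 'v) ten \<Rightarrow> ('v \<Rightarrow> 'k, 'i, 'v \<Rightarrow> 'k) ten" where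
  "fourier_level \<psi> s E b i j x =
     (THE y. \<exists>f \<rho> \<nu>. f \<in> test_fun (lev E j i) \<and> \<rho> \<in> meas (lev E j i) \<and> \<nu> \<in> vmeas E i b \<and>
        x = fun_ten E b i j f (vm_comp E j i b (vm_of E j i \<rho>) \<nu>) \<and>
        y = fun_ten (dual2 s E) b j i (fourier1 \<psi> s (lev E j i) \<rho> f) (vm_dual s E i b \<nu>))"

definition fourier :: "('k::field \<Rightarrow> complex) \<Rightarrow> ('k \<Rightarrow> 'v::ab_group_add \<Rightarrow> 'v) \<Rightarrow>
    ('i, 'a, 'v) c2 \<Rightarrow> 'i \<Rightarrow> ('i \<Rightarrow> 'i \<Rightarrow> ('v, 'i, 'v) ten) \<Rightarrow>
    'i \<Rightarrow> 'i \<Rightarrow> ('v \<Rightarrow> 'k, 'i, 'v \<Rightarrow> 'k) ten" where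
  "fourier \<psi> s E b x = (\<lambda>j i. if (j, i) \<in> le E then fourier_level \<psi> s E b i j (x i j) else {})"

definition fourier_dist_level :: "('k::field \<Rightarrow> complex) \<Rightarrow> ('k \<Rightarrow> 'v::ab_group_add \<Rightarrow> 'v) \<Rightarrow>
    ('i, 'a, 'v) c2 \<Rightarrow> 'i \<Rightarrow> 'i \<Rightarrow> 'i \<Rightarrow> ('v \<Rightarrow> complex, 'i, 'v) ten \<Rightarrow>
    (('v \<Rightarrow> 'k) \<Rightarrow> complex, 'i, 'v \<Rightarrow> 'k) ten" where
  "fourier_dist_level \<psi> s E b i j x =
     (THE y. \<exists>G \<rho> \<nu>. G \<in> distr (lev E j i) \<and> \<rho> \<in> meas (lev E j i) \<and> \<rho> \<noteq> 0 \<and> \<nu> \<in> vmeas E b i \<and>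
        x = dist_ten E b i j G (vm_comp E b i j \<nu> (vm_inv E j i (vm_of E j i \<rho>))) \<and>
        y = dist_ten (dual2 s E) b j i
              (fourier1_dist \<psi> s (lev E j i) (meas_inv s (lev E j i) \<rho>) G) (vm_dual s E b i \<nu>))"

definition fourier_dist :: "('k::field \<Rightarrow> complex) \<Rightarrow> ('k \<Rightarrow> 'v::ab_group_add \<Rightarrow> 'v) \<Rightarrow>
    ('i, 'a, 'v) c2 \<Rightarrow> 'i \<Rightarrow> ('i, 'v) dist_class \<Rightarrow> ('i, 'v \<Rightarrow> 'k) dist_class" where
  "fourier_dist \<psi> s E b X =
     (THE Y. \<exists>i j y. (j, i) \<in> le E \<and> y \<in> dist_level E b i j \<and> X = dist_cls E b i j y \<and>
        Y = dist_cls (dual2 s E) b j i (fourier_dist_level \<psi> s E b i j y))"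


section \<open>Direct and inverse images of \<open>C\<^sub>2\<close>-spaces\<close>

text \<open>
  For each of the maps there is the map at the level \<open>(i, j)\<close>, \<open>j \<le> i\<close>, of \<open>E\<^sub>2\<close>, its projective limit on
  \<open>\<D>\<close>, and the conjugate map on \<open>\<D>'\<close>, the inductive limit of the conjugates of the level maps. Maps
  out of a tensor product with a line are written as functions of two arguments.
\<close>

subsection \<open>\<open>E\<^sub>1\<close> a \<open>cC\<^sub>2\<close>-space: \<open>\<beta>\<^sub>*\<close> on \<open>\<D>\<close> and \<open>\<beta>\<^sup>*\<close> on \<open>\<D>'\<close>\<close>

text \<open>
  Here \<open>F\<^sub>1(\<epsilon>(k)) = V\<^sub>1\<close> and \<open>m \<in> \<mu>(F\<^sub>1(\<epsilon>(b)) | V\<^sub>1)\<close>, where \<open>V\<^sub>1\<close> is the member of the filtration with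
  index \<open>\<epsilon>(k)\<close>. With \<open>\<kappa>1 \<otimes> \<kappa>3 \<in> \<mu>(F\<^sub>2(j) | F\<^sub>2(b))\<close>, the measure \<open>\<rho>\<close> on \<open>F\<^sub>1(\<epsilon>(i))/F\<^sub>1(\<epsilon>(j)) = V\<^sub>1/F\<^sub>1(\<epsilon>(j))\<close>
  is \<open>\<kappa>1 \<otimes> m\<close>; passing from the index \<open>\<epsilon>(k)\<close> to the index \<open>\<epsilon>(i)\<close> of the same subspace \<open>V\<^sub>1\<close> is done
  with the measure of mass 1 on the zero space \<open>F\<^sub>1(\<epsilon>(i))/F\<^sub>1(\<epsilon>(k))\<close>.
\<close>

definition epi_push_level ::
  "('i1, 'a1, 'v1::ab_group_add, 'i2, 'a2, 'v2::ab_group_add, 'i3, 'a3, 'v3::ab_group_add) c2_triple \<Rightarrow>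
   'i2 \<Rightarrow> 'i2 \<Rightarrow> ('i1, 'v1) vm \<Rightarrow> 'i2 \<Rightarrow> 'i2 \<Rightarrow> ('v2, 'i2, 'v2) ten \<Rightarrow> ('v3, 'i3, 'v3) ten" where
  "epi_push_level T k b m i j x =
     (THE y. \<exists>f \<kappa>1 \<kappa>3 \<rho>.
        f \<in> test_fun (lev (mid T) j i) \<and>
        \<kappa>1 \<in> vmeas (sub T) (eps T j) (eps T b) \<and> \<kappa>3 \<in> vmeas (quo T) (gam T j) (gam T b) \<and>
        x = fun_ten (mid T) b i j f (vm_prod T j b \<kappa>1 \<kappa>3) \<and>
        \<rho> \<in> meas (lev (sub T) (eps T j) (eps T i)) \<and>
        vm_of (sub T) (eps T j) (eps T i) \<rho> =
          vm_comp (sub T) (eps T j) (eps T k) (eps T i)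
            (vm_comp (sub T) (eps T j) (eps T b) (eps T k) \<kappa>1 m)
            (vm_of (sub T) (eps T k) (eps T i)
              (unit_mass (lev (sub T) (eps T k) (eps T i)) (nul (lev (sub T) (eps T k) (eps T i))))) \<and>
        y = fun_ten (quo T) (gam T b) (gam T i) (gam T j) (epi_push (level T j i) f \<rho>) \<kappa>3)"

definition epi_push2 ::
  "('i1, 'a1, 'v1::ab_group_add, 'i2, 'a2, 'v2::ab_group_add, 'i3, 'a3, 'v3::ab_group_add) c2_triple \<Rightarrow>
   'i2 \<Rightarrow> 'i2 \<Rightarrow> ('i2 \<Rightarrow> 'i2 \<Rightarrow> ('v2, 'i2, 'v2) ten) \<Rightarrow> ('i1, 'v1) vm \<Rightarrow>
   'i3 \<Rightarrow> 'i3 \<Rightarrow> ('v3, 'i3, 'v3) ten" where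
  "epi_push2 T k b x m =
     (THE y. y \<in> D_space (quo T) (gam T b) \<and>
        (\<forall>i j. (j, k) \<in> le (mid T) \<and> (k, i) \<in> le (mid T) \<longrightarrow>
           y (gam T i) (gam T j) = epi_push_level T k b m i j (x i j)))"

definition epi_pull2_dist ::
  "('i1, 'a1, 'v1::ab_group_add, 'i2, 'a2, 'v2::ab_group_add, 'i3, 'a3, 'v3::ab_group_add) c2_triple \<Rightarrow>
   'i2 \<Rightarrow> 'i2 \<Rightarrow> ('i3, 'v3) dist_class \<Rightarrow> ('i1, 'v1) vm \<Rightarrow> ('i2, 'v2) dist_class" where
  "epi_pull2_dist T k b X m =
     (THE Y. \<exists>i j y. (j, k) \<in> le (mid T) \<and> (k, i) \<in> le (mid T) \<and>
        y \<in> dist_level (quo T) (gam T b) (gam T i) (gam T j) \<and>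
        X = dist_cls (quo T) (gam T b) (gam T i) (gam T j) y \<and>
        Y = dist_cls (mid T) b i j
              (conj_map (mid T) b i j (quo T) (gam T b) (gam T i) (gam T j)
                (epi_push_level T k b m i j) y))"


subsection \<open>\<open>E\<^sub>3\<close> a \<open>dC\<^sub>2\<close>-space: \<open>\<alpha>\<^sup>*\<close> on \<open>\<D>\<close> and \<open>\<alpha>\<^sub>*\<close> on \<open>\<D>'\<close>\<close>

text \<open>
  Here \<open>F\<^sub>3(\<gamma>(k)) = {0}\<close> and \<open>n \<in> \<mu>(F\<^sub>3(\<gamma>(b)) | {0})\<close>, where \<open>{0}\<close> is the member of the filtration with
  index \<open>\<gamma>(k)\<close>. The product \<open>\<kappa>3 \<otimes> n\<close> lies in \<open>\<mu>(F\<^sub>3(\<gamma>(j)) | F\<^sub>3(\<gamma>(k)))\<close>, where both members of the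
  filtration are \<open>{0}\<close>; \<open>c\<close> is the corresponding complex number.
\<close>

definition mono_pull_level ::
  "('i1, 'a1, 'v1::ab_group_add, 'i2, 'a2, 'v2::ab_group_add, 'i3, 'a3, 'v3::ab_group_add) c2_triple \<Rightarrow>
   'i2 \<Rightarrow> 'i2 \<Rightarrow> ('i3, 'v3) vm \<Rightarrow> 'i2 \<Rightarrow> 'i2 \<Rightarrow> ('v2, 'i2, 'v2) ten \<Rightarrow> ('v1, 'i1, 'v1) ten" where
  "mono_pull_level T k b n i j x =
     (THE y. \<exists>f \<kappa>1 \<kappa>3 c.
        f \<in> test_fun (lev (mid T) j i) \<and>
        \<kappa>1 \<in> vmeas (sub T) (eps T j) (eps T b) \<and> \<kappa>3 \<in> vmeas (quo T) (gam T j) (gam T b) \<and>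
        x = fun_ten (mid T) b i j f (vm_prod T j b \<kappa>1 \<kappa>3) \<and>
        vm_comp (quo T) (gam T j) (gam T b) (gam T k) \<kappa>3 n =
          vm_scale c (vm_of (quo T) (gam T j) (gam T k)
            (unit_mass (lev (quo T) (gam T j) (gam T k)) (nul (lev (quo T) (gam T j) (gam T k))))) \<and>
        y = fun_ten (sub T) (eps T b) (eps T i) (eps T j)
              (\<lambda>v. c * mono_pull (level T j i) f v) \<kappa>1)"

definition mono_pull2 ::
  "('i1, 'a1, 'v1::ab_group_add, 'i2, 'a2, 'v2::ab_group_add, 'i3, 'a3, 'v3::ab_group_add) c2_triple \<Rightarrow>
   'i2 \<Rightarrow> 'i2 \<Rightarrow> ('i2 \<Rightarrow> 'i2 \<Rightarrow> ('v2, 'i2, 'v2) ten) \<Rightarrow> ('i3, 'v3) vm \<Rightarrow>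
   'i1 \<Rightarrow> 'i1 \<Rightarrow> ('v1, 'i1, 'v1) ten" where
  "mono_pull2 T k b x n =
     (THE y. y \<in> D_space (sub T) (eps T b) \<and>
        (\<forall>i j. (j, k) \<in> le (mid T) \<and> (k, i) \<in> le (mid T) \<longrightarrow>
           y (eps T i) (eps T j) = mono_pull_level T k b n i j (x i j)))"

definition mono_push2_dist ::
  "('i1, 'a1, 'v1::ab_group_add, 'i2, 'a2, 'v2::ab_group_add, 'i3, 'a3, 'v3::ab_group_add) c2_triple \<Rightarrow>
   'i2 \<Rightarrow> 'i2 \<Rightarrow> ('i1, 'v1) dist_class \<Rightarrow> ('i3, 'v3) vm \<Rightarrow> ('i2, 'v2) dist_class" where
  "mono_push2_dist T k b X n =
     (THE Y. \<exists>i j y. (j, k) \<in> le (mid T) \<and> (k, i) \<in> le (mid T) \<and>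
        y \<in> dist_level (sub T) (eps T b) (eps T i) (eps T j) \<and>
        X = dist_cls (sub T) (eps T b) (eps T i) (eps T j) y \<and>
        Y = dist_cls (mid T) b i j
              (conj_map (mid T) b i j (sub T) (eps T b) (eps T i) (eps T j)
                (mono_pull_level T k b n i j) y))"


subsection \<open>\<open>E\<^sub>1\<close> a \<open>cfC\<^sub>2\<close>-space: \<open>\<beta>\<^sup>*\<close> on \<open>\<D>\<close> and \<open>\<beta>\<^sub>*\<close> on \<open>\<D>'\<close>\<close>

definition epi_pull_level ::
  "('i1, 'a1, 'v1::ab_group_add, 'i2, 'a2, 'v2::ab_group_add, 'i3, 'a3, 'v3::ab_group_add) c2_triple \<Rightarrow>
   'i2 \<Rightarrow> 'i2 \<Rightarrow> 'i2 \<Rightarrow> ('v3, 'i3, 'v3) ten \<Rightarrow> ('v2, 'i2, 'v2) ten" where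
  "epi_pull_level T b i j x =
     (THE y. \<exists>g \<kappa>3.
        g \<in> test_fun (lev (quo T) (gam T j) (gam T i)) \<and> \<kappa>3 \<in> vmeas (quo T) (gam T j) (gam T b) \<and>
        x = fun_ten (quo T) (gam T b) (gam T i) (gam T j) g \<kappa>3 \<and>
        y = fun_ten (mid T) b i j (epi_pull (level T j i) g)
              (vm_prod T j b (vm_triv carr (sub T) (eps T j) (eps T b)) \<kappa>3))"

definition epi_pull2 ::
  "('i1, 'a1, 'v1::ab_group_add, 'i2, 'a2, 'v2::ab_group_add, 'i3, 'a3, 'v3::ab_group_add) c2_triple \<Rightarrow>
   'i2 \<Rightarrow> ('i3 \<Rightarrow> 'i3 \<Rightarrow> ('v3, 'i3, 'v3) ten) \<Rightarrow> 'i2 \<Rightarrow> 'i2 \<Rightarrow> ('v2, 'i2, 'v2) ten" where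
  "epi_pull2 T b x =
     (\<lambda>i j. if (j, i) \<in> le (mid T) then epi_pull_level T b i j (x (gam T i) (gam T j)) else {})"

definition epi_push2_dist ::
  "('i1, 'a1, 'v1::ab_group_add, 'i2, 'a2, 'v2::ab_group_add, 'i3, 'a3, 'v3::ab_group_add) c2_triple \<Rightarrow>
   'i2 \<Rightarrow> ('i2, 'v2) dist_class \<Rightarrow> ('i3, 'v3) dist_class" where
  "epi_push2_dist T b X =
     (THE Y. \<exists>i j y. (j, i) \<in> le (mid T) \<and> y \<in> dist_level (mid T) b i j \<and>
        X = dist_cls (mid T) b i j y \<and>
        Y = dist_cls (quo T) (gam T b) (gam T i) (gam T j)
              (conj_map (quo T) (gam T b) (gam T i) (gam T j) (mid T) b i j
                (epi_pull_level T b i j) y))"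


subsection \<open>\<open>E\<^sub>3\<close> a \<open>dfC\<^sub>2\<close>-space: \<open>\<alpha>\<^sub>*\<close> on \<open>\<D>\<close> and \<open>\<alpha>\<^sup>*\<close> on \<open>\<D>'\<close>\<close>

definition mono_push_level ::
  "('i1, 'a1, 'v1::ab_group_add, 'i2, 'a2, 'v2::ab_group_add, 'i3, 'a3, 'v3::ab_group_add) c2_triple \<Rightarrow>
   'i2 \<Rightarrow> 'i2 \<Rightarrow> 'i2 \<Rightarrow> ('v1, 'i1, 'v1) ten \<Rightarrow> ('v2, 'i2, 'v2) ten" where
  "mono_push_level T b i j x =
     (THE y. \<exists>f \<kappa>1.
        f \<in> test_fun (lev (sub T) (eps T j) (eps T i)) \<and> \<kappa>1 \<in> vmeas (sub T) (eps T j) (eps T b) \<and>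
        x = fun_ten (sub T) (eps T b) (eps T i) (eps T j) f \<kappa>1 \<and>
        y = fun_ten (mid T) b i j (mono_push (level T j i) f)
              (vm_prod T j b \<kappa>1 (vm_triv nul (quo T) (gam T j) (gam T b))))"

definition mono_push2 ::
  "('i1, 'a1, 'v1::ab_group_add, 'i2, 'a2, 'v2::ab_group_add, 'i3, 'a3, 'v3::ab_group_add) c2_triple \<Rightarrow>
   'i2 \<Rightarrow> ('i1 \<Rightarrow> 'i1 \<Rightarrow> ('v1, 'i1, 'v1) ten) \<Rightarrow> 'i2 \<Rightarrow> 'i2 \<Rightarrow> ('v2, 'i2, 'v2) ten" where
  "mono_push2 T b x =
     (\<lambda>i j. if (j, i) \<in> le (mid T) then mono_push_level T b i j (x (eps T i) (eps T j)) else {})"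

definition mono_pull2_dist ::
  "('i1, 'a1, 'v1::ab_group_add, 'i2, 'a2, 'v2::ab_group_add, 'i3, 'a3, 'v3::ab_group_add) c2_triple \<Rightarrow>
   'i2 \<Rightarrow> ('i2, 'v2) dist_class \<Rightarrow> ('i1, 'v1) dist_class" where
  "mono_pull2_dist T b X =
     (THE Y. \<exists>i j y. (j, i) \<in> le (mid T) \<and> y \<in> dist_level (mid T) b i j \<and>
        X = dist_cls (mid T) b i j y \<and>
        Y = dist_cls (sub T) (eps T b) (eps T i) (eps T j)
              (conj_map (sub T) (eps T b) (eps T i) (eps T j) (mid T) b i j
                (mono_push_level T b i j) y))"

end

theory Submission
  imports Defs
begin

text \<open>
  Choose on \<open>E\<^sub>1\<close> and \<open>E\<^sub>3\<close> systems of nonzero invariant measures on the quotients \<open>F(j)/F(i)\<close> which are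
  multiplicative for \<open>l \<le> i \<le> j\<close>; their products form such a system on \<open>E\<^sub>2\<close>, and their inverses form
  systems on the duals. Such a system identifies every \<open>\<mu>(F(i) | F(j))\<close> with \<open>\<complex>\<close>, compatibly with
  compositions, so that all spaces become limits of \<open>\<D>(F(i)/F(j))\<close> and \<open>\<D>'(F(i)/F(j))\<close> and all maps limits
  of maps between levels. On a level, the assertions are Fubini's theorem, Poisson summation and Fourier
  inversion; those on \<open>\<D>'\<close> are obtained by transposition from the assertions for the dual triple.
\<close>

section \<open>Transversals\<close>

text \<open>The lines of virtual measures, the tensor products, the limits and the maps between them
  are classes or values picked out by \<open>THE\<close>, so every map must first be shown to exist
  and not to depend on representatives. Once measures are coordinates, such a check is an identity
  between scalars. One nonzero measure chosen on each quotient is multiplicative only up to a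
  2-cocycle: associativity of the product of measures is the cocycle condition, and directedness of
  the index set makes the cocycle a coboundary. The system must moreover fit the case at hand: mass
  1 on the zero spaces beyond the index where the filtration reaches V or 0, total mass 1 on compact
  levels, mass 1 at 0 on discrete ones. Duality is expressed by pairings symmetric in the two
  spaces, so that the statements for a triple and for its dual are instances of one lemma and no
  double dual is formed. Analysis on a level needs nothing but finite indices of subgroups and sums
  over representatives.\<close>

definition subgrp :: "'v::ab_group_add set \<Rightarrow> bool" where
  "subgrp S \<longleftrightarrow> 0 \<in> S \<and> (\<forall>x\<in>S. \<forall>y\<in>S. x - y \<in> S)"

lemma subgrp_zero: "subgrp S ==> 0 \<in> S"
  by (simp add: subgrp_def)

lemma subgrp_diff: "subgrp S ==> x \<in> S ==> y \<in> S ==> x - y \<in> S"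
  by (simp add: subgrp_def)

lemma subgrp_uminus: "subgrp S ==> x \<in> S ==> - x \<in> S"
  using subgrp_diff[of S 0 x] subgrp_zero by auto

lemma subgrp_add: "subgrp S ==> x \<in> S ==> y \<in> S ==> x + y \<in> S"
  using subgrp_diff[of S x "- y"] subgrp_uminus by auto

lemma subgrp_add_iff: "subgrp S ==> u \<in> S ==> v + u \<in> S \<longleftrightarrow> v \<in> S"
  using subgrp_add[of S v u] subgrp_diff[of S "v + u" u] by auto

lemma subgrp_diff_sym: "subgrp S ==> x - y \<in> S ==> y - x \<in> S"
  using subgrp_uminus[of S "x - y"] by simp

lemma subgrp_diff_trans: "subgrp S ==> x - y \<in> S ==> y - z \<in> S ==> x - z \<in> S"
  using subgrp_add[of S "x - y" "y - z"] by simp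

lemma subgrp_diff_iff: "subgrp S ==> x - y \<in> S ==> x \<in> S \<longleftrightarrow> y \<in> S"
  by (metis diff_add_cancel subgrp_add_iff add.commute)

definition transversal :: "'v::ab_group_add set \<Rightarrow> 'v set \<Rightarrow> 'v set \<Rightarrow> bool" where
  "transversal R S T \<longleftrightarrow> finite R \<and> R \<subseteq> T \<and> (\<forall>v\<in>T. \<exists>!r. r \<in> R \<and> v - r \<in> S)"

text \<open>\<open>f v\<close> is the coset of \<open>v\<close>. The cosets met by \<open>T\<close>
  are among those of the finite set \<open>Q\<close>, whose elements may lie outside
  \<open>T\<close>; \<open>inv_into\<close> then picks an element of \<open>T\<close> from
  each.\<close>

lemma transversal_exists:
  assumes "subgrp S" "finite Q" "\<And>v. v \<in> T ==> \<exists>q\<in>Q. v - q \<in> S"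
  shows "\<exists>R. transversal R S T"
proof -
  define f where "f v = {u. u - v \<in> S}" for v
  have f: "f v = f w \<longleftrightarrow> v - w \<in> S" for v w
  proof
    assume "f v = f w"
    moreover have "v \<in> f v" using assms(1) by (simp add: f_def subgrp_zero)
    ultimately show "v - w \<in> S" by (simp add: f_def)
  next
    assume "v - w \<in> S"
    then show "f v = f w"
      using subgrp_diff_trans[OF assms(1)] subgrp_diff_sym[OF assms(1)] unfolding f_def by blast
  qed
  have "f ` T \<subseteq> f ` Q"
    using assms(3) f by blast
  then have fin: "finite (f ` T)"
    using assms(2) finite_surj by blast
  define R where "R = inv_into T f ` (f ` T)"
  have "transversal R S T"
    unfolding transversal_def
  proof (intro conjI ballI)
    show "finite R" using fin by (simp add: R_def)
    show "R \<subseteq> T" by (auto simp: R_def intro: inv_into_into)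
    fix v assume v: "v \<in> T"
    show "\<exists>!r. r \<in> R \<and> v - r \<in> S"
    proof (rule ex1I[of _ "inv_into T f (f v)"])
      show "inv_into T f (f v) \<in> R \<and> v - inv_into T f (f v) \<in> S"
        using v f[of v "inv_into T f (f v)"] f_inv_into_f[of "f v" f T] by (simp add: R_def)
      fix r assume r: "r \<in> R \<and> v - r \<in> S"
      then obtain w where w: "w \<in> T" "r = inv_into T f (f w)" by (auto simp: R_def)
      then have "f r = f w" by (simp add: f_inv_into_f)
      moreover have "f v = f r" using r f by blast
      ultimately show "r = inv_into T f (f v)" using w by simp
    qed
  qed
  then show ?thesis ..
qed

section \<open>Functions on a quotient and their sums over representatives\<close>

definition supp_in :: "('v \<Rightarrow> complex) \<Rightarrow> 'v set \<Rightarrow> bool" where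
  "supp_in f S \<longleftrightarrow> (\<forall>v. f v \<noteq> 0 \<longrightarrow> v \<in> S)"

definition inv_by :: "('v::ab_group_add \<Rightarrow> complex) \<Rightarrow> 'v set \<Rightarrow> bool" where
  "inv_by f S \<longleftrightarrow> (\<forall>v. \<forall>u\<in>S. f (v + u) = f v)"

lemma supp_inD: "supp_in f S ==> v \<notin> S ==> f v = 0"
  by (auto simp: supp_in_def)

lemma inv_byD: "inv_by f S ==> u \<in> S ==> f (v + u) = f v"
  by (auto simp: inv_by_def)

lemma inv_by_diff: "inv_by f S ==> v - w \<in> S ==> f v = f w"
  using inv_byD[of f S "v - w" w] by simp

lemma supp_in_mono: "supp_in f S ==> S \<subseteq> T ==> supp_in f T"
  by (auto simp: supp_in_def)

lemma inv_by_mono: "inv_by f S ==> T \<subseteq> S ==> inv_by f T"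
  by (auto simp: inv_by_def)

lemma transversal_sum_eq:
  fixes f :: "'v::ab_group_add \<Rightarrow> complex"
  assumes S: "subgrp S" and R: "transversal R S T" and Q: "transversal Q S T" and f: "inv_by f S"
  shows "sum f R = sum f Q"
proof -
  define h where "h r = (THE q. q \<in> Q \<and> r - q \<in> S)" for r
  have h: "h r \<in> Q \<and> r - h r \<in> S" if "r \<in> R" for r
  proof -
    have "\<exists>!q. q \<in> Q \<and> r - q \<in> S" using that R Q unfolding transversal_def by blast
    from theI'[OF this] show ?thesis by (simp add: h_def)
  qed
  have "bij_betw h R Q"
  proof (rule bij_betwI')
    fix x y assume x: "x \<in> R" and y: "y \<in> R"
    show "(h x = h y) = (x = y)"
    proof
      assume "h x = h y"
      then have "x - y \<in> S"
        using h[OF x] h[OF y] subgrp_diff_trans[OF S] subgrp_diff_sym[OF S] by metis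
      moreover have "x - x \<in> S" "x \<in> T" using S x R by (auto simp: subgrp_zero transversal_def)
      ultimately show "x = y" using R x y unfolding transversal_def by blast
    qed auto
  next
    fix x assume "x \<in> R" then show "h x \<in> Q" using h by blast
  next
    fix q assume q: "q \<in> Q"
    then obtain r where r: "r \<in> R" "q - r \<in> S" using Q R unfolding transversal_def by blast
    have "r \<in> T" using r R by (auto simp: transversal_def)
    then have "h r = q"
      using h[OF r(1)] subgrp_diff_sym[OF S r(2)] q Q unfolding transversal_def by blast
    then show "\<exists>x\<in>R. q = h x" using r by blast
  qed
  then have "sum f Q = sum (\<lambda>r. f (h r)) R"
    by (simp add: sum.reindex_bij_betw)
  also have "\<dots> = sum f R"
    using h inv_by_diff[OF f] by (intro sum.cong) metis+
  finally show ?thesis by simp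
qed

lemma transversal_self: "subgrp S ==> transversal {0} S S"
  by (auto simp: transversal_def subgrp_zero)

lemma transversal_card_pos: "transversal R S T ==> T \<noteq> {} ==> card R \<noteq> 0"
  unfolding transversal_def by auto

text \<open>Subtract from an element of \<open>T\<close> its representative modulo
  \<open>S'\<close>; the rest lies in \<open>S'\<close> and has a representative modulo
  \<open>S\<close>.\<close>

lemma transversal_plus:
  assumes S: "subgrp S" and S': "subgrp S'" "S \<subseteq> S'" and T: "subgrp T" "S' \<subseteq> T"
    and A: "transversal A S S'" and R: "transversal R S' T"
  shows "inj_on (\<lambda>(a, r). a + r) (A \<times> R)" (is ?A)
    and "transversal ((\<lambda>(a, r). a + r) ` (A \<times> R)) S T" (is ?B)
proof -
  have eq: "r = r' \<and> a = a'" if m: "a \<in> A" "a' \<in> A" "r \<in> R" "r' \<in> R" and d: "(a + r) - (a' + r') \<in> S"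
    for a r a' r'
  proof -
    have a: "a \<in> S'" "a' \<in> S'" using m A by (auto simp: transversal_def)
    have "((a + r) - (a' + r')) - (a - a') \<in> S'"
      using a by (intro subgrp_diff[OF S'(1)] subsetD[OF S'(2) d]) auto
    then have "r - r' \<in> S'" by simp
    moreover have "r - r \<in> S'" "r \<in> T" using S' m R by (auto simp: subgrp_zero transversal_def)
    ultimately have r: "r = r'" using R m unfolding transversal_def by blast
    then have "a - a' \<in> S" using d by simp
    moreover have "a - a \<in> S" using S by (simp add: subgrp_zero)
    ultimately have "a = a'" using A m unfolding transversal_def by blast
    with r show ?thesis by simp
  qed
  show ?A
    using eq S by (fastforce simp: inj_on_def subgrp_zero)
  show ?B
    unfolding transversal_def
  proof (intro conjI ballI)
    show "finite ((\<lambda>(a, r). a + r) ` (A \<times> R))" using A R by (auto simp: transversal_def)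
    show "(\<lambda>(a, r). a + r) ` (A \<times> R) \<subseteq> T"
    proof clarify
      fix a r assume "a \<in> A" "r \<in> R"
      then have "a \<in> T" "r \<in> T" using A R T by (auto simp: transversal_def)
      then show "a + r \<in> T" by (rule subgrp_add[OF T(1)])
    qed
    fix v assume v: "v \<in> T"
    then obtain r where r: "r \<in> R" "v - r \<in> S'" using R unfolding transversal_def by blast
    then obtain a where a: "a \<in> A" "v - r - a \<in> S" using A unfolding transversal_def by blast
    show "\<exists>!x. x \<in> (\<lambda>(a, r). a + r) ` (A \<times> R) \<and> v - x \<in> S"
    proof (rule ex1I[of _ "a + r"])
      show "a + r \<in> (\<lambda>(a, r). a + r) ` (A \<times> R) \<and> v - (a + r) \<in> S"
        using r a by (force simp: algebra_simps)
      fix x assume x: "x \<in> (\<lambda>(a, r). a + r) ` (A \<times> R) \<and> v - x \<in> S"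
      then obtain a' r' where x': "a' \<in> A" "r' \<in> R" "x = a' + r'" by auto
      have "(v - (a + r)) \<in> S" using a by (simp add: algebra_simps)
      then have "(a' + r') - (a + r) \<in> S"
        using x x' subgrp_diff_trans[OF S] subgrp_diff_sym[OF S] by metis
      then show "x = a + r" using eq[of a' a r' r] x' a r by auto
    qed
  qed
qed

text \<open>\<open>f\<close> is constant on a coset of \<open>S'\<close>, which splits into
  \<open>card A\<close> cosets of \<open>S\<close>. This is how a sum changes when the invariance is
  refined; the factor is absorbed by the normalisation in \<open>meas_exists\<close>.\<close>

lemma transversal_sum_plus:
  fixes f :: "'v::ab_group_add \<Rightarrow> complex"
  assumes "subgrp S" "subgrp S'" "S \<subseteq> S'" "subgrp T" "S' \<subseteq> T"
    and "transversal A S S'" "transversal R S' T" "transversal W S T" "inv_by f S'"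
  shows "sum f W = of_nat (card A) * sum f R"
proof -
  let ?p = "\<lambda>(a, r). a + r"
  have fS: "inv_by f S" using assms inv_by_mono by blast
  have "sum f W = sum f (?p ` (A \<times> R))"
    using transversal_sum_eq[OF assms(1,8) transversal_plus(2)[OF assms(1-7)] fS] .
  also have "\<dots> = (\<Sum>x\<in>A \<times> R. f (?p x))"
    by (rule sum.reindex[OF transversal_plus(1)[OF assms(1-7)], unfolded o_def])
  also have "\<dots> = (\<Sum>a\<in>A. \<Sum>r\<in>R. f (a + r))"
    by (simp add: sum.cartesian_product case_prod_unfold)
  also have "\<dots> = (\<Sum>a\<in>A. \<Sum>r\<in>R. f r)"
  proof (intro sum.cong refl)
    fix a r assume "a \<in> A"
    then have "a \<in> S'" using assms by (auto simp: transversal_def)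
    then show "f (a + r) = f r" using inv_byD[OF assms(9), of a r] by (simp add: add.commute)
  qed
  finally show ?thesis by simp
qed

lemma transversal_card_plus:
  assumes "subgrp S" "subgrp S'" "S \<subseteq> S'" "subgrp T" "S' \<subseteq> T"
    and "transversal A S S'" "transversal R S' T" "transversal W S T"
  shows "card W = card A * card R"
proof -
  have "sum (\<lambda>_. 1::complex) W = of_nat (card A) * sum (\<lambda>_. 1) R"
    using assms by (rule transversal_sum_plus) (simp add: inv_by_def)
  then have "(of_nat (card W)::complex) = of_nat (card A * card R)" by simp
  then show ?thesis by (simp only: of_nat_eq_iff)
qed

text \<open>\<open>T\<close> is a union of cosets of \<open>S\<close>, so a representative of a
  coset in \<open>T\<close> lies in \<open>T\<close> itself. Complements
  \<open>transversal_sum_plus\<close>: here the ambient group is enlarged, there the subgroup is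
  refined.\<close>

lemma transversal_sum_supp:
  assumes "subgrp T" "S \<subseteq> T" "T \<subseteq> U" and W: "transversal W S U" and f: "supp_in f T"
  shows "transversal (W \<inter> T) S T" (is ?A) and "sum f W = sum f (W \<inter> T)" (is ?B)
proof -
  show ?A
    unfolding transversal_def
  proof (intro conjI ballI)
    show "finite (W \<inter> T)" "W \<inter> T \<subseteq> T" using W by (auto simp: transversal_def)
    fix v assume v: "v \<in> T"
    then obtain r where r: "r \<in> W" "v - r \<in> S" "\<And>r'. r' \<in> W ==> v - r' \<in> S ==> r' = r"
      using W assms(3) unfolding transversal_def by (metis subsetD)
    then have "r \<in> T" using subgrp_diff_iff[OF assms(1), of v r] v assms(2) by blast
    then show "\<exists>!r. r \<in> W \<inter> T \<and> v - r \<in> S" using r by blast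
  qed
  show ?B
    using W supp_inD[OF f] by (intro sum.mono_neutral_right) (auto simp: transversal_def)
qed


section \<open>Filtered groups with finite quotients\<close>

text \<open>A \<open>C1_space\<close> over a finite field reduced to additive groups: a
  finite-dimensional quotient is a finite one, and a finite set of representatives is the form in
  which this enters integrals. Duals are shown to be of this kind in
  \<open>dual1_tower\<close>.\<close>

definition "tower E \<longleftrightarrow> idx E \<noteq> {} \<and> le E \<subseteq> idx E \<times> idx E \<and> refl_on (idx E) (le E) \<and> trans (le E) \<and>
     (\<forall>i\<in>idx E. \<forall>j\<in>idx E. \<exists>k l. (k, i) \<in> le E \<and> (i, l) \<in> le E \<and> (k, j) \<in> le E \<and> (j, l) \<in> le E) \<and>
     (\<forall>i\<in>idx E. subgrp (fil E i)) \<and>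
     (\<forall>(i, j)\<in>le E. fil E i \<subseteq> fil E j \<and> (\<exists>R. transversal R (fil E i) (fil E j)))"

lemma tower_idx: "tower E ==> (i, j) \<in> le E ==> i \<in> idx E \<and> j \<in> idx E"
  by (auto simp: tower_def)

lemma tower_nonempty: "tower E ==> \<exists>i. i \<in> idx E"
  by (auto simp: tower_def)

lemma tower_refl: "tower E ==> i \<in> idx E ==> (i, i) \<in> le E"
  by (auto simp: tower_def refl_on_def)

lemma tower_trans: "tower E ==> (i, j) \<in> le E ==> (j, k) \<in> le E ==> (i, k) \<in> le E"
  unfolding tower_def by (meson transD)

lemma tower_lower:
  assumes "tower E" "i \<in> idx E" "j \<in> idx E"
  obtains k where "(k, i) \<in> le E" "(k, j) \<in> le E"
  using assms unfolding tower_def by metis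

lemma tower_upper:
  assumes "tower E" "i \<in> idx E" "j \<in> idx E"
  obtains k where "(i, k) \<in> le E" "(j, k) \<in> le E"
  using assms unfolding tower_def by metis

lemma tower_subgrp: "tower E ==> i \<in> idx E ==> subgrp (fil E i)"
  by (auto simp: tower_def)

lemma tower_mono: "tower E ==> (i, j) \<in> le E ==> fil E i \<subseteq> fil E j"
  by (auto simp: tower_def)

lemma tower_transversal: "tower E ==> (i, j) \<in> le E ==> \<exists>R. transversal R (fil E i) (fil E j)"
  by (auto simp: tower_def)

lemma fil_carr: "i \<in> idx E ==> fil E i \<subseteq> carr E"
  by (auto simp: carr_def)

lemma nul_fil: "i \<in> idx E ==> nul E \<subseteq> fil E i"
  by (auto simp: nul_def)

lemma tower_carr_subgrp: assumes "tower E" shows "subgrp (carr E)"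
proof -
  obtain i where i: "i \<in> idx E" using tower_nonempty[OF assms] by blast
  have "0 \<in> carr E" using subgrp_zero[OF tower_subgrp[OF assms i]] fil_carr[OF i] by blast
  moreover have "x - y \<in> carr E" if xy: "x \<in> carr E" "y \<in> carr E" for x y
  proof -
    obtain a b where ab: "a \<in> idx E" "x \<in> fil E a" "b \<in> idx E" "y \<in> fil E b"
      using xy unfolding carr_def by blast
    then obtain c where c: "(a, c) \<in> le E" "(b, c) \<in> le E" using tower_upper[OF assms] by blast
    then have "x - y \<in> fil E c"
      using tower_mono[OF assms] ab tower_subgrp[OF assms] tower_idx[OF assms] subgrp_diff
      by (metis subsetD)
    then show ?thesis using tower_idx[OF assms c(1)] fil_carr[of c E] by auto
  qed
  ultimately show ?thesis by (auto simp: subgrp_def)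
qed

lemma tower_nul_subgrp: "tower E ==> subgrp (nul E)"
  using tower_subgrp[of E] unfolding subgrp_def nul_def by blast

lemma nul_carr: "tower E ==> nul E \<subseteq> carr E"
  by (metis tower_nonempty nul_fil fil_carr order_trans)

section \<open>Test functions\<close>

lemma test_fun_iff:
  "f \<in> test_fun E \<longleftrightarrow> (\<exists>j\<in>idx E. supp_in f (fil E j)) \<and> (\<exists>i\<in>idx E. inv_by f (fil E i))"
  by (auto simp: test_fun_def supp_in_def inv_by_def)

lemma test_fun_bounds:
  assumes "tower E" "f \<in> test_fun E" "i0 \<in> idx E" "j0 \<in> idx E"
  obtains i j where "(i, i0) \<in> le E" "(j0, j) \<in> le E" "(i, j) \<in> le E"
    "supp_in f (fil E j)" "inv_by f (fil E i)"
proof -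
  obtain j1 i1 where *: "j1 \<in> idx E" "supp_in f (fil E j1)" "i1 \<in> idx E" "inv_by f (fil E i1)"
    using assms(2) by (auto simp: test_fun_iff)
  obtain j where j: "(j0, j) \<in> le E" "(j1, j) \<in> le E" using tower_upper[OF assms(1,4) *(1)] .
  obtain i2 where i2: "(i2, i0) \<in> le E" "(i2, i1) \<in> le E" using tower_lower[OF assms(1,3) *(3)] .
  obtain i where i: "(i, i2) \<in> le E" "(i, j) \<in> le E"
    using tower_lower[OF assms(1)] tower_idx[OF assms(1)] i2 j by metis
  show thesis
  proof (rule that)
    show "(i, i0) \<in> le E" "(i, j) \<in> le E" "(j0, j) \<in> le E" using i i2 j tower_trans[OF assms(1)] by blast+
    show "supp_in f (fil E j)" using * j tower_mono[OF assms(1)] supp_in_mono by blast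
    show "inv_by f (fil E i)" using * i i2 tower_mono[OF assms(1)] inv_by_mono
      by (metis order_trans)
  qed
qed

lemma test_fun_supp_carr: "f \<in> test_fun E ==> supp_in f (carr E)"
  by (metis fil_carr supp_in_mono test_fun_iff)

lemma test_fun_inv_nul: "f \<in> test_fun E ==> inv_by f (nul E)"
  by (metis nul_fil inv_by_mono test_fun_iff)

lemma test_funI: "supp_in f (fil E j) ==> inv_by f (fil E i) ==> i \<in> idx E ==> j \<in> idx E ==> f \<in> test_fun E"
  by (auto simp: test_fun_iff)

lemma test_fun_zero: "tower E ==> (\<lambda>_. 0) \<in> test_fun E"
  using tower_nonempty[of E] by (auto simp: test_fun_iff supp_in_def inv_by_def)

lemma test_fun_bounds2:
  assumes "tower E" "f \<in> test_fun E" "g \<in> test_fun E" "i0 \<in> idx E" "j0 \<in> idx E"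
  obtains i j where "(i, i0) \<in> le E" "(j0, j) \<in> le E" "(i, j) \<in> le E"
    "supp_in f (fil E j)" "inv_by f (fil E i)" "supp_in g (fil E j)" "inv_by g (fil E i)"
proof -
  obtain i j where 1: "(i, i0) \<in> le E" "(j0, j) \<in> le E" "(i, j) \<in> le E"
    "supp_in f (fil E j)" "inv_by f (fil E i)"
    using test_fun_bounds[OF assms(1,2,4,5)] .
  have ij: "i \<in> idx E" "j \<in> idx E" using 1(3) tower_idx[OF assms(1)] by auto
  obtain i' j' where 2: "(i', i) \<in> le E" "(j, j') \<in> le E" "(i', j') \<in> le E"
    "supp_in g (fil E j')" "inv_by g (fil E i')"
    using test_fun_bounds[OF assms(1,3) ij] .
  show thesis
  proof (rule that[of i' j'])
    show "(i', i0) \<in> le E" "(j0, j') \<in> le E" using 1 2 tower_trans[OF assms(1)] by blast+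
    show "supp_in f (fil E j')" using 1 2 tower_mono[OF assms(1)] supp_in_mono by blast
    show "inv_by f (fil E i')" using 1 2 tower_mono[OF assms(1)] inv_by_mono by blast
  qed (use 2 in auto)
qed

lemma test_fun_add:
  assumes "tower E" "f \<in> test_fun E" "g \<in> test_fun E"
  shows "(\<lambda>v. f v + g v) \<in> test_fun E"
proof -
  obtain i0 where "i0 \<in> idx E" using tower_nonempty[OF assms(1)] by blast
  then obtain i j where 1: "(i, i0) \<in> le E" "(i0, j) \<in> le E" "(i, j) \<in> le E"
    "supp_in f (fil E j)" "inv_by f (fil E i)" "supp_in g (fil E j)" "inv_by g (fil E i)"
    using test_fun_bounds2[OF assms] by blast
  show ?thesis
  proof (rule test_funI)
    show "supp_in (\<lambda>v. f v + g v) (fil E j)" using 1 unfolding supp_in_def by (metis add.right_neutral)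
    show "inv_by (\<lambda>v. f v + g v) (fil E i)" using 1 unfolding inv_by_def by simp
  qed (use 1 tower_idx[OF assms(1)] in auto)
qed

lemma test_fun_scale: "f \<in> test_fun E ==> (\<lambda>v. c * f v) \<in> test_fun E"
  unfolding test_fun_iff supp_in_def inv_by_def by (metis mult_zero_right)

lemma test_fun_sum:
  assumes "tower E" "\<And>r. r \<in> R ==> h r \<in> test_fun E"
  shows "(\<lambda>v. \<Sum>r\<in>R. h r v) \<in> test_fun E"
  using assms(2)
  by (induction R rule: infinite_finite_induct) (simp_all add: test_fun_zero test_fun_add assms(1))

lemma test_fun_translate:
  assumes "tower E" "f \<in> test_fun E" "a \<in> carr E"
  shows "(\<lambda>v. f (v + a)) \<in> test_fun E"
proof -
  obtain j0 where j0: "j0 \<in> idx E" "a \<in> fil E j0" using assms(3) by (auto simp: carr_def)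
  obtain i j where 1: "(i, j0) \<in> le E" "(j0, j) \<in> le E" "(i, j) \<in> le E"
    "supp_in f (fil E j)" "inv_by f (fil E i)"
    using test_fun_bounds[OF assms(1,2) j0(1) j0(1)] by blast
  have a: "a \<in> fil E j" using 1 j0 tower_mono[OF assms(1)] by blast
  have j: "subgrp (fil E j)" using tower_subgrp[OF assms(1)] tower_idx[OF assms(1) 1(3)] by simp
  show ?thesis
  proof (rule test_funI)
    show "supp_in (\<lambda>v. f (v + a)) (fil E j)" using 1 subgrp_add_iff[OF j a] unfolding supp_in_def by blast
    have "f (v + u + a) = f (v + a)" if "u \<in> fil E i" for u v
      using inv_byD[OF 1(5) that, of "v + a"] by (simp add: algebra_simps)
    then show "inv_by (\<lambda>v. f (v + a)) (fil E i)" by (simp add: inv_by_def)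
  qed (use 1 tower_idx[OF assms(1)] in auto)
qed

lemma indicator_test_fun:
  assumes "tower E" "i \<in> idx E"
  shows "indicator (fil E i) \<in> test_fun E"
proof (rule test_funI[OF _ _ assms(2,2)])
  show "supp_in (indicator (fil E i)) (fil E i)" by (simp add: supp_in_def indicator_def)
  show "inv_by (indicator (fil E i)) (fil E i)"
    using subgrp_add_iff[OF tower_subgrp[OF assms]] by (simp add: inv_by_def indicator_def)
qed

lemma indicator_translate_test_fun:
  assumes "tower E" "i \<in> idx E" "r \<in> carr E"
  shows "(\<lambda>v. indicator (fil E i) (v - r)) \<in> test_fun E"
  using test_fun_translate[OF assms(1) indicator_test_fun[OF assms(1,2)], of "- r"]
    subgrp_uminus[OF tower_carr_subgrp[OF assms(1)] assms(3)] by simp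

text \<open>At each \<open>v\<close> at most one summand is nonzero, that of the representative of
  \<open>v\<close>. The expansion reduces integration (\<open>meas_sum\<close>) and the Fourier
  transform (\<open>four_test_fun\<close>, \<open>four_at_zero_aux\<close>) to translates of one
  indicator.\<close>

lemma test_fun_decompose:
  assumes "tower E" "(i, j) \<in> le E" "supp_in f (fil E j)" "inv_by f (fil E i)"
    "transversal R (fil E i) (fil E j)"
  shows "f = (\<lambda>v. \<Sum>r\<in>R. f r * indicator (fil E i) (v - r))"
proof
  fix v
  show "f v = (\<Sum>r\<in>R. f r * indicator (fil E i) (v - r))"
  proof (cases "v \<in> fil E j")
    case True
    then obtain r where r: "r \<in> R" "v - r \<in> fil E i" "\<And>r'. r' \<in> R ==> v - r' \<in> fil E i ==> r' = r"
      using assms(5) unfolding transversal_def by metis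
    have "(\<Sum>r\<in>R. f r * indicator (fil E i) (v - r)) = (\<Sum>r'\<in>R. if r' = r then f r else 0)"
    proof (intro sum.cong refl)
      fix r' assume "r' \<in> R"
      then have "v - r' \<in> fil E i \<longleftrightarrow> r' = r" using r by blast
      then show "f r' * indicator (fil E i) (v - r') = (if r' = r then f r else 0)"
        by (simp add: indicator_def)
    qed
    also have "\<dots> = f r" using r(1) assms(5) by (simp add: transversal_def)
    also have "\<dots> = f v" using inv_by_diff[OF assms(4) r(2)] by (rule sym)
    finally show ?thesis by simp
  next
    case False
    have "v - r \<notin> fil E i" if "r \<in> R" for r
    proof
      assume "v - r \<in> fil E i"
      then have "v - r \<in> fil E j" using tower_mono[OF assms(1,2)] by blast
      moreover have "r \<in> fil E j" using that assms by (auto simp: transversal_def)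
      ultimately show False
        using False subgrp_diff_iff[of "fil E j" v r] tower_subgrp[OF assms(1), of j] tower_idx[OF assms(1,2)] by simp
    qed
    then show ?thesis using supp_inD[OF assms(3) False] by simp
  qed
qed

subsection \<open>Invariant measures\<close>

lemma plus_fun_eq: "f + g = (\<lambda>v. f v + g v)"
  by (rule ext) simp

lemma distr_add: "m \<in> distr E ==> f \<in> test_fun E ==> g \<in> test_fun E ==> m (\<lambda>v. f v + g v) = m f + m g"
  unfolding distr_def plus_fun_eq by blast

lemma distr_scale: "m \<in> distr E ==> f \<in> test_fun E ==> m (\<lambda>v. c * f v) = c * m f"
  unfolding distr_def by blast

lemma distr_out: "m \<in> distr E ==> f \<notin> test_fun E ==> m f = 0"
  unfolding distr_def by blast

lemma distr_zero_fun: "tower E ==> m \<in> distr E ==> m (\<lambda>_. 0) = 0"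
  using distr_scale[of m E "\<lambda>_. 0" 0] test_fun_zero by fastforce

lemma distrI:
  assumes "\<And>f g. f \<in> test_fun E ==> g \<in> test_fun E ==> m (\<lambda>v. f v + g v) = m f + m g"
    and "\<And>f c. f \<in> test_fun E ==> m (\<lambda>v. c * f v) = c * m f"
    and "\<And>f. f \<notin> test_fun E ==> m f = 0"
  shows "m \<in> distr E"
  using assms unfolding distr_def plus_fun_eq by blast

lemma distr_sum:
  assumes "tower E" "m \<in> distr E" "\<And>r. r \<in> R ==> h r \<in> test_fun E"
  shows "m (\<lambda>v. \<Sum>r\<in>R. c r * h r v) = (\<Sum>r\<in>R. c r * m (h r))"
  using assms(3)
proof (induction R rule: infinite_finite_induct)
  case (insert x F)
  have "m (\<lambda>v. c x * h x v + (\<Sum>r\<in>F. c r * h r v)) = m (\<lambda>v. c x * h x v) + m (\<lambda>v. \<Sum>r\<in>F. c r * h r v)"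
    using insert by (intro distr_add[OF assms(2)] test_fun_scale test_fun_sum assms(1)) auto
  then show ?case using insert by (simp add: distr_scale[OF assms(2)])
qed (simp_all add: distr_zero_fun[OF assms(1,2)])

lemma meas_distr: "m \<in> meas E ==> m \<in> distr E"
  by (simp add: meas_def)

lemma meas_translate: "m \<in> meas E ==> f \<in> test_fun E ==> a \<in> carr E ==> m (\<lambda>v. f (v + a)) = m f"
  by (simp add: meas_def)

lemma distr_eqI:
  assumes "m \<in> distr E" "n \<in> distr E" "\<And>f. f \<in> test_fun E ==> m f = n f"
  shows "m = n"
proof
  fix f show "m f = n f" using assms by (cases "f \<in> test_fun E") (auto simp: distr_out)
qed

lemma meas_sum:
  assumes E: "tower E" and m: "m \<in> meas E" and ij: "(i, j) \<in> le E"
    and f: "supp_in f (fil E j)" "inv_by f (fil E i)" and R: "transversal R (fil E i) (fil E j)"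
  shows "m f = m (indicator (fil E i)) * sum f R"
proof -
  have i: "i \<in> idx E" and j: "j \<in> idx E" using tower_idx[OF E ij] by auto
  have rc: "r \<in> carr E" if "r \<in> R" for r using that R fil_carr[OF j] by (auto simp: transversal_def)
  have "m f = m (\<lambda>v. \<Sum>r\<in>R. f r * indicator (fil E i) (v - r))"
    using test_fun_decompose[OF E ij f R] by simp
  also have "\<dots> = (\<Sum>r\<in>R. f r * m (\<lambda>v. indicator (fil E i) (v - r)))"
    by (rule distr_sum[OF E meas_distr[OF m]]) (use indicator_translate_test_fun[OF E i] rc in blast)
  also have "\<dots> = (\<Sum>r\<in>R. f r * m (indicator (fil E i)))"
  proof (intro sum.cong refl)
    fix r assume "r \<in> R"
    then have "- r \<in> carr E" using rc tower_carr_subgrp[OF E] subgrp_uminus by blast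
    from meas_translate[OF m indicator_test_fun[OF E i] this]
    show "f r * m (\<lambda>v. indicator (fil E i) (v - r)) = f r * m (indicator (fil E i))" by simp
  qed
  finally show ?thesis by (simp add: sum_distrib_right mult.commute[of "m (indicator _)"])
qed

lemma meas_indicator_card:
  assumes E: "tower E" and m: "m \<in> meas E" and ij: "(i, j) \<in> le E" and R: "transversal R (fil E i) (fil E j)"
  shows "m (indicator (fil E j)) = m (indicator (fil E i)) * of_nat (card R)"
proof -
  have j: "j \<in> idx E" using tower_idx[OF E ij] by auto
  have "m (indicator (fil E j)) = m (indicator (fil E i)) * sum (indicator (fil E j)) R"
  proof (rule meas_sum[OF E m ij _ _ R])
    show "supp_in (indicator (fil E j)) (fil E j)" by (simp add: supp_in_def indicator_def)
    show "inv_by (indicator (fil E j)) (fil E i)"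
      using subgrp_add_iff[OF tower_subgrp[OF E j]] tower_mono[OF E ij] by (auto simp: inv_by_def indicator_def)
  qed
  moreover have "sum (indicator (fil E j)) R = (\<Sum>r\<in>R. 1::complex)"
    using R by (intro sum.cong) (auto simp: transversal_def)
  ultimately show ?thesis by simp
qed

text \<open>The mass of one member gives that of every smaller one, by division by the index, and
  thereby all integrals through \<open>meas_sum\<close>. This is the one-dimensionality of the space
  of measures, in the form used to identify measures throughout.\<close>

lemma meas_eqI:
  assumes E: "tower E" and m: "m \<in> meas E" and n: "n \<in> meas E" and i0: "i0 \<in> idx E"
    and eq: "m (indicator (fil E i0)) = n (indicator (fil E i0))"
  shows "m = n"
proof (rule distr_eqI[OF meas_distr[OF m] meas_distr[OF n]])
  fix f assume f: "f \<in> test_fun E"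
  obtain i j where *: "(i, i0) \<in> le E" "(i, j) \<in> le E" "supp_in f (fil E j)" "inv_by f (fil E i)"
    using test_fun_bounds[OF E f i0 i0] by metis
  obtain R where R: "transversal R (fil E i) (fil E i0)" using tower_transversal[OF E *(1)] by blast
  obtain Q where Q: "transversal Q (fil E i) (fil E j)" using tower_transversal[OF E *(2)] by blast
  have "card R \<noteq> 0" using transversal_card_pos[OF R] subgrp_zero[OF tower_subgrp[OF E i0]] by blast
  then have "m (indicator (fil E i)) = n (indicator (fil E i))"
    using eq meas_indicator_card[OF E m *(1) R] meas_indicator_card[OF E n *(1) R] by simp
  then show "m f = n f"
    using meas_sum[OF E m *(2-4) Q] meas_sum[OF E n *(2-4) Q] by simp
qed

lemma zero_meas: "(\<lambda>_. 0) \<in> meas E"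
  by (simp add: meas_def distr_def)

lemma meas_scale: "m \<in> meas E ==> (\<lambda>f. c * m f) \<in> meas E"
  by (auto simp: meas_def distr_def algebra_simps)

lemma meas_add: "m \<in> meas E ==> n \<in> meas E ==> m + n \<in> meas E"
  by (simp add: meas_def distr_def algebra_simps)

lemma meas_indicator_nonzero:
  assumes E: "tower E" and m: "m \<in> meas E" "m \<noteq> 0" and i: "i \<in> idx E"
  shows "m (indicator (fil E i)) \<noteq> 0"
proof
  assume "m (indicator (fil E i)) = 0"
  then have "m = (\<lambda>_. 0)" using meas_eqI[OF E m(1) zero_meas i] by simp
  with m show False by auto
qed

text \<open>The integral is a Riemann sum over representatives of F(j)/F(i), divided by the index of
  F(i) in F(i0) so that F(i0) gets mass 1. \<open>P f z\<close> collects all such values;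
  \<open>uniq\<close> shows that there is only one.\<close>

lemma meas_exists:
  assumes E: "tower E" and i0: "i0 \<in> idx E"
  shows "\<exists>m\<in>meas E. m (indicator (fil E i0)) = 1"
proof -
  let ?F = "fil E"
  define P where "P f z \<longleftrightarrow> (\<exists>i j R Q. (i, j) \<in> le E \<and> (i, i0) \<in> le E \<and> supp_in f (?F j) \<and> inv_by f (?F i) \<and>
     transversal R (?F i) (?F j) \<and> transversal Q (?F i) (?F i0) \<and> z = sum f R / of_nat (card Q))"
    for f :: "'b \<Rightarrow> complex" and z
  \<comment> \<open>Passing from \<open>i\<close> to a lower \<open>i'\<close> multiplies numerator
    and denominator by the same index \<open>card A\<close>; passing from \<open>j\<close> to a
    higher \<open>j'\<close> adds only zeros. Two choices are later compared at a common (i',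
    j').\<close>
  have norm: "z = sum f W / of_nat (card B)"
    if t: "(i, j) \<in> le E" "(i, i0) \<in> le E" "supp_in f (?F j)" "inv_by f (?F i)"
     "transversal R (?F i) (?F j)" "transversal Q (?F i) (?F i0)" "z = sum f R / of_nat (card Q)"
     "(i', i) \<in> le E" "(j, j') \<in> le E" "transversal W (?F i') (?F j')" "transversal B (?F i') (?F i0)"
    for i j i' j' R Q W B z and f :: "'b \<Rightarrow> complex"
  proof -
    note sg = tower_subgrp[OF E] and ix = tower_idx[OF E] and mo = tower_mono[OF E]
    obtain A where A: "transversal A (?F i') (?F i)" using tower_transversal[OF E t(8)] by blast
    have a: "card A \<noteq> 0" using transversal_card_pos[OF A] subgrp_zero[OF sg] ix[OF t(1)] by blast
    have B: "card B = card A * card Q"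
      using transversal_card_plus[OF _ _ _ _ _ A t(6,11)] sg ix mo t by metis
    have ij': "fil E i' \<subseteq> fil E j" using mo t by blast
    have W: "transversal (W \<inter> ?F j) (?F i') (?F j)" "sum f W = sum f (W \<inter> ?F j)"
      using transversal_sum_supp[OF _ ij' _ t(10,3)] sg ix mo t by blast+
    have "sum f (W \<inter> ?F j) = of_nat (card A) * sum f R"
      using transversal_sum_plus[OF _ _ _ _ _ A t(5) W(1) t(4)] sg ix mo t by metis
    then show ?thesis using a t(7) B W(2) by simp
  qed
  have ex: "\<exists>z. P f z" if f: "f \<in> test_fun E" for f
  proof -
    obtain i j where *: "(i, i0) \<in> le E" "(i, j) \<in> le E" "supp_in f (?F j)" "inv_by f (?F i)"
      using test_fun_bounds[OF E f i0 i0] by metis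
    obtain R where R: "transversal R (?F i) (?F j)" using tower_transversal[OF E *(2)] by blast
    obtain Q where Q: "transversal Q (?F i) (?F i0)" using tower_transversal[OF E *(1)] by blast
    show ?thesis unfolding P_def using * R Q by blast
  qed
  have uniq: "z = z'" if "P f z" "P f z'" for f z z'
  proof -
    obtain i j R Q where 1: "(i, j) \<in> le E" "(i, i0) \<in> le E" "supp_in f (?F j)" "inv_by f (?F i)"
     "transversal R (?F i) (?F j)" "transversal Q (?F i) (?F i0)" "z = sum f R / of_nat (card Q)"
      using \<open>P f z\<close> unfolding P_def by blast
    obtain i1 j1 R1 Q1 where 2: "(i1, j1) \<in> le E" "(i1, i0) \<in> le E" "supp_in f (?F j1)" "inv_by f (?F i1)"
     "transversal R1 (?F i1) (?F j1)" "transversal Q1 (?F i1) (?F i0)" "z' = sum f R1 / of_nat (card Q1)"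
      using \<open>P f z'\<close> unfolding P_def by blast
    obtain i' where i': "(i', i) \<in> le E" "(i', i1) \<in> le E"
      using tower_lower[OF E] tower_idx[OF E] 1(1) 2(1) by metis
    obtain j' where j': "(j, j') \<in> le E" "(j1, j') \<in> le E"
      using tower_upper[OF E] tower_idx[OF E] 1(1) 2(1) by metis
    obtain W where W: "transversal W (?F i') (?F j')"
      using tower_transversal[OF E] tower_trans[OF E] i' j' 1(1) by metis
    obtain B where B: "transversal B (?F i') (?F i0)"
      using tower_transversal[OF E] tower_trans[OF E] i' 1(2) by metis
    show ?thesis using norm[OF 1 i'(1) j'(1) W B] norm[OF 2 i'(2) j'(2) W B] by simp
  qed
  define m where "m f = (if f \<in> test_fun E then (THE z. P f z) else 0)" for f
  have mP: "m f = z" if "f \<in> test_fun E" "P f z" for f z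
    unfolding m_def using that uniq by auto
  have msum: "m f = sum f R / of_nat (card Q)"
    if "(i, j) \<in> le E" "(i, i0) \<in> le E" "supp_in f (?F j)" "inv_by f (?F i)"
     "transversal R (?F i) (?F j)" "transversal Q (?F i) (?F i0)" for f i j R Q
  proof (rule mP)
    show "f \<in> test_fun E" using that tower_idx[OF E] by (intro test_funI) auto
    show "P f (sum f R / of_nat (card Q))" unfolding P_def using that by blast
  qed
  have "m \<in> meas E"
    unfolding meas_def
  proof (intro CollectI conjI ballI)
    show "m \<in> distr E"
    proof (rule distrI)
      fix f g assume f: "f \<in> test_fun E" and g: "g \<in> test_fun E"
      obtain i j where *: "(i, i0) \<in> le E" "(i, j) \<in> le E" "supp_in f (?F j)" "inv_by f (?F i)"
         "supp_in g (?F j)" "inv_by g (?F i)"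
        using test_fun_bounds2[OF E f g i0 i0] by metis
      obtain R where R: "transversal R (?F i) (?F j)" using tower_transversal[OF E *(2)] by blast
      obtain Q where Q: "transversal Q (?F i) (?F i0)" using tower_transversal[OF E *(1)] by blast
      have "supp_in (\<lambda>v. f v + g v) (fil E j)" using * unfolding supp_in_def by (metis add.right_neutral)
      moreover have "inv_by (\<lambda>v. f v + g v) (fil E i)" using * unfolding inv_by_def by simp
      ultimately show "m (\<lambda>v. f v + g v) = m f + m g"
        using msum[OF *(2,1) _ _ R Q] * by (simp add: sum.distrib add_divide_distrib)
    next
      fix f and c :: complex assume f: "f \<in> test_fun E"
      obtain i j where *: "(i, i0) \<in> le E" "(i, j) \<in> le E" "supp_in f (?F j)" "inv_by f (?F i)"
        using test_fun_bounds[OF E f i0 i0] by metis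
      obtain R where R: "transversal R (?F i) (?F j)" using tower_transversal[OF E *(2)] by blast
      obtain Q where Q: "transversal Q (?F i) (?F i0)" using tower_transversal[OF E *(1)] by blast
      have "supp_in (\<lambda>v. c * f v) (fil E j)" using * unfolding supp_in_def by (metis mult_zero_right)
      moreover have "inv_by (\<lambda>v. c * f v) (fil E i)" using * unfolding inv_by_def by simp
      ultimately show "m (\<lambda>v. c * f v) = c * m f"
        using msum[OF *(2,1) _ _ R Q] * by (simp add: sum_distrib_left)
    qed (simp add: m_def)
    fix f a assume f: "f \<in> test_fun E" and a: "a \<in> carr E"
    obtain j0 where j0: "j0 \<in> idx E" "a \<in> ?F j0" using a by (auto simp: carr_def)
    obtain i j where *: "(i, i0) \<in> le E" "(i, j) \<in> le E" "supp_in f (?F j)" "inv_by f (?F i)" "(j0, j) \<in> le E"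
      using test_fun_bounds[OF E f i0 j0(1)] by metis
    obtain R where R: "transversal R (?F i) (?F j)" using tower_transversal[OF E *(2)] by blast
    obtain Q where Q: "transversal Q (?F i) (?F i0)" using tower_transversal[OF E *(1)] by blast
    have aj: "a \<in> ?F j" using j0 * tower_mono[OF E] by blast
    have j: "subgrp (?F j)" and i: "subgrp (?F i)" using tower_subgrp[OF E] tower_idx[OF E] * by blast+
    have "supp_in (\<lambda>v. f (v + a)) (?F j)"
      using *(3) subgrp_add_iff[OF j aj] unfolding supp_in_def by blast
    moreover have "inv_by (\<lambda>v. f (v + a)) (?F i)"
      using inv_byD[OF *(4)] by (simp add: inv_by_def add.commute[of _ a])
        (metis add.assoc add.commute)
    ultimately have "m (\<lambda>v. f (v + a)) = (\<Sum>r\<in>R. f (r + a)) / of_nat (card Q)"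
      using msum[OF *(2,1) _ _ R Q] by simp
    also have "(\<Sum>r\<in>R. f (r + a)) = sum f ((\<lambda>r. r + a) ` R)"
      by (simp add: sum.reindex)
    \<comment> \<open>F(j) was chosen to contain \<open>a\<close>, so translation by
      \<open>a\<close> permutes the cosets of F(i) in F(j).\<close>
    also have "\<dots> = sum f R"
    proof (rule transversal_sum_eq[OF i _ R *(4)])
      show "transversal ((\<lambda>r. r + a) ` R) (?F i) (?F j)"
        unfolding transversal_def
      proof (intro conjI ballI)
        show "finite ((\<lambda>r. r + a) ` R)" "(\<lambda>r. r + a) ` R \<subseteq> ?F j"
          using R subgrp_add[OF j _ aj] by (auto simp: transversal_def)
        fix v assume "v \<in> ?F j"
        then have "v - a \<in> ?F j" using aj j subgrp_diff by blast
        then have "\<exists>!r. r \<in> R \<and> v - a - r \<in> ?F i" using R by (simp add: transversal_def)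
        then show "\<exists>!r. r \<in> (\<lambda>r. r + a) ` R \<and> v - r \<in> ?F i"
          by (auto simp: algebra_simps)
      qed
    qed
    finally show "m (\<lambda>v. f (v + a)) = m f" using msum[OF *(2,1) _ _ R Q] * by simp
  qed
  moreover have "m (indicator (?F i0)) = 1"
  proof -
    have ii: "(i0, i0) \<in> le E" using tower_refl[OF E i0] .
    have t: "transversal {0} (?F i0) (?F i0)" using transversal_self tower_subgrp[OF E i0] by blast
    have "m (indicator (?F i0)) = sum (indicator (?F i0)) {0} / of_nat (card {0::'b})"
    proof (rule msum[OF ii ii _ _ t t])
      show "supp_in (indicator (fil E i0)) (fil E i0)" by (simp add: supp_in_def indicator_def)
      show "inv_by (indicator (fil E i0)) (fil E i0)"
        using subgrp_add_iff[OF tower_subgrp[OF E i0]] by (simp add: inv_by_def indicator_def)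
    qed
    then show ?thesis using subgrp_zero[OF tower_subgrp[OF E i0]] by simp
  qed
  ultimately show ?thesis by blast
qed

lemma meas_multiple:
  assumes E: "tower E" and m: "m \<in> meas E" "m \<noteq> 0" and n: "n \<in> meas E"
  shows "\<exists>c. n = (\<lambda>f. c * m f)"
proof -
  obtain i where i: "i \<in> idx E" using tower_nonempty[OF E] by blast
  let ?c = "n (indicator (fil E i)) / m (indicator (fil E i))"
  have "n = (\<lambda>f. ?c * m f)"
    using meas_indicator_nonzero[OF E m i] by (intro meas_eqI[OF E n meas_scale[OF m(1)] i]) simp
  then show ?thesis by blast
qed

section \<open>Admissible triples of filtered groups\<close>

definition "sfil t i = {x\<in>carr (sub t). emb t x \<in> fil (mid t) i}"

definition "qfil t i = {y\<in>carr (quo t). \<exists>x\<in>fil (mid t) i. y - epi t x \<in> nul (quo t)}"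

lemma sfil_sub_filt: "sfil t i = fil (sub_filt (emb t) (sub t) (mid t)) i"
  by (simp add: sfil_def sub_filt_def)

lemma qfil_quot_filt: "qfil t i = fil (quot_filt (epi t) (mid t) (quo t)) i"
  by (simp add: qfil_def quot_filt_def)

text \<open>Admissibility as a property of additive groups. Domination is recorded as follows:
  induced members are members, and members and induced members are cofinal in each other in both
  directions. This is the form that \<open>dual1_adm\<close> establishes for the dual
  triple.\<close>

definition "adm t \<longleftrightarrow> tower (sub t) \<and> tower (mid t) \<and> tower (quo t) \<and>
     (\<forall>x y. emb t (x + y) = emb t x + emb t y) \<and> (\<forall>x y. epi t (x + y) = epi t x + epi t y) \<and>
     exact_triple (emb t) (epi t) (carr (sub t)) (nul (sub t))
       (carr (mid t)) (nul (mid t)) (carr (quo t)) (nul (quo t)) \<and>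
     (\<forall>i\<in>idx (mid t). \<exists>a\<in>idx (sub t). fil (sub t) a = sfil t i) \<and>
     (\<forall>a\<in>idx (sub t). (\<exists>i\<in>idx (mid t). sfil t i \<subseteq> fil (sub t) a) \<and>
        (\<exists>i\<in>idx (mid t). fil (sub t) a \<subseteq> sfil t i)) \<and>
     (\<forall>i\<in>idx (mid t). \<exists>a\<in>idx (quo t). fil (quo t) a = qfil t i) \<and>
     (\<forall>a\<in>idx (quo t). (\<exists>i\<in>idx (mid t). qfil t i \<subseteq> fil (quo t) a) \<and>
        (\<exists>i\<in>idx (mid t). fil (quo t) a \<subseteq> qfil t i))"

definition fibre ::
  "('a1, 'v1, 'a2, 'v2::ab_group_add, 'a3, 'v3) c1_triple \<Rightarrow> ('v2 \<Rightarrow> complex) \<Rightarrow> 'v2 \<Rightarrow> 'v1 \<Rightarrow> complex" where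
  "fibre t f w = (\<lambda>v. if v \<in> carr (sub t) then f (w + emb t v) else 0)"

context
  fixes t :: "(_, _, _, _, _, _) c1_triple"
  assumes adm: "adm t"
begin

lemma adm_towers: "tower (sub t)" "tower (mid t)" "tower (quo t)"
  using adm by (auto simp: adm_def)

lemma adm_emb_add: "emb t (x + y) = emb t x + emb t y"
  and adm_epi_add: "epi t (w + z) = epi t w + epi t z"
  using adm by (auto simp: adm_def)

lemma adm_emb_zero: "emb t 0 = 0"
  using adm_emb_add[of 0 0] by simp

lemma adm_epi_zero: "epi t 0 = 0"
  using adm_epi_add[of 0 0] by simp

lemma adm_epi_diff: "epi t (x - y) = epi t x - epi t y"
  using adm_epi_add[of "x - y" y] by simp

lemma adm_exact: "exact_triple (emb t) (epi t) (carr (sub t)) (nul (sub t))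
       (carr (mid t)) (nul (mid t)) (carr (quo t)) (nul (quo t))"
  using adm by (auto simp: adm_def)

lemma adm_emb_carr: "x \<in> carr (sub t) ==> emb t x \<in> carr (mid t)"
  using adm_exact by (auto simp: exact_triple_def)

lemma adm_emb_nul: "x \<in> carr (sub t) ==> emb t x \<in> nul (mid t) \<longleftrightarrow> x \<in> nul (sub t)"
  using adm_exact by (auto simp: exact_triple_def)

lemma adm_epi_carr: "x \<in> carr (mid t) ==> epi t x \<in> carr (quo t)"
  using adm_exact by (auto simp: exact_triple_def)

lemma adm_epi_nul: "x \<in> nul (mid t) ==> epi t x \<in> nul (quo t)"
  using adm_exact by (auto simp: exact_triple_def)

lemma adm_lift:
  assumes "y \<in> carr (quo t)"
  obtains x where "x \<in> carr (mid t)" "epi t x - y \<in> nul (quo t)"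
proof -
  have "\<forall>y\<in>carr (quo t). \<exists>x\<in>carr (mid t). y - epi t x \<in> nul (quo t)"
    using adm_exact by (simp add: exact_triple_def)
  then obtain x where x: "x \<in> carr (mid t)" "y - epi t x \<in> nul (quo t)"
    using assms by blast
  show thesis
    by (rule that[OF x(1) subgrp_diff_sym[OF tower_nul_subgrp[OF adm_towers(3)] x(2)]])
qed

lemma adm_kernel:
  "x \<in> carr (mid t) ==> epi t x \<in> nul (quo t) \<longleftrightarrow> (\<exists>x1\<in>carr (sub t). x - emb t x1 \<in> nul (mid t))"
  using adm_exact unfolding exact_triple_def by blast

lemma adm_epi_emb: "x \<in> carr (sub t) ==> epi t (emb t x) \<in> nul (quo t)"
  using adm_kernel[OF adm_emb_carr, of x] subgrp_zero[OF tower_nul_subgrp[OF adm_towers(2)]]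
  by (metis diff_self)

lemma adm_sfil: "i \<in> idx (mid t) ==> \<exists>a\<in>idx (sub t). fil (sub t) a = sfil t i"
  and adm_sfil_lower: "a \<in> idx (sub t) ==> \<exists>i\<in>idx (mid t). sfil t i \<subseteq> fil (sub t) a"
  and adm_sfil_upper: "a \<in> idx (sub t) ==> \<exists>i\<in>idx (mid t). fil (sub t) a \<subseteq> sfil t i"
  and adm_qfil: "i \<in> idx (mid t) ==> \<exists>a\<in>idx (quo t). fil (quo t) a = qfil t i"
  and adm_qfil_lower: "b \<in> idx (quo t) ==> \<exists>i\<in>idx (mid t). qfil t i \<subseteq> fil (quo t) b"
  and adm_qfil_upper: "b \<in> idx (quo t) ==> \<exists>i\<in>idx (mid t). fil (quo t) b \<subseteq> qfil t i"
  using adm unfolding adm_def by blast+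

lemma sfil_mono: "(i, j) \<in> le (mid t) ==> sfil t i \<subseteq> sfil t j"
  using tower_mono[OF adm_towers(2), of i j] by (auto simp: sfil_def)

lemma qfil_mono: "(i, j) \<in> le (mid t) ==> qfil t i \<subseteq> qfil t j"
  using tower_mono[OF adm_towers(2), of i j] by (auto simp: qfil_def)

lemma mid_test_fun_bounds:
  assumes "f \<in> test_fun (mid t)" "i0 \<in> idx (mid t)" "j0 \<in> idx (mid t)"
  obtains i j where "(i, i0) \<in> le (mid t)" "(j0, j) \<in> le (mid t)" "i \<in> idx (mid t)" "j \<in> idx (mid t)"
    "supp_in f (fil (mid t) j)" "inv_by f (fil (mid t) i)"
  using test_fun_bounds[OF adm_towers(2) assms] tower_idx[OF adm_towers(2)] by metis

subsection \<open>Integration over the fibres\<close>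

lemma fibre_inv:
  assumes "inv_by f (fil (mid t) i)"
  shows "inv_by (fibre t f w) (sfil t i)"
  unfolding inv_by_def
proof (intro allI ballI)
  fix v u assume u: "u \<in> sfil t i"
  have "v + u \<in> carr (sub t) \<longleftrightarrow> v \<in> carr (sub t)"
    using u subgrp_add_iff[OF tower_carr_subgrp[OF adm_towers(1)]] by (simp add: sfil_def)
  moreover have "f (w + emb t (v + u)) = f (w + emb t v)"
    using inv_byD[OF assms, of "emb t u" "w + emb t v"] u by (simp add: sfil_def adm_emb_add algebra_simps)
  ultimately show "fibre t f w (v + u) = fibre t f w v" by (simp add: fibre_def)
qed

lemma fibre_supp:
  assumes "supp_in f (fil (mid t) j)" "w \<in> fil (mid t) j" "j \<in> idx (mid t)"
  shows "supp_in (fibre t f w) (sfil t j)"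
  unfolding supp_in_def
proof (intro allI impI)
  fix v assume *: "fibre t f w v \<noteq> 0"
  then have v: "v \<in> carr (sub t)" and "f (w + emb t v) \<noteq> 0" by (auto simp: fibre_def split: if_splits)
  then have "emb t v + w \<in> fil (mid t) j" using assms(1) by (auto simp: supp_in_def add.commute)
  then show "v \<in> sfil t j"
    using v subgrp_add_iff[OF tower_subgrp[OF adm_towers(2) assms(3)] assms(2)] by (simp add: sfil_def)
qed

lemma fibre_test_fun:
  assumes f: "f \<in> test_fun (mid t)" and w: "w \<in> carr (mid t)"
  shows "fibre t f w \<in> test_fun (sub t)"
proof -
  obtain j0 where j0: "j0 \<in> idx (mid t)" "w \<in> fil (mid t) j0" using w by (auto simp: carr_def)
  obtain i j where *: "(j0, j) \<in> le (mid t)" "i \<in> idx (mid t)" "j \<in> idx (mid t)"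
    "supp_in f (fil (mid t) j)" "inv_by f (fil (mid t) i)"
    using mid_test_fun_bounds[OF f j0(1) j0(1)] by metis
  have wj: "w \<in> fil (mid t) j" using tower_mono[OF adm_towers(2) *(1)] j0 by blast
  obtain a where a: "a \<in> idx (sub t)" "fil (sub t) a = sfil t i" using adm_sfil[OF *(2)] by blast
  obtain b where b: "b \<in> idx (sub t)" "fil (sub t) b = sfil t j" using adm_sfil[OF *(3)] by blast
  show ?thesis
    using fibre_inv[OF *(5), of w] fibre_supp[OF *(4) wj *(3)] a b by (metis test_funI)
qed

lemma mono_pull_fibre: "mono_pull t f = fibre t f 0"
  by (simp add: mono_pull_def fibre_def fun_eq_iff)

lemma mono_pull_test_fun: "f \<in> test_fun (mid t) ==> mono_pull t f \<in> test_fun (sub t)"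
  using fibre_test_fun[of f 0] subgrp_zero[OF tower_carr_subgrp[OF adm_towers(2)]]
  by (simp add: mono_pull_fibre)

lemma epi_push_out: "w \<notin> carr (quo t) ==> epi_push t f m w = 0"
  by (simp add: epi_push_def)

text \<open>Two lifts differ by an element of the image of \<open>emb t\<close>, up to the null
  space, so the two fibre functions are translates of each other and \<open>m\<close> gives them the
  same integral. This makes the \<open>SOME\<close> in \<open>epi_push\<close> harmless.\<close>

lemma fibre_lift_eq:
  assumes f: "f \<in> test_fun (mid t)" and m: "m \<in> meas (sub t)"
    and w: "w \<in> carr (mid t)" "w' \<in> carr (mid t)" "epi t w - epi t w' \<in> nul (quo t)"
  shows "m (fibre t f w) = m (fibre t f w')"
proof -
  have "w - w' \<in> carr (mid t)" using w subgrp_diff[OF tower_carr_subgrp[OF adm_towers(2)]] by blast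
  then obtain x where x: "x \<in> carr (sub t)" "w - w' - emb t x \<in> nul (mid t)"
    using w(3) adm_kernel adm_epi_diff by metis
  have "fibre t f w = (\<lambda>v. fibre t f w' (v + x))"
  proof
    fix v
    have "v + x \<in> carr (sub t) \<longleftrightarrow> v \<in> carr (sub t)"
      using x subgrp_add_iff[OF tower_carr_subgrp[OF adm_towers(1)]] by simp
    moreover have "f (w + emb t v) = f (w' + emb t (v + x))"
      using x(2) by (intro inv_by_diff[OF test_fun_inv_nul[OF f]]) (simp add: adm_emb_add algebra_simps)
    ultimately show "fibre t f w v = fibre t f w' (v + x)" by (simp add: fibre_def)
  qed
  then show ?thesis using meas_translate[OF m fibre_test_fun[OF f w(2)] x(1)] by simp
qed

lemma epi_push_eq:
  assumes f: "f \<in> test_fun (mid t)" and m: "m \<in> meas (sub t)" and w: "w \<in> carr (quo t)"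
    and w': "w' \<in> carr (mid t)" "epi t w' - w \<in> nul (quo t)"
  shows "epi_push t f m w = m (fibre t f w')"
proof -
  let ?l = "SOME w'. w' \<in> carr (mid t) \<and> epi t w' - w \<in> nul (quo t)"
  have "?l \<in> carr (mid t) \<and> epi t ?l - w \<in> nul (quo t)"
    using w' by (intro someI[of "\<lambda>w'. w' \<in> carr (mid t) \<and> epi t w' - w \<in> nul (quo t)" w']) simp
  then have l: "?l \<in> carr (mid t)" "epi t ?l - epi t w' \<in> nul (quo t)"
    using w'(2) subgrp_diff_trans[OF tower_nul_subgrp[OF adm_towers(3)]]
      subgrp_diff_sym[OF tower_nul_subgrp[OF adm_towers(3)]] by blast+
  have "epi_push t f m w = m (fibre t f ?l)"
    using w by (simp add: epi_push_def fibre_def)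
  also have "\<dots> = m (fibre t f w')"
    by (rule fibre_lift_eq[OF f m l(1) w'(1) l(2)])
  finally show ?thesis .
qed

lemma epi_push_supp:
  assumes f: "f \<in> test_fun (mid t)" and m: "m \<in> meas (sub t)" and s: "supp_in f (fil (mid t) j)"
  shows "supp_in (epi_push t f m) (qfil t j)"
  unfolding supp_in_def
proof (intro allI impI)
  fix w assume nz: "epi_push t f m w \<noteq> 0"
  then have w: "w \<in> carr (quo t)" using epi_push_out by blast
  obtain w' where w': "w' \<in> carr (mid t)" "epi t w' - w \<in> nul (quo t)" using adm_lift[OF w] by blast
  have "m (fibre t f w') \<noteq> 0" using nz epi_push_eq[OF f m w w'] by simp
  then have "fibre t f w' \<noteq> (\<lambda>_. 0)"
    using distr_zero_fun[OF adm_towers(1) meas_distr[OF m]] by auto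
  then obtain v where v: "fibre t f w' v \<noteq> 0" by auto
  then have vc: "v \<in> carr (sub t)" and "f (w' + emb t v) \<noteq> 0" by (auto simp: fibre_def split: if_splits)
  then have x: "w' + emb t v \<in> fil (mid t) j" using s by (auto simp: supp_in_def)
  have "epi t (w' + emb t v) - w = (epi t w' - w) + epi t (emb t v)"
      by (simp add: adm_epi_add)
  then have "epi t (w' + emb t v) - w \<in> nul (quo t)"
    using subgrp_add[OF tower_nul_subgrp[OF adm_towers(3)] w'(2) adm_epi_emb[OF vc]] by (simp only:)
  then show "w \<in> qfil t j" using x w subgrp_diff_sym[OF tower_nul_subgrp[OF adm_towers(3)]] by (auto simp: qfil_def)
qed

lemma epi_push_inv:
  assumes f: "f \<in> test_fun (mid t)" and m: "m \<in> meas (sub t)"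
    and v: "inv_by f (fil (mid t) i)" and i: "i \<in> idx (mid t)"
  shows "inv_by (epi_push t f m) (qfil t i)"
  unfolding inv_by_def
proof (intro allI ballI)
  fix w u assume u: "u \<in> qfil t i"
  then obtain x where x: "x \<in> fil (mid t) i" "u - epi t x \<in> nul (quo t)" and uc: "u \<in> carr (quo t)"
    by (auto simp: qfil_def)
  have xc: "x \<in> carr (mid t)" using x fil_carr[OF i] by blast
  have wu: "w + u \<in> carr (quo t) \<longleftrightarrow> w \<in> carr (quo t)"
    using uc subgrp_add_iff[OF tower_carr_subgrp[OF adm_towers(3)]] by simp
  show "epi_push t f m (w + u) = epi_push t f m w"
  proof (cases "w \<in> carr (quo t)")
    case True
    obtain w' where w': "w' \<in> carr (mid t)" "epi t w' - w \<in> nul (quo t)" using adm_lift[OF True] by blast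
    have "w' + x \<in> carr (mid t)" using w' xc subgrp_add[OF tower_carr_subgrp[OF adm_towers(2)]] by blast
    moreover have "epi t (w' + x) - (w + u) \<in> nul (quo t)"
      using subgrp_diff[OF tower_nul_subgrp[OF adm_towers(3)] w'(2) x(2)] by (simp add: adm_epi_add algebra_simps)
    ultimately have "epi_push t f m (w + u) = m (fibre t f (w' + x))"
      using epi_push_eq[OF f m] wu True by blast
    also have "fibre t f (w' + x) = fibre t f w'"
    proof
      fix v show "fibre t f (w' + x) v = fibre t f w' v"
        using inv_byD[OF v x(1), of "w' + emb t v"] by (simp add: fibre_def algebra_simps)
    qed
    also have "m \<dots> = epi_push t f m w" using epi_push_eq[OF f m True w'] by simp
    finally show ?thesis .
  qed (simp add: epi_push_out wu)
qed

lemma epi_push_test_fun: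
  assumes f: "f \<in> test_fun (mid t)" and m: "m \<in> meas (sub t)"
  shows "epi_push t f m \<in> test_fun (quo t)"
proof -
  obtain i0 where "i0 \<in> idx (mid t)" using tower_nonempty[OF adm_towers(2)] by blast
  then obtain i j where *: "i \<in> idx (mid t)" "j \<in> idx (mid t)"
    "supp_in f (fil (mid t) j)" "inv_by f (fil (mid t) i)"
    using mid_test_fun_bounds[OF f] by metis
  then show ?thesis
    using epi_push_supp[OF f m *(3)] epi_push_inv[OF f m *(4,1)] adm_qfil by (metis test_funI)
qed

lemma epi_push_add:
  assumes f: "f \<in> test_fun (mid t)" and g: "g \<in> test_fun (mid t)" and m: "m \<in> meas (sub t)"
  shows "epi_push t (\<lambda>v. f v + g v) m = (\<lambda>w. epi_push t f m w + epi_push t g m w)"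
proof
  fix w show "epi_push t (\<lambda>v. f v + g v) m w = epi_push t f m w + epi_push t g m w"
  proof (cases "w \<in> carr (quo t)")
    case True
    obtain w' where w': "w' \<in> carr (mid t)" "epi t w' - w \<in> nul (quo t)" using adm_lift[OF True] by blast
    have "fibre t (\<lambda>v. f v + g v) w' = (\<lambda>v. fibre t f w' v + fibre t g w' v)"
      by (auto simp: fibre_def)
    then show ?thesis
      using epi_push_eq[OF test_fun_add[OF adm_towers(2) f g] m True w'] epi_push_eq[OF f m True w']
        epi_push_eq[OF g m True w'] distr_add[OF meas_distr[OF m]] fibre_test_fun[OF f w'(1)]
        fibre_test_fun[OF g w'(1)] by simp
  qed (simp add: epi_push_out)
qed

lemma epi_push_scale:
  assumes f: "f \<in> test_fun (mid t)" and m: "m \<in> meas (sub t)"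
  shows "epi_push t (\<lambda>v. c * f v) m = (\<lambda>w. c * epi_push t f m w)"
proof
  fix w show "epi_push t (\<lambda>v. c * f v) m w = c * epi_push t f m w"
  proof (cases "w \<in> carr (quo t)")
    case True
    obtain w' where w': "w' \<in> carr (mid t)" "epi t w' - w \<in> nul (quo t)" using adm_lift[OF True] by blast
    have "fibre t (\<lambda>v. c * f v) w' = (\<lambda>v. c * fibre t f w' v)"
      by (auto simp: fibre_def)
    then show ?thesis
      using epi_push_eq[OF test_fun_scale[OF f] m True w'] epi_push_eq[OF f m True w']
        distr_scale[OF meas_distr[OF m] fibre_test_fun[OF f w'(1)]] by simp
  qed (simp add: epi_push_out)
qed

lemma epi_push_meas_scale: "epi_push t f (\<lambda>g. c * m g) = (\<lambda>w. c * epi_push t f m w)"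
  by (auto simp: epi_push_def)

lemma epi_push_translate:
  assumes f: "f \<in> test_fun (mid t)" and m: "m \<in> meas (sub t)" and a: "a \<in> carr (mid t)"
  shows "epi_push t (\<lambda>v. f (v + a)) m = (\<lambda>w. epi_push t f m (w + epi t a))"
proof
  fix w
  have wa: "w + epi t a \<in> carr (quo t) \<longleftrightarrow> w \<in> carr (quo t)"
    using adm_epi_carr[OF a] subgrp_add_iff[OF tower_carr_subgrp[OF adm_towers(3)]] by simp
  show "epi_push t (\<lambda>v. f (v + a)) m w = epi_push t f m (w + epi t a)"
  proof (cases "w \<in> carr (quo t)")
    case True
    obtain w' where w': "w' \<in> carr (mid t)" "epi t w' - w \<in> nul (quo t)" using adm_lift[OF True] by blast
    have w'a: "w' + a \<in> carr (mid t)" "epi t (w' + a) - (w + epi t a) \<in> nul (quo t)"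
      using w' a subgrp_add[OF tower_carr_subgrp[OF adm_towers(2)]] by (auto simp: adm_epi_add)
    have "fibre t (\<lambda>v. f (v + a)) w' = fibre t f (w' + a)"
      by (auto simp: fibre_def algebra_simps)
    then show ?thesis
      using epi_push_eq[OF test_fun_translate[OF adm_towers(2) f a] m True w']
        epi_push_eq[OF f m _ w'a] wa True by simp
  qed (simp add: epi_push_out wa)
qed

text \<open>Over a point of \<open>qfil t i\<close> the fibre of the member is a translate of
  \<open>sfil t i\<close>, elsewhere it is empty. The product rule for masses in
  \<open>meas_prod\<close> comes from here.\<close>

lemma epi_push_indicator:
  assumes i: "i \<in> idx (mid t)" and m: "m \<in> meas (sub t)"
  shows "epi_push t (indicator (fil (mid t) i)) m = (\<lambda>w. m (indicator (sfil t i)) * indicator (qfil t i) w)"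
proof
  fix w
  let ?f = "indicator (fil (mid t) i)"
  note f = indicator_test_fun[OF adm_towers(2) i]
  have N: "subgrp (nul (quo t))" by (rule tower_nul_subgrp[OF adm_towers(3)])
  show "epi_push t ?f m w = m (indicator (sfil t i)) * indicator (qfil t i) w"
  proof (cases "w \<in> qfil t i")
    case True
    then obtain x where x: "x \<in> fil (mid t) i" "w - epi t x \<in> nul (quo t)" and wc: "w \<in> carr (quo t)"
      by (auto simp: qfil_def)
    have "fibre t ?f x = indicator (sfil t i)"
    proof
      fix v
      have "x + emb t v \<in> fil (mid t) i \<longleftrightarrow> emb t v \<in> fil (mid t) i"
        using subgrp_add_iff[OF tower_subgrp[OF adm_towers(2) i] x(1), of "emb t v"] by (simp add: add.commute)
      then show "fibre t ?f x v = indicator (sfil t i) v"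
        by (simp add: fibre_def indicator_def sfil_def)
    qed
    then show ?thesis
      using epi_push_eq[OF f m wc _ subgrp_diff_sym[OF N x(2)]] x(1) fil_carr[OF i] True
      by auto
  next
    case False
    have "epi_push t ?f m w = 0"
    proof (cases "w \<in> carr (quo t)")
      case wc: True
      obtain w' where w': "w' \<in> carr (mid t)" "epi t w' - w \<in> nul (quo t)" using adm_lift[OF wc] by blast
      have "fibre t ?f w' = (\<lambda>_. 0)"
      proof
        fix v
        have "w' + emb t v \<notin> fil (mid t) i" if v: "v \<in> carr (sub t)"
        proof
          assume x: "w' + emb t v \<in> fil (mid t) i"
          have "epi t (w' + emb t v) - w = (epi t w' - w) + epi t (emb t v)"
        by (simp add: adm_epi_add)
          then have "epi t (w' + emb t v) - w \<in> nul (quo t)"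
            using subgrp_add[OF N w'(2) adm_epi_emb[OF v]] by (simp only:)
          then have "w \<in> qfil t i" using x wc subgrp_diff_sym[OF N] by (auto simp: qfil_def)
          with False show False ..
        qed
        then show "fibre t ?f w' v = 0" by (simp add: fibre_def)
      qed
      then show ?thesis using epi_push_eq[OF f m wc w'] distr_zero_fun[OF adm_towers(1) meas_distr[OF m]] by simp
    qed (simp add: epi_push_out)
    with False show ?thesis by simp
  qed
qed

text \<open>Integration over the fibres followed by integration over the quotient. It is the witness
  for the description of \<open>meas_prod\<close>, which prescribes the masses of members, and turns
  it into Fubini's theorem (\<open>meas_prod_apply\<close>).\<close>

definition "iterated m1 m3 = (\<lambda>f. if f \<in> test_fun (mid t) then m3 (epi_push t f m1) else 0)"

lemma iterated_meas:
  assumes m1: "m1 \<in> meas (sub t)" and m3: "m3 \<in> meas (quo t)"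
  shows "iterated m1 m3 \<in> meas (mid t)"
  unfolding meas_def
proof (intro CollectI conjI ballI)
  show "iterated m1 m3 \<in> distr (mid t)"
  proof (rule distrI)
    fix f g assume fg: "f \<in> test_fun (mid t)" "g \<in> test_fun (mid t)"
    then show "iterated m1 m3 (\<lambda>v. f v + g v) = iterated m1 m3 f + iterated m1 m3 g"
      by (simp add: iterated_def test_fun_add adm_towers epi_push_add m1 epi_push_test_fun
          distr_add[OF meas_distr[OF m3]])
  next
    fix f and c :: complex assume f: "f \<in> test_fun (mid t)"
    then show "iterated m1 m3 (\<lambda>v. c * f v) = c * iterated m1 m3 f"
      by (simp add: iterated_def test_fun_scale epi_push_scale m1 epi_push_test_fun
          distr_scale[OF meas_distr[OF m3]])
  qed (simp add: iterated_def)
  fix f a assume "f \<in> test_fun (mid t)" "a \<in> carr (mid t)"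
  then show "iterated m1 m3 (\<lambda>v. f (v + a)) = iterated m1 m3 f"
    by (simp add: iterated_def test_fun_translate adm_towers epi_push_translate m1 epi_push_test_fun
        meas_translate[OF m3] adm_epi_carr)
qed

lemma iterated_indicator:
  assumes i: "i \<in> idx (mid t)" and m1: "m1 \<in> meas (sub t)" and m3: "m3 \<in> meas (quo t)"
  shows "iterated m1 m3 (indicator (fil (mid t) i)) = m1 (indicator (sfil t i)) * m3 (indicator (qfil t i))"
proof -
  obtain a where "a \<in> idx (quo t)" "fil (quo t) a = qfil t i" using adm_qfil[OF i] by blast
  then have "indicator (qfil t i) \<in> test_fun (quo t)" using indicator_test_fun[OF adm_towers(3)] by metis
  then show ?thesis
    using indicator_test_fun[OF adm_towers(2) i]
    by (simp add: iterated_def epi_push_indicator[OF i m1] distr_scale[OF meas_distr[OF m3]])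
qed

lemma meas_prod_iterated:
  assumes m1: "m1 \<in> meas (sub t)" and m3: "m3 \<in> meas (quo t)"
  shows "meas_prod t m1 m3 = iterated m1 m3"
  unfolding meas_prod_def sfil_sub_filt[symmetric] qfil_quot_filt[symmetric]
proof (rule the_equality)
  show "iterated m1 m3 \<in> meas (mid t) \<and> (\<forall>j\<in>idx (mid t). iterated m1 m3 (indicator (fil (mid t) j)) =
          m1 (indicator (sfil t j)) * m3 (indicator (qfil t j)))"
    using iterated_meas[OF m1 m3] iterated_indicator m1 m3 by blast
  fix m assume m: "m \<in> meas (mid t) \<and> (\<forall>j\<in>idx (mid t). m (indicator (fil (mid t) j)) =
          m1 (indicator (sfil t j)) * m3 (indicator (qfil t j)))"
  obtain j where j: "j \<in> idx (mid t)" using tower_nonempty[OF adm_towers(2)] by blast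
  show "m = iterated m1 m3"
    using m iterated_indicator[OF j m1 m3] j
    by (intro meas_eqI[OF adm_towers(2) _ iterated_meas[OF m1 m3] j]) auto
qed

lemma meas_prod_meas: "m1 \<in> meas (sub t) ==> m3 \<in> meas (quo t) ==> meas_prod t m1 m3 \<in> meas (mid t)"
  by (simp add: meas_prod_iterated iterated_meas)

lemma meas_prod_apply:
  "m1 \<in> meas (sub t) ==> m3 \<in> meas (quo t) ==> f \<in> test_fun (mid t) ==>
    meas_prod t m1 m3 f = m3 (epi_push t f m1)"
  by (simp add: meas_prod_iterated iterated_def)

lemma meas_prod_indicator:
  "m1 \<in> meas (sub t) ==> m3 \<in> meas (quo t) ==> i \<in> idx (mid t) ==>
    meas_prod t m1 m3 (indicator (fil (mid t) i)) = m1 (indicator (sfil t i)) * m3 (indicator (qfil t i))"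
  by (simp add: meas_prod_iterated iterated_indicator)

lemma meas_prod_nonzero:
  assumes m1: "m1 \<in> meas (sub t)" "m1 \<noteq> 0" and m3: "m3 \<in> meas (quo t)" "m3 \<noteq> 0"
  shows "meas_prod t m1 m3 \<noteq> 0"
proof -
  obtain i where i: "i \<in> idx (mid t)" using tower_nonempty[OF adm_towers(2)] by blast
  have "m1 (indicator (sfil t i)) \<noteq> 0" "m3 (indicator (qfil t i)) \<noteq> 0"
    using adm_sfil[OF i] adm_qfil[OF i] meas_indicator_nonzero[OF adm_towers(1) m1]
      meas_indicator_nonzero[OF adm_towers(3) m3] by metis+
  then show ?thesis using meas_prod_indicator[OF m1(1) m3(1) i] by auto
qed

lemma meas_prod_scale_left:
  assumes "m1 \<in> meas (sub t)" "m3 \<in> meas (quo t)"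
  shows "meas_prod t (\<lambda>f. c * m1 f) m3 = (\<lambda>f. c * meas_prod t m1 m3 f)"
  using assms
  by (auto simp: meas_prod_iterated iterated_def meas_scale epi_push_meas_scale epi_push_test_fun
      distr_scale[OF meas_distr])

lemma meas_prod_scale_right:
  assumes "m1 \<in> meas (sub t)" "m3 \<in> meas (quo t)"
  shows "meas_prod t m1 (\<lambda>f. c * m3 f) = (\<lambda>f. c * meas_prod t m1 m3 f)"
  using assms by (auto simp: meas_prod_iterated iterated_def meas_scale)

subsection \<open>Inverse image from a compact sub and extension by zero into a discrete quotient\<close>

text \<open>Compactness bounds the support: some member of \<open>mid t\<close> contains the image
  of the whole sub, so a larger one contains the full inverse image of the support of
  \<open>g\<close>.\<close>

lemma epi_pull_test_fun:
  assumes c: "compact_filt (sub t)" and g: "g \<in> test_fun (quo t)"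
  shows "epi_pull t g \<in> test_fun (mid t)"
proof -
  obtain a0 where a0: "a0 \<in> idx (sub t)" "fil (sub t) a0 = carr (sub t)"
    using c by (auto simp: compact_filt_def)
  obtain b a where g': "b \<in> idx (quo t)" "supp_in g (fil (quo t) b)" "a \<in> idx (quo t)" "inv_by g (fil (quo t) a)"
    using g by (auto simp: test_fun_iff)
  obtain j1 where j1: "j1 \<in> idx (mid t)" "carr (sub t) \<subseteq> sfil t j1" using adm_sfil_upper[OF a0(1)] a0(2) by auto
  obtain j2 where j2: "j2 \<in> idx (mid t)" "fil (quo t) b \<subseteq> qfil t j2" using adm_qfil_upper[OF g'(1)] by blast
  obtain j where j: "(j1, j) \<in> le (mid t)" "(j2, j) \<in> le (mid t)" using tower_upper[OF adm_towers(2) j1(1) j2(1)] .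
  obtain i where i: "i \<in> idx (mid t)" "qfil t i \<subseteq> fil (quo t) a" using adm_qfil_lower[OF g'(3)] by blast
  have jj: "j \<in> idx (mid t)" and sgj: "subgrp (fil (mid t) j)"
    using j tower_idx[OF adm_towers(2)] tower_subgrp[OF adm_towers(2)] by blast+
  show ?thesis
  proof (rule test_funI[OF _ _ i(1) jj])
    show "supp_in (epi_pull t g) (fil (mid t) j)"
      unfolding supp_in_def
    proof (intro allI impI)
      fix v assume "epi_pull t g v \<noteq> 0"
      then have v: "v \<in> carr (mid t)" and "g (epi t v) \<noteq> 0" by (auto simp: epi_pull_def split: if_splits)
      then have "epi t v \<in> qfil t j" using g'(2) j2(2) qfil_mono[OF j(2)] by (auto simp: supp_in_def)
      then obtain x where x: "x \<in> fil (mid t) j" "epi t v - epi t x \<in> nul (quo t)" by (auto simp: qfil_def)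
      have "v - x \<in> carr (mid t)"
        using v x fil_carr[OF jj] subgrp_diff[OF tower_carr_subgrp[OF adm_towers(2)]] by blast
      then obtain x1 where x1: "x1 \<in> carr (sub t)" "v - x - emb t x1 \<in> nul (mid t)"
        using x(2) adm_kernel adm_epi_diff by metis
      have "emb t x1 \<in> fil (mid t) j" using x1(1) j1(2) sfil_mono[OF j(1)] by (auto simp: sfil_def)
      moreover have "v - x - emb t x1 \<in> fil (mid t) j" using x1(2) nul_fil[OF jj] by blast
      ultimately have "(v - x - emb t x1) + emb t x1 + x \<in> fil (mid t) j" using x(1) sgj subgrp_add by blast
      then show "v \<in> fil (mid t) j" by simp
    qed
    show "inv_by (epi_pull t g) (fil (mid t) i)"
      unfolding inv_by_def
    proof (intro allI ballI)
      fix v u assume u: "u \<in> fil (mid t) i"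
      then have uc: "u \<in> carr (mid t)" using fil_carr[OF i(1)] by blast
      have "epi t u \<in> qfil t i"
        using u adm_epi_carr[OF uc] subgrp_zero[OF tower_nul_subgrp[OF adm_towers(3)]]
        by (force simp: qfil_def)
      then have "g (epi t v + epi t u) = g (epi t v)" using inv_byD[OF g'(4)] i(2) by blast
      then show "epi_pull t g (v + u) = epi_pull t g v"
        using subgrp_add_iff[OF tower_carr_subgrp[OF adm_towers(2)] uc] by (simp add: epi_pull_def adm_epi_add)
    qed
  qed
qed

lemma mono_push_eq:
  assumes f: "f \<in> test_fun (sub t)" and x: "x \<in> carr (sub t)" "v - emb t x \<in> nul (mid t)"
  shows "mono_push t f v = f x"
proof -
  let ?l = "SOME x. x \<in> carr (sub t) \<and> v - emb t x \<in> nul (mid t)"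
  have N: "subgrp (nul (mid t))" by (rule tower_nul_subgrp[OF adm_towers(2)])
  have l: "?l \<in> carr (sub t) \<and> v - emb t ?l \<in> nul (mid t)"
    using x by (intro someI[of "\<lambda>x. x \<in> carr (sub t) \<and> v - emb t x \<in> nul (mid t)" x]) simp
  have "emb t ?l = emb t (?l - x) + emb t x" using adm_emb_add[of "?l - x" x] by simp
  then have "emb t (?l - x) = (v - emb t x) - (v - emb t ?l)" by simp
  then have "emb t (?l - x) \<in> nul (mid t)"
    using subgrp_diff[OF N x(2) conjunct2[OF l]] by (simp only:)
  moreover have "?l - x \<in> carr (sub t)" using l x(1) subgrp_diff[OF tower_carr_subgrp[OF adm_towers(1)]] by blast
  ultimately have "?l - x \<in> nul (sub t)" using adm_emb_nul by blast
  then have "f ?l = f x" by (rule inv_by_diff[OF test_fun_inv_nul[OF f]])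
  then show ?thesis using x by (auto simp: mono_push_def)
qed

lemma mono_push_out:
  "(\<And>x. x \<in> carr (sub t) ==> v - emb t x \<notin> nul (mid t)) ==> mono_push t f v = 0"
  by (auto simp: mono_push_def)

text \<open>Two Fourier transforms in succession reverse the argument, so the deduction of
  \<open>lev_four_mono_push\<close> by inversion has to carry the sign through extension by
  zero.\<close>

lemma mono_push_uminus:
  assumes f: "f \<in> test_fun (sub t)" "(\<lambda>x. f (- x)) \<in> test_fun (sub t)"
  shows "mono_push t (\<lambda>x. f (- x)) = (\<lambda>v. mono_push t f (- v))"
proof
  fix v
  have neg: "- u - emb t (- x) \<in> nul (mid t)" if "u - emb t x \<in> nul (mid t)" for u x
    using subgrp_uminus[OF tower_nul_subgrp[OF adm_towers(2)] that] adm_emb_add[of x "- x"] adm_emb_add[of 0 0]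
    by (simp add: add_eq_0_iff)
  show "mono_push t (\<lambda>x. f (- x)) v = mono_push t f (- v)"
  proof (cases "\<exists>x\<in>carr (sub t). v - emb t x \<in> nul (mid t)")
    case True
    then obtain x where x: "x \<in> carr (sub t)" "v - emb t x \<in> nul (mid t)" by blast
    show ?thesis
      using mono_push_eq[OF f(2) x] mono_push_eq[OF f(1) _ neg[OF x(2)]]
        subgrp_uminus[OF tower_carr_subgrp[OF adm_towers(1)] x(1)] by simp
  next
    case False
    then have "- v - emb t x \<notin> nul (mid t)" if "x \<in> carr (sub t)" for x
      using neg[of "- v" x] subgrp_uminus[OF tower_carr_subgrp[OF adm_towers(1)] that] by auto
    then show ?thesis using False mono_push_out[of v] mono_push_out[of "- v"] by auto
  qed
qed

text \<open>Discreteness gives the invariance: some member of \<open>mid t\<close> is mapped to the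
  null space by \<open>epi t\<close>, hence lies in the image of the sub up to the null space, and
  translation by it moves \<open>f\<close> inside the sub. A member that is also small enough on the
  sub leaves \<open>f\<close> unchanged.\<close>

lemma mono_push_test_fun:
  assumes d: "discrete_filt (quo t)" and f: "f \<in> test_fun (sub t)"
  shows "mono_push t f \<in> test_fun (mid t)"
proof -
  obtain a0 where a0: "a0 \<in> idx (quo t)" "fil (quo t) a0 = nul (quo t)"
    using d by (auto simp: discrete_filt_def)
  have N: "subgrp (nul (mid t))" by (rule tower_nul_subgrp[OF adm_towers(2)])
  obtain b a where f': "b \<in> idx (sub t)" "supp_in f (fil (sub t) b)" "a \<in> idx (sub t)" "inv_by f (fil (sub t) a)"
    using f by (auto simp: test_fun_iff)
  obtain j where j: "j \<in> idx (mid t)" "fil (sub t) b \<subseteq> sfil t j" using adm_sfil_upper[OF f'(1)] by blast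
  obtain i1 where i1: "i1 \<in> idx (mid t)" "qfil t i1 \<subseteq> nul (quo t)" using adm_qfil_lower[OF a0(1)] a0(2) by auto
  obtain i2 where i2: "i2 \<in> idx (mid t)" "sfil t i2 \<subseteq> fil (sub t) a" using adm_sfil_lower[OF f'(3)] by blast
  obtain i where i: "(i, i1) \<in> le (mid t)" "(i, i2) \<in> le (mid t)" using tower_lower[OF adm_towers(2) i1(1) i2(1)] .
  have ii: "i \<in> idx (mid t)" and sgi: "subgrp (fil (mid t) i)"
    using i tower_idx[OF adm_towers(2)] tower_subgrp[OF adm_towers(2)] by blast+
  show ?thesis
  proof (rule test_funI[OF _ _ ii j(1)])
    show "supp_in (mono_push t f) (fil (mid t) j)"
      unfolding supp_in_def
    proof (intro allI impI)
      fix v assume nz: "mono_push t f v \<noteq> 0"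
      then obtain x where x: "x \<in> carr (sub t)" "v - emb t x \<in> nul (mid t)" using mono_push_out by blast
      then have "f x \<noteq> 0" using nz mono_push_eq[OF f] by metis
      then have "emb t x \<in> fil (mid t) j" using f'(2) j(2) by (auto simp: supp_in_def sfil_def)
      moreover have "v - emb t x \<in> fil (mid t) j" using x nul_fil[OF j(1)] by blast
      ultimately show "v \<in> fil (mid t) j"
        using subgrp_diff_iff[OF tower_subgrp[OF adm_towers(2) j(1)]] by blast
    qed
    have one: "mono_push t f (v + u) = mono_push t f v" if u: "u \<in> fil (mid t) i"
      and ex: "\<exists>x\<in>carr (sub t). v - emb t x \<in> nul (mid t)" for u v
    proof -
      obtain x where x: "x \<in> carr (sub t)" "v - emb t x \<in> nul (mid t)" using ex by blast
      have uc: "u \<in> carr (mid t)" using u fil_carr[OF ii] by blast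
      have "epi t u \<in> qfil t i"
        using u adm_epi_carr[OF uc] subgrp_zero[OF tower_nul_subgrp[OF adm_towers(3)]]
        by (force simp: qfil_def)
      then have "epi t u \<in> nul (quo t)" using i1(2) qfil_mono[OF i(1)] by blast
      then obtain y where y: "y \<in> carr (sub t)" "u - emb t y \<in> nul (mid t)" using adm_kernel[OF uc] by blast
      have "u - (u - emb t y) \<in> fil (mid t) i" using u y(2) nul_fil[OF ii] subgrp_diff[OF sgi] by blast
      then have "y \<in> sfil t i" using y(1) by (simp add: sfil_def)
      then have fy: "f (x + y) = f x" using inv_byD[OF f'(4)] i2(2) sfil_mono[OF i(2)] by blast
      have "v + u - emb t (x + y) = (v - emb t x) + (u - emb t y)"
        by (simp add: adm_emb_add)
      then have "v + u - emb t (x + y) \<in> nul (mid t)" using subgrp_add[OF N x(2) y(2)] by (simp only:)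
      then have "mono_push t f (v + u) = f (x + y)"
        by (intro mono_push_eq[OF f] subgrp_add[OF tower_carr_subgrp[OF adm_towers(1)] x(1) y(1)])
      then show ?thesis using mono_push_eq[OF f x] fy by simp
    qed
    show "inv_by (mono_push t f) (fil (mid t) i)"
      unfolding inv_by_def
    proof (intro allI ballI)
      fix v u assume u: "u \<in> fil (mid t) i"
      \<comment> \<open>If \<open>v + u\<close> is the one known to lie in the image,
        \<open>one\<close> is applied to it with \<open>- u\<close>; if neither does, both values
        are \<open>0\<close>.\<close>
      have "mono_push t f v = mono_push t f (v + u)"
        if "\<exists>x\<in>carr (sub t). v + u - emb t x \<in> nul (mid t)"
        using one[OF subgrp_uminus[OF sgi u] that] by simp
      moreover note one[OF u, of v]
      moreover have "mono_push t f w = 0" if "\<not> (\<exists>x\<in>carr (sub t). w - emb t x \<in> nul (mid t))" for w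
        using that by (auto simp: mono_push_def)
      ultimately show "mono_push t f (v + u) = mono_push t f v" by metis
    qed
  qed
qed

end

section \<open>Filtered groups in duality\<close>

text \<open>\<open>E'\<close> has the index set of \<open>E\<close> with the reversed order, and
  \<open>fil E' i\<close> is the annihilator of \<open>fil E i\<close>; the last two clauses make
  the duality of the finite quotients perfect on both sides. With a complex valued
  \<open>\<chi>\<close> in place of functionals the notion is symmetric
  (\<open>pairing_sym\<close>), which replaces an identification of the double dual with
  \<open>E\<close>.\<close>

definition pairing :: "('a, 'v::ab_group_add) filt \<Rightarrow> ('a, 'w::ab_group_add) filt \<Rightarrow>
    ('v \<Rightarrow> 'w \<Rightarrow> complex) \<Rightarrow> bool" where
  "pairing E E' \<chi> \<longleftrightarrow> tower E \<and> tower E' \<and> idx E' = idx E \<and> le E' = (le E)\<inverse> \<and>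
     (\<forall>v\<in>carr E. \<forall>v'\<in>carr E. \<forall>w\<in>carr E'. \<chi> (v + v') w = \<chi> v w * \<chi> v' w) \<and>
     (\<forall>v\<in>carr E. \<forall>w\<in>carr E'. \<forall>w'\<in>carr E'. \<chi> v (w + w') = \<chi> v w * \<chi> v w') \<and>
     (\<forall>i\<in>idx E. \<forall>v\<in>fil E i. \<forall>w\<in>fil E' i. \<chi> v w = 1) \<and>
     (\<forall>(i, j)\<in>le E. \<forall>v\<in>fil E j. (\<forall>w\<in>fil E' i. \<chi> v w = 1) \<longrightarrow> v \<in> fil E i) \<and>
     (\<forall>(i, j)\<in>le E. \<forall>w\<in>fil E' i. (\<forall>v\<in>fil E j. \<chi> v w = 1) \<longrightarrow> w \<in> fil E' j)"

lemma pairing_sym: "pairing E E' \<chi> ==> pairing E' E (\<lambda>w v. \<chi> v w)"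
  unfolding pairing_def by auto

text \<open>\<open>fourier1\<close> and \<open>fourier1_back\<close> are the two instances,
  \<open>\<chi>\<close> being taken with its arguments in either order.\<close>

definition four :: "('v \<Rightarrow> 'w \<Rightarrow> complex) \<Rightarrow> ('a, 'w, 'z) filt_scheme \<Rightarrow> 'v dist \<Rightarrow> ('v \<Rightarrow> complex) \<Rightarrow>
    'w \<Rightarrow> complex" where
  "four \<chi> E' m f = (\<lambda>w. if w \<in> carr E' then m (\<lambda>v. f v * \<chi> v w) else 0)"

text \<open>\<open>m'\<close> is the inverse of \<open>m\<close> in the sense of
  \<open>meas_inv\<close>, as a relation that is symmetric in the two spaces.\<close>

definition "mdual E E' m m' \<longleftrightarrow> m \<in> meas E \<and> m' \<in> meas E' \<and>
     (\<forall>i\<in>idx E. m (indicator (fil E i)) * m' (indicator (fil E' i)) = 1)"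

lemma four_meas_scale: "four \<chi> E' (\<lambda>g. c * m g) f = (\<lambda>w. c * four \<chi> E' m f w)"
  by (auto simp: four_def)

context
  fixes E E' :: "(_, _) filt"
    and \<chi>
  assumes P: "pairing E E' \<chi>"
begin

lemma pairing_tower: "tower E" and pairing_tower': "tower E'"
  using P by (simp_all add: pairing_def)

lemma pairing_idx: "idx E' = idx E" and pairing_le: "(i, j) \<in> le E' \<longleftrightarrow> (j, i) \<in> le E"
  using P by (simp_all add: pairing_def)

lemma pairing_add: "v \<in> carr E ==> v' \<in> carr E ==> w \<in> carr E' ==> \<chi> (v + v') w = \<chi> v w * \<chi> v' w"
  and pairing_add': "v \<in> carr E ==> w \<in> carr E' ==> w' \<in> carr E' ==> \<chi> v (w + w') = \<chi> v w * \<chi> v w'"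
  using P by (simp_all add: pairing_def)

lemma pairing_one: "i \<in> idx E ==> v \<in> fil E i ==> w \<in> fil E' i ==> \<chi> v w = 1"
  using P by (simp add: pairing_def)

lemma pairing_perfect': "(i, j) \<in> le E ==> w \<in> fil E' i ==> \<forall>v\<in>fil E j. \<chi> v w = 1 ==> w \<in> fil E' j"
  using P unfolding pairing_def by fast

text \<open>Perfectness is available on F(j)/F(i) for comparable indices; a common lower bound of
  \<open>i\<close> and of an index whose annihilator contains \<open>w\<close> reduces to this
  case.\<close>

lemma pairing_annih':
  assumes i: "i \<in> idx E" and w: "w \<in> carr E'"
  shows "w \<in> fil E' i \<longleftrightarrow> (\<forall>v\<in>fil E i. \<chi> v w = 1)"
proof
  assume *: "\<forall>v\<in>fil E i. \<chi> v w = 1"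
  obtain j0 where j0: "j0 \<in> idx E" "w \<in> fil E' j0" using w pairing_idx by (auto simp: carr_def)
  obtain j where j: "(j, i) \<in> le E" "(j, j0) \<in> le E" using tower_lower[OF pairing_tower i j0(1)] .
  then have "w \<in> fil E' j" using tower_mono[OF pairing_tower', of j0 j] pairing_le j0 by blast
  then show "w \<in> fil E' i" using pairing_perfect'[OF j(1) _ *] by blast
qed (use pairing_one[OF i] in blast)

lemma pairing_nul':
  assumes w: "w \<in> carr E'"
  shows "w \<in> nul E' \<longleftrightarrow> (\<forall>v\<in>carr E. \<chi> v w = 1)"
proof
  assume *: "w \<in> nul E'"
  show "\<forall>v\<in>carr E. \<chi> v w = 1"
  proof
    fix v assume "v \<in> carr E"
    then obtain i where "i \<in> idx E" "v \<in> fil E i" by (auto simp: carr_def)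
    then show "\<chi> v w = 1" using pairing_one[of i v w] * pairing_idx by (auto simp: nul_def)
  qed
next
  assume *: "\<forall>v\<in>carr E. \<chi> v w = 1"
  have "w \<in> fil E' i" if i: "i \<in> idx E" for i
    using pairing_annih'[OF i w] * fil_carr[OF i] by blast
  then show "w \<in> nul E'" by (simp add: nul_def pairing_idx)
qed

lemma pairing_nul_left:
  assumes "v \<in> carr E" "u \<in> nul E" "w \<in> carr E'"
  shows "\<chi> (v + u) w = \<chi> v w"
proof -
  obtain i where i: "i \<in> idx E" "w \<in> fil E' i" using assms(3) by (auto simp: carr_def pairing_idx)
  have "\<chi> u w = 1" using pairing_one[OF i(1) _ i(2)] assms(2) nul_fil[OF i(1)] by blast
  moreover have "u \<in> carr E" using assms(2) nul_carr[OF pairing_tower] by blast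
  ultimately show ?thesis using pairing_add assms by simp
qed

lemma pairing_nul_right:
  assumes "v \<in> carr E" "u \<in> nul E'" "w \<in> carr E'"
  shows "\<chi> v (w + u) = \<chi> v w"
proof -
  have u: "u \<in> carr E'" using assms(2) nul_carr[OF pairing_tower'] by blast
  then have "\<chi> v u = 1" using pairing_nul'[OF u] assms by blast
  then show ?thesis using pairing_add'[OF assms(1,3) u] by simp
qed

lemma char_test_fun:
  assumes f: "f \<in> test_fun E" and w: "w \<in> carr E'"
  shows "(\<lambda>v. f v * \<chi> v w) \<in> test_fun E"
proof -
  obtain k where k: "k \<in> idx E" "w \<in> fil E' k" using w by (auto simp: carr_def pairing_idx)
  obtain i j where *: "(i, k) \<in> le E" "(i, j) \<in> le E" "supp_in f (fil E j)" "inv_by f (fil E i)"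
    using test_fun_bounds[OF pairing_tower f k(1) k(1)] by metis
  have i: "i \<in> idx E" and j: "j \<in> idx E" using tower_idx[OF pairing_tower *(2)] by auto
  show ?thesis
  proof (rule test_funI[OF _ _ i j])
    show "supp_in (\<lambda>v. f v * \<chi> v w) (fil E j)" using *(3) by (auto simp: supp_in_def)
    show "inv_by (\<lambda>v. f v * \<chi> v w) (fil E i)"
      unfolding inv_by_def
    proof (intro allI ballI)
      fix v u assume u: "u \<in> fil E i"
      have fu: "f (v + u) = f v" by (rule inv_byD[OF *(4) u])
      show "f (v + u) * \<chi> (v + u) w = f v * \<chi> v w"
      proof (cases "f v = 0")
        case False
        then have v: "v \<in> carr E" using *(3) fil_carr[OF j] by (auto simp: supp_in_def)
        have "\<chi> u w = 1" using pairing_one[OF k(1) _ k(2)] u tower_mono[OF pairing_tower *(1)] by blast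
        moreover have "u \<in> carr E" using u fil_carr[OF i] by blast
        ultimately show ?thesis using pairing_add[OF v _ w] fu by simp
      qed (simp add: fu)
    qed
  qed
qed

text \<open>If \<open>w\<close> is not in the annihilator, some \<open>v0\<close> in F(i) has
  \<open>\<chi> v0 w\<close> different from \<open>1\<close>. Translation by \<open>v0\<close>
  preserves the measure and multiplies the integrand by this factor, so the integral
  vanishes.\<close>

lemma orthogonality:
  assumes m: "m \<in> meas E" and i: "i \<in> idx E" and w: "w \<in> carr E'"
  shows "m (\<lambda>v. indicator (fil E i) v * \<chi> v w) = (if w \<in> fil E' i then m (indicator (fil E i)) else 0)"
proof (cases "w \<in> fil E' i")
  case True
  have "(\<lambda>v. indicator (fil E i) v * \<chi> v w) = indicator (fil E i)"
    using pairing_one[OF i _ True] by (auto simp: indicator_def)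
  then show ?thesis using True by simp
next
  case False
  then obtain v0 where v0: "v0 \<in> fil E i" "\<chi> v0 w \<noteq> 1" using pairing_annih'[OF i w] by blast
  have v0c: "v0 \<in> carr E" using v0 fil_carr[OF i] by blast
  let ?f = "\<lambda>v. indicator (fil E i) v * \<chi> v w"
  have t: "?f \<in> test_fun E" by (rule char_test_fun[OF indicator_test_fun[OF pairing_tower i] w])
  have "(\<lambda>v. ?f (v + v0)) = (\<lambda>v. \<chi> v0 w * ?f v)"
  proof
    fix v
    show "?f (v + v0) = \<chi> v0 w * ?f v"
    proof (cases "v \<in> fil E i")
      case True
      then have "\<chi> (v + v0) w = \<chi> v w * \<chi> v0 w" using pairing_add v0c w fil_carr[OF i] by blast
      then show ?thesis
        using subgrp_add_iff[OF tower_subgrp[OF pairing_tower i] v0(1), of v] by (simp add: indicator_def)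
    next
      case F: False
      then show ?thesis
        using subgrp_add_iff[OF tower_subgrp[OF pairing_tower i] v0(1), of v] by simp
    qed
  qed
  then have "m ?f = \<chi> v0 w * m ?f"
    using meas_translate[OF m t v0c] distr_scale[OF meas_distr[OF m] t] by simp
  then show ?thesis using v0(2) False by simp
qed

lemma four_indicator_translate:
  assumes m: "m \<in> meas E" and i: "i \<in> idx E" and r: "r \<in> carr E"
  shows "four \<chi> E' m (\<lambda>v. indicator (fil E i) (v - r)) =
    (\<lambda>w. m (indicator (fil E i)) * (indicator (fil E' i) w * \<chi> r w))"
proof
  fix w
  let ?g = "\<lambda>v. indicator (fil E i) v * \<chi> v w"
  show "four \<chi> E' m (\<lambda>v. indicator (fil E i) (v - r)) w =
    m (indicator (fil E i)) * (indicator (fil E' i) w * \<chi> r w)"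
  proof (cases "w \<in> carr E'")
    case True
    let ?h = "\<lambda>v. indicator (fil E i) (v - r) * \<chi> v w"
    have t: "?h \<in> test_fun E"
      by (rule char_test_fun[OF indicator_translate_test_fun[OF pairing_tower i r] True])
    have "(\<lambda>v. ?h (v + r)) = (\<lambda>v. \<chi> r w * ?g v)"
      using pairing_add[OF _ r True] fil_carr[OF i] by (fastforce simp: indicator_def)
    then have "m ?h = \<chi> r w * m ?g"
      using meas_translate[OF m t r] distr_scale[OF meas_distr[OF m]
        char_test_fun[OF indicator_test_fun[OF pairing_tower i] True]] by simp
    then show ?thesis using orthogonality[OF m i True] True by (simp add: four_def)
  next
    case False
    then have "w \<notin> fil E' i" using fil_carr[of i E'] i pairing_idx by auto
    then show ?thesis using False by (simp add: four_def)
  qed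
qed

lemma four_sum:
  assumes m: "m \<in> meas E" and h: "\<And>r. r \<in> R ==> h r \<in> test_fun E"
  shows "four \<chi> E' m (\<lambda>v. \<Sum>r\<in>R. c r * h r v) = (\<lambda>w. \<Sum>r\<in>R. c r * four \<chi> E' m (h r) w)"
proof
  fix w show "four \<chi> E' m (\<lambda>v. \<Sum>r\<in>R. c r * h r v) w = (\<Sum>r\<in>R. c r * four \<chi> E' m (h r) w)"
  proof (cases "w \<in> carr E'")
    case True
    have "m (\<lambda>v. \<Sum>r\<in>R. c r * (h r v * \<chi> v w)) = (\<Sum>r\<in>R. c r * m (\<lambda>v. h r v * \<chi> v w))"
      by (rule distr_sum[OF pairing_tower meas_distr[OF m] char_test_fun[OF h True]])
    then show ?thesis by (simp add: four_def sum_distrib_right mult.assoc)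
  qed (simp add: four_def)
qed

text \<open>Support and invariance change places: a function supported in F(j) and invariant under
  F(i) is a combination of translates of the indicator of F(i), whose transforms are supported in
  \<open>fil E' i\<close> and invariant under \<open>fil E' j\<close>.\<close>

lemma four_test_fun:
  assumes m: "m \<in> meas E" and f: "f \<in> test_fun E"
  shows "four \<chi> E' m f \<in> test_fun E'"
proof -
  obtain i0 where i0: "i0 \<in> idx E" using tower_nonempty[OF pairing_tower] by blast
  obtain i j where *: "(i, j) \<in> le E" "supp_in f (fil E j)" "inv_by f (fil E i)"
    using test_fun_bounds[OF pairing_tower f i0 i0] by metis
  have i: "i \<in> idx E" and j: "j \<in> idx E" using tower_idx[OF pairing_tower *(1)] by auto
  obtain R where R: "transversal R (fil E i) (fil E j)" using tower_transversal[OF pairing_tower *(1)] by blast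
  have rc: "r \<in> carr E" if "r \<in> R" for r using that R fil_carr[OF j] by (auto simp: transversal_def)
  have "four \<chi> E' m f = four \<chi> E' m (\<lambda>v. \<Sum>r\<in>R. f r * indicator (fil E i) (v - r))"
    using test_fun_decompose[OF pairing_tower * R] by simp
  also have "\<dots> = (\<lambda>w. \<Sum>r\<in>R. f r * four \<chi> E' m (\<lambda>v. indicator (fil E i) (v - r)) w)"
    by (rule four_sum[OF m indicator_translate_test_fun[OF pairing_tower i rc]])
  also have "\<dots> = (\<lambda>w. \<Sum>r\<in>R. f r * (m (indicator (fil E i)) * (indicator (fil E' i) w * \<chi> r w)))"
    by (intro ext sum.cong refl) (simp add: four_indicator_translate[OF m i rc])
  finally have eq: "four \<chi> E' m f = \<dots>" .
  have "(\<lambda>w. indicator (fil E' i) w * \<chi> r w) \<in> test_fun E'" if r: "r \<in> R" for r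
  proof (rule test_funI)
    show "supp_in (\<lambda>w. indicator (fil E' i) w * \<chi> r w) (fil E' i)" by (auto simp: supp_in_def indicator_def)
    show "inv_by (\<lambda>w. indicator (fil E' i) w * \<chi> r w) (fil E' j)"
      unfolding inv_by_def
    proof (intro allI ballI)
      fix w u assume u: "u \<in> fil E' j"
      have ui: "u \<in> fil E' i" using u tower_mono[OF pairing_tower', of j i] * pairing_le by blast
      have c: "fil E' i \<subseteq> carr E'" using fil_carr[of i E'] i pairing_idx by simp
      have "\<chi> r u = 1" using pairing_one[OF j _ u] r R by (auto simp: transversal_def)
      then have "\<chi> r (w + u) = \<chi> r w" if "w \<in> fil E' i"
        using pairing_add'[OF rc[OF r], of w u] that c ui by auto
      then show "indicator (fil E' i) (w + u) * \<chi> r (w + u) = indicator (fil E' i) w * \<chi> r w"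
        using subgrp_add_iff[OF tower_subgrp[OF pairing_tower', of i] ui, of w] i pairing_idx
        by auto
    qed
  qed (use i j pairing_idx in auto)
  then show ?thesis
    unfolding eq by (intro test_fun_sum[OF pairing_tower'] test_fun_scale)
qed

end

text \<open>
  Orthogonality for \<open>E'\<close> turns the decomposition of \<open>f\<close> into translates of an indicator function
  into the inversion formula at \<open>0\<close>; that the constant does not depend on \<open>i\<close> comes for free, by
  applying the formula to one function with two choices of \<open>i\<close>.
\<close>

lemma four_at_zero_aux:
  assumes P: "pairing E E' \<chi>" and m: "m \<in> meas E" and m': "m' \<in> meas E'"
    and ij: "(i, j) \<in> le E" and f: "supp_in f (fil E j)" "inv_by f (fil E i)"
  shows "m' (four \<chi> E' m f) = m (indicator (fil E i)) * m' (indicator (fil E' i)) * f 0"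
proof -
  note T = pairing_tower[OF P] and T' = pairing_tower'[OF P]
  have i: "i \<in> idx E" and j: "j \<in> idx E" using tower_idx[OF T ij] by auto
  have i': "i \<in> idx E'" using i pairing_idx[OF P] by simp
  obtain R where R: "transversal R (fil E i) (fil E j)" using tower_transversal[OF T ij] by blast
  have rc: "r \<in> carr E" if "r \<in> R" for r using that R fil_carr[OF j] by (auto simp: transversal_def)
  let ?c = "m (indicator (fil E i)) * m' (indicator (fil E' i))"
  let ?I = "\<lambda>r v. indicator (fil E i) (v - r) :: complex"
  have I: "?I r \<in> test_fun E" if "r \<in> R" for r
    by (rule indicator_translate_test_fun[OF T i rc[OF that]])
  have fF: "four \<chi> E' m f = (\<lambda>w. \<Sum>r\<in>R. f r * four \<chi> E' m (?I r) w)"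
    by (subst test_fun_decompose[OF T ij f R], rule four_sum[OF P m I])
  have "m' (four \<chi> E' m (?I r)) = ?c * ?I r 0" if r: "r \<in> R" for r
  proof -
    have t: "(\<lambda>w. indicator (fil E' i) w * \<chi> r w) \<in> test_fun E'"
      by (rule char_test_fun[OF pairing_sym[OF P] indicator_test_fun[OF T' i'] rc[OF r]])
    have "m' (four \<chi> E' m (?I r)) = m (indicator (fil E i)) * m' (\<lambda>w. indicator (fil E' i) w * \<chi> r w)"
      unfolding four_indicator_translate[OF P m i rc[OF r]] by (rule distr_scale[OF meas_distr[OF m'] t])
    also have "m' (\<lambda>w. indicator (fil E' i) w * \<chi> r w) = (if r \<in> fil E i then m' (indicator (fil E' i)) else 0)"
      by (rule orthogonality[OF pairing_sym[OF P] m' i' rc[OF r]])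
    finally have *: "m' (four \<chi> E' m (?I r)) = m (indicator (fil E i)) * (if r \<in> fil E i then m' (indicator (fil E' i)) else 0)" .
    have "- r \<in> fil E i \<longleftrightarrow> r \<in> fil E i"
      using subgrp_uminus[OF tower_subgrp[OF T i], of r] subgrp_uminus[OF tower_subgrp[OF T i], of "- r"] by auto
    then show ?thesis unfolding * by simp
  qed
  then have "m' (four \<chi> E' m f) = (\<Sum>r\<in>R. f r * (?c * ?I r 0))"
    unfolding fF
    by (subst distr_sum[OF T' meas_distr[OF m'] four_test_fun[OF P m I]]) (auto intro!:)
  also have "\<dots> = ?c * (\<Sum>r\<in>R. f r * ?I r 0)"
    by (simp add: sum_distrib_left algebra_simps)
  also have "(\<Sum>r\<in>R. f r * ?I r 0) = f 0"
    using fun_cong[OF test_fun_decompose[OF T ij f R], of 0] by simp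
  finally show ?thesis .
qed

lemma mass_product_constant:
  assumes P: "pairing E E' \<chi>" and m: "m \<in> meas E" and m': "m' \<in> meas E'"
    and i: "i \<in> idx E" and j: "j \<in> idx E"
  shows "m (indicator (fil E i)) * m' (indicator (fil E' i)) = m (indicator (fil E j)) * m' (indicator (fil E' j))"
proof -
  note T = pairing_tower[OF P]
  have *: "m (indicator (fil E i)) * m' (indicator (fil E' i)) = m (indicator (fil E j)) * m' (indicator (fil E' j))"
    if ij: "(i, j) \<in> le E" for i j
  proof -
    let ?f = "indicator (fil E j) :: _ \<Rightarrow> complex"
    have j: "j \<in> idx E" using tower_idx[OF T ij] by auto
    note sg = tower_subgrp[OF T j]
    have s: "supp_in ?f (fil E j)" by (simp add: supp_in_def indicator_def)
    have v: "inv_by ?f (fil E j)" using subgrp_add_iff[OF sg] by (simp add: inv_by_def indicator_def)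
    have v': "inv_by ?f (fil E i)" by (rule inv_by_mono[OF v tower_mono[OF T ij]])
    show ?thesis
      using four_at_zero_aux[OF P m m' ij s v'] four_at_zero_aux[OF P m m' tower_refl[OF T j] s v]
        subgrp_zero[OF sg] by simp
  qed
  obtain k where "(i, k) \<in> le E" "(j, k) \<in> le E" using tower_upper[OF T i j] .
  then show ?thesis using *[of i k] *[of j k] by simp
qed

lemma mdual_I:
  assumes P: "pairing E E' \<chi>" and m: "m \<in> meas E" and m': "m' \<in> meas E'"
    and i: "i \<in> idx E" "m (indicator (fil E i)) * m' (indicator (fil E' i)) = 1"
  shows "mdual E E' m m'"
  using mass_product_constant[OF P m m' i(1)] i m m' by (auto simp: mdual_def)

lemma mdual_exists:
  assumes P: "pairing E E' \<chi>" and m: "m \<in> meas E" "m \<noteq> 0"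
  shows "\<exists>m'. mdual E E' m m'"
proof -
  obtain i where i: "i \<in> idx E" using tower_nonempty[OF pairing_tower[OF P]] by blast
  then obtain m' where m': "m' \<in> meas E'" "m' (indicator (fil E' i)) = 1"
    using meas_exists[OF pairing_tower'[OF P], of i] pairing_idx[OF P] by auto
  let ?c = "m (indicator (fil E i))"
  have "?c \<noteq> 0" by (rule meas_indicator_nonzero[OF pairing_tower[OF P] m i])
  then have "mdual E E' m (\<lambda>f. inverse ?c * m' f)"
    using m' by (intro mdual_I[OF P m(1) meas_scale[OF m'(1)] i]) simp
  then show ?thesis by blast
qed

lemma mdual_nonzero:
  assumes P: "pairing E E' \<chi>" and d: "mdual E E' m m'"
  shows "m \<noteq> 0" "m' \<noteq> 0"
proof -
  obtain i where i: "i \<in> idx E" using tower_nonempty[OF pairing_tower[OF P]] by blast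
  then have "m (indicator (fil E i)) * m' (indicator (fil E' i)) = 1" using d by (auto simp: mdual_def)
  then show "m \<noteq> 0" "m' \<noteq> 0" by auto
qed

lemma mdual_unique:
  assumes P: "pairing E E' \<chi>" and "mdual E E' m m'" "mdual E E' m n'"
  shows "n' = m'"
proof -
  obtain i where i: "i \<in> idx E" using tower_nonempty[OF pairing_tower[OF P]] by blast
  then have "m (indicator (fil E i)) * m' (indicator (fil E' i)) = 1"
    "m (indicator (fil E i)) * n' (indicator (fil E' i)) = 1" using assms by (auto simp: mdual_def)
  then have "n' (indicator (fil E' i)) = m' (indicator (fil E' i))"
    by (metis mult_cancel_left mult_zero_left zero_neq_one)
  then show ?thesis
    using assms i pairing_idx[OF P] by (intro meas_eqI[OF pairing_tower'[OF P], of n' m' i]) (auto simp: mdual_def)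
qed

lemma mdual_sym: "pairing E E' \<chi> ==> mdual E E' m m' ==> mdual E' E m' m"
  using pairing_idx[of E E' \<chi>] by (simp add: mdual_def mult.commute)

lemma mdual_scale:
  assumes "mdual E E' m m'" "c \<noteq> 0"
  shows "mdual E E' (\<lambda>f. c * m f) (\<lambda>f. inverse c * m' f)"
  using assms by (simp add: mdual_def meas_scale algebra_simps)

lemma four_at_zero:
  assumes P: "pairing E E' \<chi>" and d: "mdual E E' m m'" and f: "f \<in> test_fun E"
  shows "m' (four \<chi> E' m f) = f 0"
proof -
  have m: "m \<in> meas E" and m': "m' \<in> meas E'" using d by (auto simp: mdual_def)
  obtain i0 where i0: "i0 \<in> idx E" using tower_nonempty[OF pairing_tower[OF P]] by blast
  obtain i j where *: "(i, j) \<in> le E" "supp_in f (fil E j)" "inv_by f (fil E i)"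
    using test_fun_bounds[OF pairing_tower[OF P] f i0 i0] by metis
  have "i \<in> idx E" using tower_idx[OF pairing_tower[OF P] *(1)] by auto
  then have "m (indicator (fil E i)) * m' (indicator (fil E' i)) = 1" using d by (auto simp: mdual_def)
  then show ?thesis using four_at_zero_aux[OF P m m' *] by simp
qed

lemma four_translate:
  assumes P: "pairing E E' \<chi>" and m: "m \<in> meas E" and f: "f \<in> test_fun E" and a: "a \<in> carr E"
  shows "four \<chi> E' m (\<lambda>v. f (v + a)) = (\<lambda>w. \<chi> (- a) w * four \<chi> E' m f w)"
proof
  fix w
  have a': "- a \<in> carr E" by (rule subgrp_uminus[OF tower_carr_subgrp[OF pairing_tower[OF P]] a])
  show "four \<chi> E' m (\<lambda>v. f (v + a)) w = \<chi> (- a) w * four \<chi> E' m f w"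
  proof (cases "w \<in> carr E'")
    case True
    let ?g = "\<lambda>v. f v * \<chi> v w"
    have g: "?g \<in> test_fun E" by (rule char_test_fun[OF P f True])
    have "(\<lambda>v. f (v + a) * \<chi> v w) = (\<lambda>v. \<chi> (- a) w * ?g (v + a))"
    proof
      fix v
      show "f (v + a) * \<chi> v w = \<chi> (- a) w * ?g (v + a)"
      proof (cases "f (v + a) = 0")
        case False
        then have "v + a \<in> carr E" using test_fun_supp_carr[OF f] by (auto simp: supp_in_def)
        from pairing_add[OF P this a' True] show ?thesis by simp
      qed simp
    qed
    then have "m (\<lambda>v. f (v + a) * \<chi> v w) = m (\<lambda>v. \<chi> (- a) w * ?g (v + a))" by (rule arg_cong)
    also have "\<dots> = \<chi> (- a) w * m ?g"
      using distr_scale[OF meas_distr[OF m] test_fun_translate[OF pairing_tower[OF P] g a]]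
        meas_translate[OF m g a] by simp
    finally show ?thesis by (simp add: four_def)
  qed (simp add: four_def)
qed

text \<open>Inversion at \<open>0\<close> is applied to a translate of \<open>f\<close>, and
  \<open>four_translate\<close> turns the translation into a factor \<open>\<chi>\<close>. Both
  transforms use \<open>\<chi>\<close>, neither its inverse, so the result is
  \<open>f (- v)\<close>.\<close>

lemma four_four:
  assumes P: "pairing E E' \<chi>" and d: "mdual E E' m m'" and f: "f \<in> test_fun E"
  shows "four (\<lambda>w v. \<chi> v w) E m' (four \<chi> E' m f) = (\<lambda>v. f (- v))"
proof
  fix v
  note C = tower_carr_subgrp[OF pairing_tower[OF P]]
  have m: "m \<in> meas E" using d by (simp add: mdual_def)
  show "four (\<lambda>w v. \<chi> v w) E m' (four \<chi> E' m f) v = f (- v)"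
  proof (cases "v \<in> carr E")
    case True
    note a = subgrp_uminus[OF C True]
    have "m' (four \<chi> E' m (\<lambda>x. f (x + - v))) = f (- v)"
      using four_at_zero[OF P d test_fun_translate[OF pairing_tower[OF P] f a]] by simp
    then show ?thesis
      using True unfolding four_translate[OF P m f a] by (simp add: four_def[of _ E] mult.commute)
  next
    case False
    then show ?thesis
      using supp_inD[OF test_fun_supp_carr[OF f], of "- v"] subgrp_uminus[OF C, of "- v"] by (auto simp: four_def[of _ E])
  qed
qed

lemma four_inj:
  assumes P: "pairing E E' \<chi>" and m: "m \<in> meas E" "m \<noteq> 0"
    and f: "f \<in> test_fun E" and g: "g \<in> test_fun E" and eq: "four \<chi> E' m f = four \<chi> E' m g"
  shows "f = g"
proof
  fix v
  obtain m' where d: "mdual E E' m m'" using mdual_exists[OF P m] ..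
  show "f v = g v" using fun_cong[of _ _ "- v", OF four_four[OF P d f]] fun_cong[of _ _ "- v", OF four_four[OF P d g]] eq by simp
qed

section \<open>Triples in duality\<close>

definition "tpair t t' \<chi>1 \<chi>2 \<chi>3 \<longleftrightarrow> adm t \<and> adm t' \<and>
     pairing (sub t) (quo t') \<chi>1 \<and> pairing (mid t) (mid t') \<chi>2 \<and> pairing (quo t) (sub t') \<chi>3 \<and>
     (\<forall>v\<in>carr (sub t). \<forall>w\<in>carr (mid t'). \<chi>2 (emb t v) w = \<chi>1 v (epi t' w)) \<and>
     (\<forall>v\<in>carr (mid t). \<forall>w\<in>carr (sub t'). \<chi>2 v (emb t' w) = \<chi>3 (epi t v) w)"

lemma tpair_sym:
  "tpair t t' \<chi>1 \<chi>2 \<chi>3 ==> tpair t' t (\<lambda>w v. \<chi>3 v w) (\<lambda>w v. \<chi>2 v w) (\<lambda>w v. \<chi>1 v w)"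
  unfolding tpair_def using pairing_sym[of "sub t" "quo t'" \<chi>1] pairing_sym[of "mid t" "mid t'" \<chi>2]
    pairing_sym[of "quo t" "sub t'" \<chi>3] by metis

context
  fixes t :: "(_, _, _, _, _, _) c1_triple"
    and t' :: "(_, _, _, _, _, _) c1_triple"
    and \<chi>1 \<chi>2 \<chi>3
  assumes TP: "tpair t t' \<chi>1 \<chi>2 \<chi>3"
begin

lemma tpair_adm: "adm t" and tpair_adm': "adm t'"
  using TP by (simp_all add: tpair_def)

lemma tpair_pairing: "pairing (sub t) (quo t') \<chi>1" "pairing (mid t) (mid t') \<chi>2" "pairing (quo t) (sub t') \<chi>3"
  using TP by (simp_all add: tpair_def)

lemma tpair_emb: "v \<in> carr (sub t) ==> w \<in> carr (mid t') ==> \<chi>2 (emb t v) w = \<chi>1 v (epi t' w)"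
  using TP by (simp add: tpair_def)

lemma tpair_epi: "z \<in> carr (mid t) ==> y \<in> carr (sub t') ==> \<chi>2 z (emb t' y) = \<chi>3 (epi t z) y"
  using TP by (simp add: tpair_def)

text \<open>The character \<open>emb t' w\<close> is pulled back from the quotient along
  \<open>epi t\<close>, hence constant on each fibre, and can be taken out of the integral over the
  sub.\<close>

lemma epi_push_char:
  assumes f: "f \<in> test_fun (mid t)" and m: "m \<in> meas (sub t)" and w: "w \<in> carr (sub t')"
  shows "epi_push t (\<lambda>v. f v * \<chi>2 v (emb t' w)) m = (\<lambda>y. epi_push t f m y * \<chi>3 y w)"
proof
  fix y
  have ew: "emb t' w \<in> carr (mid t')" by (rule adm_emb_carr[OF tpair_adm' w])
  let ?g = "\<lambda>v. f v * \<chi>2 v (emb t' w)"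
  have g: "?g \<in> test_fun (mid t)" by (rule char_test_fun[OF tpair_pairing(2) f ew])
  show "epi_push t ?g m y = epi_push t f m y * \<chi>3 y w"
  proof (cases "y \<in> carr (quo t)")
    case True
    obtain z where z: "z \<in> carr (mid t)" "epi t z - y \<in> nul (quo t)" using adm_lift[OF tpair_adm True] by blast
    have "fibre t ?g z = (\<lambda>v. \<chi>3 y w * fibre t f z v)"
    proof
      fix v
      show "fibre t ?g z v = \<chi>3 y w * fibre t f z v"
      proof (cases "v \<in> carr (sub t)")
        case v: True
        have zv: "z + emb t v \<in> carr (mid t)"
          using subgrp_add[OF tower_carr_subgrp[OF adm_towers(2)[OF tpair_adm]] z(1) adm_emb_carr[OF tpair_adm v]] .
        have "epi t (z + emb t v) = y + ((epi t z - y) + epi t (emb t v))"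
          by (simp add: adm_epi_add[OF tpair_adm])
        moreover have "(epi t z - y) + epi t (emb t v) \<in> nul (quo t)"
          using subgrp_add[OF tower_nul_subgrp[OF adm_towers(3)[OF tpair_adm]] z(2) adm_epi_emb[OF tpair_adm v]] .
        ultimately have "\<chi>3 (epi t (z + emb t v)) w = \<chi>3 y w"
          using pairing_nul_left[OF tpair_pairing(3) True _ w] by metis
        then show ?thesis using tpair_epi[OF zv w] by (simp add: fibre_def)
      qed (simp add: fibre_def)
    qed
    then show ?thesis
      using epi_push_eq[OF tpair_adm g m True z] epi_push_eq[OF tpair_adm f m True z]
        distr_scale[OF meas_distr[OF m] fibre_test_fun[OF tpair_adm f z(1)]] by simp
  qed (simp add: epi_push_out[OF tpair_adm])
qed

text \<open>Fubini: the integral over \<open>mid t\<close> of \<open>f\<close> times a character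
  pulled back from the quotient is iterated by \<open>meas_prod_apply\<close>, and
  \<open>epi_push_char\<close> takes the character out of the inner integral.\<close>

theorem four_epi_push:
  assumes f: "f \<in> test_fun (mid t)" and m1: "m1 \<in> meas (sub t)" and m3: "m3 \<in> meas (quo t)"
  shows "four \<chi>3 (sub t') m3 (epi_push t f m1) = mono_pull t' (four \<chi>2 (mid t') (meas_prod t m1 m3) f)"
proof
  fix w
  show "four \<chi>3 (sub t') m3 (epi_push t f m1) w = mono_pull t' (four \<chi>2 (mid t') (meas_prod t m1 m3) f) w"
  proof (cases "w \<in> carr (sub t')")
    case True
    then show ?thesis
      using epi_push_char[OF f m1 True] adm_emb_carr[OF tpair_adm' True]
        meas_prod_apply[OF tpair_adm m1 m3 char_test_fun[OF tpair_pairing(2) f adm_emb_carr[OF tpair_adm' True]]]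
      by (simp add: four_def mono_pull_def)
  qed (simp add: four_def mono_pull_def)
qed

text \<open>Poisson summation: the sum over the annihilator of \<open>E\<^sub>1\<close> is computed by inversion at \<open>0\<close> on \<open>E\<^sub>3\<close>.\<close>

theorem four_mono_pull:
  assumes f: "f \<in> test_fun (mid t)" and m1: "m1 \<in> meas (sub t)" and d: "mdual (quo t) (sub t') m3 m3'"
  shows "four \<chi>1 (quo t') m1 (mono_pull t f) = epi_push t' (four \<chi>2 (mid t') (meas_prod t m1 m3) f) m3'"
proof
  fix w
  let ?m2 = "meas_prod t m1 m3"
  have m3: "m3 \<in> meas (quo t)" and m3': "m3' \<in> meas (sub t')" using d by (auto simp: mdual_def)
  have m2: "?m2 \<in> meas (mid t)" by (rule meas_prod_meas[OF tpair_adm m1 m3])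
  show "four \<chi>1 (quo t') m1 (mono_pull t f) w = epi_push t' (four \<chi>2 (mid t') ?m2 f) m3' w"
  proof (cases "w \<in> carr (quo t')")
    case True
    obtain z where z: "z \<in> carr (mid t')" "epi t' z - w \<in> nul (quo t')" using adm_lift[OF tpair_adm' True] by blast
    let ?h = "\<lambda>v. f v * \<chi>2 v z"
    have h: "?h \<in> test_fun (mid t)" by (rule char_test_fun[OF tpair_pairing(2) f z(1)])
    \<comment> \<open>\<open>z\<close> lifts \<open>w\<close>. Along the coset of \<open>z\<close>
      under the annihilator of the sub, which is \<open>sub t'\<close>, the transform of
      \<open>f\<close> is the transform over the quotient of the push-forward of \<open>?h\<close>.
      Integrating it against \<open>m3'\<close> is inversion at \<open>0\<close>, and the fibre over
      \<open>0\<close> is the sub.\<close>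
    have "fibre t' (four \<chi>2 (mid t') ?m2 f) z = four \<chi>3 (sub t') m3 (epi_push t ?h m1)"
    proof
      fix y
      show "fibre t' (four \<chi>2 (mid t') ?m2 f) z y = four \<chi>3 (sub t') m3 (epi_push t ?h m1) y"
      proof (cases "y \<in> carr (sub t')")
        case y: True
        note ey = adm_emb_carr[OF tpair_adm' y]
        have zy: "z + emb t' y \<in> carr (mid t')"
          using subgrp_add[OF tower_carr_subgrp[OF adm_towers(2)[OF tpair_adm']] z(1) ey] .
        have e: "(\<lambda>v. f v * \<chi>2 v (z + emb t' y)) = (\<lambda>v. ?h v * \<chi>2 v (emb t' y))"
        proof
          fix v
          show "f v * \<chi>2 v (z + emb t' y) = ?h v * \<chi>2 v (emb t' y)"
          proof (cases "f v = 0")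
            case False
            then have "v \<in> carr (mid t)" using test_fun_supp_carr[OF f] by (auto simp: supp_in_def)
            from pairing_add'[OF tpair_pairing(2) this z(1) ey] show ?thesis by simp
          qed simp
        qed
        show ?thesis
          using zy e meas_prod_apply[OF tpair_adm m1 m3 char_test_fun[OF tpair_pairing(2) h ey]]
            epi_push_char[OF h m1 y]
          by (simp add: fibre_def four_def)
      qed (simp add: fibre_def four_def)
    qed
    then have "epi_push t' (four \<chi>2 (mid t') ?m2 f) m3' w = epi_push t ?h m1 0"
      using epi_push_eq[OF tpair_adm' four_test_fun[OF tpair_pairing(2) m2 f] m3' True z]
        four_at_zero[OF tpair_pairing(3) d epi_push_test_fun[OF tpair_adm h m1]] by simp
    also have "\<dots> = m1 (fibre t ?h 0)"
      using subgrp_zero[OF tower_carr_subgrp[OF adm_towers(2)[OF tpair_adm]]]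
        subgrp_zero[OF tower_carr_subgrp[OF adm_towers(3)[OF tpair_adm]]]
        subgrp_zero[OF tower_nul_subgrp[OF adm_towers(3)[OF tpair_adm]]]
      by (intro epi_push_eq[OF tpair_adm h m1]) (simp_all add: adm_epi_zero[OF tpair_adm])
    also have "fibre t ?h 0 = (\<lambda>v. mono_pull t f v * \<chi>1 v w)"
    proof
      fix v
      show "fibre t ?h 0 v = mono_pull t f v * \<chi>1 v w"
      proof (cases "v \<in> carr (sub t)")
        case v: True
        have "\<chi>1 v (w + (epi t' z - w)) = \<chi>1 v w" by (rule pairing_nul_right[OF tpair_pairing(1) v z(2) True])
        then show ?thesis using tpair_emb[OF v z(1)] by (simp add: fibre_def mono_pull_def)
      qed (simp add: fibre_def mono_pull_def)
    qed
    finally show ?thesis using True by (simp add: four_def)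
  qed (simp add: four_def epi_push_out[OF tpair_adm'])
qed

text \<open>One member suffices. The transform of its indicator is integrated in two steps: over
  \<open>sub t'\<close> by Poisson summation, over \<open>quo t'\<close> by inversion at
  \<open>0\<close> on the sub. The outcome is the value \<open>1\<close> of the indicator at
  \<open>0\<close>; by \<open>four_at_zero_aux\<close> it is also the product of the two
  masses.\<close>

lemma mdual_meas_prod:
  assumes d1: "mdual (sub t) (quo t') m1 m1'" and d3: "mdual (quo t) (sub t') m3 m3'"
  shows "mdual (mid t) (mid t') (meas_prod t m1 m3) (meas_prod t' m3' m1')"
proof -
  have m1: "m1 \<in> meas (sub t)" and m1': "m1' \<in> meas (quo t')" using d1 by (auto simp: mdual_def)
  have m3: "m3 \<in> meas (quo t)" and m3': "m3' \<in> meas (sub t')" using d3 by (auto simp: mdual_def)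
  note m2 = meas_prod_meas[OF tpair_adm m1 m3] and m2' = meas_prod_meas[OF tpair_adm' m3' m1']
  note T = adm_towers(2)[OF tpair_adm]
  obtain i where i: "i \<in> idx (mid t)" using tower_nonempty[OF T] by blast
  let ?f = "indicator (fil (mid t) i) :: _ \<Rightarrow> complex"
  note f = indicator_test_fun[OF T i]
  have "meas_prod t' m3' m1' (four \<chi>2 (mid t') (meas_prod t m1 m3) ?f) =
      m1' (epi_push t' (four \<chi>2 (mid t') (meas_prod t m1 m3) ?f) m3')"
    by (rule meas_prod_apply[OF tpair_adm' m3' m1' four_test_fun[OF tpair_pairing(2) m2 f]])
  also have "\<dots> = m1' (four \<chi>1 (quo t') m1 (mono_pull t ?f))"
    using four_mono_pull[OF f m1 d3] by simp
  also have "\<dots> = mono_pull t ?f 0"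
    by (rule four_at_zero[OF tpair_pairing(1) d1 mono_pull_test_fun[OF tpair_adm f]])
  also have "\<dots> = 1"
    using subgrp_zero[OF tower_carr_subgrp[OF adm_towers(1)[OF tpair_adm]]] subgrp_zero[OF tower_subgrp[OF T i]]
    by (simp add: mono_pull_def adm_emb_zero[OF tpair_adm])
  finally have "meas_prod t' m3' m1' (four \<chi>2 (mid t') (meas_prod t m1 m3) ?f) = 1" .
  moreover have "supp_in ?f (fil (mid t) i)" by (simp add: supp_in_def indicator_def)
  moreover have "inv_by ?f (fil (mid t) i)"
    using subgrp_add_iff[OF tower_subgrp[OF T i]] by (simp add: inv_by_def indicator_def)
  ultimately have "meas_prod t m1 m3 ?f * meas_prod t' m3' m1' (indicator (fil (mid t') i)) = 1"
    using four_at_zero_aux[OF tpair_pairing(2) m2 m2' tower_refl[OF T i]] subgrp_zero[OF tower_subgrp[OF T i]]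
    by simp
  then show ?thesis by (rule mdual_I[OF tpair_pairing(2) m2 m2' i])
qed

text \<open>On a fibre of \<open>epi t\<close> the integrand is a constant times a character of the
  compact sub, whose integral is \<open>1\<close> or \<open>0\<close> according as the character is
  trivial or not. It is trivial when \<open>epi t' w\<close> is null, that is, when \<open>w\<close>
  comes from \<open>sub t'\<close> up to the null space; for all other \<open>w\<close> the
  transform vanishes, as extension by zero does.\<close>

theorem four_epi_pull:
  assumes c: "compact_filt (sub t)" and m1: "m1 \<in> meas (sub t)" "m1 (indicator (carr (sub t))) = 1"
    and m3: "m3 \<in> meas (quo t)" and g: "g \<in> test_fun (quo t)"
  shows "four \<chi>2 (mid t') (meas_prod t m1 m3) (epi_pull t g) = mono_push t' (four \<chi>3 (sub t') m3 g)"
proof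
  fix w
  obtain a where a: "a \<in> idx (sub t)" "fil (sub t) a = carr (sub t)" using c by (auto simp: compact_filt_def)
  note A = tpair_adm and A' = tpair_adm'
  have h: "epi_pull t g \<in> test_fun (mid t)" by (rule epi_pull_test_fun[OF A c g])
  have F: "four \<chi>3 (sub t') m3 g \<in> test_fun (sub t')" by (rule four_test_fun[OF tpair_pairing(3) m3 g])
  show "four \<chi>2 (mid t') (meas_prod t m1 m3) (epi_pull t g) w = mono_push t' (four \<chi>3 (sub t') m3 g) w"
  proof (cases "w \<in> carr (mid t')")
    case True
    let ?h = "\<lambda>v. epi_pull t g v * \<chi>2 v w"
    have h': "?h \<in> test_fun (mid t)" by (rule char_test_fun[OF tpair_pairing(2) h True])
    note ew = adm_epi_carr[OF A' True]
    \<comment> \<open>The member \<open>a\<close> is the whole sub, so its annihilator is the null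
      space.\<close>
    have nul: "epi t' w \<in> fil (quo t') a \<longleftrightarrow> epi t' w \<in> nul (quo t')"
      using pairing_annih'[OF tpair_pairing(1) a(1) ew] pairing_nul'[OF tpair_pairing(1) ew] a(2) by simp
    have push: "epi_push t ?h m1 y = (if epi t' w \<in> nul (quo t') then g y * \<chi>2 z w else 0)"
      if y: "y \<in> carr (quo t)" and z: "z \<in> carr (mid t)" "epi t z - y \<in> nul (quo t)" for y z
    proof -
      let ?k = "\<lambda>v. indicator (fil (sub t) a) v * \<chi>1 v (epi t' w)"
      have "fibre t ?h z = (\<lambda>v. (g y * \<chi>2 z w) * ?k v)"
      proof
        fix v
        show "fibre t ?h z v = (g y * \<chi>2 z w) * ?k v"
        proof (cases "v \<in> carr (sub t)")
          case v: True
          note ev = adm_emb_carr[OF A v]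
          have zv: "z + emb t v \<in> carr (mid t)"
            using subgrp_add[OF tower_carr_subgrp[OF adm_towers(2)[OF A]] z(1) ev] .
          have "epi t (z + emb t v) - y = (epi t z - y) + epi t (emb t v)"
            by (simp add: adm_epi_add[OF A])
          then have "epi t (z + emb t v) - y \<in> nul (quo t)"
            using subgrp_add[OF tower_nul_subgrp[OF adm_towers(3)[OF A]] z(2) adm_epi_emb[OF A v]] by (simp only:)
          then have "g (epi t (z + emb t v)) = g y" by (rule inv_by_diff[OF test_fun_inv_nul[OF g]])
          then show ?thesis
            using zv a(2) pairing_add[OF tpair_pairing(2) z(1) ev True] tpair_emb[OF v True]
            by (simp add: fibre_def epi_pull_def)
        qed (simp add: fibre_def a(2))
      qed
      moreover have "?k \<in> test_fun (sub t)"
        by (rule char_test_fun[OF tpair_pairing(1) indicator_test_fun[OF adm_towers(1)[OF A] a(1)] ew])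
      ultimately show ?thesis
        using epi_push_eq[OF A h' m1(1) y z] distr_scale[OF meas_distr[OF m1(1)]]
          orthogonality[OF tpair_pairing(1) m1(1) a(1) ew] m1(2) a(2) nul by simp
    qed
    have "four \<chi>2 (mid t') (meas_prod t m1 m3) (epi_pull t g) w = m3 (epi_push t ?h m1)"
      using True meas_prod_apply[OF A m1(1) m3 h'] by (simp add: four_def)
    also have "\<dots> = mono_push t' (four \<chi>3 (sub t') m3 g) w"
    proof (cases "epi t' w \<in> nul (quo t')")
      case N: True
      obtain x where x: "x \<in> carr (sub t')" "w - emb t' x \<in> nul (mid t')" using adm_kernel[OF A' True] N by blast
      have "epi_push t ?h m1 = (\<lambda>y. g y * \<chi>3 y x)"
      proof
        fix y
        show "epi_push t ?h m1 y = g y * \<chi>3 y x"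
        proof (cases "y \<in> carr (quo t)")
          case y: True
          obtain z where z: "z \<in> carr (mid t)" "epi t z - y \<in> nul (quo t)" using adm_lift[OF A y] by blast
          have "\<chi>2 z (emb t' x + (w - emb t' x)) = \<chi>2 z (emb t' x)"
            by (rule pairing_nul_right[OF tpair_pairing(2) z(1) x(2) adm_emb_carr[OF A' x(1)]])
          moreover have "\<chi>3 (y + (epi t z - y)) x = \<chi>3 y x"
            by (rule pairing_nul_left[OF tpair_pairing(3) y z(2) x(1)])
          ultimately show ?thesis using push[OF y z] N tpair_epi[OF z(1) x(1)] by simp
        next
          case False
          then show ?thesis using supp_inD[OF test_fun_supp_carr[OF g]] by (simp add: epi_push_out[OF A])
        qed
      qed
      then show ?thesis using x(1) mono_push_eq[OF A' F x] by (simp add: four_def)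
    next
      case N: False
      have "epi_push t ?h m1 = (\<lambda>_. 0)"
      proof
        fix y show "epi_push t ?h m1 y = 0"
          using push[of y] adm_lift[OF A, of y] N epi_push_out[OF A] by (cases "y \<in> carr (quo t)") auto
      qed
      moreover have "mono_push t' (four \<chi>3 (sub t') m3 g) w = 0"
        using adm_kernel[OF A' True] N by (intro mono_push_out[OF A']) blast
      ultimately show ?thesis using distr_zero_fun[OF adm_towers(3)[OF A] meas_distr[OF m3]] by simp
    qed
    finally show ?thesis .
  next
    case False
    have "w - emb t' x \<notin> nul (mid t')" if x: "x \<in> carr (sub t')" for x
    proof
      assume "w - emb t' x \<in> nul (mid t')"
      then have "w - emb t' x \<in> carr (mid t')" using nul_carr[OF adm_towers(2)[OF A']] by blast
      then show False
        using False adm_emb_carr[OF A' x] subgrp_diff_iff[OF tower_carr_subgrp[OF adm_towers(2)[OF A']]] by blast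
    qed
    then show ?thesis using False mono_push_out[OF A', of w] by (simp add: four_def)
  qed
qed

end

section \<open>Multiplicative systems of measures\<close>

definition dirset :: "'i set \<Rightarrow> 'i rel \<Rightarrow> bool" where
  "dirset I R \<longleftrightarrow> I \<noteq> {} \<and> R \<subseteq> I \<times> I \<and> refl_on I R \<and> trans R \<and>
     (\<forall>i\<in>I. \<forall>j\<in>I. \<exists>k l. (k, i) \<in> R \<and> (i, l) \<in> R \<and> (k, j) \<in> R \<and> (j, l) \<in> R)"

lemma dirset_converse: "dirset I R ==> dirset I (R\<inverse>)"
  unfolding dirset_def by auto metis

abbreviation "lfun E l i \<equiv> test_fun (lev E l i)"

text \<open>The form in which both a \<open>C2_space\<close> and its \<open>dual2\<close> are used;
  that it holds for the two is \<open>C2_space_nice2\<close>.\<close>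

definition "nice2 E \<longleftrightarrow> dirset (idx E) (le E) \<and>
     (\<forall>i j k. (i, j) \<in> le E \<longrightarrow> (j, k) \<in> le E \<longrightarrow> adm (lev_triple E i j k))"

lemma lev_triple_sel [simp]:
  "emb (lev_triple E i j k) = id" "epi (lev_triple E i j k) = id"
  "sub (lev_triple E i j k) = lev E i j" "mid (lev_triple E i j k) = lev E i k"
  "quo (lev_triple E i j k) = lev E j k"
  by (simp_all add: lev_triple_def)

lemma level_sel [simp]:
  "emb (level T j i) = emb T" "epi (level T j i) = epi T"
  "sub (level T j i) = lev (sub T) (eps T j) (eps T i)" "mid (level T j i) = lev (mid T) j i"
  "quo (level T j i) = lev (quo T) (gam T j) (gam T i)"
  by (simp_all add: level_def)

context
  fixes E
  assumes E: "nice2 E"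
begin

lemma le_idx: "(i, j) \<in> le E ==> i \<in> idx E" "(i, j) \<in> le E ==> j \<in> idx E"
  using E by (auto simp: nice2_def dirset_def)

lemma le_refl: "i \<in> idx E ==> (i, i) \<in> le E"
  using E by (auto simp: nice2_def dirset_def refl_on_def)

lemma le_trans: "(i, j) \<in> le E ==> (j, k) \<in> le E ==> (i, k) \<in> le E"
  using E unfolding nice2_def dirset_def by (meson transD)

lemma le_lower:
  assumes "i \<in> idx E" "j \<in> idx E"
  obtains k where "(k, i) \<in> le E" "(k, j) \<in> le E"
  using E assms unfolding nice2_def dirset_def by metis

lemma le_upper:
  assumes "i \<in> idx E" "j \<in> idx E"
  obtains k where "(i, k) \<in> le E" "(j, k) \<in> le E"
  using E assms unfolding nice2_def dirset_def by metis

lemma lev_adm: "(i, j) \<in> le E ==> (j, k) \<in> le E ==> adm (lev_triple E i j k)"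
  using E by (simp add: nice2_def)

lemma lev_tower: "(i, j) \<in> le E ==> tower (lev E i j)"
  using adm_towers(1)[OF lev_adm[of i j j]] le_refl le_idx by simp

lemma lev_carr_mono: "(i, j) \<in> le E ==> (j, k) \<in> le E ==> x \<in> carr (lev E i j) ==> x \<in> carr (lev E i k)"
  using adm_emb_carr[OF lev_adm, of i j k x] by simp

lemma lev_carr_quo: "(i, j) \<in> le E ==> (j, k) \<in> le E ==> x \<in> carr (lev E i k) ==> x \<in> carr (lev E j k)"
  using adm_epi_carr[OF lev_adm, of i j k x] by simp

lemma lev_nul_quo: "(i, j) \<in> le E ==> (j, k) \<in> le E ==> x \<in> nul (lev E i k) ==> x \<in> nul (lev E j k)"
  using adm_epi_nul[OF lev_adm, of i j k x] by simp

lemma lev_nul_sub: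
  "(i, j) \<in> le E ==> (j, k) \<in> le E ==> x \<in> carr (lev E i j) ==> x \<in> nul (lev E i k) \<longleftrightarrow> x \<in> nul (lev E i j)"
  using adm_emb_nul[OF lev_adm, of i j k x] by simp

lemma lev_sub_nul: "(i, j) \<in> le E ==> (j, k) \<in> le E ==> x \<in> carr (lev E i j) ==> x \<in> nul (lev E j k)"
  using adm_epi_emb[OF lev_adm, of i j k x] by simp

lemma lev_nul_sub_mono: "(i, j) \<in> le E ==> (j, k) \<in> le E ==> x \<in> nul (lev E i j) ==> x \<in> nul (lev E i k)"
  using lev_nul_sub nul_carr[OF lev_tower] by blast

lemma lev_kernel:
  "(i, j) \<in> le E ==> (j, k) \<in> le E ==> x \<in> carr (lev E i k) ==>
    x \<in> nul (lev E j k) \<longleftrightarrow> (\<exists>y\<in>carr (lev E i j). x - y \<in> nul (lev E i k))"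
  using adm_kernel[OF lev_adm, of i j k x] by simp

lemma lev_lift:
  assumes "(i, j) \<in> le E" "(j, k) \<in> le E" "y \<in> carr (lev E j k)"
  obtains x where "x \<in> carr (lev E i k)" "x - y \<in> nul (lev E j k)"
  using adm_lift[OF lev_adm, of i j k y] assms by auto

text \<open>Both sides are invariant measures on F(k)/F(l), so they are compared on one member
  \<open>?F\<close>. Each multiplies the masses of the traces of \<open>?F\<close> on F(i)/F(l),
  F(j)/F(i) and F(k)/F(j); \<open>s1\<close>, \<open>sq\<close> and \<open>q1\<close> say that both
  routes produce the same traces.\<close>

lemma meas_prod_assoc:
  assumes ij: "(l, i) \<in> le E" "(i, j) \<in> le E" "(j, k) \<in> le E"
    and a: "a \<in> meas (lev E l i)" and b: "b \<in> meas (lev E i j)" and c: "c \<in> meas (lev E j k)"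
  shows "meas_prod (lev_triple E l i k) a (meas_prod (lev_triple E i j k) b c) =
    meas_prod (lev_triple E l j k) (meas_prod (lev_triple E l i j) a b) c"
proof -
  have ik: "(i, k) \<in> le E" and lj: "(l, j) \<in> le E" and lk: "(l, k) \<in> le E"
    using ij le_trans by blast+
  note lik = lev_adm[OF ij(1) ik] and ijk = lev_adm[OF ij(2,3)] and ljk = lev_adm[OF lj ij(3)] and lij = lev_adm[OF ij(1,2)]
  note carr_mono = lev_carr_mono and carr_quo = lev_carr_quo and nul_quo = lev_nul_quo
    and nul_sub = lev_nul_sub and sub_nul = lev_sub_nul and sub_mono = lev_nul_sub_mono
  have bc: "meas_prod (lev_triple E i j k) b c \<in> meas (lev E i k)"
    using meas_prod_meas[OF ijk] b c by simp
  have ab: "meas_prod (lev_triple E l i j) a b \<in> meas (lev E l j)"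
    using meas_prod_meas[OF lij] a b by simp
  obtain x where x: "x \<in> idx (lev E l k)" using tower_nonempty[OF lev_tower[OF lk]] by blast
  let ?F = "fil (lev E l k) x"
  have Fc: "?F \<subseteq> carr (lev E l k)" by (rule fil_carr[OF x])
  have sF: "subgrp ?F" by (rule tower_subgrp[OF lev_tower[OF lk] x])
  obtain y where y: "y \<in> idx (lev E i k)" "fil (lev E i k) y = qfil (lev_triple E l i k) x"
    using adm_qfil[OF lik, of x] x by auto
  obtain z where z: "z \<in> idx (lev E l j)" "fil (lev E l j) z = sfil (lev_triple E l j k) x"
    using adm_sfil[OF ljk, of x] x by auto
  have s1: "sfil (lev_triple E l i j) z = sfil (lev_triple E l i k) x"
    using carr_mono[OF ij(1,2)] by (auto simp: sfil_def z(2))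
  have q1: "qfil (lev_triple E i j k) y = qfil (lev_triple E l j k) x"
  proof -
    have "\<exists>u\<in>?F. w - u \<in> nul (lev E j k)" if w: "u \<in> ?F" "v - u \<in> nul (lev E i k)" "w - v \<in> nul (lev E j k)" for u v w
    proof -
      have "v - u \<in> nul (lev E j k)" using w(2) nul_quo[OF ij(2,3)] by blast
      then have "(w - v) + (v - u) \<in> nul (lev E j k)"
        by (intro subgrp_add[OF tower_nul_subgrp[OF lev_tower[OF ij(3)]]] w)
      then show ?thesis using w(1) by auto
    qed
    moreover have "u \<in> qfil (lev_triple E l i k) x" if u: "u \<in> ?F" for u
      using u Fc carr_quo[OF ij(1) ik] subgrp_zero[OF tower_nul_subgrp[OF lev_tower[OF ik]]]
      by (force simp: qfil_def)
    ultimately show ?thesis unfolding qfil_def[of "lev_triple E i j k"] qfil_def[of "lev_triple E l j k"]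
      by (simp add: y(2)) (fastforce simp: qfil_def)
  qed
  \<comment> \<open>The modular law: since F(i) is contained in F(j), intersecting with F(j) and
    reducing modulo F(i) commute.\<close>
  have sq: "sfil (lev_triple E i j k) y = qfil (lev_triple E l i j) z"
  proof (intro equalityI subsetI)
    fix u assume "u \<in> qfil (lev_triple E l i j) z"
    then obtain v where v: "u \<in> carr (lev E i j)" "v \<in> carr (lev E l j)" "v \<in> ?F" "u - v \<in> nul (lev E i j)"
      by (auto simp: qfil_def z(2) sfil_def)
    then show "u \<in> sfil (lev_triple E i j k) y"
      using carr_mono[OF ij(2,3)] sub_mono[OF ij(2,3)] by (auto simp: sfil_def y(2) qfil_def)
  next
    fix u assume "u \<in> sfil (lev_triple E i j k) y"
    then obtain v where v: "u \<in> carr (lev E i j)" "v \<in> ?F" "u - v \<in> nul (lev E i k)"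
      by (auto simp: qfil_def y(2) sfil_def)
    obtain u' where u': "u' \<in> carr (lev E l j)" "u' - u \<in> nul (lev E i j)" using lev_lift[OF ij(1,2) v(1)] by blast
    have u'k: "u' \<in> carr (lev E l k)" using u'(1) carr_mono[OF lj ij(3)] by blast
    have u'v: "u' - v \<in> carr (lev E l k)"
      using u'k v(2) Fc subgrp_diff[OF tower_carr_subgrp[OF lev_tower[OF lk]]] by blast
    have "u' - u \<in> nul (lev E i k)" using u'(2) sub_mono[OF ij(2,3)] by blast
    then have "u' - v \<in> nul (lev E i k)"
      using subgrp_diff_trans[OF tower_nul_subgrp[OF lev_tower[OF ik]] _ v(3)] by blast
    then obtain x1 where x1: "x1 \<in> carr (lev E l i)" "u' - v - x1 \<in> nul (lev E l k)"
      using lev_kernel[OF ij(1) ik u'v] by blast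
    have x1j: "x1 \<in> carr (lev E l j)" using x1(1) carr_mono[OF ij(1,2)] by blast
    have "u' - v - x1 \<in> ?F" using x1(2) nul_fil[OF x] by blast
    then have "(u' - v - x1) + v \<in> ?F" using subgrp_add[OF sF] v(2) by blast
    then have F: "u' - x1 \<in> ?F" by simp
    have "u' - x1 \<in> carr (lev E l j)"
      using subgrp_diff[OF tower_carr_subgrp[OF lev_tower[OF lj]] u'(1) x1j] .
    moreover have "u - (u' - x1) \<in> nul (lev E i j)"
    proof -
      have "x1 \<in> nul (lev E i j)" using sub_nul[OF ij(1,2) x1(1)] .
      then have "x1 - (u' - u) \<in> nul (lev E i j)"
        using subgrp_diff[OF tower_nul_subgrp[OF lev_tower[OF ij(2)]]] u'(2) by blast
      then show ?thesis by (simp add: algebra_simps)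
    qed
    ultimately show "u \<in> qfil (lev_triple E l i j) z"
      using v(1) F by (auto simp: qfil_def z(2) sfil_def)
  qed
  show ?thesis
  proof (rule meas_eqI[OF lev_tower[OF lk] _ _ x])
    show "meas_prod (lev_triple E l i k) a (meas_prod (lev_triple E i j k) b c) \<in> meas (lev E l k)"
      using meas_prod_meas[OF lik] a bc by simp
    show "meas_prod (lev_triple E l j k) (meas_prod (lev_triple E l i j) a b) c \<in> meas (lev E l k)"
      using meas_prod_meas[OF ljk] ab c by simp
    have "meas_prod (lev_triple E l i k) a (meas_prod (lev_triple E i j k) b c) (indicator ?F) =
        a (indicator (sfil (lev_triple E l i k) x)) * meas_prod (lev_triple E i j k) b c (indicator (fil (lev E i k) y))"
      using meas_prod_indicator[OF lik, of a _ x] a bc x by (simp add: y(2))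
    also have "\<dots> = a (indicator (sfil (lev_triple E l i j) z)) * (b (indicator (qfil (lev_triple E l i j) z)) *
        c (indicator (qfil (lev_triple E l j k) x)))"
      using meas_prod_indicator[OF ijk, of b c y] b c y(1) by (simp add: s1 q1 sq)
    also have "\<dots> = meas_prod (lev_triple E l i j) a b (indicator (fil (lev E l j) z)) *
        c (indicator (qfil (lev_triple E l j k) x))"
      using meas_prod_indicator[OF lij, of a b z] a b z(1) by simp
    also have "\<dots> = meas_prod (lev_triple E l j k) (meas_prod (lev_triple E l i j) a b) c (indicator ?F)"
      using meas_prod_indicator[OF ljk, of _ c x] ab c x by (simp add: z(2))
    finally show "meas_prod (lev_triple E l i k) a (meas_prod (lev_triple E i j k) b c) (indicator ?F) =
      meas_prod (lev_triple E l j k) (meas_prod (lev_triple E l i j) a b) c (indicator ?F)" .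
  qed
qed

end

definition "msys E v \<longleftrightarrow> (\<forall>(l, i)\<in>le E. v l i \<in> meas (lev E l i) \<and> v l i \<noteq> 0) \<and>
     (\<forall>l j i. (l, j) \<in> le E \<longrightarrow> (j, i) \<in> le E \<longrightarrow> meas_prod (lev_triple E l j i) (v l j) (v j i) = v l i)"

lemma msys_meas: "msys E v ==> (l, i) \<in> le E ==> v l i \<in> meas (lev E l i)"
  and msys_nonzero: "msys E v ==> (l, i) \<in> le E ==> v l i \<noteq> 0"
  and msys_mult: "msys E v ==> (l, j) \<in> le E ==> (j, i) \<in> le E ==> meas_prod (lev_triple E l j i) (v l j) (v j i) = v l i"
  unfolding msys_def by blast+

text \<open>A cocycle on a directed poset is a coboundary: refer everything to one index \<open>b\<close>.\<close>

lemma cocycle_trivial: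
  fixes c :: "'i \<Rightarrow> 'i \<Rightarrow> 'i \<Rightarrow> complex"
  assumes D: "dirset I R"
    and nz: "\<And>l i j. (l, i) \<in> R ==> (i, j) \<in> R ==> c l i j \<noteq> 0"
    and coc: "\<And>l i j k. (l, i) \<in> R ==> (i, j) \<in> R ==> (j, k) \<in> R ==> c l i k * c i j k = c l j k * c l i j"
  shows "\<exists>s. (\<forall>(i, j)\<in>R. s i j \<noteq> 0) \<and> (\<forall>i j k. (i, j) \<in> R \<longrightarrow> (j, k) \<in> R \<longrightarrow> s i j * s j k * c i j k = s i k)"
proof -
  have tr: "(i, k) \<in> R" if "(i, j) \<in> R" "(j, k) \<in> R" for i j k
    using D that unfolding dirset_def by (meson transD)
  have ix: "i \<in> I" "j \<in> I" if "(i, j) \<in> R" for i j using D that by (auto simp: dirset_def)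
  have low: "\<exists>k. (k, i) \<in> R \<and> (k, j) \<in> R" if "i \<in> I" "j \<in> I" for i j
    using D that unfolding dirset_def by metis
  obtain b where b: "b \<in> I" using D by (auto simp: dirset_def)
  define L where "L i = (SOME k. (k, i) \<in> R \<and> (k, b) \<in> R)" for i
  have L: "(L i, i) \<in> R" "(L i, b) \<in> R" if "i \<in> I" for i
    using someI_ex[OF low[OF that b]] by (auto simp: L_def)
  \<comment> \<open>\<open>L i\<close> is a common lower bound of \<open>i\<close> and
    \<open>b\<close>. \<open>T i l\<close> compares \<open>i\<close> with \<open>b\<close> as seen
    from a stage \<open>l\<close> below \<open>L i\<close>; \<open>Tl\<close> says how this
    coefficient changes with the stage.\<close>
  define T where "T i l = c l (L i) i / c l (L i) b" for i l
  have Tnz: "T i l \<noteq> 0" if "i \<in> I" "(l, L i) \<in> R" for i l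
    using nz that L[of i] by (simp add: T_def)
  have Tl: "T i l' = T i l * c l' l i / c l' l b" if "i \<in> I" "(l', l) \<in> R" "(l, L i) \<in> R" for i l l'
  proof -
    have 1: "c l' (L i) i * c l' l (L i) = c l' l i * c l (L i) i"
      using coc[of l' l "L i" i] that L[of i] by simp
    have 2: "c l' (L i) b * c l' l (L i) = c l' l b * c l (L i) b"
      using coc[of l' l "L i" b] that L[of i] by simp
    have n: "c l' l (L i) \<noteq> 0" "c l' (L i) b \<noteq> 0" "c l' l b \<noteq> 0" "c l (L i) b \<noteq> 0"
      using nz that L[of i] tr by blast+
    have "c l' (L i) i / c l' (L i) b = (c l' (L i) i * c l' l (L i)) / (c l' (L i) b * c l' l (L i))"
      using n by simp
    also have "\<dots> = (c l' l i * c l (L i) i) / (c l' l b * c l (L i) b)" unfolding 1 2 ..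
    finally show ?thesis unfolding T_def by (simp add: mult.commute)
  qed
  \<comment> \<open>The quotient of the coefficients of \<open>j\<close> and \<open>i\<close>,
    corrected by \<open>c l i j\<close>. By \<open>Tl\<close> and the cocycle identity the stage
    drops out, so any \<open>l\<close> below \<open>L i\<close> and \<open>L j\<close> may be used,
    in particular one common to several pairs.\<close>
  define s where "s i j = (let l = SOME l. (l, L i) \<in> R \<and> (l, L j) \<in> R in T j l / (T i l * c l i j))" for i j
  have s: "s i j = T j l / (T i l * c l i j)" if ij: "(i, j) \<in> R" and l: "(l, L i) \<in> R" "(l, L j) \<in> R" for i j l
  proof -
    note ii = ix[OF ij]
    define l0 where "l0 = (SOME l. (l, L i) \<in> R \<and> (l, L j) \<in> R)"
    have l0: "(l0, L i) \<in> R" "(l0, L j) \<in> R"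
      using someI[of "\<lambda>l. (l, L i) \<in> R \<and> (l, L j) \<in> R" l] l by (auto simp: l0_def)
    obtain m where m: "(m, l0) \<in> R" "(m, l) \<in> R" using low ix(1)[OF l0(1)] ix(1)[OF l(1)] by blast
    have *: "T j l / (T i l * c l i j) = T j m / (T i m * c m i j)"
      if l: "(l, L i) \<in> R" "(l, L j) \<in> R" "(m, l) \<in> R" for l
    proof -
      have li: "(l, i) \<in> R" using tr[OF l(1) L(1)[OF ii(1)]] .
      have lb: "(l, b) \<in> R" using tr[OF l(1) L(2)[OF ii(1)]] .
      have n: "c m l i \<noteq> 0" "c m l j \<noteq> 0" "c m l b \<noteq> 0" "c l i j \<noteq> 0" "c m i j \<noteq> 0" "T i l \<noteq> 0"
        using nz[OF l(3) li] nz[OF l(3) tr[OF li ij]] nz[OF l(3) lb] nz[OF li ij] nz[OF tr[OF l(3) li] ij]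
          Tnz[OF ii(1) l(1)] by auto
      have co: "c m l j * c l i j = c m i j * c m l i" using coc[OF l(3) li ij] .
      have "T j m / (T i m * c m i j) = (T j l * c m l j) / (T i l * (c m i j * c m l i))"
        using n by (simp add: Tl[OF ii(1) l(3,1)] Tl[OF ii(2) l(3,2)])
      also have "\<dots> = T j l / (T i l * c l i j)" unfolding co[symmetric] using n by simp
      finally show ?thesis ..
    qed
    have "s i j = T j l0 / (T i l0 * c l0 i j)" by (simp add: s_def l0_def Let_def)
    also have "\<dots> = T j m / (T i m * c m i j)" by (rule *[OF l0 m(1)])
    also have "\<dots> = T j l / (T i l * c l i j)" by (rule *[OF l m(2), symmetric])
    finally show ?thesis .
  qed
  have exl: "\<exists>l. (l, L i) \<in> R \<and> (l, L j) \<in> R" if "(i, j) \<in> R" for i j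
    using low[of "L i" "L j"] ix[OF that] L(1)[of i] L(1)[of j] ix by blast
  have "s i j \<noteq> 0" if ij: "(i, j) \<in> R" for i j
  proof -
    obtain l where l: "(l, L i) \<in> R" "(l, L j) \<in> R" using exl[OF ij] by blast
    have "(l, i) \<in> R" using tr[OF l(1) L(1)] ix[OF ij] by blast
    then show ?thesis using s[OF ij l] Tnz[OF _ l(1)] Tnz[OF _ l(2)] ix[OF ij] nz[OF _ ij, of l] by simp
  qed
  moreover have "s i j * s j k * c i j k = s i k" if ij: "(i, j) \<in> R" "(j, k) \<in> R" for i j k
  proof -
    note ii = ix[OF ij(1)] ix(2)[OF ij(2)]
    obtain l1 where l1: "(l1, L i) \<in> R" "(l1, L j) \<in> R" using exl[OF ij(1)] by blast
    obtain l where l: "(l, l1) \<in> R" "(l, L k) \<in> R"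
      using low[of l1 "L k"] ix(1)[OF l1(1)] ix(1)[OF L(1)[OF ii(3)]] by blast
    have l': "(l, L i) \<in> R" "(l, L j) \<in> R" using l l1 tr by blast+
    have li: "(l, i) \<in> R" using tr[OF l'(1) L(1)[OF ii(1)]] .
    have n: "c l i j \<noteq> 0" "c l j k \<noteq> 0" "c l i k \<noteq> 0" "c i j k \<noteq> 0" "T i l \<noteq> 0" "T j l \<noteq> 0"
      using nz[OF li ij(1)] nz[OF tr[OF li ij(1)] ij(2)] nz[OF li tr[OF ij]] nz[OF ij] Tnz[OF ii(1) l'(1)]
        Tnz[OF ii(2) l'(2)] by auto
    have co: "c l i k * c i j k = c l j k * c l i j" using coc[OF li ij] .
    have "s i j * s j k * c i j k = T k l * c i j k / (T i l * (c l j k * c l i j))"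
      using n by (simp add: s[OF ij(1) l'] s[OF ij(2) l'(2) l(2)])
    also have "\<dots> = T k l / (T i l * c l i k)" unfolding co[symmetric] using n by simp
    also have "\<dots> = s i k" using s[OF tr[OF ij] l'(1) l(2)] by simp
    finally show ?thesis .
  qed
  ultimately show ?thesis by (intro exI[of _ s]) auto
qed

text \<open>Arbitrary nonzero measures \<open>e\<close> multiply up to scalars \<open>c\<close>. By
  \<open>meas_prod_assoc\<close> these form a cocycle, and the function \<open>s\<close> that
  trivialises it rescales \<open>e\<close> to a multiplicative system.\<close>

lemma msys_exists:
  fixes E
  assumes E: "nice2 E"
  shows "\<exists>v. msys E v"
proof -
  define e where "e l i = (SOME m. m \<in> meas (lev E l i) \<and> m \<noteq> 0)" for l i
  have e: "e l i \<in> meas (lev E l i)" "e l i \<noteq> 0" if li: "(l, i) \<in> le E" for l i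
  proof -
    obtain a where "a \<in> idx (lev E l i)" using tower_nonempty[OF lev_tower[OF E li]] by blast
    then obtain m where "m \<in> meas (lev E l i)" "m (indicator (fil (lev E l i) a)) = 1"
      using meas_exists[OF lev_tower[OF E li]] by blast
    then have "m \<in> meas (lev E l i) \<and> m \<noteq> 0" by auto
    then show "e l i \<in> meas (lev E l i)" "e l i \<noteq> 0"
      unfolding e_def using someI[of "\<lambda>m. m \<in> meas (lev E l i) \<and> m \<noteq> 0"] by blast+
  qed
  define c where "c l i j = (SOME x. meas_prod (lev_triple E l i j) (e l i) (e i j) = (\<lambda>f. x * e l j f))" for l i j
  have pm: "meas_prod (lev_triple E l i j) (e l i) (e i j) \<in> meas (lev E l j)"
    if "(l, i) \<in> le E" "(i, j) \<in> le E" for l i j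
    using meas_prod_meas[OF lev_adm[OF E that], of "e l i" "e i j"] e that by simp
  have c: "meas_prod (lev_triple E l i j) (e l i) (e i j) = (\<lambda>f. c l i j * e l j f)"
    if "(l, i) \<in> le E" "(i, j) \<in> le E" for l i j
    unfolding c_def
    by (rule someI_ex, rule meas_multiple[OF lev_tower[OF E le_trans[OF E that]] e[OF le_trans[OF E that]] pm[OF that]])
  have "\<exists>s. (\<forall>(i, j)\<in>le E. s i j \<noteq> 0) \<and> (\<forall>i j k. (i, j) \<in> le E \<longrightarrow> (j, k) \<in> le E \<longrightarrow> s i j * s j k * c i j k = s i k)"
  proof (rule cocycle_trivial)
    show "dirset (idx E) (le E)" using E by (simp add: nice2_def)
    show "c l i j \<noteq> 0" if "(l, i) \<in> le E" "(i, j) \<in> le E" for l i j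
    proof
      assume "c l i j = 0"
      then have "meas_prod (lev_triple E l i j) (e l i) (e i j) = 0" using c[OF that] by auto
      then show False using meas_prod_nonzero[OF lev_adm[OF E that], of "e l i" "e i j"] e that by simp
    qed
    fix l i j k assume a: "(l, i) \<in> le E" "(i, j) \<in> le E" "(j, k) \<in> le E"
    have ik: "(i, k) \<in> le E" and lj: "(l, j) \<in> le E" and lk: "(l, k) \<in> le E"
      using a le_trans[OF E] by blast+
    have "meas_prod (lev_triple E l i k) (e l i) (\<lambda>f. c i j k * e i k f) = (\<lambda>f. c i j k * (c l i k * e l k f))"
      using meas_prod_scale_right[OF lev_adm[OF E a(1) ik], of "e l i" "e i k"] e a ik c[OF a(1) ik] by simp
    moreover have "meas_prod (lev_triple E l j k) (\<lambda>f. c l i j * e l j f) (e j k) = (\<lambda>f. c l i j * (c l j k * e l k f))"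
      using meas_prod_scale_left[OF lev_adm[OF E lj a(3)], of "e l j" "e j k"] e a lj c[OF lj a(3)] by simp
    moreover have "meas_prod (lev_triple E l i k) (e l i) (\<lambda>f. c i j k * e i k f) =
        meas_prod (lev_triple E l j k) (\<lambda>f. c l i j * e l j f) (e j k)"
      using meas_prod_assoc[OF E a e(1)[OF a(1)] e(1)[OF a(2)] e(1)[OF a(3)]]
      by (simp add: c[OF a(2,3)] c[OF a(1,2)])
    ultimately have eq: "(\<lambda>f. c i j k * (c l i k * e l k f)) = (\<lambda>f. c l i j * (c l j k * e l k f))" by simp
    obtain f where "e l k f \<noteq> 0" using e(2)[OF lk] by (auto simp: fun_eq_iff)
    then show "c l i k * c i j k = c l j k * c l i j" using fun_cong[OF eq, of f] by (simp add: mult.commute)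
  qed
  then obtain s where s: "\<And>i j. (i, j) \<in> le E ==> s i j \<noteq> 0"
    "\<And>i j k. (i, j) \<in> le E ==> (j, k) \<in> le E ==> s i j * s j k * c i j k = s i k"
    by blast
  have "msys E (\<lambda>l i f. s l i * e l i f)"
    unfolding msys_def
  proof (intro conjI allI impI)
    have "(\<lambda>f. s l i * e l i f) \<in> meas (lev E l i) \<and> (\<lambda>f. s l i * e l i f) \<noteq> 0" if li: "(l, i) \<in> le E" for l i
    proof -
      obtain f where "e l i f \<noteq> 0" using e(2)[OF li] by (auto simp: fun_eq_iff)
      then have "(\<lambda>f. s l i * e l i f) \<noteq> 0" using s(1)[OF li] by (auto dest!: fun_cong[of _ _ f])
      then show ?thesis using meas_scale[OF e(1)[OF li]] by blast
    qed
    then show "\<forall>(l, i)\<in>le E. (\<lambda>f. s l i * e l i f) \<in> meas (lev E l i) \<and> (\<lambda>f. s l i * e l i f) \<noteq> 0" by blast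
    fix l j i assume a: "(l, j) \<in> le E" "(j, i) \<in> le E"
    have "meas_prod (lev_triple E l j i) (\<lambda>f. s l j * e l j f) (\<lambda>f. s j i * e j i f) =
        (\<lambda>f. s l j * (s j i * (c l j i * e l i f)))"
      using meas_prod_scale_left[OF lev_adm[OF E a], of "e l j" "\<lambda>f. s j i * e j i f"]
        meas_prod_scale_right[OF lev_adm[OF E a], of "e l j" "e j i"] e a c[OF a] meas_scale[OF e(1)[OF a(2)]] by simp
    also have "\<dots> = (\<lambda>f. s l i * e l i f)" by (simp add: s(2)[OF a, symmetric] mult.assoc)
    finally show "meas_prod (lev_triple E l j i) (\<lambda>f. s l j * e l j f) (\<lambda>f. s j i * e j i f) = (\<lambda>f. s l i * e l i f)" .
  qed
  then show ?thesis by blast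
qed

section \<open>Multiplicative systems normalised on zero, compact and discrete levels\<close>

lemma trivial_fil:
  assumes "tower E" "carr E = nul E" "i \<in> idx E"
  shows "fil E i = nul E"
  using fil_carr[OF assms(3)] nul_fil[OF assms(3)] assms(2) by blast

lemma trivial_lev:
  assumes E: "nice2 E" and le: "(k, j) \<in> le E" "(j, i) \<in> le E" and z: "carr (lev E k i) = nul (lev E k i)"
  shows "carr (lev E j i) = nul (lev E j i)"
proof -
  have "y \<in> nul (lev E j i)" if y: "y \<in> carr (lev E j i)" for y
  proof -
    obtain x where x: "x \<in> carr (lev E k i)" "x - y \<in> nul (lev E j i)" using lev_lift[OF E le y] by blast
    then have "x \<in> nul (lev E j i)" using z lev_nul_quo[OF E le] by blast
    then show ?thesis using subgrp_diff_iff[OF tower_nul_subgrp[OF lev_tower[OF E le(2)]] x(2)] by blast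
  qed
  then show ?thesis using nul_carr[OF lev_tower[OF E le(2)]] by blast
qed

lemma trivial_msys_mult:
  assumes E: "nice2 E" and v: "msys E v" and le: "(k, j) \<in> le E" "(j, i) \<in> le E"
    and z: "carr (lev E k i) = nul (lev E k i)"
  shows "v k i (indicator (nul (lev E k i))) = v k j (indicator (nul (lev E k j))) * v j i (indicator (nul (lev E j i)))"
proof -
  note ki = le_trans[OF E le] and A = lev_adm[OF E le]
  note zji = trivial_lev[OF E le z]
  have zkj: "carr (lev E k j) = nul (lev E k j)"
    using z lev_carr_mono[OF E le] lev_nul_sub[OF E le] nul_carr[OF lev_tower[OF E le(1)]] by blast
  obtain x where x: "x \<in> idx (lev E k i)" using tower_nonempty[OF lev_tower[OF E ki]] by blast
  have "sfil (lev_triple E k j i) x = nul (lev E k j)"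
    using adm_sfil[OF A, of x] x trivial_fil[OF lev_tower[OF E le(1)] zkj] by auto
  moreover have "qfil (lev_triple E k j i) x = nul (lev E j i)"
    using adm_qfil[OF A, of x] x trivial_fil[OF lev_tower[OF E le(2)] zji] by auto
  moreover have "fil (lev E k i) x = nul (lev E k i)" by (rule trivial_fil[OF lev_tower[OF E ki] z x])
  ultimately show ?thesis
    using meas_prod_indicator[OF A, of "v k j" "v j i" x] x msys_meas[OF v] le msys_mult[OF v le] by simp
qed

lemma trivial_msys_nonzero:
  assumes E: "nice2 E" and v: "msys E v" and le: "(k, i) \<in> le E" and z: "carr (lev E k i) = nul (lev E k i)"
  shows "v k i (indicator (nul (lev E k i))) \<noteq> 0"
proof -
  obtain x where x: "x \<in> idx (lev E k i)" using tower_nonempty[OF lev_tower[OF E le]] by blast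
  then show ?thesis
    using meas_indicator_nonzero[OF lev_tower[OF E le] msys_meas[OF v le] msys_nonzero[OF v le] x]
      trivial_fil[OF lev_tower[OF E le] z x] by simp
qed

text \<open>A coboundary in \<open>a\<close> cancels in products over consecutive levels. This is
  the freedom used to normalise a given system.\<close>

lemma msys_rescale:
  assumes E: "nice2 E" and v: "msys E v" and a: "\<And>i. i \<in> idx E ==> a i \<noteq> 0"
  shows "msys E (\<lambda>l i f. a i / a l * v l i f)"
  unfolding msys_def
proof (intro conjI allI impI)
  have "(\<lambda>f. a i / a l * v l i f) \<in> meas (lev E l i) \<and> (\<lambda>f. a i / a l * v l i f) \<noteq> 0" if li: "(l, i) \<in> le E" for l i
  proof -
    obtain f where "v l i f \<noteq> 0" using msys_nonzero[OF v li] by (auto simp: fun_eq_iff)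
    then have "(\<lambda>f. a i / a l * v l i f) \<noteq> 0" using a le_idx[OF E li] by (auto dest!: fun_cong[of _ _ f])
    then show ?thesis using meas_scale[OF msys_meas[OF v li]] by blast
  qed
  then show "\<forall>(l, i)\<in>le E. (\<lambda>f. a i / a l * v l i f) \<in> meas (lev E l i) \<and> (\<lambda>f. a i / a l * v l i f) \<noteq> 0" by blast
  fix l j i assume le: "(l, j) \<in> le E" "(j, i) \<in> le E"
  note A = lev_adm[OF E le]
  have *: "meas_prod (lev_triple E l j i) (\<lambda>f. c * v l j f) (\<lambda>f. d * v j i f) = (\<lambda>f. c * (d * v l i f))" for c d
    using meas_prod_scale_left[OF A, of "v l j" "\<lambda>f. d * v j i f" c]
      meas_prod_scale_right[OF A, of "v l j" "v j i" d] msys_meas[OF v] le msys_mult[OF v le]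
      meas_scale[OF msys_meas[OF v le(2)]] by simp
  show "meas_prod (lev_triple E l j i) (\<lambda>f. a j / a l * v l j f) (\<lambda>f. a i / a j * v j i f) =
      (\<lambda>f. a i / a l * v l i f)"
    unfolding * using a[OF le_idx(2)[OF E le(1)]] by simp
qed

text \<open>For the case F(k) = V, where all levels above \<open>k\<close> are zero spaces:
  \<open>epi_push_level\<close> passes between such indices with the measure of mass
  \<open>1\<close> on the zero space, so a system has to be rescaled to have this value
  there.\<close>

lemma msys_normalised_lower:
  assumes E: "nice2 E" and z: "\<And>i. (k, i) \<in> le E ==> carr (lev E k i) = nul (lev E k i)"
  shows "\<exists>v. msys E v \<and> (\<forall>i j. (k, j) \<in> le E \<longrightarrow> (j, i) \<in> le E \<longrightarrow> v j i (indicator (nul (lev E j i))) = 1)"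
proof -
  obtain v where v: "msys E v" using msys_exists[OF E] ..
  define a where "a i = (if (k, i) \<in> le E then inverse (v k i (indicator (nul (lev E k i)))) else 1)" for i
  have a: "a i \<noteq> 0" for i using trivial_msys_nonzero[OF E v _ z] by (simp add: a_def)
  have "a i / a j * v j i (indicator (nul (lev E j i))) = 1" if le: "(k, j) \<in> le E" "(j, i) \<in> le E" for i j
    using trivial_msys_mult[OF E v le z[OF le_trans[OF E le]]] le le_trans[OF E le]

      trivial_msys_nonzero[OF E v le_trans[OF E le] z[OF le_trans[OF E le]]]
    by (simp add: a_def)
  then show ?thesis using msys_rescale[OF E v a] by (intro exI[of _ "\<lambda>l i f. a i / a l * v l i f"]) simp
qed

text \<open>The counterpart for F(k) = 0, where the levels below \<open>k\<close> are zero spaces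
  and \<open>mono_pull_level\<close> reads off a scalar against the measure of mass
  \<open>1\<close>.\<close>

lemma msys_normalised_upper:
  assumes E: "nice2 E" and z: "\<And>i. (i, k) \<in> le E ==> carr (lev E i k) = nul (lev E i k)"
  shows "\<exists>v. msys E v \<and> (\<forall>i j. (i, j) \<in> le E \<longrightarrow> (j, k) \<in> le E \<longrightarrow> v i j (indicator (nul (lev E i j))) = 1)"
proof -
  obtain v where v: "msys E v" using msys_exists[OF E] ..
  define a where "a i = (if (i, k) \<in> le E then v i k (indicator (nul (lev E i k))) else 1)" for i
  have a: "a i \<noteq> 0" for i using trivial_msys_nonzero[OF E v _ z] by (simp add: a_def)
  have "a j / a i * v i j (indicator (nul (lev E i j))) = 1" if le: "(i, j) \<in> le E" "(j, k) \<in> le E" for i j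
    using trivial_msys_mult[OF E v le z[OF le_trans[OF E le]]] le le_trans[OF E le]
      trivial_msys_nonzero[OF E v le_trans[OF E le] z[OF le_trans[OF E le]]]
    by (simp add: a_def)
  then show ?thesis using msys_rescale[OF E v a] by (intro exI[of _ "\<lambda>l i f. a i / a l * v l i f"]) simp
qed

text \<open>The whole space is a member on every level, and its traces on sub and quotient are whole
  spaces again. Total mass \<open>1\<close> is therefore multiplicative as it stands, with no
  cocycle to remove. This is the system behind \<open>vm_triv carr\<close>.\<close>

lemma msys_compact:
  assumes E: "nice2 E" and c: "\<And>l i. (l, i) \<in> le E ==> compact_filt (lev E l i)"
  shows "\<exists>v. msys E v \<and> (\<forall>(l, i)\<in>le E. v l i (indicator (carr (lev E l i))) = 1)"
proof -
  define v where "v l i = (SOME m. m \<in> meas (lev E l i) \<and> m (indicator (carr (lev E l i))) = 1)" for l i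
  have v: "v l i \<in> meas (lev E l i) \<and> v l i (indicator (carr (lev E l i))) = 1" if li: "(l, i) \<in> le E" for l i
  proof -
    obtain a where "a \<in> idx (lev E l i)" "fil (lev E l i) a = carr (lev E l i)"
      using c[OF li] by (auto simp: compact_filt_def)
    then have "\<exists>m. m \<in> meas (lev E l i) \<and> m (indicator (carr (lev E l i))) = 1"
      using meas_exists[OF lev_tower[OF E li]] by metis
    then show ?thesis unfolding v_def by (rule someI_ex)
  qed
  have "msys E v"
    unfolding msys_def
  proof (intro conjI allI impI)
    show "\<forall>(l, i)\<in>le E. v l i \<in> meas (lev E l i) \<and> v l i \<noteq> 0" using v by fastforce
    fix l j i assume le: "(l, j) \<in> le E" "(j, i) \<in> le E"
    note li = le_trans[OF E le] and A = lev_adm[OF E le]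
    obtain a where a: "a \<in> idx (lev E l i)" "fil (lev E l i) a = carr (lev E l i)"
      using c[OF li] by (auto simp: compact_filt_def)
    have "sfil (lev_triple E l j i) a = carr (lev E l j)"
      using lev_carr_mono[OF E le] by (auto simp: sfil_def a(2))
    moreover have "qfil (lev_triple E l j i) a = carr (lev E j i)"
    proof (intro equalityI subsetI)
      fix y assume y: "y \<in> carr (lev E j i)"
      obtain x where x: "x \<in> carr (lev E l i)" "x - y \<in> nul (lev E j i)" using lev_lift[OF E le y] by blast
      have "y - x \<in> nul (lev E j i)"
        by (rule subgrp_diff_sym[OF tower_nul_subgrp[OF lev_tower[OF E le(2)]] x(2)])
      then show "y \<in> qfil (lev_triple E l j i) a" using x(1) y by (auto simp: qfil_def a(2))
    qed (simp add: qfil_def)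
    ultimately have "meas_prod (lev_triple E l j i) (v l j) (v j i) (indicator (fil (lev E l i) a)) = 1"
      using meas_prod_indicator[OF A, of "v l j" "v j i" a] a(1) v le by simp
    then show "meas_prod (lev_triple E l j i) (v l j) (v j i) = v l i"
      using meas_prod_meas[OF A, of "v l j" "v j i"] v le li a
      by (intro meas_eqI[OF lev_tower[OF E li] _ _ a(1)]) auto
  qed
  then show ?thesis using v by blast
qed

text \<open>As for compact levels, with the null space as the distinguished member; the system
  behind \<open>vm_triv nul\<close>.\<close>

lemma msys_discrete:
  assumes E: "nice2 E" and c: "\<And>l i. (l, i) \<in> le E ==> discrete_filt (lev E l i)"
  shows "\<exists>v. msys E v \<and> (\<forall>(l, i)\<in>le E. v l i (indicator (nul (lev E l i))) = 1)"
proof -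
  define v where "v l i = (SOME m. m \<in> meas (lev E l i) \<and> m (indicator (nul (lev E l i))) = 1)" for l i
  have v: "v l i \<in> meas (lev E l i) \<and> v l i (indicator (nul (lev E l i))) = 1" if li: "(l, i) \<in> le E" for l i
  proof -
    obtain a where "a \<in> idx (lev E l i)" "fil (lev E l i) a = nul (lev E l i)"
      using c[OF li] by (auto simp: discrete_filt_def)
    then have "\<exists>m. m \<in> meas (lev E l i) \<and> m (indicator (nul (lev E l i))) = 1"
      using meas_exists[OF lev_tower[OF E li]] by metis
    then show ?thesis unfolding v_def by (rule someI_ex)
  qed
  have "msys E v"
    unfolding msys_def
  proof (intro conjI allI impI)
    show "\<forall>(l, i)\<in>le E. v l i \<in> meas (lev E l i) \<and> v l i \<noteq> 0" using v by fastforce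
    fix l j i assume le: "(l, j) \<in> le E" "(j, i) \<in> le E"
    note li = le_trans[OF E le] and A = lev_adm[OF E le]
    have N: "subgrp (nul (lev E j i))" by (rule tower_nul_subgrp[OF lev_tower[OF E le(2)]])
    obtain a where a: "a \<in> idx (lev E l i)" "fil (lev E l i) a = nul (lev E l i)"
      using c[OF li] by (auto simp: discrete_filt_def)
    have "sfil (lev_triple E l j i) a = nul (lev E l j)"
      using lev_nul_sub[OF E le] nul_carr[OF lev_tower[OF E le(1)]] by (auto simp: sfil_def a(2))
    moreover have "qfil (lev_triple E l j i) a = nul (lev E j i)"
    proof (intro equalityI subsetI)
      fix y assume "y \<in> qfil (lev_triple E l j i) a"
      then obtain x where x: "x \<in> nul (lev E l i)" "y - x \<in> nul (lev E j i)" by (auto simp: qfil_def a(2))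
      then have "x \<in> nul (lev E j i)" using lev_nul_quo[OF E le] by blast
      then show "y \<in> nul (lev E j i)" using subgrp_diff_iff[OF N x(2)] by blast
    next
      fix y assume "y \<in> nul (lev E j i)"
      then show "y \<in> qfil (lev_triple E l j i) a"
        using nul_carr[OF lev_tower[OF E le(2)]] subgrp_zero[OF tower_nul_subgrp[OF lev_tower[OF E li]]]
        by (force simp: qfil_def a(2))
    qed
    ultimately have "meas_prod (lev_triple E l j i) (v l j) (v j i) (indicator (fil (lev E l i) a)) = 1"
      using meas_prod_indicator[OF A, of "v l j" "v j i" a] a(1) v le by simp
    then show "meas_prod (lev_triple E l j i) (v l j) (v j i) = v l i"
      using meas_prod_meas[OF A, of "v l j" "v j i"] v le li a
      by (intro meas_eqI[OF lev_tower[OF E li] _ _ a(1)]) auto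
  qed
  then show ?thesis using v by blast
qed

section \<open>Admissible triples at all levels\<close>

abbreviation "le2 T \<equiv> le (mid T)"
abbreviation "idx2 T \<equiv> idx (mid T)"
abbreviation "lev1 T j i \<equiv> lev (sub T) (eps T j) (eps T i)"
abbreviation "lev2 T j i \<equiv> lev (mid T) j i"
abbreviation "lev3 T j i \<equiv> lev (quo T) (gam T j) (gam T i)"

definition "nice3 T \<longleftrightarrow> nice2 (sub T) \<and> nice2 (mid T) \<and> nice2 (quo T) \<and>
     (\<forall>(i, j)\<in>le2 T. (eps T i, eps T j) \<in> le (sub T) \<and> (gam T i, gam T j) \<in> le (quo T)) \<and>
     (\<forall>a\<in>idx (sub T). \<exists>i\<in>idx2 T. \<exists>j\<in>idx2 T. (eps T i, a) \<in> le (sub T) \<and> (a, eps T j) \<in> le (sub T)) \<and>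
     (\<forall>a\<in>idx (quo T). \<exists>i\<in>idx2 T. \<exists>j\<in>idx2 T. (gam T i, a) \<in> le (quo T) \<and> (a, gam T j) \<in> le (quo T)) \<and>
     (\<forall>(j, i)\<in>le2 T. adm (level T j i))"

context
  fixes T
  assumes T: "nice3 T"
begin

lemma nice3_nice2: "nice2 (sub T)" "nice2 (mid T)" "nice2 (quo T)"
  using T by (simp_all add: nice3_def)

lemma nice3_eps: "(i, j) \<in> le2 T ==> (eps T i, eps T j) \<in> le (sub T)"
  and nice3_gam: "(i, j) \<in> le2 T ==> (gam T i, gam T j) \<in> le (quo T)"
  and nice3_adm: "(i, j) \<in> le2 T ==> adm (level T i j)"
  using T unfolding nice3_def by blast+

lemma nice3_eps_cofinal:
  "a \<in> idx (sub T) ==> \<exists>i\<in>idx2 T. \<exists>j\<in>idx2 T. (eps T i, a) \<in> le (sub T) \<and> (a, eps T j) \<in> le (sub T)"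
  and nice3_gam_cofinal:
  "c \<in> idx (quo T) ==> \<exists>i\<in>idx2 T. \<exists>j\<in>idx2 T. (gam T i, c) \<in> le (quo T) \<and> (c, gam T j) \<in> le (quo T)"
  using T unfolding nice3_def by blast+

text \<open>
  Both sides integrate over the kernel of \<open>F\<^sub>2(j)/F\<^sub>2(l) \<rightarrow> F\<^sub>3(j)/F\<^sub>3(i)\<close>, but the integrations over
  \<open>F\<^sub>1(j)/F\<^sub>1(i)\<close> and \<open>F\<^sub>3(i)/F\<^sub>3(l)\<close> come in opposite order. They commute because the first one is, uniformly
  in the other variable, a finite sum over a fixed set of representatives.
\<close>

lemma msys_triple_swap:
  assumes v1: "msys (sub T) v1" and v3: "msys (quo T) v3"
    and li: "(l, i) \<in> le2 T" and ij: "(i, j) \<in> le2 T"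
    and f: "f \<in> test_fun (lev2 T l j)"
  defines "v2 \<equiv> \<lambda>j i. meas_prod (level T j i) (v1 (eps T j) (eps T i)) (v3 (gam T j) (gam T i))"
  shows "epi_push (level T i j) (epi_push (lev_triple (mid T) l i j) f (v2 l i)) (v1 (eps T i) (eps T j)) =
    epi_push (lev_triple (quo T) (gam T l) (gam T i) (gam T j))
      (epi_push (level T l j) f (v1 (eps T l) (eps T j))) (v3 (gam T l) (gam T i))"
    (is "?A = ?B")
proof
  fix x3
  note N = nice3_nice2
  note lj = le_trans[OF N(2) li ij]
  let ?E1 = "\<lambda>i j. lev1 T i j" and ?E2 = "lev (mid T)"
    and ?E3 = "\<lambda>i j. lev3 T i j"
  let ?L1 = "lev_triple (sub T) (eps T l) (eps T i) (eps T j)" and ?L2 = "lev_triple (mid T) l i j"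
    and ?L3 = "lev_triple (quo T) (gam T l) (gam T i) (gam T j)"
  note L1 = lev_adm[OF N(1) nice3_eps[OF li] nice3_eps[OF ij]] and L2 = lev_adm[OF N(2) li ij]
    and L3 = lev_adm[OF N(3) nice3_gam[OF li] nice3_gam[OF ij]]
  note tli = nice3_adm[OF li] and tij = nice3_adm[OF ij] and tlj = nice3_adm[OF lj]
  let ?v1li = "v1 (eps T l) (eps T i)" and ?v1ij = "v1 (eps T i) (eps T j)" and ?v1lj = "v1 (eps T l) (eps T j)"
    and ?v3li = "v3 (gam T l) (gam T i)"
  have m1li: "?v1li \<in> meas (?E1 l i)" and m1ij: "?v1ij \<in> meas (?E1 i j)" and m1lj: "?v1lj \<in> meas (?E1 l j)"
    using msys_meas[OF v1] nice3_eps li ij lj by blast+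
  have m3li: "?v3li \<in> meas (?E3 l i)" using msys_meas[OF v3] nice3_gam li by blast
  have m2li: "v2 l i \<in> meas (?E2 l i)"
    using meas_prod_meas[OF tli, of ?v1li ?v3li] m1li m3li by (simp add: v2_def)
  let ?P = "epi_push ?L2 f (v2 l i)"
  have P: "?P \<in> test_fun (?E2 i j)" using epi_push_test_fun[OF L2, of f "v2 l i"] f m2li by simp
  let ?b = "epi_push (level T l j) f ?v1lj"
  have b: "?b \<in> test_fun (?E3 l j)" using epi_push_test_fun[OF tlj, of f ?v1lj] f m1lj by simp
  note t1ij = lev_tower[OF N(1) nice3_eps[OF ij]] and t2ij = lev_tower[OF N(2) ij]
    and t2lj = lev_tower[OF N(2) lj] and t1lj = lev_tower[OF N(1) nice3_eps[OF lj]]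
    and t3ij = lev_tower[OF N(3) nice3_gam[OF ij]] and t3li = lev_tower[OF N(3) nice3_gam[OF li]]
    and t3lj = lev_tower[OF N(3) nice3_gam[OF lj]] and t2li = lev_tower[OF N(2) li]
  have N2ij: "subgrp (nul (?E2 i j))" by (rule tower_nul_subgrp[OF t2ij])
  have N3ij: "subgrp (nul (?E3 i j))" by (rule tower_nul_subgrp[OF t3ij])
  show "?A x3 = ?B x3"
  proof (cases "x3 \<in> carr (?E3 i j)")
    case False
    then show ?thesis using epi_push_out[OF tij] epi_push_out[OF L3] by simp
  next
    case x3: True
    obtain x' where x': "x' \<in> carr (?E2 i j)" "epi T x' - x3 \<in> nul (?E3 i j)"
      using adm_lift[OF tij, of x3] x3 by auto
    obtain x where x: "x \<in> carr (?E2 l j)" "x - x' \<in> nul (?E2 i j)" using lev_lift[OF N(2) li ij x'(1)] by blast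
    have xij: "x \<in> carr (?E2 i j)" using lev_carr_quo[OF N(2) li ij x(1)] .
    have "epi T (x - x') \<in> nul (?E3 i j)" using adm_epi_nul[OF tij, of "x - x'"] x(2) by simp
    then have "epi T x - epi T x' \<in> nul (?E3 i j)" using adm_epi_diff[OF tij] by simp
    then have bx: "epi T x - x3 \<in> nul (?E3 i j)" using subgrp_diff_trans[OF N3ij _ x'(2)] by blast
    have bxc: "epi T x \<in> carr (?E3 l j)" using adm_epi_carr[OF tlj, of x] x(1) by simp
    define \<phi> where "\<phi> = fibre (level T i j) ?P x"
    define g where "g y = epi_push ?L1 (fibre (level T l j) f (x + y)) ?v1li" for y
    have \<phi>: "\<phi> \<in> test_fun (?E1 i j)" using fibre_test_fun[OF tij, of ?P x] P xij by (simp add: \<phi>_def)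
    have fib: "fibre (level T l j) f (x + y) \<in> test_fun (?E1 l j)" if y: "y \<in> carr (?E2 l i)" for y
      using fibre_test_fun[OF tlj, of f "x + y"] f
        subgrp_add[OF tower_carr_subgrp[OF t2lj] x(1) lev_carr_mono[OF N(2) li ij y]] by simp
    obtain q0 where q0: "q0 \<in> idx (?E2 l j)" "x \<in> fil (?E2 l j) q0" using x(1) by (auto simp: carr_def)
    obtain p q where pq: "(q0, q) \<in> le (?E2 l j)" "(p, q) \<in> le (?E2 l j)"
      "supp_in f (fil (?E2 l j) q)" "inv_by f (fil (?E2 l j) p)"
      using test_fun_bounds[OF t2lj f q0(1) q0(1)] by metis
    have p: "p \<in> idx (?E2 l j)" and q: "q \<in> idx (?E2 l j)" using tower_idx[OF t2lj pq(2)] by auto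
    have xq: "x \<in> fil (?E2 l j) q" using q0 tower_mono[OF t2lj pq(1)] by blast
    obtain p1 where p1: "p1 \<in> idx (?E1 l j)" "fil (?E1 l j) p1 = sfil (level T l j) p"
      using adm_sfil[OF tlj, of p] p by auto
    obtain a1 where a1: "a1 \<in> idx (?E1 i j)" "fil (?E1 i j) a1 = qfil ?L1 p1"
      using adm_qfil[OF L1, of p1] p1 by auto
    obtain q' where q': "q' \<in> idx (?E2 i j)" "fil (?E2 i j) q' = qfil ?L2 q"
      using adm_qfil[OF L2, of q] q by auto
    obtain b1 where b1: "b1 \<in> idx (?E1 i j)" "fil (?E1 i j) b1 = sfil (level T i j) q'"
      using adm_sfil[OF tij, of q'] q' by auto
    \<comment> \<open>The bounds \<open>a1\<close> for the invariance and \<open>b1\<close> for the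
      support of \<open>g y\<close> do not depend on \<open>y\<close>. Hence a single set
      \<open>R\<close> of representatives computes the integrals of all \<open>g y\<close>, and that
      of \<open>\<phi>\<close> as well.\<close>
    have ginv: "inv_by (g y) (fil (?E1 i j) a1)" if y: "y \<in> carr (?E2 l i)" for y
    proof -
      have "inv_by (fibre (level T l j) f (x + y)) (fil (?E1 l j) p1)"
        using fibre_inv[OF tlj, of f p "x + y"] pq(4) p1(2) by simp
      then show ?thesis
        unfolding g_def a1(2) using epi_push_inv[OF L1, of "fibre (level T l j) f (x + y)" ?v1li p1] fib[OF y] m1li p1(1)
        by simp
    qed
    have geq: "g y r = ?v1li (fibre ?L1 (fibre (level T l j) f (x + y)) r')"
      if y: "y \<in> carr (?E2 l i)" and r: "r \<in> carr (?E1 i j)" and r': "r' \<in> carr (?E1 l j)" "r' - r \<in> nul (?E1 i j)"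
      for y r r'
      unfolding g_def using epi_push_eq[OF L1, of "fibre (level T l j) f (x + y)" ?v1li r r'] fib[OF y] m1li r r'
      by simp
    have gsupp: "supp_in (g y) (fil (?E1 i j) b1)" if y: "y \<in> carr (?E2 l i)" for y
      unfolding supp_in_def
    proof (intro allI impI)
      fix r assume nz: "g y r \<noteq> 0"
      then have r: "r \<in> carr (?E1 i j)" using epi_push_out[OF L1] by (auto simp: g_def)
      obtain r' where r': "r' \<in> carr (?E1 l j)" "r' - r \<in> nul (?E1 i j)"
        using lev_lift[OF N(1) nice3_eps[OF li] nice3_eps[OF ij] r] by blast
      have "fibre ?L1 (fibre (level T l j) f (x + y)) r' \<noteq> (\<lambda>_. 0)"
        using nz geq[OF y r r'] distr_zero_fun[OF lev_tower[OF N(1) nice3_eps[OF li]] meas_distr[OF m1li]] by auto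
      then obtain u where u: "fibre ?L1 (fibre (level T l j) f (x + y)) r' u \<noteq> 0" by auto
      then have uc: "u \<in> carr (?E1 l i)" and ru: "r' + u \<in> carr (?E1 l j)" and
        "f (x + y + emb T (r' + u)) \<noteq> 0" by (auto simp: fibre_def split: if_splits)
      then have s: "x + y + emb T (r' + u) \<in> fil (?E2 l j) q" using pq(3) by (auto simp: supp_in_def)
      have rc: "emb T r \<in> carr (?E2 i j)" using adm_emb_carr[OF tij, of r] r by simp
      have "y \<in> nul (?E2 i j)" using lev_sub_nul[OF N(2) li ij y] .
      moreover have "emb T u \<in> nul (?E2 i j)"
      proof -
        have "u \<in> nul (?E1 i j)" by (rule lev_sub_nul[OF N(1) nice3_eps[OF li] nice3_eps[OF ij] uc])
        then show ?thesis using adm_emb_nul[OF tij, of u] nul_carr[OF t1ij] by auto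
      qed
      moreover have "emb T (r' - r) \<in> nul (?E2 i j)"
        using adm_emb_nul[OF tij, of "r' - r"] r'(2) nul_carr[OF t1ij] by auto
      ultimately have n: "y + emb T u + emb T (r' - r) \<in> nul (?E2 i j)" using subgrp_add[OF N2ij] by blast
      have "emb T r' = emb T (r' - r) + emb T r" using adm_emb_add[OF tij, of "r' - r" r] by simp
      then have "(x + y + emb T (r' + u)) - x = (y + emb T u + emb T (r' - r)) + emb T r"
        using adm_emb_add[OF tij, of r' u] by simp
      then have e: "emb T r - ((x + y + emb T (r' + u)) - x) = - (y + emb T u + emb T (r' - r))" by simp
      have "(x + y + emb T (r' + u)) - x \<in> fil (?E2 l j) q"
        using subgrp_diff[OF tower_subgrp[OF t2lj q] s xq] .
      moreover have "emb T r - ((x + y + emb T (r' + u)) - x) \<in> nul (?E2 i j)"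
        unfolding e by (rule subgrp_uminus[OF N2ij n])
      ultimately have "emb T r \<in> qfil ?L2 q" using rc by (auto simp: qfil_def)
      then show "r \<in> fil (?E1 i j) b1" using r b1(2) q'(2) by (simp add: sfil_def)
    qed
    obtain a c where ab: "(a, a1) \<in> le (?E1 i j)" "(b1, c) \<in> le (?E1 i j)" "(a, c) \<in> le (?E1 i j)"
      "supp_in \<phi> (fil (?E1 i j) c)" "inv_by \<phi> (fil (?E1 i j) a)"
      using test_fun_bounds[OF t1ij \<phi> a1(1) b1(1)] by metis
    obtain R where R: "transversal R (fil (?E1 i j) a) (fil (?E1 i j) c)" using tower_transversal[OF t1ij ab(3)] by blast
    let ?C = "?v1ij (indicator (fil (?E1 i j) a))"
    have rc: "r \<in> carr (?E1 i j)" if "r \<in> R" for r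
      using that R fil_carr[of c "?E1 i j"] tower_idx[OF t1ij ab(3)] by (auto simp: transversal_def)
    have sum\<phi>: "?v1ij \<phi> = ?C * sum \<phi> R" by (rule meas_sum[OF t1ij m1ij ab(3-5) R])
    have sumg: "?v1ij (g y) = ?C * sum (g y) R" if y: "y \<in> carr (?E2 l i)" for y
      by (rule meas_sum[OF t1ij m1ij ab(3) supp_in_mono[OF gsupp[OF y] tower_mono[OF t1ij ab(2)]]
            inv_by_mono[OF ginv[OF y] tower_mono[OF t1ij ab(1)]] R])
    define lf where "lf r = (SOME r'. r' \<in> carr (?E1 l j) \<and> r' - r \<in> nul (?E1 i j))" for r
    have lf: "lf r \<in> carr (?E1 l j)" "lf r - r \<in> nul (?E1 i j)" if r: "r \<in> R" for r
    proof -
      have "\<exists>r'. r' \<in> carr (?E1 l j) \<and> r' - r \<in> nul (?E1 i j)"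
        using lev_lift[OF N(1) nice3_eps[OF li] nice3_eps[OF ij] rc[OF r]] by blast
      from someI_ex[OF this] show "lf r \<in> carr (?E1 l j)" "lf r - r \<in> nul (?E1 i j)" by (auto simp: lf_def)
    qed
    define z where "z r = x + emb T (lf r)" for r
    have zc: "z r \<in> carr (?E2 l j)" if "r \<in> R" for r
      using adm_emb_carr[OF tlj, of "lf r"] lf[OF that] subgrp_add[OF tower_carr_subgrp[OF t2lj] x(1)]
      by (simp add: z_def)
    \<comment> \<open>The inner integral over F1(i)/F1(l) for a fixed representative
      \<open>r\<close>, as a function on F3(i)/F3(l). One side integrates each \<open>H r\<close>
      and then sums over \<open>r\<close>, the other sums first; linearity of \<open>?v3li\<close>
      exchanges the two.\<close>
    define H where "H r = epi_push (level T l i) (fibre ?L2 f (z r)) ?v1li" for r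
    have fz: "fibre ?L2 f (z r) \<in> test_fun (?E2 l i)" if "r \<in> R" for r
      using fibre_test_fun[OF L2, of f "z r"] f zc[OF that] by simp
    have H: "H r \<in> test_fun (?E3 l i)" if "r \<in> R" for r
      unfolding H_def using epi_push_test_fun[OF tli, of "fibre ?L2 f (z r)" ?v1li] fz[OF that] m1li by simp
    have \<phi>H: "\<phi> r = ?v3li (H r)" if r: "r \<in> R" for r
    proof -
      have w: "x + emb T r \<in> carr (?E2 i j)"
        using adm_emb_carr[OF tij, of r] rc[OF r] subgrp_add[OF tower_carr_subgrp[OF t2ij] xij] by simp
      have "emb T (lf r - r) \<in> nul (?E2 i j)"
        using adm_emb_nul[OF tij, of "lf r - r"] lf[OF r] nul_carr[OF t1ij] by auto
      moreover have "emb T (lf r) = emb T (lf r - r) + emb T r" using adm_emb_add[OF tij, of "lf r - r" r] by simp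
      ultimately have "z r - (x + emb T r) \<in> nul (?E2 i j)" by (simp add: z_def)
      then have "?P (x + emb T r) = v2 l i (fibre ?L2 f (z r))"
        using epi_push_eq[OF L2, of f "v2 l i" "x + emb T r" "z r"] f m2li w zc[OF r] by simp
      also have "\<dots> = ?v3li (H r)"
        using meas_prod_apply[OF tli, of ?v1li ?v3li "fibre ?L2 f (z r)"] m1li m3li fz[OF r]
        by (simp add: v2_def H_def)
      finally show ?thesis using rc[OF r] by (simp add: \<phi>_def fibre_def)
    qed
    have main: "fibre ?L3 ?b (epi T x) = (\<lambda>y3. \<Sum>r\<in>R. ?C * H r y3)"
    proof
      fix y3
      show "fibre ?L3 ?b (epi T x) y3 = (\<Sum>r\<in>R. ?C * H r y3)"
      proof (cases "y3 \<in> carr (?E3 l i)")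
        case False
        then show ?thesis using epi_push_out[OF tli] by (simp add: fibre_def H_def)
      next
        case y3: True
        obtain y where y: "y \<in> carr (?E2 l i)" "epi T y - y3 \<in> nul (?E3 l i)"
          using adm_lift[OF tli, of y3] y3 by auto
        have yj: "y \<in> carr (?E2 l j)" using lev_carr_mono[OF N(2) li ij y(1)] .
        have y3j: "y3 \<in> carr (?E3 l j)" using lev_carr_mono[OF N(3) nice3_gam[OF li] nice3_gam[OF ij] y3] .
        have "epi T y - y3 \<in> nul (?E3 l j)"
          using lev_nul_sub_mono[OF N(3) nice3_gam[OF li] nice3_gam[OF ij] y(2)] .
        then have "epi T (x + y) - (epi T x + y3) \<in> nul (?E3 l j)"
          using adm_epi_add[OF tlj, of x y] by simp
        then have "?b (epi T x + y3) = ?v1lj (fibre (level T l j) f (x + y))"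
          using epi_push_eq[OF tlj, of f ?v1lj "epi T x + y3" "x + y"] f m1lj
            subgrp_add[OF tower_carr_subgrp[OF t3lj] bxc y3j] subgrp_add[OF tower_carr_subgrp[OF t2lj] x(1) yj] by simp
        also have "\<dots> = ?v1ij (g y)"
          using meas_prod_apply[OF L1, of ?v1li ?v1ij "fibre (level T l j) f (x + y)"] m1li m1ij fib[OF y(1)]
            msys_mult[OF v1 nice3_eps[OF li] nice3_eps[OF ij]] by (simp add: g_def)
        also have "\<dots> = (\<Sum>r\<in>R. ?C * g y r)" using sumg[OF y(1)] by (simp add: sum_distrib_left)
        also have "\<dots> = (\<Sum>r\<in>R. ?C * H r y3)"
        proof (intro sum.cong refl arg_cong[of _ _ "\<lambda>x. ?C * x"])
          fix r assume r: "r \<in> R"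
          have "g y r = ?v1li (fibre ?L1 (fibre (level T l j) f (x + y)) (lf r))"
            by (rule geq[OF y(1) rc[OF r] lf[OF r]])
          also have "fibre ?L1 (fibre (level T l j) f (x + y)) (lf r) = fibre (level T l i) (fibre ?L2 f (z r)) y"
          proof
            fix u
            show "fibre ?L1 (fibre (level T l j) f (x + y)) (lf r) u = fibre (level T l i) (fibre ?L2 f (z r)) y u"
            proof (cases "u \<in> carr (?E1 l i)")
              case u: True
              have uj: "u \<in> carr (?E1 l j)" using lev_carr_mono[OF N(1) nice3_eps[OF li] nice3_eps[OF ij] u] .
              have "lf r + u \<in> carr (?E1 l j)" using subgrp_add[OF tower_carr_subgrp[OF t1lj] lf(1)[OF r] uj] .
              moreover have "y + emb T u \<in> carr (?E2 l i)"
                using adm_emb_carr[OF tli, of u] u subgrp_add[OF tower_carr_subgrp[OF t2li] y(1)] by simp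
              moreover have "f (x + y + emb T (lf r + u)) = f (z r + (y + emb T u))"
                using adm_emb_add[OF tij, of "lf r" u] by (intro arg_cong[of _ _ f]) (simp add: z_def)
              ultimately show ?thesis by (simp add: fibre_def)
            qed (simp add: fibre_def)
          qed
          also have "?v1li (fibre (level T l i) (fibre ?L2 f (z r)) y) = H r y3"
            unfolding H_def using epi_push_eq[OF tli, of "fibre ?L2 f (z r)" ?v1li y3 y] fz[OF r] m1li y3 y by simp
          finally show "g y r = H r y3" .
        qed
        finally show ?thesis using y3 by (simp add: fibre_def)
      qed
    qed
    have "?A x3 = ?v1ij \<phi>"
      using epi_push_eq[OF tij, of ?P ?v1ij x3 x] P m1ij x3 xij bx by (simp add: \<phi>_def)
    also have "\<dots> = (\<Sum>r\<in>R. ?C * ?v3li (H r))" using sum\<phi> \<phi>H by (simp add: sum_distrib_left)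
    also have "\<dots> = ?v3li (\<lambda>y3. \<Sum>r\<in>R. ?C * H r y3)"
      by (rule distr_sum[OF t3li meas_distr[OF m3li] H, symmetric])
    also have "\<dots> = ?B x3"
      using epi_push_eq[OF L3, of ?b ?v3li x3 "epi T x"] b m3li x3 bxc bx main by simp
    finally show ?thesis .
  qed
qed

text \<open>Both measures on F2(j)/F2(l) are iterated integrals over the same four quotients. The
  left side takes them in the order F1(i)/F1(l), F3(i)/F3(l), F1(j)/F1(i), F3(j)/F3(i), the right
  side with the two middle ones interchanged, which is \<open>msys_triple_swap\<close>.\<close>

lemma msys_triple:
  assumes v1: "msys (sub T) v1" and v3: "msys (quo T) v3"
  shows "msys (mid T) (\<lambda>j i. meas_prod (level T j i) (v1 (eps T j) (eps T i)) (v3 (gam T j) (gam T i)))"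
    (is "msys _ ?v2")
  unfolding msys_def
proof (intro conjI allI impI)
  note N = nice3_nice2
  have m: "?v2 l i \<in> meas (lev2 T l i)" "?v2 l i \<noteq> 0" if li: "(l, i) \<in> le2 T" for l i
    using meas_prod_meas[OF nice3_adm[OF li], of "v1 (eps T l) (eps T i)" "v3 (gam T l) (gam T i)"]
      meas_prod_nonzero[OF nice3_adm[OF li], of "v1 (eps T l) (eps T i)" "v3 (gam T l) (gam T i)"]
      msys_meas[OF v1 nice3_eps[OF li]] msys_meas[OF v3 nice3_gam[OF li]]
      msys_nonzero[OF v1 nice3_eps[OF li]] msys_nonzero[OF v3 nice3_gam[OF li]] by simp_all
  then show "\<forall>(l, i)\<in>le2 T. ?v2 l i \<in> meas (lev2 T l i) \<and> ?v2 l i \<noteq> 0" by blast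
  fix l i j assume li: "(l, i) \<in> le2 T" and ij: "(i, j) \<in> le2 T"
  note lj = le_trans[OF N(2) li ij] and L2 = lev_adm[OF N(2) li ij]
  note L3 = lev_adm[OF N(3) nice3_gam[OF li] nice3_gam[OF ij]]
  show "meas_prod (lev_triple (mid T) l i j) (?v2 l i) (?v2 i j) = ?v2 l j"
  proof (rule distr_eqI)
    show "meas_prod (lev_triple (mid T) l i j) (?v2 l i) (?v2 i j) \<in> distr (lev2 T l j)"
      using meas_prod_meas[OF L2, of "?v2 l i" "?v2 i j"] m(1)[OF li] m(1)[OF ij] meas_distr by simp
    show "?v2 l j \<in> distr (lev2 T l j)" using m(1)[OF lj] meas_distr by blast
    fix f assume f: "f \<in> test_fun (lev2 T l j)"
    let ?P = "epi_push (lev_triple (mid T) l i j) f (?v2 l i)"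
    let ?b = "epi_push (level T l j) f (v1 (eps T l) (eps T j))"
    have P: "?P \<in> test_fun (lev2 T i j)" using epi_push_test_fun[OF L2, of f "?v2 l i"] f m(1)[OF li] by simp
    have b: "?b \<in> test_fun (lev3 T l j)"
      using epi_push_test_fun[OF nice3_adm[OF lj], of f "v1 (eps T l) (eps T j)"] f msys_meas[OF v1 nice3_eps[OF lj]] by simp
    have "meas_prod (lev_triple (mid T) l i j) (?v2 l i) (?v2 i j) f = ?v2 i j ?P"
      using meas_prod_apply[OF L2, of "?v2 l i" "?v2 i j" f] m(1)[OF li] m(1)[OF ij] f by simp
    also have "\<dots> = v3 (gam T i) (gam T j) (epi_push (level T i j) ?P (v1 (eps T i) (eps T j)))"
      using meas_prod_apply[OF nice3_adm[OF ij], of "v1 (eps T i) (eps T j)" "v3 (gam T i) (gam T j)" ?P] P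
        msys_meas[OF v1 nice3_eps[OF ij]] msys_meas[OF v3 nice3_gam[OF ij]] by simp
    also have "\<dots> = v3 (gam T i) (gam T j) (epi_push (lev_triple (quo T) (gam T l) (gam T i) (gam T j)) ?b (v3 (gam T l) (gam T i)))"
      by (simp only: msys_triple_swap[OF v1 v3 li ij f])
    also have "\<dots> = v3 (gam T l) (gam T j) ?b"
      using meas_prod_apply[OF L3, of "v3 (gam T l) (gam T i)" "v3 (gam T i) (gam T j)" ?b] b
        msys_meas[OF v3 nice3_gam[OF li]] msys_meas[OF v3 nice3_gam[OF ij]]
        msys_mult[OF v3 nice3_gam[OF li] nice3_gam[OF ij]] by simp
    also have "\<dots> = ?v2 l j f"
      using meas_prod_apply[OF nice3_adm[OF lj], of "v1 (eps T l) (eps T j)" "v3 (gam T l) (gam T j)" f] f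
        msys_meas[OF v1 nice3_eps[OF lj]] msys_meas[OF v3 nice3_gam[OF lj]] by simp
    finally show "meas_prod (lev_triple (mid T) l i j) (?v2 l i) (?v2 i j) f = ?v2 l j f" .
  qed
qed

end

section \<open>Transition maps on functions\<close>

definition rs :: "('i, 'a, 'v) c2 \<Rightarrow> 'i \<Rightarrow> 'i \<Rightarrow> ('v \<Rightarrow> complex) \<Rightarrow> 'v \<Rightarrow> complex" where
  "rs E l j f = (\<lambda>v. if v \<in> carr (lev E l j) then f v else 0)"

definition "ps E v l j i f = epi_push (lev_triple E l j i) f (v l j)"

lemma mono_pull_rs: "mono_pull (lev_triple E l j i) f = rs E l j f"
  by (simp add: mono_pull_def rs_def cong: if_cong)

text \<open>What the limits use of the levels. Functoriality of \<open>ps\<close> is a form of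
  Fubini's theorem; \<open>dual_sys_laws\<close> obtains it from the dual space rather than by
  manipulating integrals.\<close>

definition "laws E v \<longleftrightarrow> nice2 E \<and> msys E v \<and>
     (\<forall>l i f. (l, i) \<in> le E \<longrightarrow> f \<in> lfun E l i \<longrightarrow> ps E v l l i f = f) \<and>
     (\<forall>l j k i f. (l, j) \<in> le E \<longrightarrow> (j, k) \<in> le E \<longrightarrow> (k, i) \<in> le E \<longrightarrow> f \<in> lfun E l i \<longrightarrow>
        ps E v j k i (ps E v l j i f) = ps E v l k i f)"

lemma rs_test_fun:
  assumes "nice2 E" "(l, j) \<in> le E" "(j, i) \<in> le E" "f \<in> lfun E l i"
  shows "rs E l j f \<in> lfun E l j"
  using mono_pull_test_fun[OF lev_adm[OF assms(1-3)], of f] assms(4) by (simp add: mono_pull_rs)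

lemma ps_test_fun:
  assumes "nice2 E" "msys E v" "(l, j) \<in> le E" "(j, i) \<in> le E" "f \<in> lfun E l i"
  shows "ps E v l j i f \<in> lfun E j i"
  using epi_push_test_fun[OF lev_adm[OF assms(1,3,4)], of f "v l j"] assms msys_meas[OF assms(2,3)]
  by (simp add: ps_def)

lemma rs_rs:
  assumes "nice2 E" "(l, k) \<in> le E" "(k, j) \<in> le E"
  shows "rs E l k (rs E l j f) = rs E l k f"
  using lev_carr_mono[OF assms] by (auto simp: rs_def)

lemma rs_id: "f \<in> lfun E l i ==> rs E l i f = f"
  using supp_inD[OF test_fun_supp_carr] by (fastforce simp: rs_def)

text \<open>Base change: a point of F(k)/F(j) has a lift in F(k)/F(l), and the fibre through this
  lift stays in F(k), where \<open>f\<close> and its restriction agree.\<close>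

lemma rs_ps:
  assumes E: "nice2 E" and v: "msys E v" and le: "(l, j) \<in> le E" "(j, k) \<in> le E" "(k, i) \<in> le E"
    and f: "f \<in> lfun E l i"
  shows "rs E j k (ps E v l j i f) = ps E v l j k (rs E l k f)"
proof
  fix x
  have ji: "(j, i) \<in> le E" and lk: "(l, k) \<in> le E" using le le_trans[OF E] by blast+
  note A = lev_adm[OF E le(1) ji] and B = lev_adm[OF E le(1,2)]
  note f' = rs_test_fun[OF E lk le(3) f]
  note m = msys_meas[OF v le(1)]
  show "rs E j k (ps E v l j i f) x = ps E v l j k (rs E l k f) x"
  proof (cases "x \<in> carr (lev E j k)")
    case True
    obtain y where y: "y \<in> carr (lev E l k)" "y - x \<in> nul (lev E j k)" using lev_lift[OF E le(1,2) True] by blast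
    have "ps E v l j i f x = v l j (fibre (lev_triple E l j i) f y)"
      unfolding ps_def using epi_push_eq[OF A, of f "v l j" x y] f m lev_carr_mono[OF E le(2,3) True]
        lev_carr_mono[OF E lk le(3) y(1)] lev_nul_sub_mono[OF E le(2,3) y(2)] by simp
    also have "fibre (lev_triple E l j i) f y = fibre (lev_triple E l j k) (rs E l k f) y"
      using subgrp_add[OF tower_carr_subgrp[OF lev_tower[OF E lk]] y(1)] lev_carr_mono[OF E le(1,2)]
      by (auto simp: fibre_def rs_def)
    also have "v l j \<dots> = ps E v l j k (rs E l k f) x"
      unfolding ps_def using epi_push_eq[OF B, of "rs E l k f" "v l j" x y] f' m True y by simp
    finally show ?thesis using True by (simp add: rs_def)
  next
    case False
    then show ?thesis using epi_push_out[OF B] by (simp add: rs_def ps_def)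
  qed
qed

section \<open>Dual systems\<close>

definition "dual_sys E E' \<chi> v v' \<longleftrightarrow> nice2 E \<and> nice2 E' \<and> idx E' = idx E \<and> le E' = (le E)\<inverse> \<and> msys E v \<and> msys E' v' \<and>
     (\<forall>l j i. (l, j) \<in> le E \<longrightarrow> (j, i) \<in> le E \<longrightarrow> tpair (lev_triple E l j i) (lev_triple E' i j l) \<chi> \<chi> \<chi>) \<and>
     (\<forall>l i. (l, i) \<in> le E \<longrightarrow> mdual (lev E l i) (lev E' i l) (v l i) (v' i l))"

lemma dual_sys_pairing:
  assumes "dual_sys E E' \<chi> v v'" "(l, i) \<in> le E"
  shows "pairing (lev E l i) (lev E' i l) \<chi>"
proof -
  have "nice2 E" using assms by (simp add: dual_sys_def)
  then have "(i, i) \<in> le E" using le_refl le_idx assms(2) by metis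
  then have "tpair (lev_triple E l i i) (lev_triple E' i i l) \<chi> \<chi> \<chi>" using assms by (simp add: dual_sys_def)
  from tpair_pairing(1)[OF this] show ?thesis by simp
qed

lemma dual_sys_sym:
  assumes D: "dual_sys E E' \<chi> v v'"
  shows "dual_sys E' E (\<lambda>w x. \<chi> x w) v' v"
proof -
  have "tpair (lev_triple E' l j i) (lev_triple E i j l) (\<lambda>w x. \<chi> x w) (\<lambda>w x. \<chi> x w) (\<lambda>w x. \<chi> x w)"
    if "(l, j) \<in> le E'" "(j, i) \<in> le E'" for l j i
    using that D tpair_sym[of "lev_triple E i j l" "lev_triple E' l j i" \<chi> \<chi> \<chi>] by (simp add: dual_sys_def)
  moreover have "mdual (lev E' l i) (lev E i l) (v' l i) (v i l)" if "(l, i) \<in> le E'" for l i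
    using that D mdual_sym[OF dual_sys_pairing[OF D, of i l]] by (simp add: dual_sys_def)
  moreover have "nice2 E" "nice2 E'" "idx E' = idx E" "le E' = (le E)\<inverse>" "msys E v" "msys E' v'"
    using D by (simp_all add: dual_sys_def)
  ultimately show ?thesis by (simp add: dual_sys_def)
qed

context
  fixes E E' \<chi> v v'
  assumes D: "dual_sys E E' \<chi> v v'"
begin

lemma dual_sys_nice: "nice2 E" "nice2 E'" and dual_sys_msys: "msys E v" "msys E' v'"
  using D by (simp_all add: dual_sys_def)

lemma dual_sys_le: "(i, j) \<in> le E' \<longleftrightarrow> (j, i) \<in> le E"
  using D by (simp add: dual_sys_def)

lemma dual_sys_mdual: "(l, i) \<in> le E ==> mdual (lev E l i) (lev E' i l) (v l i) (v' i l)"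
  using D by (simp add: dual_sys_def)

lemma dual_sys_tpair: "(l, j) \<in> le E ==> (j, i) \<in> le E ==> tpair (lev_triple E l j i) (lev_triple E' i j l) \<chi> \<chi> \<chi>"
  using D by (simp add: dual_sys_def)

lemma sys_four_test_fun:
  assumes "(l, i) \<in> le E" "f \<in> lfun E l i"
  shows "four \<chi> (lev E' i l) (v l i) f \<in> lfun E' i l"
  by (rule four_test_fun[OF dual_sys_pairing[OF D assms(1)] msys_meas[OF dual_sys_msys(1) assms(1)] assms(2)])

lemma sys_four_inj:
  assumes "(l, i) \<in> le E" "f \<in> lfun E l i" "g \<in> lfun E l i"
    "four \<chi> (lev E' i l) (v l i) f = four \<chi> (lev E' i l) (v l i) g"
  shows "f = g"
  by (rule four_inj[OF dual_sys_pairing[OF D assms(1)] msys_meas[OF dual_sys_msys(1) assms(1)]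
        msys_nonzero[OF dual_sys_msys(1) assms(1)] assms(2-4)])

lemma four_rs:
  assumes le: "(l, j) \<in> le E" "(j, i) \<in> le E" and f: "f \<in> lfun E l i"
  shows "four \<chi> (lev E' j l) (v l j) (rs E l j f) = ps E' v' i j l (four \<chi> (lev E' i l) (v l i) f)"
  using four_mono_pull[OF dual_sys_tpair[OF le], of f "v l j" "v j i" "v' i j"] f
    msys_meas[OF dual_sys_msys(1) le(1)] dual_sys_mdual[OF le(2)] msys_mult[OF dual_sys_msys(1) le]
  by (simp add: mono_pull_rs ps_def)

lemma four_ps:
  assumes le: "(l, j) \<in> le E" "(j, i) \<in> le E" and f: "f \<in> lfun E l i"
  shows "four \<chi> (lev E' i j) (v j i) (ps E v l j i f) = rs E' i j (four \<chi> (lev E' i l) (v l i) f)"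
  using four_epi_push[OF dual_sys_tpair[OF le], of f "v l j" "v j i"] f
    msys_meas[OF dual_sys_msys(1) le(1)] msys_meas[OF dual_sys_msys(1) le(2)] msys_mult[OF dual_sys_msys(1) le]
  by (simp add: mono_pull_rs ps_def)

text \<open>The Fourier transform turns push-forwards into restrictions, for which functoriality is obvious.\<close>

lemma dual_sys_laws: "laws E v"
  unfolding laws_def
proof (intro conjI allI impI dual_sys_nice(1) dual_sys_msys(1))
  note N = dual_sys_nice(1) and N' = dual_sys_nice(2)
  fix l i f assume li: "(l, i) \<in> le E" and f: "f \<in> lfun E l i"
  have ll: "(l, l) \<in> le E" using le_refl[OF N] le_idx[OF N li] by blast
  show "ps E v l l i f = f"
    using four_ps[OF ll li f] rs_id[OF sys_four_test_fun[OF li f]]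
    by (intro sys_four_inj[OF li ps_test_fun[OF N dual_sys_msys(1) ll li f] f]) simp
next
  note N = dual_sys_nice(1) and N' = dual_sys_nice(2)
  fix l j k i f assume le: "(l, j) \<in> le E" "(j, k) \<in> le E" "(k, i) \<in> le E" and f: "f \<in> lfun E l i"
  have ji: "(j, i) \<in> le E" and lk: "(l, k) \<in> le E" using le le_trans[OF N] by blast+
  note g = ps_test_fun[OF N dual_sys_msys(1) le(1) ji f]
  show "ps E v j k i (ps E v l j i f) = ps E v l k i f"
  proof (rule sys_four_inj[OF le(3)])
    show "ps E v j k i (ps E v l j i f) \<in> lfun E k i"
      by (rule ps_test_fun[OF N dual_sys_msys(1) le(2,3) g])
    show "ps E v l k i f \<in> lfun E k i" by (rule ps_test_fun[OF N dual_sys_msys(1) lk le(3) f])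
    show "four \<chi> (lev E' i k) (v k i) (ps E v j k i (ps E v l j i f)) = four \<chi> (lev E' i k) (v k i) (ps E v l k i f)"
      using four_ps[OF le(2,3) g] four_ps[OF le(1) ji f] four_ps[OF lk le(3) f]
        rs_rs[OF N', of i k j "four \<chi> (lev E' i l) (v l i) f"] dual_sys_le le by simp
  qed
qed

end

text \<open>The case in which F(k) is the whole space: the levels with lower index at least
  \<open>k\<close> are zero and carry mass \<open>1\<close>. Duality exchanges it with
  \<open>uptriv\<close>, the case F(k) = 0, and \<open>cfsys\<close> with
  \<open>dfsys\<close>.\<close>

definition "lowtriv E v k \<longleftrightarrow> (\<forall>j i. (k, j) \<in> le E \<longrightarrow> (j, i) \<in> le E \<longrightarrow>
     carr (lev E j i) = nul (lev E j i) \<and> v j i (indicator (nul (lev E j i))) = 1)"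

definition "uptriv E v k \<longleftrightarrow> (\<forall>j i. (i, j) \<in> le E \<longrightarrow> (j, k) \<in> le E \<longrightarrow>
     carr (lev E i j) = nul (lev E i j) \<and> v i j (indicator (nul (lev E i j))) = 1)"

definition "cfsys E v \<longleftrightarrow> (\<forall>l i. (l, i) \<in> le E \<longrightarrow> compact_filt (lev E l i) \<and> v l i (indicator (carr (lev E l i))) = 1)"

definition "dfsys E v \<longleftrightarrow> (\<forall>l i. (l, i) \<in> le E \<longrightarrow> discrete_filt (lev E l i) \<and> v l i (indicator (nul (lev E l i))) = 1)"

lemma pairing_trivial:
  assumes P: "pairing E E' \<chi>" and d: "mdual E E' m m'" and z: "carr E = nul E" "m (indicator (nul E)) = 1"
  shows "carr E' = nul E'" "m' (indicator (nul E')) = 1" (is ?B)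
proof -
  have "w \<in> nul E'" if w: "w \<in> carr E'" for w
    using pairing_nul'[OF P w] pairing_nul'[OF pairing_sym[OF P]] z(1) w by blast
  then show eq: "carr E' = nul E'" using nul_carr[OF pairing_tower'[OF P]] by blast
  obtain i where i: "i \<in> idx E" using tower_nonempty[OF pairing_tower[OF P]] by blast
  then have "m (indicator (fil E i)) * m' (indicator (fil E' i)) = 1" using d by (simp add: mdual_def)
  moreover have "fil E i = nul E" by (rule trivial_fil[OF pairing_tower[OF P] z(1) i])
  moreover have "fil E' i = nul E'"
    using trivial_fil[OF pairing_tower'[OF P] eq] i pairing_idx[OF P] by simp
  ultimately show ?B using z(2) by simp
qed

lemma pairing_compact_discrete:
  assumes P: "pairing E E' \<chi>" and d: "mdual E E' m m'" and z: "compact_filt E" "m (indicator (carr E)) = 1"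
  shows "discrete_filt E'" "m' (indicator (nul E')) = 1"
proof -
  obtain i where i: "i \<in> idx E" "fil E i = carr E" using z(1) by (auto simp: compact_filt_def)
  have i': "i \<in> idx E'" using i pairing_idx[OF P] by simp
  have "fil E' i = nul E'"
  proof
    show "fil E' i \<subseteq> nul E'"
      using pairing_annih'[OF P i(1)] pairing_nul'[OF P] fil_carr[OF i'] i(2) by blast
  qed (rule nul_fil[OF i'])
  then show "discrete_filt E'" "m' (indicator (nul E')) = 1"
    using i i' d z(2) by (auto simp: discrete_filt_def mdual_def)
qed

lemma pairing_discrete_compact:
  assumes P: "pairing E E' \<chi>" and d: "mdual E E' m m'" and z: "discrete_filt E" "m (indicator (nul E)) = 1"
  shows "compact_filt E'" "m' (indicator (carr E')) = 1"
proof -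
  obtain i where i: "i \<in> idx E" "fil E i = nul E" using z(1) by (auto simp: discrete_filt_def)
  have i': "i \<in> idx E'" using i pairing_idx[OF P] by simp
  have "fil E' i = carr E'"
  proof
    show "carr E' \<subseteq> fil E' i"
    proof
      fix w assume w: "w \<in> carr E'"
      have "\<chi> x w = 1" if x: "x \<in> nul E" for x
        using pairing_nul'[OF pairing_sym[OF P], of x] x nul_carr[OF pairing_tower[OF P]] w by blast
      then show "w \<in> fil E' i" using pairing_annih'[OF P i(1) w] i(2) by simp
    qed
  qed (rule fil_carr[OF i'])
  then show "compact_filt E'" "m' (indicator (carr E')) = 1"
    using i i' d z(2) by (auto simp: compact_filt_def mdual_def)
qed

lemma dual_uptriv:
  assumes D: "dual_sys E E' \<chi> v v'" and z: "uptriv E v k"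
  shows "lowtriv E' v' k"
  unfolding lowtriv_def
proof (intro allI impI)
  fix j i assume "(k, j) \<in> le E'" "(j, i) \<in> le E'"
  then have le: "(j, k) \<in> le E" "(i, j) \<in> le E" using dual_sys_le[OF D] by auto
  then have "carr (lev E i j) = nul (lev E i j)" "v i j (indicator (nul (lev E i j))) = 1"
    using z by (auto simp: uptriv_def)
  from pairing_trivial[OF dual_sys_pairing[OF D le(2)] dual_sys_mdual[OF D le(2)] this]
  show "carr (lev E' j i) = nul (lev E' j i) \<and> v' j i (indicator (nul (lev E' j i))) = 1" by simp
qed

lemma dual_lowtriv:
  assumes D: "dual_sys E E' \<chi> v v'" and z: "lowtriv E v k"
  shows "uptriv E' v' k"
  unfolding uptriv_def
proof (intro allI impI)
  fix j i assume "(i, j) \<in> le E'" "(j, k) \<in> le E'"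
  then have le: "(k, j) \<in> le E" "(j, i) \<in> le E" using dual_sys_le[OF D] by auto
  then have "carr (lev E j i) = nul (lev E j i)" "v j i (indicator (nul (lev E j i))) = 1"
    using z by (auto simp: lowtriv_def)
  from pairing_trivial[OF dual_sys_pairing[OF D le(2)] dual_sys_mdual[OF D le(2)] this]
  show "carr (lev E' i j) = nul (lev E' i j) \<and> v' i j (indicator (nul (lev E' i j))) = 1" by simp
qed

lemma dual_cfsys:
  assumes D: "dual_sys E E' \<chi> v v'" and z: "cfsys E v"
  shows "dfsys E' v'"
  unfolding dfsys_def
proof (intro allI impI)
  fix l i assume "(l, i) \<in> le E'"
  then have le: "(i, l) \<in> le E" using dual_sys_le[OF D] by auto
  then have "compact_filt (lev E i l)" "v i l (indicator (carr (lev E i l))) = 1" using z by (auto simp: cfsys_def)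
  from pairing_compact_discrete[OF dual_sys_pairing[OF D le] dual_sys_mdual[OF D le] this]
  show "discrete_filt (lev E' l i) \<and> v' l i (indicator (nul (lev E' l i))) = 1" by simp
qed

lemma dual_dfsys:
  assumes D: "dual_sys E E' \<chi> v v'" and z: "dfsys E v"
  shows "cfsys E' v'"
  unfolding cfsys_def
proof (intro allI impI)
  fix l i assume "(l, i) \<in> le E'"
  then have le: "(i, l) \<in> le E" using dual_sys_le[OF D] by auto
  then have "discrete_filt (lev E i l)" "v i l (indicator (nul (lev E i l))) = 1" using z by (auto simp: dfsys_def)
  from pairing_discrete_compact[OF dual_sys_pairing[OF D le] dual_sys_mdual[OF D le] this]
  show "compact_filt (lev E' l i) \<and> v' l i (indicator (carr (lev E' l i))) = 1" by simp
qed

section \<open>Direct and inverse images on functions\<close>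

text \<open>Only the compatibilities with restrictions are proved directly; those with push-forwards follow by duality.\<close>

context
  fixes T l j i
  assumes T: "nice3 T" and lj: "(l, j) \<in> le2 T" and ji: "(j, i) \<in> le2 T"
begin

lemma mono_pull_rs_comm:
  "mono_pull (level T l j) (rs (mid T) l j f) = rs (sub T) (eps T l) (eps T j) (mono_pull (level T l i) f)"
  using adm_emb_carr[OF nice3_adm[OF T lj]]
    lev_carr_mono[OF nice3_nice2(1)[OF T] nice3_eps[OF T lj] nice3_eps[OF T ji]]
  by (auto simp: mono_pull_def rs_def)

lemma epi_pull_rs_comm:
  "rs (mid T) l j (epi_pull (level T l i) g) = epi_pull (level T l j) (rs (quo T) (gam T l) (gam T j) g)"
  using adm_epi_carr[OF nice3_adm[OF T lj]] lev_carr_mono[OF nice3_nice2(2)[OF T] lj ji]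
  by (auto simp: epi_pull_def rs_def)

text \<open>The content is that an element of F2(j) which comes from F1(i) up to F2(l) already comes
  from F1(j): its origin vanishes in F2(i)/F2(j), hence in F1(i)/F1(j) by injectivity on that
  level.\<close>

lemma mono_push_rs_comm:
  assumes f: "f \<in> test_fun (lev1 T l i)"
  shows "rs (mid T) l j (mono_push (level T l i) f) = mono_push (level T l j) (rs (sub T) (eps T l) (eps T j) f)"
proof
  fix v
  note N = nice3_nice2[OF T]
  note li = le_trans[OF N(2) lj ji]
  note e1 = nice3_eps[OF T lj] and e2 = nice3_eps[OF T ji]
  note A = nice3_adm[OF T li] and B = nice3_adm[OF T lj] and C = nice3_adm[OF T ji]
  have f': "rs (sub T) (eps T l) (eps T j) f \<in> test_fun (lev1 T l j)"
    by (rule rs_test_fun[OF N(1) e1 e2 f])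
  have Nli: "subgrp (nul (lev2 T l i))" by (rule tower_nul_subgrp[OF lev_tower[OF N(2) li]])
  have Clj: "subgrp (carr (lev2 T l j))" by (rule tower_carr_subgrp[OF lev_tower[OF N(2) lj]])
  show "rs (mid T) l j (mono_push (level T l i) f) v = mono_push (level T l j) (rs (sub T) (eps T l) (eps T j) f) v"
  proof (cases "\<exists>x\<in>carr (lev1 T l j). v - emb T x \<in> nul (lev2 T l j)")
    case True
    then obtain x where x: "x \<in> carr (lev1 T l j)" "v - emb T x \<in> nul (lev2 T l j)" by blast
    have "emb T x \<in> carr (lev2 T l j)" using adm_emb_carr[OF B, of x] x(1) by simp
    then have vc: "v \<in> carr (lev2 T l j)"
      using subgrp_diff_iff[OF Clj, of v "emb T x"] x(2) nul_carr[OF lev_tower[OF N(2) lj]] by blast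
    have "mono_push (level T l j) (rs (sub T) (eps T l) (eps T j) f) v = rs (sub T) (eps T l) (eps T j) f x"
      using mono_push_eq[OF B, of _ x v] f' x by simp
    moreover have "mono_push (level T l i) f v = f x"
      using mono_push_eq[OF A, of f x v] f lev_carr_mono[OF N(1) e1 e2 x(1)] lev_nul_sub_mono[OF N(2) lj ji x(2)]
      by simp
    ultimately show ?thesis using vc x(1) by (simp add: rs_def)
  next
    case False
    have "mono_push (level T l i) f v = 0" if vc: "v \<in> carr (lev2 T l j)"
    proof (rule mono_push_out[OF A])
      fix x assume "x \<in> carr (sub (level T l i))"
      then have x: "x \<in> carr (lev1 T l i)" by simp
      show "v - emb (level T l i) x \<notin> nul (mid (level T l i))"
      proof
        assume "v - emb (level T l i) x \<in> nul (mid (level T l i))"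
        then have d: "v - emb T x \<in> nul (lev2 T l i)" by simp
        have ec: "emb T x \<in> carr (lev2 T l i)" using adm_emb_carr[OF A, of x] x by simp
        have "emb T x - v \<in> nul (lev2 T l i)" using subgrp_diff_sym[OF Nli d] .
        then have "emb T x \<in> nul (lev2 T j i)" using lev_kernel[OF N(2) lj ji ec] vc by blast
        then have "x \<in> nul (lev1 T j i)"
          using adm_emb_nul[OF C, of x] lev_carr_quo[OF N(1) e1 e2 x] by simp
        then obtain x1 where x1: "x1 \<in> carr (lev1 T l j)"
          "x - x1 \<in> nul (lev1 T l i)" using lev_kernel[OF N(1) e1 e2 x] by blast
        have "emb T (x - x1) \<in> nul (lev2 T l i)"
          using adm_emb_nul[OF A, of "x - x1"] x1(2) nul_carr[OF lev_tower[OF N(1) nice3_eps[OF T li]]] by auto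
        then have "(v - emb T x) + emb T (x - x1) \<in> nul (lev2 T l i)" by (rule subgrp_add[OF Nli d])
        moreover have "emb T (x - x1) + emb T x1 = emb T x" using adm_emb_add[OF A, of "x - x1" x1] by simp
        then have "v - emb T x1 = (v - emb T x) + emb T (x - x1)" by (simp add: algebra_simps)
        ultimately have "v - emb T x1 \<in> nul (lev2 T l i)" by (simp only:)
        moreover have "v - emb T x1 \<in> carr (lev2 T l j)"
          using adm_emb_carr[OF B, of x1] x1(1) subgrp_diff[OF Clj vc] by simp
        ultimately show False using False x1(1) lev_nul_sub[OF N(2) lj ji] by blast
      qed
    qed
    moreover have "mono_push (level T l j) (rs (sub T) (eps T l) (eps T j) f) v = 0"
      using False by (intro mono_push_out[OF B]) auto
    ultimately show ?thesis by (simp add: rs_def)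
  qed
qed

text \<open>The left side integrates over F1(i)/F1(l), the right side over F1(j)/F1(l). Since
  \<open>j\<close> is above \<open>k\<close>, these differ by the zero space F1(i)/F1(j) of mass
  \<open>1\<close>; \<open>integral\<close> shrinks the domain without changing the value.\<close>

lemma epi_push_rs_comm:
  assumes v1: "msys (sub T) v1" and z: "lowtriv (sub T) v1 (eps T k)"
    and k: "(l, k) \<in> le2 T" "(k, j) \<in> le2 T" and f: "f \<in> test_fun (lev2 T l i)"
  shows "rs (quo T) (gam T l) (gam T j) (epi_push (level T l i) f (v1 (eps T l) (eps T i))) =
    epi_push (level T l j) (rs (mid T) l j f) (v1 (eps T l) (eps T j))"
proof
  fix w
  note N = nice3_nice2[OF T]
  note li = le_trans[OF N(2) lj ji]
  note e1 = nice3_eps[OF T lj] and e2 = nice3_eps[OF T ji] and g1 = nice3_gam[OF T lj] and g2 = nice3_gam[OF T ji]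
  note A = nice3_adm[OF T li] and B = nice3_adm[OF T lj] and L = lev_adm[OF N(1) e1 e2]
  note f' = rs_test_fun[OF N(2) lj ji f]
  have m: "v1 (eps T l) (eps T i) \<in> meas (lev1 T l i)"
    "v1 (eps T l) (eps T j) \<in> meas (lev1 T l j)"
    "v1 (eps T j) (eps T i) \<in> meas (lev1 T j i)"
    using msys_meas[OF v1] nice3_eps[OF T] li lj ji by blast+
  have z': "carr (lev1 T j i) = nul (lev1 T j i)"
    "v1 (eps T j) (eps T i) (indicator (nul (lev1 T j i))) = 1"
    using z nice3_eps[OF T k(2)] e2 by (auto simp: lowtriv_def)
  have t1: "tower (lev1 T j i)" by (rule lev_tower[OF N(1) e2])
  have integral: "v1 (eps T l) (eps T i) g = v1 (eps T l) (eps T j) (rs (sub T) (eps T l) (eps T j) g)"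
    if g: "g \<in> test_fun (lev1 T l i)" for g
  proof -
    let ?L = "lev_triple (sub T) (eps T l) (eps T j) (eps T i)"
    let ?c = "v1 (eps T l) (eps T j) (rs (sub T) (eps T l) (eps T j) g)"
    have p: "epi_push ?L g (v1 (eps T l) (eps T j)) \<in> test_fun (lev1 T j i)"
      using epi_push_test_fun[OF L, of g] g m(2) by simp
    have z0: "0 \<in> carr (lev1 T j i)" by (rule subgrp_zero[OF tower_carr_subgrp[OF t1]])
    have p0: "epi_push ?L g (v1 (eps T l) (eps T j)) 0 = ?c"
      using epi_push_eq[OF L, of g "v1 (eps T l) (eps T j)" 0 0] g m(2) z0
        subgrp_zero[OF tower_carr_subgrp[OF lev_tower[OF N(1) nice3_eps[OF T li]]]]
        subgrp_zero[OF tower_nul_subgrp[OF t1]]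
      by (simp add: fibre_def rs_def cong: if_cong)
    have "epi_push ?L g (v1 (eps T l) (eps T j)) = (\<lambda>y. ?c * indicator (nul (lev1 T j i)) y)"
    proof
      fix y
      show "epi_push ?L g (v1 (eps T l) (eps T j)) y = ?c * indicator (nul (lev1 T j i)) y"
      proof (cases "y \<in> nul (lev1 T j i)")
        case True
        then show ?thesis using inv_byD[OF test_fun_inv_nul[OF p] True, of 0] p0 by simp
      next
        case False
        then show ?thesis using epi_push_out[OF L, of y] z'(1) by simp
      qed
    qed
    moreover obtain a where a: "a \<in> idx (lev1 T j i)" using tower_nonempty[OF t1] by blast
    then have "indicator (nul (lev1 T j i)) \<in> test_fun (lev1 T j i)"
      using indicator_test_fun[OF t1 a] trivial_fil[OF t1 z'(1) a] by simp
    ultimately have "v1 (eps T j) (eps T i) (epi_push ?L g (v1 (eps T l) (eps T j))) = ?c"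
      using distr_scale[OF meas_distr[OF m(3)]] z'(2) by simp
    then show ?thesis
      using meas_prod_apply[OF L, of "v1 (eps T l) (eps T j)" "v1 (eps T j) (eps T i)" g] m g msys_mult[OF v1 e1 e2] by simp
  qed
  show "rs (quo T) (gam T l) (gam T j) (epi_push (level T l i) f (v1 (eps T l) (eps T i))) w =
    epi_push (level T l j) (rs (mid T) l j f) (v1 (eps T l) (eps T j)) w"
  proof (cases "w \<in> carr (lev3 T l j)")
    case True
    obtain x where x: "x \<in> carr (lev2 T l j)" "epi T x - w \<in> nul (lev3 T l j)"
      using adm_lift[OF B, of w] True by auto
    have xi: "x \<in> carr (lev2 T l i)" using lev_carr_mono[OF N(2) lj ji x(1)] .
    have "epi_push (level T l i) f (v1 (eps T l) (eps T i)) w = v1 (eps T l) (eps T i) (fibre (level T l i) f x)"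
      using epi_push_eq[OF A, of f "v1 (eps T l) (eps T i)" w x] f m(1) xi lev_carr_mono[OF N(3) g1 g2 True]
        lev_nul_sub_mono[OF N(3) g1 g2 x(2)] by simp
    also have "\<dots> = v1 (eps T l) (eps T j) (rs (sub T) (eps T l) (eps T j) (fibre (level T l i) f x))"
      using integral[of "fibre (level T l i) f x"] fibre_test_fun[OF A, of f x] f xi by simp
    also have "rs (sub T) (eps T l) (eps T j) (fibre (level T l i) f x) = fibre (level T l j) (rs (mid T) l j f) x"
    proof
      fix v
      show "rs (sub T) (eps T l) (eps T j) (fibre (level T l i) f x) v = fibre (level T l j) (rs (mid T) l j f) x v"
        using lev_carr_mono[OF N(1) e1 e2, of v] adm_emb_carr[OF B, of v]
          subgrp_add[OF tower_carr_subgrp[OF lev_tower[OF N(2) lj]] x(1), of "emb T v"]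
        by (simp add: rs_def fibre_def)
    qed
    also have "v1 (eps T l) (eps T j) \<dots> = epi_push (level T l j) (rs (mid T) l j f) (v1 (eps T l) (eps T j)) w"
      using epi_push_eq[OF B, of "rs (mid T) l j f" "v1 (eps T l) (eps T j)" w x] f' m(2) True x by simp
    finally show ?thesis using True by (simp add: rs_def)
  next
    case False
    then show ?thesis using epi_push_out[OF B, of w] by (simp add: rs_def)
  qed
qed

end

text \<open>A triple, its dual and all chosen measures in one predicate that is symmetric in the
  two: \<open>dual_triples_sym\<close> exchanges the first space with the third and each system with
  its inverse, so a fact about \<open>T\<close> is available for \<open>T'\<close>.\<close>

definition "dual_triples T T' \<chi>1 \<chi>2 \<chi>3 v1 v1' v2 v2' v3 v3' \<longleftrightarrow> nice3 T \<and> nice3 T' \<and> eps T' = gam T \<and> gam T' = eps T \<and>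
     dual_sys (sub T) (quo T') \<chi>1 v1 v1' \<and> dual_sys (mid T) (mid T') \<chi>2 v2 v2' \<and> dual_sys (quo T) (sub T') \<chi>3 v3 v3' \<and>
     (\<forall>j i. (j, i) \<in> le2 T \<longrightarrow> tpair (level T j i) (level T' i j) \<chi>1 \<chi>2 \<chi>3 \<and>
        v2 j i = meas_prod (level T j i) (v1 (eps T j) (eps T i)) (v3 (gam T j) (gam T i)) \<and>
        v2' i j = meas_prod (level T' i j) (v3' (gam T i) (gam T j)) (v1' (eps T i) (eps T j)))"

lemma dual_triples_sym:
  assumes "dual_triples T T' \<chi>1 \<chi>2 \<chi>3 v1 v1' v2 v2' v3 v3'"
  shows "dual_triples T' T (\<lambda>w v. \<chi>3 v w) (\<lambda>w v. \<chi>2 v w) (\<lambda>w v. \<chi>1 v w) v3' v3 v2' v2 v1' v1"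
proof -
  have D: "dual_sys (sub T) (quo T') \<chi>1 v1 v1'" "dual_sys (mid T) (mid T') \<chi>2 v2 v2'" "dual_sys (quo T) (sub T') \<chi>3 v3 v3'"
    using assms by (simp_all add: dual_triples_def)
  show ?thesis
    unfolding dual_triples_def
  proof (intro conjI allI impI)
    fix j i assume "(j, i) \<in> le2 T'"
    then have ij: "(i, j) \<in> le2 T" using dual_sys_le[OF D(2)] by simp
    then have "tpair (level T i j) (level T' j i) \<chi>1 \<chi>2 \<chi>3" using assms by (simp add: dual_triples_def)
    from tpair_sym[OF this]
    show "tpair (level T' j i) (level T i j) (\<lambda>w v. \<chi>3 v w) (\<lambda>w v. \<chi>2 v w) (\<lambda>w v. \<chi>1 v w)" .
    show "v2' j i = meas_prod (level T' j i) (v3' (eps T' j) (eps T' i)) (v1' (gam T' j) (gam T' i))"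
      "v2 i j = meas_prod (level T i j) (v1 (gam T' i) (gam T' j)) (v3 (eps T' i) (eps T' j))"
      using assms ij by (simp_all add: dual_triples_def)
  qed (use assms D[THEN dual_sys_sym] in \<open>simp_all add: dual_triples_def\<close>)
qed

context
  fixes T T' \<chi>1 \<chi>2 \<chi>3 v1 v1' v2 v2' v3 v3'
  assumes D: "dual_triples T T' \<chi>1 \<chi>2 \<chi>3 v1 v1' v2 v2' v3 v3'"
begin

lemma dual_triples_nice: "nice3 T" "nice3 T'"
  using D by (simp_all add: dual_triples_def)

lemma dual_triples_sys: "dual_sys (sub T) (quo T') \<chi>1 v1 v1'" "dual_sys (mid T) (mid T') \<chi>2 v2 v2'"
  "dual_sys (quo T) (sub T') \<chi>3 v3 v3'"
  using D by (simp_all add: dual_triples_def)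

lemma dual_triples_idx: "eps T' = gam T" "gam T' = eps T" "(i, j) \<in> le2 T' \<longleftrightarrow> (j, i) \<in> le2 T"
  using D dual_sys_le[OF dual_triples_sys(2)] by (simp_all add: dual_triples_def)

lemma dual_triples_tpair: "(j, i) \<in> le2 T ==> tpair (level T j i) (level T' i j) \<chi>1 \<chi>2 \<chi>3"
  and dual_triples_prod: "(j, i) \<in> le2 T ==>
    meas_prod (level T j i) (v1 (eps T j) (eps T i)) (v3 (gam T j) (gam T i)) = v2 j i"
  using D by (simp_all add: dual_triples_def)

lemma dual_triples_meas:
  assumes "(j, i) \<in> le2 T"
  shows "v1 (eps T j) (eps T i) \<in> meas (lev1 T j i)"
    "v2 j i \<in> meas (lev2 T j i)"
    "v3 (gam T j) (gam T i) \<in> meas (lev3 T j i)"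
    "mdual (lev3 T j i) (lev (sub T') (gam T i) (gam T j)) (v3 (gam T j) (gam T i)) (v3' (gam T i) (gam T j))"
  using msys_meas[OF dual_sys_msys(1)[OF dual_triples_sys(1)] nice3_eps[OF dual_triples_nice(1) assms]]
    msys_meas[OF dual_sys_msys(1)[OF dual_triples_sys(2)] assms]
    msys_meas[OF dual_sys_msys(1)[OF dual_triples_sys(3)] nice3_gam[OF dual_triples_nice(1) assms]]
    dual_sys_mdual[OF dual_triples_sys(3) nice3_gam[OF dual_triples_nice(1) assms]] .

lemma lev_four_epi_push:
  assumes ji: "(j, i) \<in> le2 T" and f: "f \<in> test_fun (lev2 T j i)"
  shows "four \<chi>3 (lev (sub T') (gam T i) (gam T j)) (v3 (gam T j) (gam T i)) (epi_push (level T j i) f (v1 (eps T j) (eps T i))) =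
    mono_pull (level T' i j) (four \<chi>2 (lev2 T' i j) (v2 j i) f)"
  using four_epi_push[OF dual_triples_tpair[OF ji], of f "v1 (eps T j) (eps T i)" "v3 (gam T j) (gam T i)"] f
    dual_triples_meas[OF ji] dual_triples_prod[OF ji] by (simp add: dual_triples_idx)

lemma lev_four_mono_pull:
  assumes ji: "(j, i) \<in> le2 T" and f: "f \<in> test_fun (lev2 T j i)"
  shows "four \<chi>1 (lev (quo T') (eps T i) (eps T j)) (v1 (eps T j) (eps T i)) (mono_pull (level T j i) f) =
    epi_push (level T' i j) (four \<chi>2 (lev2 T' i j) (v2 j i) f) (v3' (gam T i) (gam T j))"
  using four_mono_pull[OF dual_triples_tpair[OF ji], of f "v1 (eps T j) (eps T i)" "v3 (gam T j) (gam T i)" "v3' (gam T i) (gam T j)"] f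
    dual_triples_meas[OF ji] dual_triples_prod[OF ji] by (simp add: dual_triples_idx)

lemma lev_four_epi_pull:
  assumes cf: "cfsys (sub T) v1" and ji: "(j, i) \<in> le2 T" and g: "g \<in> test_fun (lev3 T j i)"
  shows "four \<chi>2 (lev2 T' i j) (v2 j i) (epi_pull (level T j i) g) =
    mono_push (level T' i j) (four \<chi>3 (lev (sub T') (gam T i) (gam T j)) (v3 (gam T j) (gam T i)) g)"
  using four_epi_pull[OF dual_triples_tpair[OF ji], of "v1 (eps T j) (eps T i)" "v3 (gam T j) (gam T i)" g] g
    dual_triples_meas[OF ji] dual_triples_prod[OF ji] cf nice3_eps[OF dual_triples_nice(1) ji]
  by (simp add: dual_triples_idx cfsys_def)

lemma lev_epi_push_test_fun:
  assumes ji: "(j, i) \<in> le2 T" and f: "f \<in> test_fun (lev2 T j i)"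
  shows "epi_push (level T j i) f (v1 (eps T j) (eps T i)) \<in> test_fun (lev3 T j i)"
  using epi_push_test_fun[OF nice3_adm[OF dual_triples_nice(1) ji], of f] f dual_triples_meas[OF ji] by simp

lemma lev_mono_pull_test_fun:
  assumes ji: "(j, i) \<in> le2 T" and f: "f \<in> test_fun (lev2 T j i)"
  shows "mono_pull (level T j i) f \<in> test_fun (lev1 T j i)"
  using mono_pull_test_fun[OF nice3_adm[OF dual_triples_nice(1) ji], of f] f by simp

lemma lev_epi_pull_test_fun:
  assumes cf: "cfsys (sub T) v1" and ji: "(j, i) \<in> le2 T" and g: "g \<in> test_fun (lev3 T j i)"
  shows "epi_pull (level T j i) g \<in> test_fun (lev2 T j i)"
  using epi_pull_test_fun[OF nice3_adm[OF dual_triples_nice(1) ji], of g] g cf nice3_eps[OF dual_triples_nice(1) ji]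
  by (simp add: cfsys_def)

lemma lev_mono_push_test_fun:
  assumes df: "dfsys (quo T) v3" and ji: "(j, i) \<in> le2 T" and f: "f \<in> test_fun (lev1 T j i)"
  shows "mono_push (level T j i) f \<in> test_fun (lev2 T j i)"
  using mono_push_test_fun[OF nice3_adm[OF dual_triples_nice(1) ji], of f] f df nice3_gam[OF dual_triples_nice(1) ji]
  by (simp add: dfsys_def)

end

text \<open>Dual to \<open>lev_four_epi_pull\<close>, by Fourier inversion.\<close>

lemma lev_four_mono_push:
  assumes D: "dual_triples T T' \<chi>1 \<chi>2 \<chi>3 v1 v1' v2 v2' v3 v3'"
    and df: "dfsys (quo T) v3" and ji: "(j, i) \<in> le2 T" and f: "f \<in> test_fun (lev1 T j i)"
  shows "four \<chi>2 (lev2 T' i j) (v2 j i) (mono_push (level T j i) f) =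
    epi_pull (level T' i j) (four \<chi>1 (lev (quo T') (eps T i) (eps T j)) (v1 (eps T j) (eps T i)) f)"
    (is "_ = epi_pull _ ?g")
proof -
  note S = dual_triples_sys[OF D] and N = dual_triples_nice[OF D] and I = dual_triples_idx[OF D]
  note e = nice3_eps[OF N(1) ji]
  have ij: "(i, j) \<in> le2 T'" "(eps T i, eps T j) \<in> le (quo T')" using ji e dual_sys_le[OF S(1)] by (simp_all add: I)
  have cf: "cfsys (sub T') v3'" by (rule dual_dfsys[OF S(3) df])
  have g: "?g \<in> test_fun (lev (quo T') (eps T i) (eps T j))" by (rule sys_four_test_fun[OF S(1) e f])
  have f': "four (\<lambda>w v. \<chi>1 v w) (lev1 T j i) (v1' (eps T i) (eps T j)) ?g = (\<lambda>x. f (- x))"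
    by (rule four_four[OF dual_sys_pairing[OF S(1) e] dual_sys_mdual[OF S(1) e] f])
  then have "(\<lambda>x. f (- x)) \<in> test_fun (lev1 T j i)"
    using sys_four_test_fun[OF dual_sys_sym[OF S(1)] ij(2) g] by simp
  note u = mono_push_uminus[OF nice3_adm[OF N(1) ji], simplified, OF f this]
  have h: "mono_push (level T j i) f \<in> test_fun (lev2 T j i)" by (rule lev_mono_push_test_fun[OF D df ji f])
  show ?thesis
  proof (rule sys_four_inj[OF dual_sys_sym[OF S(2)] ij(1)])
    show "four \<chi>2 (lev2 T' i j) (v2 j i) (mono_push (level T j i) f) \<in> test_fun (lev2 T' i j)"
      by (rule sys_four_test_fun[OF S(2) ji h])
    show "epi_pull (level T' i j) ?g \<in> test_fun (lev2 T' i j)"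
      using lev_epi_pull_test_fun[OF dual_triples_sym[OF D] cf ij(1)] g by (simp add: I)
    show "four (\<lambda>w v. \<chi>2 v w) (lev2 T j i) (v2' i j) (four \<chi>2 (lev2 T' i j) (v2 j i) (mono_push (level T j i) f)) =
        four (\<lambda>w v. \<chi>2 v w) (lev2 T j i) (v2' i j) (epi_pull (level T' i j) ?g)"
      using lev_four_epi_pull[OF dual_triples_sym[OF D] cf ij(1)] g four_four[OF dual_sys_pairing[OF S(2) ji] dual_sys_mdual[OF S(2) ji] h]
      by (simp add: I f' u)
  qed
qed

context
  fixes T T' \<chi>1 \<chi>2 \<chi>3 v1 v1' v2 v2' v3 v3' l j i
  assumes D: "dual_triples T T' \<chi>1 \<chi>2 \<chi>3 v1 v1' v2 v2' v3 v3'"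
    and lj: "(l, j) \<in> le2 T" and ji: "(j, i) \<in> le2 T"
begin

private lemma li: "(l, i) \<in> le2 T"
  using le_trans[OF nice3_nice2(2)[OF dual_triples_nice(1)[OF D]] lj ji] .

private lemma le': "(j, l) \<in> le2 T'" "(i, j) \<in> le2 T'"
  using lj ji by (simp_all add: dual_triples_idx(3)[OF D])

lemma epi_push_ps_comm:
  assumes f: "f \<in> test_fun (lev2 T l i)"
  shows "ps (quo T) v3 (gam T l) (gam T j) (gam T i) (epi_push (level T l i) f (v1 (eps T l) (eps T i))) =
    epi_push (level T j i) (ps (mid T) v2 l j i f) (v1 (eps T j) (eps T i))"
proof -
  note S = dual_triples_sys[OF D] and N = dual_triples_nice[OF D]
  note gl = nice3_gam[OF N(1) lj] and gj = nice3_gam[OF N(1) ji]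
  note b = lev_epi_push_test_fun[OF D li f]
  note p = ps_test_fun[OF dual_sys_nice(1)[OF S(2)] dual_sys_msys(1)[OF S(2)] lj ji f]
  show ?thesis
  proof (rule sys_four_inj[OF S(3) gj])
    show "ps (quo T) v3 (gam T l) (gam T j) (gam T i) (epi_push (level T l i) f (v1 (eps T l) (eps T i))) \<in> test_fun (lev3 T j i)"
      by (rule ps_test_fun[OF dual_sys_nice(1)[OF S(3)] dual_sys_msys(1)[OF S(3)] gl gj b])
    show "epi_push (level T j i) (ps (mid T) v2 l j i f) (v1 (eps T j) (eps T i)) \<in> test_fun (lev3 T j i)"
      by (rule lev_epi_push_test_fun[OF D ji p])
  qed (simp add: four_ps[OF S(3) gl gj b] lev_four_epi_push[OF D li f] lev_four_epi_push[OF D ji p]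
      four_ps[OF S(2) lj ji f] mono_pull_rs_comm[OF N(2) le'(2,1)] dual_triples_idx[OF D])
qed

text \<open>After the transform this is \<open>epi_push_rs_comm\<close> for \<open>T'\<close>. The
  normalisation needed there holds because \<open>uptriv\<close> on the quotient of \<open>T\<close>
  is dual to \<open>lowtriv\<close> on the sub of \<open>T'\<close>.\<close>

lemma mono_pull_ps_comm:
  assumes z: "uptriv (quo T) v3 (gam T k)" and k: "(j, k) \<in> le2 T" "(k, i) \<in> le2 T"
    and f: "f \<in> test_fun (lev2 T l i)"
  shows "ps (sub T) v1 (eps T l) (eps T j) (eps T i) (mono_pull (level T l i) f) = mono_pull (level T j i) (ps (mid T) v2 l j i f)"
proof -
  note S = dual_triples_sys[OF D] and N = dual_triples_nice[OF D]
  note el = nice3_eps[OF N(1) lj] and ej = nice3_eps[OF N(1) ji]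
  note b = lev_mono_pull_test_fun[OF D li f]
  note p = ps_test_fun[OF dual_sys_nice(1)[OF S(2)] dual_sys_msys(1)[OF S(2)] lj ji f]
  have z': "lowtriv (sub T') v3' (eps T' k)" using dual_uptriv[OF S(3) z] by (simp add: dual_triples_idx[OF D])
  have k': "(i, k) \<in> le2 T'" "(k, j) \<in> le2 T'" using k by (simp_all add: dual_triples_idx(3)[OF D])
  note F = sys_four_test_fun[OF S(2) li f]
  show ?thesis
  proof (rule sys_four_inj[OF S(1) ej])
    show "ps (sub T) v1 (eps T l) (eps T j) (eps T i) (mono_pull (level T l i) f) \<in> test_fun (lev1 T j i)"
      by (rule ps_test_fun[OF dual_sys_nice(1)[OF S(1)] dual_sys_msys(1)[OF S(1)] el ej b])
    show "mono_pull (level T j i) (ps (mid T) v2 l j i f) \<in> test_fun (lev1 T j i)"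
      by (rule lev_mono_pull_test_fun[OF D ji p])
  qed (use epi_push_rs_comm[OF N(2) le'(2,1) dual_sys_msys(2)[OF S(3)] z' k' F] in
      \<open>simp add: four_ps[OF S(1) el ej b] lev_four_mono_pull[OF D li f] lev_four_mono_pull[OF D ji p]
        four_ps[OF S(2) lj ji f] dual_triples_idx[OF D]\<close>)
qed

lemma epi_pull_ps_comm:
  assumes cf: "cfsys (sub T) v1" and g: "g \<in> test_fun (lev3 T l i)"
  shows "ps (mid T) v2 l j i (epi_pull (level T l i) g) = epi_pull (level T j i) (ps (quo T) v3 (gam T l) (gam T j) (gam T i) g)"
proof -
  note S = dual_triples_sys[OF D] and N = dual_triples_nice[OF D]
  note gl = nice3_gam[OF N(1) lj] and gj = nice3_gam[OF N(1) ji]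
  note b = lev_epi_pull_test_fun[OF D cf li g]
  note p = ps_test_fun[OF dual_sys_nice(1)[OF S(3)] dual_sys_msys(1)[OF S(3)] gl gj g]
  note F = sys_four_test_fun[OF S(3) nice3_gam[OF N(1) li] g]
  show ?thesis
  proof (rule sys_four_inj[OF S(2) ji])
    show "ps (mid T) v2 l j i (epi_pull (level T l i) g) \<in> test_fun (lev2 T j i)"
      by (rule ps_test_fun[OF dual_sys_nice(1)[OF S(2)] dual_sys_msys(1)[OF S(2)] lj ji b])
    show "epi_pull (level T j i) (ps (quo T) v3 (gam T l) (gam T j) (gam T i) g) \<in> test_fun (lev2 T j i)"
      by (rule lev_epi_pull_test_fun[OF D cf ji p])
  qed (use mono_push_rs_comm[OF N(2) le'(2,1), of "four \<chi>3 (lev (sub T') (gam T i) (gam T l)) (v3 (gam T l) (gam T i)) g"] F in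
      \<open>simp add: four_ps[OF S(2) lj ji b] lev_four_epi_pull[OF D cf li g] lev_four_epi_pull[OF D cf ji p]
        four_ps[OF S(3) gl gj g] dual_triples_idx[OF D]\<close>)
qed

lemma mono_push_ps_comm:
  assumes df: "dfsys (quo T) v3" and f: "f \<in> test_fun (lev1 T l i)"
  shows "ps (mid T) v2 l j i (mono_push (level T l i) f) = mono_push (level T j i) (ps (sub T) v1 (eps T l) (eps T j) (eps T i) f)"
proof -
  note S = dual_triples_sys[OF D] and N = dual_triples_nice[OF D]
  note el = nice3_eps[OF N(1) lj] and ej = nice3_eps[OF N(1) ji]
  note b = lev_mono_push_test_fun[OF D df li f]
  note p = ps_test_fun[OF dual_sys_nice(1)[OF S(1)] dual_sys_msys(1)[OF S(1)] el ej f]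
  show ?thesis
  proof (rule sys_four_inj[OF S(2) ji])
    show "ps (mid T) v2 l j i (mono_push (level T l i) f) \<in> test_fun (lev2 T j i)"
      by (rule ps_test_fun[OF dual_sys_nice(1)[OF S(2)] dual_sys_msys(1)[OF S(2)] lj ji b])
    show "mono_push (level T j i) (ps (sub T) v1 (eps T l) (eps T j) (eps T i) f) \<in> test_fun (lev2 T j i)"
      by (rule lev_mono_push_test_fun[OF D df ji p])
  qed (use epi_pull_rs_comm[OF N(2) le'(2,1)] in
      \<open>simp add: four_ps[OF S(2) lj ji b] lev_four_mono_push[OF D df li f] lev_four_mono_push[OF D df ji p]
        four_ps[OF S(1) el ej f] dual_triples_idx[OF D]\<close>)
qed

end

section \<open>Coordinates on virtual measures\<close>

lemma lim_class_eqI: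
  assumes x: "x \<in> S" and closed: "\<And>y z. (y, z) \<in> R ==> y \<in> S \<longleftrightarrow> z \<in> S"
    and conn: "\<And>y. y \<in> S ==> (x, y) \<in> (R \<union> R\<inverse>)\<^sup>*"
  shows "lim_class R x = S"
proof -
  have "y \<in> S" if "(x, y) \<in> (R \<union> R\<inverse>)\<^sup>*" for y
    using that by (induction rule: rtrancl_induct) (use x closed in auto)
  then show ?thesis using conn by (auto simp: lim_class_def)
qed

text \<open>The virtual measure of coordinate \<open>c\<close>, as the full set of its
  representatives: at a stage \<open>l\<close> it sends \<open>v l i\<close> to \<open>c\<close>
  times \<open>v l j\<close>. By \<open>vm_class_cvm\<close> these sets are exactly the classes of
  the inductive limit.\<close>

definition "cvm E v i j c = {(l, h). (l, h) \<in> vm_stage E i j \<and> h (v l i) = (\<lambda>f. c * v l j f)}"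

lemma scale_eq_iff:
  fixes m :: "'x \<Rightarrow> complex"
  assumes "m \<noteq> 0"
  shows "(\<lambda>f. c * m f) = (\<lambda>f. d * m f) \<longleftrightarrow> c = d"
proof
  obtain f where "m f \<noteq> 0" using assms by (auto simp: fun_eq_iff)
  moreover assume "(\<lambda>f. c * m f) = (\<lambda>f. d * m f)"
  ultimately show "c = d" by (metis mult_right_cancel)
qed simp

lemma meas_hom_scale:
  "h \<in> meas_hom E i j l ==> a \<in> meas (lev E l i) ==> h (\<lambda>f. c * a f) = (\<lambda>f. c * h a f)"
  by (simp add: meas_hom_def)

context
  fixes E v
  assumes E: "nice2 E" and v: "msys E v"
begin

lemma msys_coord:
  assumes "(l, i) \<in> le E" "a \<in> meas (lev E l i)"
  obtains x where "a = (\<lambda>f. x * v l i f)"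
  using meas_multiple[OF lev_tower[OF E assms(1)] msys_meas[OF v assms(1)] msys_nonzero[OF v assms(1)] assms(2)] by blast

lemma meas_hom_ext:
  assumes "(l, i) \<in> le E" "h \<in> meas_hom E i j l" "h' \<in> meas_hom E i j l" "h (v l i) = h' (v l i)"
  shows "h = h'"
proof
  fix a show "h a = h' a"
  proof (cases "a \<in> meas (lev E l i)")
    case True
    then obtain x where "a = (\<lambda>f. x * v l i f)" using msys_coord assms(1) by blast
    then show ?thesis
      using meas_hom_scale[OF assms(2) msys_meas[OF v assms(1)], of x]
        meas_hom_scale[OF assms(3) msys_meas[OF v assms(1)], of x] assms(4) by simp
  qed (use assms in \<open>simp add: meas_hom_def\<close>)
qed

lemma meas_hom_exists:
  assumes le: "(l, i) \<in> le E" "(l, j) \<in> le E"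
  shows "\<exists>h\<in>meas_hom E i j l. h (v l i) = (\<lambda>f. c * v l j f)"
proof -
  note nz = msys_nonzero[OF v le(1)]
  define h where "h a = (if a \<in> meas (lev E l i) then (\<lambda>f. (THE x. a = (\<lambda>f. x * v l i f)) * c * v l j f) else 0)" for a
  have h: "h (\<lambda>f. x * v l i f) = (\<lambda>f. x * c * v l j f)" for x
    using meas_scale[OF msys_meas[OF v le(1)]] scale_eq_iff[OF nz] by (simp add: h_def)
  have "h \<in> meas_hom E i j l"
    unfolding meas_hom_def
  proof (intro CollectI conjI ballI allI impI)
    fix a assume "a \<in> meas (lev E l i)"
    then obtain x where x: "a = (\<lambda>f. x * v l i f)" using msys_coord[OF le(1)] by blast
    then show "h a \<in> meas (lev E l j)" using h meas_scale[OF msys_meas[OF v le(2)]] by simp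
    show "h (\<lambda>f. d * a f) = (\<lambda>f. d * h a f)" for d
      using h[of "d * x"] h[of x] by (simp add: x mult.assoc)
    fix b assume "b \<in> meas (lev E l i)"
    then obtain y where y: "b = (\<lambda>f. y * v l i f)" using msys_coord[OF le(1)] by blast
    have "a + b = (\<lambda>f. (x + y) * v l i f)" by (auto simp: x y distrib_right)
    then have "h (a + b) = (\<lambda>f. (x + y) * c * v l j f)" by (simp only: h)
    also have "\<dots> = h a + h b" unfolding x y h by (simp add: fun_eq_iff distrib_right)
    finally show "h (a + b) = h a + h b" .
  qed (simp add: h_def)
  moreover have "h (v l i) = (\<lambda>f. c * v l j f)" using h[of 1] by simp
  ultimately show ?thesis by blast
qed

lemma cvm_stage: "(l, h) \<in> cvm E v i j c ==> (l, i) \<in> le E \<and> (l, j) \<in> le E \<and> h \<in> meas_hom E i j l"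
  by (simp add: cvm_def vm_stage_def)

lemma cvm_apply: "(l, h) \<in> cvm E v i j c ==> h (\<lambda>f. x * v l i f) = (\<lambda>f. x * c * v l j f)"
  using cvm_stage[of l h i j c] meas_hom_scale[of h E i j l "v l i" x] msys_meas[OF v, of l i]
  by (simp add: cvm_def mult.assoc)

lemma cvm_exists:
  assumes "(l, i) \<in> le E" "(l, j) \<in> le E"
  shows "\<exists>h. (l, h) \<in> cvm E v i j c"
  using meas_hom_exists[OF assms] assms by (auto simp: cvm_def vm_stage_def)

lemma cvm_unique: "(l, h) \<in> cvm E v i j c ==> (l, h') \<in> cvm E v i j c ==> h = h'"
  using meas_hom_ext[of l i h j h'] by (auto simp: cvm_def vm_stage_def)

lemma vm_stage_cvm:
  assumes "(l, h) \<in> vm_stage E i j"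
  shows "\<exists>c. (l, h) \<in> cvm E v i j c"
proof -
  have le: "(l, i) \<in> le E" "(l, j) \<in> le E" and h: "h \<in> meas_hom E i j l" using assms by (auto simp: vm_stage_def)
  have "h (v l i) \<in> meas (lev E l j)" using h msys_meas[OF v le(1)] by (simp add: meas_hom_def)
  then obtain x where "h (v l i) = (\<lambda>f. x * v l j f)" using msys_coord[OF le(2)] by blast
  then show ?thesis using assms by (auto simp: cvm_def)
qed

lemma cvm_disjoint:
  assumes "(l, h) \<in> cvm E v i j c" "(l, h) \<in> cvm E v i j d"
  shows "c = d"
  using assms scale_eq_iff[OF msys_nonzero[OF v, of l j]] by (auto simp: cvm_def vm_stage_def)

lemma meas_prod_coord:
  assumes "(l, j) \<in> le E" "(j, i) \<in> le E"
  shows "meas_prod (lev_triple E l j i) (\<lambda>f. x * v l j f) (\<lambda>f. y * v j i f) = (\<lambda>f. x * y * v l i f)"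
  using meas_prod_scale_left[OF lev_adm[OF E assms], of "v l j" "\<lambda>f. y * v j i f" x]
    meas_prod_scale_right[OF lev_adm[OF E assms], of "v l j" "v j i" y] msys_meas[OF v assms(1)]
    msys_meas[OF v assms(2)] meas_scale[OF msys_meas[OF v assms(2)]] msys_mult[OF v assms]
  by (simp add: mult.assoc)

text \<open>A transition tensors with a measure on F(l)/F(l'), and \<open>v\<close> is
  multiplicative, so the coordinate is the same at both stages. This makes the coordinate an
  invariant of the class.\<close>

lemma vm_trans_iff:
  assumes s: "(l, h) \<in> cvm E v i j c" "(l', h') \<in> cvm E v i j d" and le: "(l', l) \<in> le E"
  shows "((l, h), (l', h')) \<in> vm_trans E i j \<longleftrightarrow> c = d"
proof
  have li: "(l, i) \<in> le E" "(l, j) \<in> le E" "(l', i) \<in> le E" "(l', j) \<in> le E" using s cvm_stage by blast+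
  {
    assume "((l, h), (l', h')) \<in> vm_trans E i j"
    then have "h' (meas_prod (lev_triple E l' l i) (v l' l) (v l i)) = meas_prod (lev_triple E l' l j) (v l' l) (h (v l i))"
      using msys_meas[OF v le] msys_meas[OF v li(1)] by (simp add: vm_trans_def)
    then have "(\<lambda>f. d * v l' j f) = (\<lambda>f. c * v l' j f)"
      using msys_mult[OF v le li(1)] s meas_prod_coord[OF le li(2), of 1 c] by (simp add: cvm_def)
    then show "c = d" using scale_eq_iff[OF msys_nonzero[OF v li(4)]] by simp
  }
  assume "c = d"
  have "h' (meas_prod (lev_triple E l' l i) b a) = meas_prod (lev_triple E l' l j) b (h a)"
    if a: "a \<in> meas (lev E l i)" and b: "b \<in> meas (lev E l' l)" for a b
  proof -
    obtain x where "a = (\<lambda>f. x * v l i f)" using msys_coord[OF li(1) a] .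
    moreover obtain y where "b = (\<lambda>f. y * v l' l f)" using msys_coord[OF le b] .
    ultimately show ?thesis
      using meas_prod_coord[OF le li(1), of y x] meas_prod_coord[OF le li(2), of y "x * c"] cvm_apply[OF s(1), of x]
        cvm_apply[OF s(2), of "y * x"] \<open>c = d\<close> by (simp add: mult.assoc)
  qed
  then show "((l, h), (l', h')) \<in> vm_trans E i j" using s le by (simp add: vm_trans_def cvm_def)
qed

lemma vm_class_cvm:
  assumes lh: "(l, h) \<in> cvm E v i j c"
  shows "vm_class E i j l h = cvm E v i j c"
proof (rule lim_class_eqI[OF lh])
  fix y z assume yz: "(y, z) \<in> vm_trans E i j"
  obtain l1 h1 l2 h2 where [simp]: "y = (l1, h1)" "z = (l2, h2)" by (cases y, cases z)
  have s: "(l1, h1) \<in> vm_stage E i j" "(l2, h2) \<in> vm_stage E i j" and le: "(l2, l1) \<in> le E"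
    using yz by (auto simp: vm_trans_def)
  obtain d e where de: "(l1, h1) \<in> cvm E v i j d" "(l2, h2) \<in> cvm E v i j e" using vm_stage_cvm s by meson
  then have "d = e" using vm_trans_iff[OF de le] yz by simp
  then show "y \<in> cvm E v i j c \<longleftrightarrow> z \<in> cvm E v i j c"
    using de cvm_disjoint[of l1 h1 i j d c] cvm_disjoint[of l2 h2 i j e c] by auto
next
  fix y assume y: "y \<in> cvm E v i j c"
  obtain l' h' where y': "y = (l', h')" by (cases y)
  have le: "(l, i) \<in> le E" "(l', i) \<in> le E" using lh y cvm_stage by (auto simp: y')
  \<comment> \<open>The stages \<open>l\<close> and \<open>l'\<close> may be incomparable; both
    representatives are related to the one at a common lower stage.\<close>
  obtain k where k: "(k, l) \<in> le E" "(k, l') \<in> le E" using le_lower[OF E] le_idx[OF E] le by metis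
  have "(k, i) \<in> le E" "(k, j) \<in> le E" using le_trans[OF E k(1)] lh cvm_stage by blast+
  then obtain g where g: "(k, g) \<in> cvm E v i j c" using cvm_exists by blast
  have "((l, h), (k, g)) \<in> vm_trans E i j" "((l', h'), (k, g)) \<in> vm_trans E i j"
    using vm_trans_iff[OF lh g k(1)] vm_trans_iff[OF _ g k(2)] y by (simp_all add: y')
  then show "((l, h), y) \<in> (vm_trans E i j \<union> (vm_trans E i j)\<inverse>)\<^sup>*"
    unfolding y' by (meson UnI1 UnI2 converse_iff rtrancl.rtrancl_refl rtrancl_into_rtrancl)
qed

lemma vmeas_cvm:
  assumes "i \<in> idx E" "j \<in> idx E"
  shows "vmeas E i j = range (cvm E v i j)"
proof (intro equalityI subsetI)
  fix \<kappa> assume "\<kappa> \<in> vmeas E i j"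
  then obtain l h where lh: "(l, h) \<in> vm_stage E i j" "\<kappa> = vm_class E i j l h" by (auto simp: vmeas_def)
  then show "\<kappa> \<in> range (cvm E v i j)" using vm_stage_cvm[OF lh(1)] vm_class_cvm by auto
next
  fix \<kappa> assume "\<kappa> \<in> range (cvm E v i j)"
  then obtain c where c: "\<kappa> = cvm E v i j c" by blast
  obtain l where "(l, i) \<in> le E" "(l, j) \<in> le E" using le_lower[OF E assms] .
  then obtain h where h: "(l, h) \<in> cvm E v i j c" using cvm_exists by blast
  then have "(l, h) \<in> vm_stage E i j" by (simp add: cvm_def)
  then show "\<kappa> \<in> vmeas E i j" unfolding vmeas_def c vm_class_cvm[OF h, symmetric] by blast
qed

lemma cvm_in_vmeas: "i \<in> idx E ==> j \<in> idx E ==> cvm E v i j c \<in> vmeas E i j"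
  using vmeas_cvm by blast

lemma cvm_eq_iff:
  assumes "i \<in> idx E" "j \<in> idx E"
  shows "cvm E v i j c = cvm E v i j d \<longleftrightarrow> c = d"
proof
  obtain l where "(l, i) \<in> le E" "(l, j) \<in> le E" using le_lower[OF E assms] .
  then obtain h where h: "(l, h) \<in> cvm E v i j c" using cvm_exists by blast
  assume "cvm E v i j c = cvm E v i j d"
  then show "c = d" using h cvm_disjoint by metis
qed simp

lemma vm_scale_cvm: "vm_scale d (cvm E v i j c) = cvm E v i j (d * c)"
proof (intro equalityI subsetI)
  have scale: "(l, \<lambda>a f. d * h a f) \<in> cvm E v i j (d * c)" if h: "(l, h) \<in> cvm E v i j c" for l h
  proof -
    have hh: "h \<in> meas_hom E i j l" using cvm_stage[OF h] by blast
    have "(\<lambda>a f. d * h a f) \<in> meas_hom E i j l"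
      using hh by (auto simp: meas_hom_def meas_scale fun_eq_iff algebra_simps)
    then show ?thesis using h by (simp add: cvm_def vm_stage_def mult.assoc)
  qed
  fix x
  {
    assume "x \<in> vm_scale d (cvm E v i j c)"
    then show "x \<in> cvm E v i j (d * c)" using scale by (auto simp: vm_scale_def)
  }
  assume x: "x \<in> cvm E v i j (d * c)"
  obtain l g where [simp]: "x = (l, g)" by (cases x)
  obtain h where h: "(l, h) \<in> cvm E v i j c" using cvm_exists[of l i j c] cvm_stage[of l g i j] x by auto
  then have "g = (\<lambda>a f. d * h a f)" using cvm_unique[OF _ scale[OF h]] x by simp
  then show "x \<in> vm_scale d (cvm E v i j c)" using h by (force simp: vm_scale_def)
qed

lemma vm_comp_cvm:
  assumes "i \<in> idx E" "j \<in> idx E" "k \<in> idx E"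
  shows "vm_comp E i j k (cvm E v i j c) (cvm E v j k d) = cvm E v i k (c * d)"
proof -
  have *: "vm_class E i k l (h' \<circ> h) = cvm E v i k (c * d)"
    if h: "(l, h) \<in> cvm E v i j c" and h': "(l, h') \<in> cvm E v j k d" for l h h'
  proof (rule vm_class_cvm)
    have m: "h \<in> meas_hom E i j l" "h' \<in> meas_hom E j k l" and le: "(l, i) \<in> le E" "(l, k) \<in> le E"
      using cvm_stage h h' by blast+
    \<comment> \<open>Maps in \<open>meas_hom\<close> are \<open>0\<close> outside their source. For
      the composite this requires that the second map send the default value \<open>0\<close> of the
      first to \<open>0\<close>.\<close>
    have z: "h' 0 = 0" using meas_hom_scale[OF m(2), of 0 0] zero_meas[of "lev E l j"]
      by (simp add: zero_fun_def)
    have "h' \<circ> h \<in> meas_hom E i k l"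
      unfolding meas_hom_def
    proof (intro CollectI conjI ballI allI impI)
      fix a assume a: "a \<in> meas (lev E l i)"
      have ha: "h a \<in> meas (lev E l j)" using m(1) a by (simp add: meas_hom_def)
      then show "(h' \<circ> h) a \<in> meas (lev E l k)" using m(2) by (simp add: meas_hom_def)
      show "(h' \<circ> h) (\<lambda>f. e * a f) = (\<lambda>f. e * (h' \<circ> h) a f)" for e
        using meas_hom_scale[OF m(1) a] meas_hom_scale[OF m(2) ha] by simp
      fix b assume b: "b \<in> meas (lev E l i)"
      have hb: "h b \<in> meas (lev E l j)" using m(1) b by (simp add: meas_hom_def)
      have "h (a + b) = h a + h b" using m(1) a b unfolding meas_hom_def by blast
      moreover have "h' (h a + h b) = h' (h a) + h' (h b)" using m(2) ha hb unfolding meas_hom_def by blast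
      ultimately show "(h' \<circ> h) (a + b) = (h' \<circ> h) a + (h' \<circ> h) b" by simp
    next
      fix a assume "a \<notin> meas (lev E l i)"
      then show "(h' \<circ> h) a = 0" using m(1) z by (simp add: meas_hom_def)
    qed
    moreover have "(h' \<circ> h) (v l i) = (\<lambda>f. c * d * v l k f)"
      using cvm_apply[OF h, of 1] cvm_apply[OF h', of c] by simp
    ultimately show "(l, h' \<circ> h) \<in> cvm E v i k (c * d)" using le by (simp add: cvm_def vm_stage_def)
  qed
  obtain l0 where l0: "(l0, i) \<in> le E" "(l0, j) \<in> le E" using le_lower[OF E assms(1,2)] .
  obtain l where l: "(l, l0) \<in> le E" "(l, k) \<in> le E" using le_lower[OF E le_idx(1)[OF E l0(1)] assms(3)] .
  have le: "(l, i) \<in> le E" "(l, j) \<in> le E" using le_trans[OF E l(1)] l0 by blast+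
  obtain h h' where "(l, h) \<in> cvm E v i j c" "(l, h') \<in> cvm E v j k d" using cvm_exists le l(2) by meson
  then show ?thesis unfolding vm_comp_def using * by (intro the_equality) blast+
qed

lemma vm_one_cvm: assumes "i \<in> idx E" shows "vm_one E i = cvm E v i i 1"
  unfolding vm_one_def
proof (rule vm_class_cvm)
  have ii: "(i, i) \<in> le E" using le_refl[OF E assms] .
  have "(\<lambda>a. if a \<in> meas (lev E i i) then a else 0) \<in> meas_hom E i i i"
    by (auto simp: meas_hom_def meas_add meas_scale)
  then show "(i, \<lambda>a. if a \<in> meas (lev E i i) then a else 0) \<in> cvm E v i i 1"
    using ii msys_meas[OF v ii] by (simp add: cvm_def vm_stage_def)
qed

lemma vm_inv_cvm:
  assumes "i \<in> idx E" "j \<in> idx E" "c \<noteq> 0"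
  shows "vm_inv E i j (cvm E v i j c) = cvm E v j i (inverse c)"
  unfolding vm_inv_def
proof (rule the_equality)
  show "cvm E v j i (inverse c) \<in> vmeas E j i \<and> vm_comp E i j i (cvm E v i j c) (cvm E v j i (inverse c)) = vm_one E i"
    using assms by (simp add: cvm_in_vmeas vm_comp_cvm vm_one_cvm)
  fix \<kappa> assume \<kappa>: "\<kappa> \<in> vmeas E j i \<and> vm_comp E i j i (cvm E v i j c) \<kappa> = vm_one E i"
  then obtain d where d: "\<kappa> = cvm E v j i d" using vmeas_cvm assms by blast
  then have "c * d = 1" using \<kappa> assms by (simp add: vm_comp_cvm vm_one_cvm cvm_eq_iff)
  then show "\<kappa> = cvm E v j i (inverse c)" unfolding d by (simp add: inverse_unique)
qed

lemma vm_of_cvm: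
  assumes ij: "(i, j) \<in> le E"
  shows "vm_of E i j (\<lambda>f. c * v i j f) = cvm E v i j c"
proof -
  have *: "vm_class E i j l (\<lambda>a. if a \<in> meas (lev E l i) then meas_prod (lev_triple E l i j) a (\<lambda>f. c * v i j f) else 0)
      = cvm E v i j c" (is "vm_class E i j l ?h = _") if li: "(l, i) \<in> le E" for l
  proof (rule vm_class_cvm)
    have lj: "(l, j) \<in> le E" using le_trans[OF E li ij] .
    obtain h where h: "(l, h) \<in> cvm E v i j c" using cvm_exists[OF li lj] by blast
    have "?h = h"
    proof
      fix a
      show "?h a = h a"
      proof (cases "a \<in> meas (lev E l i)")
        case True
        then obtain x where "a = (\<lambda>f. x * v l i f)" using msys_coord[OF li] by blast
        then show ?thesis using True meas_prod_coord[OF li ij, of x c] cvm_apply[OF h, of x] by simp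
      next
        case False
        then show ?thesis using cvm_stage[OF h] by (simp add: meas_hom_def)
      qed
    qed
    then show "(l, ?h) \<in> cvm E v i j c" using h by simp
  qed
  show ?thesis unfolding vm_of_def using * le_refl[OF E] le_idx[OF E ij] by (intro the_equality) blast+
qed

lemma vm_of_cvm_one: "(i, j) \<in> le E ==> vm_of E i j (v i j) = cvm E v i j 1"
  using vm_of_cvm[of i j 1] by simp

lemma vm_triv_cvm:
  assumes ij: "i \<in> idx E" "j \<in> idx E" and u: "\<And>l i. (l, i) \<in> le E ==> unit_mass (lev E l i) (S (lev E l i)) = v l i"
  shows "vm_triv S E i j = cvm E v i j 1"
proof -
  have *: "vm_comp E i l j
          (vm_inv E l i (vm_of E l i (unit_mass (lev E l i) (S (lev E l i)))))
          (vm_of E l j (unit_mass (lev E l j) (S (lev E l j)))) = cvm E v i j 1"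
    if le: "(l, i) \<in> le E" "(l, j) \<in> le E" for l
    using le_idx[OF E le(1)] ij u[OF le(1)] u[OF le(2)] vm_of_cvm_one[OF le(1)] vm_of_cvm_one[OF le(2)]
    by (simp add: vm_inv_cvm vm_comp_cvm)
  obtain l where "(l, i) \<in> le E" "(l, j) \<in> le E" using le_lower[OF E ij] .
  then show ?thesis unfolding vm_triv_def using * by (intro the_equality) blast+
qed

end

lemma unit_mass_eq:
  assumes "tower E" "i \<in> idx E" "fil E i = S" "m \<in> meas E" "m (indicator S) = 1"
  shows "unit_mass E S = m"
  unfolding unit_mass_def using assms by (intro the_equality) (auto intro: meas_eqI)

text \<open>(M) multiplies coordinates because \<open>v2\<close> is the product of \<open>v1\<close>
  and \<open>v3\<close> on every level. The description of \<open>vm_prod\<close> works at a common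
  stage, which exists for all three spaces as the image of one index of the middle space.\<close>

lemma vm_prod_cvm:
  assumes D: "dual_triples T T' \<chi>1 \<chi>2 \<chi>3 v1 v1' v2 v2' v3 v3'" and ij: "i \<in> idx2 T" "j \<in> idx2 T"
  shows "vm_prod T i j (cvm (sub T) v1 (eps T i) (eps T j) c) (cvm (quo T) v3 (gam T i) (gam T j) d) =
    cvm (mid T) v2 i j (c * d)"
proof -
  note T = dual_triples_nice(1)[OF D] and S = dual_triples_sys[OF D]
  note N = nice3_nice2[OF T] and M = dual_sys_msys(1)[OF S(1)] dual_sys_msys(1)[OF S(2)] dual_sys_msys(1)[OF S(3)]
  have coord: "meas_prod (level T l i) (\<lambda>f. x * v1 (eps T l) (eps T i) f) (\<lambda>f. y * v3 (gam T l) (gam T i) f) =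
      (\<lambda>f. x * y * v2 l i f)" if li: "(l, i) \<in> le2 T" for l i x y
    using meas_prod_scale_left[OF nice3_adm[OF T li], of "v1 (eps T l) (eps T i)" "\<lambda>f. y * v3 (gam T l) (gam T i) f" x]
      meas_prod_scale_right[OF nice3_adm[OF T li], of "v1 (eps T l) (eps T i)" "v3 (gam T l) (gam T i)" y]
      msys_meas[OF M(1) nice3_eps[OF T li]] msys_meas[OF M(3) nice3_gam[OF T li]]
      meas_scale[OF msys_meas[OF M(3) nice3_gam[OF T li]]] dual_triples_prod[OF D li]
    by (simp add: mult.assoc)
  have *: "vm_class (mid T) i j l h2 = cvm (mid T) v2 i j (c * d)"
    if le: "(l, i) \<in> le2 T" "(l, j) \<in> le2 T" and h1: "(eps T l, h1) \<in> cvm (sub T) v1 (eps T i) (eps T j) c"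
      and h3: "(gam T l, h3) \<in> cvm (quo T) v3 (gam T i) (gam T j) d" and h2: "h2 \<in> meas_hom (mid T) i j l"
      and eq: "\<forall>a1\<in>meas (lev1 T l i). \<forall>a3\<in>meas (lev3 T l i).
           h2 (meas_prod (level T l i) a1 a3) = meas_prod (level T l j) (h1 a1) (h3 a3)" for l h1 h2 h3
  proof (rule vm_class_cvm[OF N(2) M(2)])
    have "h2 (v2 l i) = meas_prod (level T l j) (h1 (v1 (eps T l) (eps T i))) (h3 (v3 (gam T l) (gam T i)))"
      using eq msys_meas[OF M(1) nice3_eps[OF T le(1)]] msys_meas[OF M(3) nice3_gam[OF T le(1)]] dual_triples_prod[OF D le(1)]
      by metis
    also have "\<dots> = (\<lambda>f. c * d * v2 l j f)"
      using cvm_apply[OF N(1) M(1) h1, of 1] cvm_apply[OF N(3) M(3) h3, of 1] coord[OF le(2), of c d] by simp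
    finally show "(l, h2) \<in> cvm (mid T) v2 i j (c * d)" using le h2 by (simp add: cvm_def vm_stage_def)
  qed
  obtain l where le: "(l, i) \<in> le2 T" "(l, j) \<in> le2 T" using le_lower[OF N(2) ij] .
  obtain h1 where h1: "(eps T l, h1) \<in> cvm (sub T) v1 (eps T i) (eps T j) c"
    using cvm_exists[OF N(1) M(1)] nice3_eps[OF T] le by meson
  obtain h3 where h3: "(gam T l, h3) \<in> cvm (quo T) v3 (gam T i) (gam T j) d"
    using cvm_exists[OF N(3) M(3)] nice3_gam[OF T] le by meson
  obtain h2 where h2: "(l, h2) \<in> cvm (mid T) v2 i j (c * d)"
    using cvm_exists[OF N(2) M(2)] le by meson
  have "h2 (meas_prod (level T l i) a1 a3) = meas_prod (level T l j) (h1 a1) (h3 a3)"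
    if a: "a1 \<in> meas (lev1 T l i)" "a3 \<in> meas (lev3 T l i)" for a1 a3
  proof -
    obtain x where x: "a1 = (\<lambda>f. x * v1 (eps T l) (eps T i) f)"
      using msys_coord[OF N(1) M(1) nice3_eps[OF T le(1)] a(1)] .
    obtain y where y: "a3 = (\<lambda>f. y * v3 (gam T l) (gam T i) f)"
      using msys_coord[OF N(3) M(3) nice3_gam[OF T le(1)] a(2)] .
    show ?thesis
      using coord[OF le(1), of x y] coord[OF le(2), of "x * c" "y * d"] cvm_apply[OF N(1) M(1) h1, of x]
        cvm_apply[OF N(3) M(3) h3, of y] cvm_apply[OF N(2) M(2) h2, of "x * y"] by (simp add: x y algebra_simps)
  qed
  moreover have "h2 \<in> meas_hom (mid T) i j l" using h2 by (simp add: cvm_def vm_stage_def)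
  ultimately show ?thesis unfolding vm_prod_def using * le h1 h3 by (intro the_equality) blast+
qed

section \<open>Coordinates on tensors\<close>

text \<open>Coordinates on the tensor product with a line: the element of coordinate
  \<open>1\<close> is a basis, so every tensor is \<open>tf\<close> of exactly one test function
  (\<open>fun_level_tf\<close>, \<open>tf_inj\<close>). For distributions \<open>td\<close> plays
  this role, with the two members in the line exchanged.\<close>

definition "tf E v b i l f = fun_ten E b i l f (cvm E v l b 1)"

definition "td E v b i l G = dist_ten E b i l G (cvm E v b l 1)"

text \<open>The transpose of \<open>\<phi>\<close>. The value \<open>0\<close> outside the test
  functions is the convention made in \<open>distr\<close>.\<close>

definition "pull E \<phi> G = (\<lambda>f. if f \<in> test_fun E then G (\<phi> f) else 0)"

lemma distr_scaleI: "G \<in> distr E ==> (\<lambda>f. c * G f) \<in> distr E"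
  by (auto simp: distr_def algebra_simps)

context
  fixes E v
  assumes E: "nice2 E" and v: "msys E v"
begin

lemma tens_cvm:
  assumes "i \<in> idx E" "j \<in> idx E"
  shows "tens X (vmeas E i j) x (cvm E v i j c) = {(y, cvm E v i j d) | y d. y \<in> X \<and> (\<forall>p. c * x p = d * y p)}"
proof (intro equalityI subsetI)
  fix z assume "z \<in> tens X (vmeas E i j) x (cvm E v i j c)"
  then obtain y \<kappa> e a b where z: "z = (y, \<kappa>)" "y \<in> X" "e \<in> vmeas E i j" "cvm E v i j c = vm_scale a e" "\<kappa> = vm_scale b e"
    "\<forall>p. a * x p = b * y p"
    by (auto simp: tens_def)
  obtain t where t: "e = cvm E v i j t" using z(3) vmeas_cvm[OF E v assms] by blast
  have "c = a * t" using z(4) t assms by (simp add: vm_scale_cvm[OF E v] cvm_eq_iff[OF E v])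
  moreover have "\<kappa> = cvm E v i j (b * t)" using z(5) t by (simp add: vm_scale_cvm[OF E v])
  moreover have "a * t * x p = b * t * y p" for p using z(6) by (metis mult.assoc mult.commute)
  ultimately show "z \<in> {(y, cvm E v i j d) | y d. y \<in> X \<and> (\<forall>p. c * x p = d * y p)}" using z(1,2) by blast
next
  fix z assume "z \<in> {(y, cvm E v i j d) | y d. y \<in> X \<and> (\<forall>p. c * x p = d * y p)}"
  then obtain y d where z: "z = (y, cvm E v i j d)" "y \<in> X" "\<forall>p. c * x p = d * y p" by blast
  have "cvm E v i j c = vm_scale c (cvm E v i j 1)" "cvm E v i j d = vm_scale d (cvm E v i j 1)"
    by (simp_all add: vm_scale_cvm[OF E v])
  then show "z \<in> tens X (vmeas E i j) x (cvm E v i j c)"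
    unfolding tens_def using z cvm_in_vmeas[OF E v assms] by blast
qed

lemma fun_ten_cvm:
  assumes "l \<in> idx E" "b \<in> idx E"
  shows "fun_ten E b i l f (cvm E v l b c) = tf E v b i l (\<lambda>x. c * f x)"
  unfolding tf_def fun_ten_def tens_cvm[OF assms] by simp

lemma dist_ten_cvm:
  assumes "l \<in> idx E" "b \<in> idx E"
  shows "dist_ten E b i l G (cvm E v b l c) = td E v b i l (\<lambda>x. c * G x)"
  unfolding td_def dist_ten_def tens_cvm[OF assms(2,1)] by simp

lemma tf_inj:
  assumes "l \<in> idx E" "b \<in> idx E" "f \<in> lfun E l i" and eq: "tf E v b i l f = tf E v b i l g"
  shows "f = g"
proof -
  have "(f, cvm E v l b 1) \<in> tf E v b i l f" unfolding tf_def fun_ten_def tens_cvm[OF assms(1,2)] using assms(3) by auto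
  then have "(f, cvm E v l b 1) \<in> tf E v b i l g" by (simp only: eq)
  then obtain d where "cvm E v l b 1 = cvm E v l b d" "\<forall>p. 1 * g p = d * f p"
    unfolding tf_def fun_ten_def tens_cvm[OF assms(1,2)] by auto
  then show ?thesis using cvm_eq_iff[OF E v assms(1,2)] by auto
qed

lemma td_inj:
  assumes "l \<in> idx E" "b \<in> idx E" "G \<in> distr (lev E l i)" and eq: "td E v b i l G = td E v b i l H"
  shows "G = H"
proof -
  have "(G, cvm E v b l 1) \<in> td E v b i l G" unfolding td_def dist_ten_def tens_cvm[OF assms(2,1)] using assms(3) by auto
  then have "(G, cvm E v b l 1) \<in> td E v b i l H" by (simp only: eq)
  then obtain d where "cvm E v b l 1 = cvm E v b l d" "\<forall>p. 1 * H p = d * G p"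
    unfolding td_def dist_ten_def tens_cvm[OF assms(2,1)] by auto
  then show ?thesis using cvm_eq_iff[OF E v assms(2,1)] by auto
qed

lemma fun_level_tf:
  assumes "l \<in> idx E" "b \<in> idx E"
  shows "fun_level E b i l = tf E v b i l ` lfun E l i"
proof (intro equalityI subsetI)
  fix x assume "x \<in> fun_level E b i l"
  then obtain f \<kappa> where x: "x = fun_ten E b i l f \<kappa>" "f \<in> lfun E l i" "\<kappa> \<in> vmeas E l b"
    by (auto simp: fun_level_def)
  obtain c where "\<kappa> = cvm E v l b c" using x(3) vmeas_cvm[OF E v assms] by blast
  then show "x \<in> tf E v b i l ` lfun E l i"
    using x(1) test_fun_scale[OF x(2), of c] by (simp add: fun_ten_cvm[OF assms])
next
  fix x assume "x \<in> tf E v b i l ` lfun E l i"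
  then show "x \<in> fun_level E b i l" using cvm_in_vmeas[OF E v assms] by (auto simp: fun_level_def tf_def)
qed

lemma dist_level_td:
  assumes "l \<in> idx E" "b \<in> idx E"
  shows "dist_level E b i l = td E v b i l ` distr (lev E l i)"
proof (intro equalityI subsetI)
  fix x assume "x \<in> dist_level E b i l"
  then obtain G \<kappa> where x: "x = dist_ten E b i l G \<kappa>" "G \<in> distr (lev E l i)" "\<kappa> \<in> vmeas E b l"
    by (auto simp: dist_level_def)
  obtain c where "\<kappa> = cvm E v b l c" using x(3) vmeas_cvm[OF E v assms(2,1)] by blast
  then show "x \<in> td E v b i l ` distr (lev E l i)"
    using x(1) distr_scaleI[OF x(2), of c] by (simp add: dist_ten_cvm[OF assms])
next
  fix x assume "x \<in> td E v b i l ` distr (lev E l i)"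
  then show "x \<in> dist_level E b i l" using cvm_in_vmeas[OF E v assms(2,1)] by (auto simp: dist_level_def td_def)
qed

lemma level_pair_tf_td:
  assumes lb: "l \<in> idx E" "b \<in> idx E" and f: "f \<in> lfun E l i" and G: "G \<in> distr (lev E l i)"
  shows "level_pair E b i l (tf E v b i l f) (td E v b i l G) = G f"
  unfolding level_pair_def
proof (rule the_equality, goal_cases)
  case 1
  show ?case
    using f G cvm_in_vmeas[OF E v] lb
    by (intro exI[of _ f] exI[of _ "cvm E v l b 1"] exI[of _ G] exI[of _ "cvm E v b l 1"] exI[of _ 1])
      (simp add: tf_def td_def vm_comp_cvm[OF E v] vm_one_cvm[OF E v] vm_scale_cvm[OF E v])
next
  case (2 z)
  then obtain f' \<kappa> G' \<kappa>' c where 1: "f' \<in> lfun E l i" "\<kappa> \<in> vmeas E l b" "tf E v b i l f = fun_ten E b i l f' \<kappa>"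
      "G' \<in> distr (lev E l i)" "\<kappa>' \<in> vmeas E b l" "td E v b i l G = dist_ten E b i l G' \<kappa>'"
      "vm_comp E l b l \<kappa> \<kappa>' = vm_scale c (vm_one E l)" "z = c * G' f'" by blast
  obtain d where d: "\<kappa> = cvm E v l b d" using 1(2) vmeas_cvm[OF E v lb] by blast
  obtain e where e: "\<kappa>' = cvm E v b l e" using 1(5) vmeas_cvm[OF E v lb(2,1)] by blast
  have "c = d * e" using 1(7) lb by (simp add: d e vm_comp_cvm[OF E v] vm_one_cvm[OF E v] vm_scale_cvm[OF E v] cvm_eq_iff[OF E v])
  moreover have "f = (\<lambda>x. d * f' x)" using tf_inj[OF lb f] 1(3) by (simp add: d fun_ten_cvm[OF lb])
  moreover have "G = (\<lambda>x. e * G' x)" using td_inj[OF lb G] 1(6) by (simp add: e dist_ten_cvm[OF lb])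
  ultimately show ?case using distr_scale[OF 1(4,1)] 1(8) by simp
qed

lemma trans_restrict_tf:
  assumes b: "b \<in> idx E" and le: "(l, j) \<in> le E" "(j, i) \<in> le E" and f: "f \<in> lfun E l i"
  shows "trans_restrict E b i j l (tf E v b i l f) = tf E v b j l (rs E l j f)"
proof -
  have l: "l \<in> idx E" using le_idx[OF E le(1)] by blast
  show ?thesis
    unfolding trans_restrict_def
  proof (rule the_equality, goal_cases)
    case 1
    show ?case
      using f cvm_in_vmeas[OF E v l b] by (intro exI[of _ f] exI[of _ "cvm E v l b 1"]) (simp add: tf_def mono_pull_rs)
  next
    case (2 y)
    then obtain f' \<kappa> where 1: "f' \<in> lfun E l i" "\<kappa> \<in> vmeas E l b" "tf E v b i l f = fun_ten E b i l f' \<kappa>"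
        "y = fun_ten E b j l (rs E l j f') \<kappa>" by (auto simp: mono_pull_rs)
    obtain d where d: "\<kappa> = cvm E v l b d" using 1(2) vmeas_cvm[OF E v l b] by blast
    have "f = (\<lambda>x. d * f' x)" using tf_inj[OF l b f] 1(3) by (simp add: d fun_ten_cvm[OF l b])
    then have "rs E l j f = (\<lambda>x. d * rs E l j f' x)" by (auto simp: rs_def)
    then show ?case using 1(4) by (simp add: d fun_ten_cvm[OF l b])
  qed
qed

lemma trans_push_tf:
  assumes b: "b \<in> idx E" and le: "(l, j) \<in> le E" "(j, i) \<in> le E" and f: "f \<in> lfun E l i"
  shows "trans_push E b i j l (tf E v b i l f) = tf E v b i j (ps E v l j i f)"
proof -
  have l: "l \<in> idx E" and j: "j \<in> idx E" using le_idx[OF E le(1)] by blast+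
  note A = lev_adm[OF E le]
  show ?thesis
    unfolding trans_push_def
  proof (rule the_equality, goal_cases)
    case 1
    show ?case
      using f cvm_in_vmeas[OF E v j b] msys_meas[OF v le(1)] l j b
      by (intro exI[of _ f] exI[of _ "v l j"] exI[of _ "cvm E v j b 1"])
        (simp add: tf_def ps_def vm_of_cvm_one[OF E v le(1)] vm_comp_cvm[OF E v])
  next
    case (2 y)
    then obtain f' \<rho> \<nu> where 1: "f' \<in> lfun E l i" "\<rho> \<in> meas (lev E l j)" "\<nu> \<in> vmeas E j b"
      "tf E v b i l f = fun_ten E b i l f' (vm_comp E l j b (vm_of E l j \<rho>) \<nu>)"
      "y = fun_ten E b i j (epi_push (lev_triple E l j i) f' \<rho>) \<nu>" by blast
    obtain d where d: "\<nu> = cvm E v j b d" using 1(3) vmeas_cvm[OF E v j b] by blast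
    obtain r where r: "\<rho> = (\<lambda>f. r * v l j f)" using msys_coord[OF E v le(1) 1(2)] .
    have "f = (\<lambda>x. r * d * f' x)"
      using tf_inj[OF l b f] 1(4) l j b by (simp add: d r vm_of_cvm[OF E v le(1)] vm_comp_cvm[OF E v] fun_ten_cvm[OF l b])
    then have "ps E v l j i f = (\<lambda>x. d * epi_push (lev_triple E l j i) f' \<rho> x)"
      unfolding ps_def r epi_push_meas_scale[OF A]
      using epi_push_scale[OF A, of f' "v l j" "r * d"] 1(1) msys_meas[OF v le(1)]
      by (simp add: algebra_simps)
    then show ?case using 1(5) by (simp add: d fun_ten_cvm[OF j b])
  qed
qed

end

lemma pull_distr:
  assumes G: "G \<in> distr E'" and \<phi>: "\<And>f. f \<in> test_fun E ==> \<phi> f \<in> test_fun E'"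
    and add: "\<And>f g. f \<in> test_fun E ==> g \<in> test_fun E ==> \<phi> (\<lambda>x. f x + g x) = (\<lambda>x. \<phi> f x + \<phi> g x)"
    and scale: "\<And>f c. f \<in> test_fun E ==> \<phi> (\<lambda>x. c * f x) = (\<lambda>x. c * \<phi> f x)"
    and E: "tower E"
  shows "pull E \<phi> G \<in> distr E"
  using assms
  by (intro distrI) (simp_all add: pull_def test_fun_add test_fun_scale distr_add[OF G] distr_scale[OF G])

text \<open>By \<open>level_pair_tf_td\<close>, pairing with \<open>tf\<close> of a test function
  evaluates the functional at it. The description in \<open>conj_map\<close> therefore determines
  all values, and they are those of the transpose.\<close>

lemma conj_map_td:
  assumes E: "nice2 E" "msys E v" and E': "nice2 E'" "msys E' v'"
    and ix: "b \<in> idx E" "l \<in> idx E" "b' \<in> idx E'" "l' \<in> idx E'"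
    and \<Phi>: "\<And>f. f \<in> lfun E l i ==> \<Phi> (tf E v b i l f) = tf E' v' b' i' l' (\<phi> f)"
    and \<phi>: "\<And>f. f \<in> lfun E l i ==> \<phi> f \<in> lfun E' l' i'"
    and G: "G \<in> distr (lev E' l' i')" and H: "pull (lev E l i) \<phi> G \<in> distr (lev E l i)"
  shows "conj_map E b i l E' b' i' l' \<Phi> (td E' v' b' i' l' G) = td E v b i l (pull (lev E l i) \<phi> G)"
  unfolding conj_map_def
proof (rule the_equality)
  let ?H = "pull (lev E l i) \<phi> G"
  have pair: "level_pair E' b' i' l' (\<Phi> (tf E v b i l f)) (td E' v' b' i' l' G) = ?H f" if "f \<in> lfun E l i" for f
    using level_pair_tf_td[OF E' ix(4,3) \<phi>[OF that] G] \<Phi>[OF that] that by (simp add: pull_def)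
  show "td E v b i l ?H \<in> dist_level E b i l \<and> (\<forall>x\<in>fun_level E b i l.
      level_pair E b i l x (td E v b i l ?H) = level_pair E' b' i' l' (\<Phi> x) (td E' v' b' i' l' G))"
    using H pair level_pair_tf_td[OF E ix(2,1) _ H]
    by (auto simp: dist_level_td[OF E ix(2,1)] fun_level_tf[OF E ix(2,1)])
  fix z assume z: "z \<in> dist_level E b i l \<and> (\<forall>x\<in>fun_level E b i l.
      level_pair E b i l x z = level_pair E' b' i' l' (\<Phi> x) (td E' v' b' i' l' G))"
  then obtain K where K: "z = td E v b i l K" "K \<in> distr (lev E l i)" by (auto simp: dist_level_td[OF E ix(2,1)])
  have "K f = ?H f" if f: "f \<in> lfun E l i" for f
    using z f pair[OF f] level_pair_tf_td[OF E ix(2,1) f K(2)] by (auto simp: fun_level_tf[OF E ix(2,1)] K(1))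
  then have "K = ?H" by (rule distr_eqI[OF K(2) H])
  then show "z = td E v b i l ?H" by (simp add: K(1))
qed

section \<open>Projective limits\<close>

definition lin :: "('v \<Rightarrow> complex) set \<Rightarrow> (('v \<Rightarrow> complex) \<Rightarrow> 'w \<Rightarrow> complex) \<Rightarrow> bool" where
  "lin A \<phi> \<longleftrightarrow> (\<forall>f\<in>A. \<forall>g\<in>A. \<phi> (\<lambda>x. f x + g x) = (\<lambda>x. \<phi> f x + \<phi> g x)) \<and>
     (\<forall>f\<in>A. \<forall>c. \<phi> (\<lambda>x. c * f x) = (\<lambda>x. c * \<phi> f x))"

lemma lin_add: "lin A \<phi> ==> f \<in> A ==> g \<in> A ==> \<phi> (\<lambda>x. f x + g x) = (\<lambda>x. \<phi> f x + \<phi> g x)"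
  and lin_scale: "lin A \<phi> ==> f \<in> A ==> \<phi> (\<lambda>x. c * f x) = (\<lambda>x. c * \<phi> f x)"
  unfolding lin_def by blast+

lemma lin_comp:
  assumes "lin A \<phi>" "lin B \<theta>" "\<And>f. f \<in> A ==> \<phi> f \<in> B"
  shows "lin A (\<lambda>f. \<theta> (\<phi> f))"
  using assms unfolding lin_def by simp

lemma lin_times: "lin A \<phi> ==> lin A (\<lambda>f x. c * \<phi> f x)"
  unfolding lin_def by (auto simp: algebra_simps)

lemma lin_rs: "lin A (rs E l j)"
  by (auto simp: lin_def rs_def)

lemma lin_mono_pull: "lin A (mono_pull t)"
  by (auto simp: lin_def mono_pull_def)

lemma lin_epi_pull: "lin A (epi_pull t)"
  by (auto simp: lin_def epi_pull_def)

lemma lin_mono_push: "lin A (mono_push t)"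
  by (auto simp: lin_def mono_push_def)

lemma lin_epi_push: "adm t ==> m \<in> meas (sub t) ==> lin (test_fun (mid t)) (\<lambda>f. epi_push t f m)"
  by (simp add: lin_def epi_push_add epi_push_scale)

lemma lin_ps:
  assumes "nice2 E" "msys E v" "(l, j) \<in> le E" "(j, i) \<in> le E"
  shows "lin (lfun E l i) (ps E v l j i)"
  using lin_epi_push[OF lev_adm[OF assms(1,3,4)], of "v l j"] msys_meas[OF assms(2,3)]
  by (simp add: ps_def[abs_def])

lemma lin_four:
  assumes P: "pairing E E' \<chi>" and m: "m \<in> meas E"
  shows "lin (test_fun E) (four \<chi> E' m)"
  unfolding lin_def
proof (intro conjI ballI allI)
  fix f assume f: "f \<in> test_fun E"
  show "four \<chi> E' m (\<lambda>x. c * f x) = (\<lambda>x. c * four \<chi> E' m f x)" for c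
    using distr_scale[OF meas_distr[OF m] char_test_fun[OF P f]] by (auto simp: four_def mult.assoc)
  fix g assume g: "g \<in> test_fun E"
  show "four \<chi> E' m (\<lambda>x. f x + g x) = (\<lambda>x. four \<chi> E' m f x + four \<chi> E' m g x)"
    using distr_add[OF meas_distr[OF m] char_test_fun[OF P f] char_test_fun[OF P g]]
    by (auto simp: four_def distrib_right)
qed

text \<open>The general transition between levels: restriction to the smaller upper index, then
  push-forward to the larger lower one. The opposite order gives the same map by
  \<open>rs_ps\<close>.\<close>

definition "tr E v i l i' l' f = ps E v l l' i' (rs E l i' f)"

definition "sublev E i l i' l' \<longleftrightarrow> (l, l') \<in> le E \<and> (l', i') \<in> le E \<and> (i', i) \<in> le E"

definition "fam E v g \<longleftrightarrow> (\<forall>l i. (l, i) \<in> le E \<longrightarrow> g i l \<in> lfun E l i) \<and>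
     (\<forall>l j i. (l, j) \<in> le E \<longrightarrow> (j, i) \<in> le E \<longrightarrow> rs E l j (g i l) = g j l \<and> ps E v l j i (g i l) = g i j)"

definition "xf E v b g = (\<lambda>i l. if (l, i) \<in> le E then tf E v b i l (g i l) else {})"

context
  fixes E v
  assumes L: "laws E v"
begin

lemma laws_nice: "nice2 E" and laws_msys: "msys E v"
  using L by (simp_all add: laws_def)

lemma ps_id: "(l, i) \<in> le E ==> f \<in> lfun E l i ==> ps E v l l i f = f"
  using L by (simp add: laws_def)

lemma ps_ps: "(l, j) \<in> le E ==> (j, k) \<in> le E ==> (k, i) \<in> le E ==> f \<in> lfun E l i ==>
    ps E v j k i (ps E v l j i f) = ps E v l k i f"
  using L by (simp add: laws_def)

lemma sublev_le:
  assumes "sublev E i l i' l'"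
  shows "(l, i) \<in> le E" "(l, i') \<in> le E" "(l', i) \<in> le E" "(l, l') \<in> le E" "(l', i') \<in> le E" "(i', i) \<in> le E"
  using assms le_trans[OF laws_nice] unfolding sublev_def by blast+

lemma tr_test_fun:
  assumes s: "sublev E i l i' l'" and f: "f \<in> lfun E l i"
  shows "tr E v i l i' l' f \<in> lfun E l' i'"
  unfolding tr_def
  by (intro ps_test_fun[OF laws_nice laws_msys] rs_test_fun[OF laws_nice _ _ f] sublev_le[OF s])

lemma lin_tr:
  assumes s: "sublev E i l i' l'"
  shows "lin (lfun E l i) (tr E v i l i' l')"
  unfolding tr_def
  by (rule lin_comp[OF lin_rs lin_ps[OF laws_nice laws_msys sublev_le(4,5)[OF s]]
        rs_test_fun[OF laws_nice sublev_le(2,6)[OF s]]])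

lemma sublev_trans:
  assumes "sublev E i l i' l'" "sublev E i' l' i'' l''"
  shows "sublev E i l i'' l''"
  using sublev_le[OF assms(1)] sublev_le[OF assms(2)] le_trans[OF laws_nice] unfolding sublev_def by blast

text \<open>\<open>rs_ps\<close> moves the second restriction past the first push-forward, after
  which restrictions and push-forwards compose separately.\<close>

lemma tr_tr:
  assumes s: "sublev E i l i' l'" "sublev E i' l' i'' l''" and f: "f \<in> lfun E l i"
  shows "tr E v i' l' i'' l'' (tr E v i l i' l' f) = tr E v i l i'' l'' f"
proof -
  note a = sublev_le[OF s(1)] and b = sublev_le[OF s(2)]
  note f' = rs_test_fun[OF laws_nice a(2,6) f]
  have li'': "(l, i'') \<in> le E" using le_trans[OF laws_nice a(4) b(2)] .
  have "rs E l' i'' (ps E v l l' i' (rs E l i' f)) = ps E v l l' i'' (rs E l i'' f)"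
    using rs_ps[OF laws_nice laws_msys a(4) b(2,6) f'] rs_rs[OF laws_nice li'' b(6)] by simp
  then show ?thesis
    unfolding tr_def using ps_ps[OF a(4) b(4,5)] rs_test_fun[OF laws_nice li'' _ f] le_trans[OF laws_nice b(6) a(6)]
    by simp
qed

lemma tr_self: "(l, i) \<in> le E ==> f \<in> lfun E l i ==> tr E v i l i l f = f"
  by (simp add: tr_def rs_id ps_id)

lemma fam_test_fun: "fam E v g ==> (l, i) \<in> le E ==> g i l \<in> lfun E l i"
  by (simp add: fam_def)

lemma fam_tr:
  assumes g: "fam E v g" and s: "sublev E i l i' l'"
  shows "tr E v i l i' l' (g i l) = g i' l'"
  using g sublev_le[OF s] by (simp add: tr_def fam_def)

text \<open>Coordinates chosen level by level turn the compatibility conditions of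
  \<open>D_space\<close> into those of \<open>fam\<close>; injectivity of \<open>tf\<close> is what
  allows them to be read off.\<close>

lemma D_space_xf:
  assumes b: "b \<in> idx E"
  shows "D_space E b = {xf E v b g | g. fam E v g}"
proof (intro equalityI subsetI)
  note N = laws_nice and M = laws_msys
  fix x assume x: "x \<in> D_space E b"
  define g where "g i l = (SOME f. f \<in> lfun E l i \<and> x i l = tf E v b i l f)" for i l
  have g: "g i l \<in> lfun E l i" "x i l = tf E v b i l (g i l)" if li: "(l, i) \<in> le E" for i l
  proof -
    have "x i l \<in> fun_level E b i l" using x li by (simp add: D_space_def)
    then have "\<exists>f. f \<in> lfun E l i \<and> x i l = tf E v b i l f"
      using fun_level_tf[OF N M _ b, of l i] le_idx[OF N li] by auto
    from someI_ex[OF this] show "g i l \<in> lfun E l i" "x i l = tf E v b i l (g i l)"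
      by (simp_all add: g_def)
  qed
  have "rs E l j (g i l) = g j l \<and> ps E v l j i (g i l) = g i j" if le: "(l, j) \<in> le E" "(j, i) \<in> le E" for l j i
  proof -
    note li = le_trans[OF N le] and ix = le_idx[OF N le(1)]
    have x': "trans_restrict E b i j l (x i l) = x j l" "trans_push E b i j l (x i l) = x i j"
      using x le unfolding D_space_def by blast+
    have "tf E v b j l (rs E l j (g i l)) = tf E v b j l (g j l)"
      using x'(1) trans_restrict_tf[OF N M b le g(1)[OF li]] g(2)[OF li] g(2)[OF le(1)] by simp
    then have 1: "rs E l j (g i l) = g j l"
      using tf_inj[OF N M ix(1) b] rs_test_fun[OF N le g(1)[OF li]] by blast
    have "tf E v b i j (ps E v l j i (g i l)) = tf E v b i j (g i j)"
      using x'(2) trans_push_tf[OF N M b le g(1)[OF li]] g(2)[OF li] g(2)[OF le(2)] by simp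
    then show ?thesis
      using 1 tf_inj[OF N M ix(2) b] ps_test_fun[OF N M le g(1)[OF li]] by blast
  qed
  then have "fam E v g" using g(1) by (simp add: fam_def)
  moreover have "x = xf E v b g"
    using x g(2) by (intro ext) (simp add: xf_def D_space_def)
  ultimately show "x \<in> {xf E v b g | g. fam E v g}" by blast
next
  note N = laws_nice and M = laws_msys
  fix x assume "x \<in> {xf E v b g | g. fam E v g}"
  then obtain g where x: "x = xf E v b g" and g: "fam E v g" by blast
  show "x \<in> D_space E b"
    unfolding D_space_def
  proof (intro CollectI conjI allI impI)
    show "x i l \<in> fun_level E b i l" if "(l, i) \<in> le E" for i l
      using that fam_test_fun[OF g that] fun_level_tf[OF N M _ b] le_idx[OF N that] by (simp add: x xf_def)
    show "x i l = {}" if "(l, i) \<notin> le E" for i l using that by (simp add: x xf_def)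
    fix i j l assume "(l, j) \<in> le E \<and> (j, i) \<in> le E"
    then have le: "(l, j) \<in> le E" "(j, i) \<in> le E" by auto
    note li = le_trans[OF N le]
    show "trans_restrict E b i j l (x i l) = x j l"
      using trans_restrict_tf[OF N M b le fam_test_fun[OF g li]] li le g by (simp add: x xf_def fam_def)
    show "trans_push E b i j l (x i l) = x i j"
      using trans_push_tf[OF N M b le fam_test_fun[OF g li]] li le g by (simp add: x xf_def fam_def)
  qed
qed

lemma xf_eqI: "(\<And>l i. (l, i) \<in> le E ==> g i l = h i l) ==> xf E v b g = xf E v b h"
  by (intro ext) (simp add: xf_def)

end

section \<open>Families along a cofinal index map\<close>

definition "cofin J Q I R s \<longleftrightarrow> (\<forall>(i, j)\<in>Q. (s i, s j) \<in> R) \<and>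
     (\<forall>a\<in>I. \<exists>i\<in>J. \<exists>j\<in>J. (s i, a) \<in> R \<and> (a, s j) \<in> R)"

context
  fixes J Q E v s
  assumes J: "dirset J Q" and L: "laws E v" and s: "cofin J Q (idx E) (le E) s"
begin

lemma cofin_mono: "(i, j) \<in> Q ==> (s i, s j) \<in> le E"
  using s by (auto simp: cofin_def)

lemma dirset_trans: "(i, j) \<in> Q ==> (j, k) \<in> Q ==> (i, k) \<in> Q"
  using J unfolding dirset_def by (meson transD)

lemma dirset_idx: "(i, j) \<in> Q ==> i \<in> J \<and> j \<in> J"
  using J by (auto simp: dirset_def)

lemma dirset_upper: "i \<in> J ==> j \<in> J ==> \<exists>k. (i, k) \<in> Q \<and> (j, k) \<in> Q"
  and dirset_lower: "i \<in> J ==> j \<in> J ==> \<exists>k. (k, i) \<in> Q \<and> (k, j) \<in> Q"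
  using J unfolding dirset_def by metis+

lemma cofin_upper:
  assumes "a \<in> idx E" "i \<in> J"
  shows "\<exists>j. (i, j) \<in> Q \<and> (a, s j) \<in> le E"
proof -
  obtain j0 where j0: "j0 \<in> J" "(a, s j0) \<in> le E" using s assms by (auto simp: cofin_def)
  obtain j where j: "(i, j) \<in> Q" "(j0, j) \<in> Q" using dirset_upper assms(2) j0(1) by blast
  then show ?thesis using le_trans[OF laws_nice[OF L] j0(2) cofin_mono] by blast
qed

lemma cofin_lower:
  assumes "a \<in> idx E" "i \<in> J"
  shows "\<exists>j. (j, i) \<in> Q \<and> (s j, a) \<in> le E"
proof -
  obtain j0 where j0: "j0 \<in> J" "(s j0, a) \<in> le E" using s assms by (auto simp: cofin_def)
  obtain j where j: "(j, i) \<in> Q" "(j, j0) \<in> Q" using dirset_lower assms(2) j0(1) by blast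
  then show ?thesis using le_trans[OF laws_nice[OF L] cofin_mono j0(2)] by blast
qed

text \<open>Existence for the descriptions of \<open>epi_push2\<close> and
  \<open>mono_pull2\<close>, which prescribe values on the levels around \<open>k\<close>. Every
  level is reached by \<open>tr\<close> from one around \<open>k\<close>; the value is transported
  from there, and two such sources are compared through a larger one above both.\<close>

lemma fam_extend:
  assumes k: "k \<in> J"
    and h: "\<And>i j. (j, k) \<in> Q ==> (k, i) \<in> Q ==> h i j \<in> test_fun (lev E (s j) (s i))"
    and hr: "\<And>l j i. (l, k) \<in> Q ==> (k, j) \<in> Q ==> (j, i) \<in> Q ==> rs E (s l) (s j) (h i l) = h j l"
    and hp: "\<And>l j i. (l, j) \<in> Q ==> (j, k) \<in> Q ==> (k, i) \<in> Q ==> ps E v (s l) (s j) (s i) (h i l) = h i j"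
  shows "\<exists>g. fam E v g \<and> (\<forall>i j. (j, k) \<in> Q \<longrightarrow> (k, i) \<in> Q \<longrightarrow> g (s i) (s j) = h i j)"
proof -
  note N = laws_nice[OF L]
  define ok where "ok a c i j \<longleftrightarrow> (j, k) \<in> Q \<and> (k, i) \<in> Q \<and> sublev E (s i) (s j) a c" for a c i j
  have ex: "\<exists>i j. ok a c i j" if ca: "(c, a) \<in> le E" for a c
    using cofin_upper[OF le_idx(2)[OF N ca] k] cofin_lower[OF le_idx(1)[OF N ca] k] ca unfolding ok_def sublev_def by blast
  have htr: "tr E v (s i') (s j') (s i) (s j) (h i' j') = h i j"
    if q: "(j', j) \<in> Q" "(j, k) \<in> Q" "(k, i) \<in> Q" "(i, i') \<in> Q" for i i' j j'
    using hr[OF dirset_trans[OF q(1,2)] q(3,4)] hp[OF q(1-3)] by (simp add: tr_def)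
  define g where "g a c = (let (i, j) = (SOME (i, j). ok a c i j) in tr E v (s i) (s j) a c (h i j))" for a c
  have g: "g a c = tr E v (s i) (s j) a c (h i j)" if o: "ok a c i j" for a c i j
  proof -
    obtain i0 j0 where ij0: "(SOME (i, j). ok a c i j) = (i0, j0)" by (cases "SOME (i, j). ok a c i j")
    have o0: "ok a c i0 j0" using someI[of "\<lambda>(i, j). ok a c i j" "(i, j)"] o ij0 by auto
    obtain i' where i': "(i, i') \<in> Q" "(i0, i') \<in> Q" using dirset_upper o o0 dirset_idx unfolding ok_def by metis
    obtain j' where j': "(j', j) \<in> Q" "(j', j0) \<in> Q" using dirset_lower o o0 dirset_idx unfolding ok_def by metis
    have *: "tr E v (s i) (s j) a c (h i j) = tr E v (s i') (s j') a c (h i' j')"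
      if o: "ok a c i j" and i': "(i, i') \<in> Q" "(j', j) \<in> Q" for i j
    proof -
      have q: "(j, k) \<in> Q" "(k, i) \<in> Q" and sl: "sublev E (s i) (s j) a c" using o by (auto simp: ok_def)
      have "sublev E (s i') (s j') (s i) (s j)"
        using cofin_mono i' sublev_le(1)[OF L sl] by (auto simp: sublev_def)
      from tr_tr[OF L this sl h] show ?thesis
        using htr[OF i'(2) q i'(1)] q i' dirset_trans by metis
    qed
    show ?thesis using *[OF o i'(1) j'(1)] *[OF o0 i'(2) j'(2)] by (simp add: g_def ij0)
  qed
  have gt: "g a c \<in> lfun E c a" if ca: "(c, a) \<in> le E" for a c
  proof -
    obtain i j where o: "ok a c i j" using ex[OF ca] by blast
    then show ?thesis using g[OF o] tr_test_fun[OF L _ h] by (simp add: ok_def)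
  qed
  have gtr: "tr E v a c a' c' (g a c) = g a' c'" if sl: "sublev E a c a' c'" for a c a' c'
  proof -
    obtain i j where o: "ok a c i j" using ex[OF sublev_le(1)[OF L sl]] by blast
    then have o': "ok a' c' i j" using sublev_trans[OF L _ sl] by (auto simp: ok_def)
    show ?thesis unfolding g[OF o] g[OF o'] using o tr_tr[OF L _ sl h] by (auto simp: ok_def)
  qed
  have "fam E v g"
    unfolding fam_def
  proof (intro conjI allI impI)
    fix l j i assume le: "(l, j) \<in> le E" "(j, i) \<in> le E"
    note li = le_trans[OF N le] and ix = le_idx[OF N le(1)] le_idx[OF N le(2)]
    have "sublev E i l j l" "sublev E i l i j" using le ix le_refl[OF N] by (auto simp: sublev_def)
    from gtr[OF this(1)] gtr[OF this(2)]
    show "rs E l j (g i l) = g j l" "ps E v l j i (g i l) = g i j"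
      using ps_id[OF L le(1)] rs_test_fun[OF N le gt[OF li]] rs_id[OF gt[OF li]] by (simp_all add: tr_def)
  qed (rule gt)
  moreover have "g (s i) (s j) = h i j" if q: "(j, k) \<in> Q" "(k, i) \<in> Q" for i j
  proof -
    have ji: "(s j, s i) \<in> le E" using q dirset_trans cofin_mono by blast
    have "ok (s i) (s j) i j" using q ji le_idx[OF N ji] le_refl[OF N] by (auto simp: ok_def sublev_def)
    then show ?thesis using g tr_self[OF L ji h[OF q]] by simp
  qed
  ultimately show ?thesis by blast
qed

text \<open>Uniqueness for the same descriptions: every level lies under one around
  \<open>k\<close>, from which \<open>tr\<close> recovers the value.\<close>

lemma fam_unique:
  assumes k: "k \<in> J" and g: "fam E v g" "fam E v g'"
    and eq: "\<And>i j. (j, k) \<in> Q ==> (k, i) \<in> Q ==> g (s i) (s j) = g' (s i) (s j)" and ca: "(c, a) \<in> le E"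
  shows "g a c = g' a c"
proof -
  note N = laws_nice[OF L]
  obtain i where i: "(k, i) \<in> Q" "(a, s i) \<in> le E" using cofin_upper[OF le_idx(2)[OF N ca] k] by blast
  obtain j where j: "(j, k) \<in> Q" "(s j, c) \<in> le E" using cofin_lower[OF le_idx(1)[OF N ca] k] by blast
  have "sublev E (s i) (s j) a c" using i j ca by (simp add: sublev_def)
  then show ?thesis using fam_tr[OF L g(1)] fam_tr[OF L g(2)] eq[OF j(1) i(1)] by metis
qed

lemma D_space_the:
  assumes k: "k \<in> J" and b: "b \<in> idx E" and g: "fam E v g"
    and y: "\<And>i j. (j, k) \<in> Q ==> (k, i) \<in> Q ==> Y i j = tf E v b (s i) (s j) (g (s i) (s j))"
  shows "(THE y. y \<in> D_space E b \<and> (\<forall>i j. (j, k) \<in> Q \<and> (k, i) \<in> Q \<longrightarrow> y (s i) (s j) = Y i j)) = xf E v b g"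
proof (rule the_equality)
  note N = laws_nice[OF L] and M = laws_msys[OF L]
  have ji: "(s j, s i) \<in> le E" if "(j, k) \<in> Q" "(k, i) \<in> Q" for i j using that dirset_trans cofin_mono by blast
  show "xf E v b g \<in> D_space E b \<and> (\<forall>i j. (j, k) \<in> Q \<and> (k, i) \<in> Q \<longrightarrow> xf E v b g (s i) (s j) = Y i j)"
    using g y ji by (auto simp: D_space_xf[OF L b] xf_def)
  fix x assume x: "x \<in> D_space E b \<and> (\<forall>i j. (j, k) \<in> Q \<and> (k, i) \<in> Q \<longrightarrow> x (s i) (s j) = Y i j)"
  then obtain g' where g': "x = xf E v b g'" "fam E v g'" by (auto simp: D_space_xf[OF L b])
  have eq: "g' (s i) (s j) = g (s i) (s j)" if q: "(j, k) \<in> Q" "(k, i) \<in> Q" for i j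
  proof (rule tf_inj[OF N M le_idx(1)[OF N ji[OF q]] b fam_test_fun[OF L g'(2) ji[OF q]]])
    show "tf E v b (s i) (s j) (g' (s i) (s j)) = tf E v b (s i) (s j) (g (s i) (s j))"
    proof -
      have "x (s i) (s j) = Y i j" using x q by blast
      then show ?thesis using y[OF q] ji[OF q] by (simp add: g'(1) xf_def)
    qed
  qed
  show "x = xf E v b g" unfolding g'(1) by (rule xf_eqI[OF L], rule fam_unique[OF k g'(2) g eq])
qed

end

section \<open>Inductive limits\<close>

definition "cls E v b i l G = dist_cls E b i l (td E v b i l G)"

lemma lim_class_step:
  assumes "(x, y) \<in> R"
  shows "lim_class R x = lim_class R y"
proof -
  have "sym (R \<union> R\<inverse>)" by (auto simp: sym_def)
  then have "sym ((R \<union> R\<inverse>)\<^sup>*)" by (rule sym_rtrancl)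
  moreover have "(x, y) \<in> (R \<union> R\<inverse>)\<^sup>*" using assms by blast
  ultimately show ?thesis unfolding lim_class_def by (auto dest: symD rtrancl_trans)
qed

lemma pull_pull:
  assumes "\<And>f. f \<in> test_fun E ==> \<phi> f \<in> test_fun E'"
  shows "pull E \<phi> (pull E' \<theta> G) = pull E (\<lambda>f. \<theta> (\<phi> f)) G"
  using assms by (auto simp: pull_def)

lemma pull_cong: "(\<And>f. f \<in> test_fun E ==> G (\<phi> f) = H (\<theta> f)) ==> pull E \<phi> G = pull E \<theta> H"
  by (auto simp: pull_def)

lemma pull_lin_distr:
  assumes "tower E" "G \<in> distr E'" "\<And>f. f \<in> test_fun E ==> \<phi> f \<in> test_fun E'" "lin (test_fun E) \<phi>"
  shows "pull E \<phi> G \<in> distr E"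
  using assms(1-3) lin_add[OF assms(4)] lin_scale[OF assms(4)] by (intro pull_distr[of G E' E \<phi>]) blast+

context
  fixes E v b
  assumes L: "laws E v" and b: "b \<in> idx E"
begin

lemma pull_tr_distr:
  assumes "sublev E i l i' l'" "G \<in> distr (lev E l' i')"
  shows "pull (lev E l i) (tr E v i l i' l') G \<in> distr (lev E l i)"
  by (rule pull_lin_distr[OF lev_tower[OF laws_nice[OF L] sublev_le(1)[OF L assms(1)]] assms(2)
        tr_test_fun[OF L assms(1)] lin_tr[OF L assms(1)]])

lemma conj_restrict_td:
  assumes le: "(l, j) \<in> le E" "(j, i) \<in> le E" and G: "G \<in> distr (lev E l j)"
  shows "conj_map E b i l E b j l (trans_restrict E b i j l) (td E v b j l G) = td E v b i l (pull (lev E l i) (rs E l j) G)" (is ?A)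
    and "pull (lev E l i) (rs E l j) G \<in> distr (lev E l i)"
proof -
  note N = laws_nice[OF L] and M = laws_msys[OF L]
  note l = le_idx(1)[OF N le(1)] and t = rs_test_fun[OF N le]
  show H: "pull (lev E l i) (rs E l j) G \<in> distr (lev E l i)"
    by (rule pull_lin_distr[OF lev_tower[OF N le_trans[OF N le]] G t lin_rs])
  show ?A
    by (rule conj_map_td[OF N M N M b l b l trans_restrict_tf[OF N M b le] t G H])
qed

lemma conj_push_td:
  assumes le: "(l, j) \<in> le E" "(j, i) \<in> le E" and G: "G \<in> distr (lev E j i)"
  shows "conj_map E b i l E b i j (trans_push E b i j l) (td E v b i j G) = td E v b i l (pull (lev E l i) (ps E v l j i) G)" (is ?A)
    and "pull (lev E l i) (ps E v l j i) G \<in> distr (lev E l i)"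
proof -
  note N = laws_nice[OF L] and M = laws_msys[OF L]
  note l = le_idx[OF N le(1)] and t = ps_test_fun[OF N M le]
  show H: "pull (lev E l i) (ps E v l j i) G \<in> distr (lev E l i)"
    by (rule pull_lin_distr[OF lev_tower[OF N le_trans[OF N le]] G t lin_ps[OF N M le]])
  show ?A
    by (rule conj_map_td[OF N M N M b l(1) b l(2) trans_push_tf[OF N M b le] t G H])
qed

lemma td_dist_level: "(l, i) \<in> le E ==> G \<in> distr (lev E l i) ==> td E v b i l G \<in> dist_level E b i l"
  using dist_level_td[OF laws_nice[OF L] laws_msys[OF L] _ b, of l i] le_idx[OF laws_nice[OF L], of l i] by simp

text \<open>Two generating transitions in succession: the conjugate of a push-forward, then the
  conjugate of a restriction. Transposition reverses their order in \<open>tr\<close>.\<close>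

lemma cls_tr:
  assumes s: "sublev E i l i' l'" and G: "G \<in> distr (lev E l' i')"
  shows "cls E v b i' l' G = cls E v b i l (pull (lev E l i) (tr E v i l i' l') G)"
proof -
  note N = laws_nice[OF L] and le = sublev_le[OF L s]
  let ?G1 = "pull (lev E l i') (ps E v l l' i') G"
  note c1 = conj_push_td[OF le(4,5) G]
  note c2 = conj_restrict_td[OF le(2,6) c1(2)]
  have "((i', l', td E v b i' l' G), (i', l, td E v b i' l ?G1)) \<in> dist_trans E b"
    unfolding dist_trans_def c1(1)[symmetric] using le td_dist_level[OF le(5) G] by blast
  moreover have "((i', l, td E v b i' l ?G1), (i, l, td E v b i l (pull (lev E l i) (rs E l i') ?G1))) \<in> dist_trans E b"
    unfolding dist_trans_def c2(1)[symmetric] using le td_dist_level[OF le(2) c1(2)] by blast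
  moreover have "pull (lev E l i) (rs E l i') ?G1 = pull (lev E l i) (tr E v i l i' l') G"
    using pull_pull[OF rs_test_fun[OF N le(2,6)], where G = G and \<theta> = "ps E v l l' i'"] by (simp add: tr_def[abs_def])
  ultimately show ?thesis unfolding cls_def using lim_class_step by metis
qed

lemma common_sublev:
  assumes "(l, i) \<in> le E" "(l', i') \<in> le E"
  shows "\<exists>i'' l''. sublev E i'' l'' i l \<and> sublev E i'' l'' i' l'"
proof -
  note N = laws_nice[OF L]
  obtain i'' where "(i, i'') \<in> le E" "(i', i'') \<in> le E" using le_upper[OF N] le_idx[OF N] assms by metis
  moreover obtain l'' where "(l'', l) \<in> le E" "(l'', l') \<in> le E" using le_lower[OF N] le_idx[OF N] assms by metis
  ultimately show ?thesis using assms by (auto simp: sublev_def)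
qed

text \<open>Classes are formed with the generated equivalence relation, whose chains go up and down.
  \<open>P\<close> says that a representative agrees with \<open>G1\<close> on some level above
  both; it passes along a transition in either direction, hence along every chain to
  \<open>G2\<close>.\<close>

lemma cls_eq_refine:
  assumes le: "(l1, i1) \<in> le E" "(l2, i2) \<in> le E" and G1: "G1 \<in> distr (lev E l1 i1)" and G2: "G2 \<in> distr (lev E l2 i2)"
    and eq: "cls E v b i1 l1 G1 = cls E v b i2 l2 G2"
  shows "\<exists>i l. sublev E i l i1 l1 \<and> sublev E i l i2 l2 \<and>
    (\<forall>f\<in>lfun E l i. G1 (tr E v i l i1 l1 f) = G2 (tr E v i l i2 l2 f))"
proof -
  note N = laws_nice[OF L] and M = laws_msys[OF L]
  define P where "P x \<longleftrightarrow> (\<exists>i' l' G'. x = (i', l', td E v b i' l' G') \<and> (l', i') \<in> le E \<and> G' \<in> distr (lev E l' i') \<and>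
    (\<exists>i l. sublev E i l i1 l1 \<and> sublev E i l i' l' \<and>
    (\<forall>f\<in>lfun E l i. G1 (tr E v i l i1 l1 f) = G' (tr E v i l i' l' f))))" for x
  have PD: "\<exists>i l. sublev E i l i1 l1 \<and> sublev E i l i' l' \<and>
    (\<forall>f\<in>lfun E l i. G1 (tr E v i l i1 l1 f) = G' (tr E v i l i' l' f))"
    if p: "P (i', l', td E v b i' l' G')" and G': "G' \<in> distr (lev E l' i')" and le': "(l', i') \<in> le E" for i' l' G'
  proof -
    obtain H where "td E v b i' l' G' = td E v b i' l' H" and H: "\<exists>i l. sublev E i l i1 l1 \<and> sublev E i l i' l' \<and>
      (\<forall>f\<in>lfun E l i. G1 (tr E v i l i1 l1 f) = H (tr E v i l i' l' f))"
      using p by (auto simp: P_def)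
    then have "G' = H" using td_inj[OF N M le_idx(1)[OF N le'] b G'] by blast
    then show ?thesis using H by simp
  qed
  \<comment> \<open>From the smaller level to the larger one, a common refinement with the witness
    is taken; in the opposite direction the witness itself serves, since transitions
    compose.\<close>
  have move: "P (i', l', td E v b i' l' G') \<longleftrightarrow> P (i, l, td E v b i l H)"
    if s: "sublev E i l i' l'" and G': "G' \<in> distr (lev E l' i')" and H: "H \<in> distr (lev E l i)"
      and HG: "\<And>f. f \<in> lfun E l i ==> H f = G' (tr E v i l i' l' f)" for i l i' l' G' H
  proof
    note les = sublev_le[OF L s]
    {
      assume "P (i', l', td E v b i' l' G')"
      then obtain a c where ac: "sublev E a c i1 l1" "sublev E a c i' l'"
        "\<And>f. f \<in> lfun E c a ==> G1 (tr E v a c i1 l1 f) = G' (tr E v a c i' l' f)" using PD[OF _ G' les(5)] by blast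
      obtain a' c' where ac': "sublev E a' c' a c" "sublev E a' c' i l"
        using common_sublev[OF sublev_le(1)[OF L ac(1)] les(1)] by blast
      have "G1 (tr E v a' c' i1 l1 f) = H (tr E v a' c' i l f)" if f: "f \<in> lfun E c' a'" for f
        using ac(3)[OF tr_test_fun[OF L ac'(1) f]] tr_tr[OF L ac'(1) ac(1) f] tr_tr[OF L ac'(1) ac(2) f]
          HG[OF tr_test_fun[OF L ac'(2) f]] tr_tr[OF L ac'(2) s f] by simp
      then show "P (i, l, td E v b i l H)"
        unfolding P_def using les(1) H ac'(2) sublev_trans[OF L ac'(1) ac(1)] by blast
    }
    assume "P (i, l, td E v b i l H)"
    then obtain a c where ac: "sublev E a c i1 l1" "sublev E a c i l"
      "\<And>f. f \<in> lfun E c a ==> G1 (tr E v a c i1 l1 f) = H (tr E v a c i l f)" using PD[OF _ H les(1)] by blast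
    have "G1 (tr E v a c i1 l1 f) = G' (tr E v a c i' l' f)" if f: "f \<in> lfun E c a" for f
      using ac(3)[OF f] HG[OF tr_test_fun[OF L ac(2) f]] tr_tr[OF L ac(2) s f] by simp
    then show "P (i', l', td E v b i' l' G')"
      unfolding P_def using les(5) G' ac(1) sublev_trans[OF L ac(2) s] by blast
  qed
  have step: "P x \<longleftrightarrow> P y" if xy: "(x, y) \<in> dist_trans E b" for x y
  proof -
    consider (r) i j l z where "x = (j, l, z)" "y = (i, l, conj_map E b i l E b j l (trans_restrict E b i j l) z)"
        "(l, j) \<in> le E" "(j, i) \<in> le E" "z \<in> dist_level E b j l"
      | (p) i j l z where "x = (i, j, z)" "y = (i, l, conj_map E b i l E b i j (trans_push E b i j l) z)"
        "(l, j) \<in> le E" "(j, i) \<in> le E" "z \<in> dist_level E b i j"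
      using xy unfolding dist_trans_def by blast
    then show ?thesis
    proof cases
      case r
      note l = le_idx(1)[OF N r(3)]
      obtain G' where G': "z = td E v b j l G'" "G' \<in> distr (lev E l j)"
        using r(5) by (auto simp: dist_level_td[OF N M l b])
      have s: "sublev E i l j l" using r le_refl[OF N l] by (simp add: sublev_def)
      have "pull (lev E l i) (rs E l j) G' f = G' (tr E v i l j l f)" if "f \<in> lfun E l i" for f
        using that ps_id[OF L r(3) rs_test_fun[OF N r(3,4) that]] by (simp add: pull_def tr_def)
      from move[OF s G'(2) conj_restrict_td(2)[OF r(3,4) G'(2)] this] show ?thesis
        using r(1,2) conj_restrict_td(1)[OF r(3,4) G'(2)] G'(1) by simp
    next
      case p
      note j = le_idx(2)[OF N p(3)] and i = le_idx(2)[OF N p(4)]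
      obtain G' where G': "z = td E v b i j G'" "G' \<in> distr (lev E j i)"
        using p(5) by (auto simp: dist_level_td[OF N M j b])
      have s: "sublev E i l i j" using p le_refl[OF N i] by (simp add: sublev_def)
      have "pull (lev E l i) (ps E v l j i) G' f = G' (tr E v i l i j f)" if "f \<in> lfun E l i" for f
        using that rs_id[OF that] by (simp add: pull_def tr_def)
      from move[OF s G'(2) conj_push_td(2)[OF p(3,4) G'(2)] this] show ?thesis
        using p(1,2) conj_push_td(1)[OF p(3,4) G'(2)] G'(1) by simp
    qed
  qed
  have "P y" if "((i1, l1, td E v b i1 l1 G1), y) \<in> (dist_trans E b \<union> (dist_trans E b)\<inverse>)\<^sup>*" for y
    using that
  proof (induction rule: rtrancl_induct)
    case base
    have "sublev E i1 l1 i1 l1" using le(1) le_refl[OF N] le_idx[OF N] by (auto simp: sublev_def)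
    then show ?case unfolding P_def using le(1) G1 by blast
  next
    case (step y z)
    then show ?case using \<open>\<And>x y. (x, y) \<in> dist_trans E b ==> P x \<longleftrightarrow> P y\<close> by blast
  qed
  moreover have "(i2, l2, td E v b i2 l2 G2) \<in> cls E v b i1 l1 G1" unfolding eq by (simp add: cls_def lim_class_def)
  ultimately have "P (i2, l2, td E v b i2 l2 G2)" unfolding cls_def lim_class_def by blast
  then show ?thesis by (rule PD[OF _ G2 le(2)])
qed

lemma D'_space_cls: "X \<in> D'_space E b \<longleftrightarrow> (\<exists>i l G. (l, i) \<in> le E \<and> G \<in> distr (lev E l i) \<and> X = cls E v b i l G)"
proof -
  note N = laws_nice[OF L] and M = laws_msys[OF L]
  have "y \<in> dist_level E b i l \<longleftrightarrow> (\<exists>G\<in>distr (lev E l i). y = td E v b i l G)" if "(l, i) \<in> le E" for i l y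
    using dist_level_td[OF N M le_idx(1)[OF N that] b] by auto
  then show ?thesis unfolding D'_space_def cls_def mem_Collect_eq by metis
qed

end

text \<open>Common form of the maps on distributions that are described by a representative on some
  level. \<open>K\<close> selects the admissible levels, \<open>U\<close> and \<open>D\<close> are
  the upper and lower index of the target level, and functionals are pulled back along
  \<open>\<phi>\<close>. \<open>U\<close> and \<open>D\<close> are independent parameters because
  the Fourier transform exchanges upper and lower indices while direct and inverse images do
  not.\<close>

lemma D'_the:
  fixes S Tt J
  assumes J: "dirset J Q" and LS: "laws S vs" and LT: "laws Tt vt" and s: "cofin J Q (idx S) (le S) s"
    and bs: "bs \<in> idx S" and bt: "bt \<in> idx Tt"
    and KQ: "\<And>i j. K i j ==> (j, i) \<in> Q"
    and Kup: "\<And>i j i' j'. K i j ==> (i, i') \<in> Q ==> (j', j) \<in> Q ==> K i' j'"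
    and sub: "\<And>i j i' j'. K i j ==> (i, i') \<in> Q ==> (j', j) \<in> Q ==> sublev Tt (U i' j') (D i' j') (U i j) (D i j)"
    and \<phi>: "\<And>i j f. K i j ==> f \<in> test_fun (lev Tt (D i j) (U i j)) ==> \<phi> i j f \<in> test_fun (lev S (s j) (s i))"
    and \<phi>l: "\<And>i j. K i j ==> lin (test_fun (lev Tt (D i j) (U i j))) (\<phi> i j)"
    and comm: "\<And>i j i' j' f. K i j ==> (i, i') \<in> Q ==> (j', j) \<in> Q ==> f \<in> test_fun (lev Tt (D i' j') (U i' j')) ==>
      \<phi> i j (tr Tt vt (U i' j') (D i' j') (U i j) (D i j) f) = tr S vs (s i') (s j') (s i) (s j) (\<phi> i' j' f)"
    and \<Psi>: "\<And>i j G. K i j ==> G \<in> distr (lev S (s j) (s i)) ==>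
      \<Psi> i j (td S vs bs (s i) (s j) G) = td Tt vt bt (U i j) (D i j) (pull (lev Tt (D i j) (U i j)) (\<phi> i j) G)"
    and ij: "K i0 j0" and G: "G0 \<in> distr (lev S (s j0) (s i0))"
  shows "(THE Y. \<exists>i j y. K i j \<and> y \<in> dist_level S bs (s i) (s j) \<and> cls S vs bs (s i0) (s j0) G0 = dist_cls S bs (s i) (s j) y \<and>
      Y = dist_cls Tt bt (U i j) (D i j) (\<Psi> i j y)) =
    cls Tt vt bt (U i0 j0) (D i0 j0) (pull (lev Tt (D i0 j0) (U i0 j0)) (\<phi> i0 j0) G0)" (is ?A)
    and "pull (lev Tt (D i0 j0) (U i0 j0)) (\<phi> i0 j0) G0 \<in> distr (lev Tt (D i0 j0) (U i0 j0))" (is ?B)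
proof -
  note NS = laws_nice[OF LS] and MS = laws_msys[OF LS] and NT = laws_nice[OF LT]
  note tra = dirset_trans[OF J LS s] and idx = dirset_idx[OF J LS s]
  have refl: "(i, i) \<in> Q" if "i \<in> J" for i using J that by (simp add: dirset_def refl_on_def)
  have le: "(s j, s i) \<in> le S" if "K i j" for i j using cofin_mono[OF J LS s KQ[OF that]] .
  have sub0: "sublev Tt (U i j) (D i j) (U i j) (D i j)" if "K i j" for i j
    using sub[OF that] refl idx[OF KQ[OF that]] by blast
  have pd: "pull (lev Tt (D i j) (U i j)) (\<phi> i j) G \<in> distr (lev Tt (D i j) (U i j))"
    if "K i j" "G \<in> distr (lev S (s j) (s i))" for i j G
    by (rule pull_lin_distr[OF lev_tower[OF NT sublev_le(1)[OF LT sub0[OF that(1)]]] that(2) \<phi>[OF that(1)] \<phi>l[OF that(1)]])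
  show ?B by (rule pd[OF ij G])
  show ?A
  proof (rule the_equality, goal_cases)
    case 1
    show ?case
      using ij td_dist_level[OF LS bs le[OF ij] G] \<Psi>[OF ij G]
      by (intro exI[of _ i0] exI[of _ j0] exI[of _ "td S vs bs (s i0) (s j0) G0"]) (simp add: cls_def)
  next
    case (2 Y)
    then obtain i j y where 1: "K i j" "y \<in> dist_level S bs (s i) (s j)" "cls S vs bs (s i0) (s j0) G0 = dist_cls S bs (s i) (s j) y"
      "Y = dist_cls Tt bt (U i j) (D i j) (\<Psi> i j y)" by blast
    obtain H where H: "y = td S vs bs (s i) (s j) H" "H \<in> distr (lev S (s j) (s i))"
      using 1(2) dist_level_td[OF NS MS le_idx(1)[OF NS le[OF 1(1)]] bs] by auto
    have "cls S vs bs (s i0) (s j0) G0 = cls S vs bs (s i) (s j) H" using 1(3) H(1) by (simp add: cls_def)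
    from cls_eq_refine[OF LS bs le[OF ij] le[OF 1(1)] G H(2) this] obtain a c where
      ac: "sublev S a c (s i0) (s j0)" "sublev S a c (s i) (s j)"
      "\<And>f. f \<in> lfun S c a ==> G0 (tr S vs a c (s i0) (s j0) f) = H (tr S vs a c (s i) (s j) f)" by blast
    note q0 = idx[OF KQ[OF ij]] and q = idx[OF KQ[OF 1(1)]]
    obtain i1 where i1: "(i0, i1) \<in> Q" "(i, i1) \<in> Q" using dirset_upper[OF J LS s] q0 q by blast
    obtain i' where i': "(i1, i') \<in> Q" "(a, s i') \<in> le S"
      using cofin_upper[OF J LS s le_idx(2)[OF NS sublev_le(1)[OF LS ac(1)]]] idx[OF i1(1)] by blast
    obtain j1 where j1: "(j1, j0) \<in> Q" "(j1, j) \<in> Q" using dirset_lower[OF J LS s] q0 q by blast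
    obtain j' where j': "(j', j1) \<in> Q" "(s j', c) \<in> le S"
      using cofin_lower[OF J LS s le_idx(1)[OF NS sublev_le(1)[OF LS ac(1)]]] idx[OF j1(1)] by blast
    have ii: "(i0, i') \<in> Q" "(i, i') \<in> Q" "(j', j0) \<in> Q" "(j', j) \<in> Q" using i1 i' j1 j' tra by blast+
    have K': "K i' j'" by (rule Kup[OF ij ii(1,3)])
    have sl: "sublev S (s i') (s j') a c" using i' j' sublev_le[OF LS ac(1)] by (simp add: sublev_def)
    let ?D = "D i' j'" and ?U = "U i' j'"
    have s0: "sublev Tt ?U ?D (U i0 j0) (D i0 j0)" and s1: "sublev Tt ?U ?D (U i j) (D i j)"
      using sub ij 1(1) ii by blast+
    \<comment> \<open>Both candidates are moved up to the level belonging to (i', j'). There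
      \<open>comm\<close> turns their comparison into one in \<open>S\<close>, where the two
      representatives agree by \<open>cls_eq_refine\<close>.\<close>
    have "cls Tt vt bt (U i0 j0) (D i0 j0) (pull (lev Tt (D i0 j0) (U i0 j0)) (\<phi> i0 j0) G0) =
      cls Tt vt bt ?U ?D (pull (lev Tt ?D ?U) (\<lambda>f. \<phi> i0 j0 (tr Tt vt ?U ?D (U i0 j0) (D i0 j0) f)) G0)"
      using cls_tr[OF LT bt s0 pd[OF ij G]]
        pull_pull[where E = "lev Tt ?D ?U" and \<phi> = "tr Tt vt ?U ?D (U i0 j0) (D i0 j0)", OF tr_test_fun[OF LT s0], where \<theta> = "\<phi> i0 j0" and G = G0]
      by simp
    also have "pull (lev Tt ?D ?U) (\<lambda>f. \<phi> i0 j0 (tr Tt vt ?U ?D (U i0 j0) (D i0 j0) f)) G0 =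
      pull (lev Tt ?D ?U) (\<lambda>f. \<phi> i j (tr Tt vt ?U ?D (U i j) (D i j) f)) H"
    proof (rule pull_cong)
      fix f assume f: "f \<in> test_fun (lev Tt ?D ?U)"
      note pf = \<phi>[OF K' f]
      show "G0 (\<phi> i0 j0 (tr Tt vt ?U ?D (U i0 j0) (D i0 j0) f)) = H (\<phi> i j (tr Tt vt ?U ?D (U i j) (D i j) f))"
        using ac(3)[OF tr_test_fun[OF LS sl pf]] tr_tr[OF LS sl ac(1) pf] tr_tr[OF LS sl ac(2) pf]
          comm[OF ij ii(1,3) f] comm[OF 1(1) ii(2,4) f] by simp
    qed
    also have "cls Tt vt bt ?U ?D \<dots> = cls Tt vt bt (U i j) (D i j) (pull (lev Tt (D i j) (U i j)) (\<phi> i j) H)"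
      using cls_tr[OF LT bt s1 pd[OF 1(1) H(2)]]
        pull_pull[where E = "lev Tt ?D ?U" and \<phi> = "tr Tt vt ?U ?D (U i j) (D i j)", OF tr_test_fun[OF LT s1], where \<theta> = "\<phi> i j" and G = H]
      by simp
    also have "\<dots> = Y" using 1(4) \<Psi>[OF 1(1) H(2)] H(1) by (simp add: cls_def)
    finally show ?case ..
  qed
qed

text \<open>A class may be moved to any larger level by \<open>cls_tr\<close>, and cofinality of
  \<open>s\<close> together with \<open>Kext\<close> provides an admissible one.\<close>

lemma D'_represent:
  fixes S J
  assumes J: "dirset J Q" and LS: "laws S vs" and s: "cofin J Q (idx S) (le S) s" and bs: "bs \<in> idx S"
    and Kext: "\<And>i0 j0. i0 \<in> J ==> j0 \<in> J ==> \<exists>i j. K i j \<and> (i0, i) \<in> Q \<and> (j, j0) \<in> Q"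
    and X: "X \<in> D'_space S bs"
  shows "\<exists>i j G. K i j \<and> G \<in> distr (lev S (s j) (s i)) \<and> X = cls S vs bs (s i) (s j) G"
proof -
  note NS = laws_nice[OF LS]
  obtain a c G where X': "(c, a) \<in> le S" "G \<in> distr (lev S c a)" "X = cls S vs bs a c G"
    using iffD1[OF D'_space_cls[OF LS bs] X] by blast
  obtain i where i: "i \<in> J" using J by (auto simp: dirset_def)
  obtain i0 where i0: "(i, i0) \<in> Q" "(a, s i0) \<in> le S" using cofin_upper[OF J LS s le_idx(2)[OF NS X'(1)] i] by blast
  obtain j0 where j0: "(j0, i) \<in> Q" "(s j0, c) \<in> le S" using cofin_lower[OF J LS s le_idx(1)[OF NS X'(1)] i] by blast
  obtain i' j' where ij: "K i' j'" "(i0, i') \<in> Q" "(j', j0) \<in> Q"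
    using Kext dirset_idx[OF J LS s i0(1)] dirset_idx[OF J LS s j0(1)] by blast
  have sl: "sublev S (s i') (s j') a c"
    using le_trans[OF NS i0(2) cofin_mono[OF J LS s ij(2)]] le_trans[OF NS cofin_mono[OF J LS s ij(3)] j0(2)] X'(1)
    by (simp add: sublev_def)
  show ?thesis using cls_tr[OF LS bs sl X'(2)] pull_tr_distr[OF LS bs sl X'(2)] ij(1) X'(3) by blast
qed

section \<open>Dual spaces of linear functionals\<close>

abbreviation "functional s \<equiv> Vector_Spaces.linear s (*)"

text \<open>\<open>R\<close> is the graph of a linear functional on a subspace, given as a relation
  so that redundant parametrisations can be used; \<open>zero\<close> makes it single valued. A
  basis inside its domain carries the values, and a map prescribed on an independent set extends
  linearly to the whole space.\<close>

lemma functional_extend: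
  fixes s :: "'k::field \<Rightarrow> _"
  assumes V: "vector_space s" and add: "\<And>x a y b. (x, a) \<in> R ==> (y, b) \<in> R ==> (x + y, a + b) \<in> R"
    and scale: "\<And>c x a. (x, a) \<in> R ==> (s c x, c * a) \<in> R" and zero: "\<And>a. (0, a) \<in> R ==> a = 0"
  shows "\<exists>w. functional s w \<and> (\<forall>(x, a)\<in>R. w x = a)"
proof -
  interpret V: vector_space s by (rule V)
  have K: "vector_space ((*) :: 'k \<Rightarrow> 'k \<Rightarrow> 'k)" by unfold_locales (auto simp: algebra_simps)
  interpret P: vector_space_pair s "(*) :: 'k \<Rightarrow> 'k \<Rightarrow> 'k" using V K by (simp add: vector_space_pair_def)
  obtain B where B: "B \<subseteq> fst ` R" "V.independent B" "fst ` R \<subseteq> V.span B" using V.maximal_independent_subset by blast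
  obtain w where w: "functional s w" "\<forall>x\<in>B. w x = (SOME a. (x, a) \<in> R)"
    using P.linear_independent_extend[OF B(2), of "\<lambda>x. SOME a. (x, a) \<in> R"] by blast
  have wl: "w (x + y) = w x + w y" "w (s c x) = c * w x" "w 0 = 0" for x y c
    using w(1) Vector_Spaces.linear_iff[of s "(*)" w] by (auto intro: P.linear_0)
  have wB: "(x, w x) \<in> R" if x: "x \<in> B" for x
  proof -
    have "\<exists>a. (x, a) \<in> R" using subsetD[OF B(1) x] by auto
    then show ?thesis using w(2) x by (metis someI_ex)
  qed
  have sp: "x = 0 \<or> (x, w x) \<in> R" if "x \<in> V.span B" for x
    using that
  proof (induction rule: V.span_induct_alt)
    case (step c x y)
    then show ?case using scale[OF wB[OF step(1)], of c] add[of "s c x" "c * w x" y "w y"] by (auto simp: wl)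
  qed simp
  \<comment> \<open>Two values over the same \<open>x\<close> differ by a value over
    \<open>0\<close>.\<close>
  have "w x = a" if xa: "(x, a) \<in> R" for x a
  proof -
    have "x = 0 \<or> (x + s (- 1) x, w x + - 1 * a) \<in> R"
      using sp[of x] add[of x "w x" "s (- 1) x" "- 1 * a"] scale[OF xa, of "- 1"] B(3) xa by force
    then show ?thesis using zero[of a] zero[of "w x - a"] xa wl(3) by auto
  qed
  then show ?thesis using w(1) by blast
qed

lemma functional_separate:
  fixes s :: "'k::field \<Rightarrow> _"
  assumes V: "vector_space s" and U: "module.subspace s U" and x: "x \<notin> U"
  shows "\<exists>w. functional s w \<and> (\<forall>u\<in>U. w u = 0) \<and> w x = 1"
proof -
  interpret V: vector_space s by (rule V)
  have K: "vector_space ((*) :: 'k \<Rightarrow> 'k \<Rightarrow> 'k)" by unfold_locales (auto simp: algebra_simps)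
  interpret P: vector_space_pair s "(*) :: 'k \<Rightarrow> 'k \<Rightarrow> 'k" using V K by (simp add: vector_space_pair_def)
  obtain B where B: "B \<subseteq> U" "V.independent B" "U \<subseteq> V.span B" using V.maximal_independent_subset by blast
  have "V.span B \<subseteq> V.span U" by (rule V.span_mono[OF B(1)])
  also have "\<dots> = U" using V.span_eq_iff[of U] U by blast
  finally have "V.span B \<subseteq> U" .
  then have x': "x \<notin> V.span B" using x by blast
  then have I: "V.independent (insert x B)" by (rule V.independent_insertI[OF _ B(2)])
  obtain w where w: "functional s w" "\<forall>y\<in>insert x B. w y = (if y = x then 1 else 0)"
    using P.linear_independent_extend[OF I, of "\<lambda>y. if y = x then 1 else 0"] by blast
  have "x \<notin> B" using x' V.span_base by blast
  then have "\<forall>b\<in>B. w b = 0" using w(2) by auto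
  then have "w u = 0" if "u \<in> U" for u using P.linear_eq_0_on_span[OF w(1)] that B(3) by blast
  then show ?thesis using w by auto
qed

lemma linear_functional:
  assumes "functional s w"
  shows "w (x + y) = w x + w y" "w (s c x) = c * w x" "w 0 = 0" "w (x - y) = w x - w y" "w (- x) = - w x"
proof -
  show a: "w (x + y) = w x + w y" "w (s c x) = c * w x" for x y c using assms by (auto simp: Vector_Spaces.linear_iff)
  have "w 0 + w 0 = w 0 + 0" using a(1)[of 0 0] by (metis add_0_right)
  then show z: "w 0 = 0" by (metis add_left_cancel)
  show "w (x - y) = w x - w y" using a(1)[of "x - y" y] by simp
  show "w (- x) = - w x" using a(1)[of x "- x"] z by (simp add: eq_neg_iff_add_eq_0 add.commute)
qed

section \<open>Spaces of finite index and their duals\<close>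

lemma dual1_sel [simp]:
  "idx (dual1 s E) = idx E" "le (dual1 s E) = (le E)\<inverse>" "fil (dual1 s E) i = annih s (fil E i)"
  by (simp_all add: dual1_def)

lemma dual1_carr: "w \<in> carr (dual1 s E) \<longleftrightarrow> functional s w \<and> (\<exists>i\<in>idx E. \<forall>v\<in>fil E i. w v = 0)"
  by (auto simp: carr_def annih_def)

lemma dual1_nul: "idx E \<noteq> {} ==> w \<in> nul (dual1 s E) \<longleftrightarrow> functional s w \<and> (\<forall>v\<in>carr E. w v = 0)"
  by (auto simp: nul_def annih_def carr_def)

lemma subspace_subgrp: "vector_space s ==> module.subspace s S ==> subgrp S"
  using module.subspace_0[of s S] module.subspace_diff[of s S] by (auto simp: subgrp_def module_iff_vector_space)

lemma annih_subgrp: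
  assumes "vector_space (s :: 'k::field \<Rightarrow> 'v::ab_group_add \<Rightarrow> 'v)"
  shows "subgrp (annih s S)"
proof -
  have K: "vector_space ((*) :: 'k \<Rightarrow> 'k \<Rightarrow> 'k)" by unfold_locales (auto simp: algebra_simps)
  have "functional s (\<lambda>_. 0)" using assms K by (simp add: Vector_Spaces.linear_iff)
  moreover have "functional s (\<lambda>x. v x - w x)"
    if "functional s v" "functional s w" for v w
    using that by (auto simp: Vector_Spaces.linear_iff algebra_simps)
  ultimately show ?thesis by (auto simp: subgrp_def annih_def zero_fun_def fun_diff_def)
qed

text \<open>The representatives are the linear combinations of \<open>S\<close>, finite in number
  over a finite field. This turns finite dimension into finite index.\<close>

lemma finite_index_span:
  fixes s :: "'k::{field,finite} \<Rightarrow> _"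
  assumes V: "vector_space s" and S: "finite S"
  shows "\<exists>Q. finite Q \<and> (\<forall>v\<in>module.span s (F \<union> S). \<exists>q\<in>Q. v - q \<in> module.span s F)"
proof -
  interpret V: vector_space s by (rule V)
  let ?Q = "(\<lambda>u. \<Sum>v\<in>S. s (u v) v) ` (S \<rightarrow>\<^sub>E (UNIV :: 'k set))"
  have "finite ?Q" using S by (intro finite_imageI finite_PiE) auto
  moreover have "\<exists>q\<in>?Q. v - q \<in> V.span F" if "v \<in> V.span (F \<union> S)" for v
  proof -
    obtain x y where xy: "v = x + y" "x \<in> V.span F" "y \<in> V.span S" using \<open>v \<in> V.span (F \<union> S)\<close> unfolding V.span_Un by blast
    obtain u where u: "y = (\<Sum>v\<in>S. s (u v) v)" using xy(3) unfolding V.span_finite[OF S] by blast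
    have "y = (\<Sum>v\<in>S. s (restrict u S v) v)" unfolding u by (intro sum.cong) auto
    then have "y \<in> ?Q" by (intro image_eqI[of _ _ "restrict u S"]) auto
    then show ?thesis using xy by (intro bexI[of _ y]) auto
  qed
  ultimately show ?thesis by blast
qed

lemma C1_space_tower:
  fixes s :: "'k::{field,finite} \<Rightarrow> _"
  assumes V: "vector_space s" and E: "C1_space s E"
  shows "tower E"
  unfolding tower_def
proof (intro conjI)
  interpret V: vector_space s by (rule V)
  have F: "filtered s E" using E by (simp add: C1_space_def)
  show "idx E \<noteq> {}" "le E \<subseteq> idx E \<times> idx E" "refl_on (idx E) (le E)" "trans (le E)"
    "\<forall>i\<in>idx E. \<forall>j\<in>idx E. \<exists>k l. (k, i) \<in> le E \<and> (i, l) \<in> le E \<and> (k, j) \<in> le E \<and> (j, l) \<in> le E"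
    using F by (auto simp: filtered_def partial_order_on_def preorder_on_def)
  show sg: "\<forall>i\<in>idx E. subgrp (fil E i)" using F subspace_subgrp[OF V] by (auto simp: filtered_def)
  have "\<exists>R. transversal R (fil E i) (fil E j)" if ij: "(i, j) \<in> le E" for i j
  proof -
    have i: "i \<in> idx E" using F ij by (auto simp: filtered_def partial_order_on_def preorder_on_def)
    have sub: "V.span (fil E i) = fil E i" using F i by (auto simp: filtered_def)
    obtain S where S: "finite S" "fil E j = V.span (fil E i \<union> S)" using E ij by (auto simp: C1_space_def)
    obtain Q where "finite Q" "\<forall>v\<in>V.span (fil E i \<union> S). \<exists>q\<in>Q. v - q \<in> V.span (fil E i)"
      using finite_index_span[OF V S(1)] by blast
    then show ?thesis using transversal_exists[of "fil E i" Q "fil E j"] sg i S(2) sub by auto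
  qed
  then show "\<forall>(i, j)\<in>le E. fil E i \<subseteq> fil E j \<and> (\<exists>R. transversal R (fil E i) (fil E j))"
    using F by (auto simp: filtered_def)
qed

text \<open>Let F(j) be spanned by F(i) and a finite set \<open>S\<close>. A functional vanishing on
  F(i) is determined on F(j) by its values on \<open>S\<close>, so the quotient of the two
  annihilators is finite; one functional is picked for each restriction to \<open>S\<close>.\<close>

lemma dual1_tower:
  fixes s :: "'k::{field,finite} \<Rightarrow> _"
  assumes V: "vector_space s" and E: "C1_space s E"
  shows "tower (dual1 s E)"
  unfolding tower_def dual1_sel
proof (intro conjI)
  interpret V: vector_space s by (rule V)
  note T = C1_space_tower[OF V E]
  show "idx E \<noteq> {}" using T by (simp add: tower_def)
  show "(le E)\<inverse> \<subseteq> idx E \<times> idx E" "trans ((le E)\<inverse>)" using T by (auto simp: tower_def)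
  show "refl_on (idx E) ((le E)\<inverse>)" using T by (simp add: tower_def)
  show "\<forall>i\<in>idx E. \<forall>j\<in>idx E. \<exists>k l. (k, i) \<in> (le E)\<inverse> \<and> (i, l) \<in> (le E)\<inverse> \<and> (k, j) \<in> (le E)\<inverse> \<and> (j, l) \<in> (le E)\<inverse>"
  proof (intro ballI)
    fix i j assume "i \<in> idx E" "j \<in> idx E"
    then obtain k l where "(k, i) \<in> le E" "(k, j) \<in> le E" "(i, l) \<in> le E" "(j, l) \<in> le E"
      using tower_lower[OF T] tower_upper[OF T] by metis
    then show "\<exists>k l. (k, i) \<in> (le E)\<inverse> \<and> (i, l) \<in> (le E)\<inverse> \<and> (k, j) \<in> (le E)\<inverse> \<and> (j, l) \<in> (le E)\<inverse>"
      by blast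
  qed
  show "\<forall>i\<in>idx E. subgrp (annih s (fil E i))" using annih_subgrp[OF V] by blast
  have "annih s (fil E j) \<subseteq> annih s (fil E i) \<and> (\<exists>R. transversal R (annih s (fil E j)) (annih s (fil E i)))"
    if ij: "(i, j) \<in> le E" for i j
  proof
    show "annih s (fil E j) \<subseteq> annih s (fil E i)" using tower_mono[OF T ij] by (auto simp: annih_def)
    obtain S where S: "finite S" "fil E j = V.span (fil E i \<union> S)" using E ij by (auto simp: C1_space_def)
    let ?A = "annih s (fil E i)"
    let ?r = "\<lambda>w. restrict w S"
    have fin: "finite (?r ` ?A)"
      by (rule finite_subset[of _ "S \<rightarrow>\<^sub>E (UNIV :: 'k set)"]) (use S(1) in \<open>auto intro: finite_PiE\<close>)
    define Q where "Q = inv_into ?A ?r ` (?r ` ?A)"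
    have "finite Q" using fin by (simp add: Q_def)
    moreover have "\<exists>q\<in>Q. v - q \<in> annih s (fil E j)" if v: "v \<in> ?A" for v
    proof
      define q where "q = inv_into ?A ?r (?r v)"
      show "q \<in> Q" using v by (simp add: Q_def q_def)
      have q: "q \<in> ?A" "?r q = ?r v" using v inv_into_into[of "?r v" ?r ?A] f_inv_into_f[of "?r v" ?r ?A] by (auto simp: q_def)
      have d: "v - q \<in> ?A" using subgrp_diff[OF annih_subgrp[OF V] v q(1)] .
      have l: "functional s (v - q)" using d by (simp add: annih_def)
      have "(v - q) x = 0" if "x \<in> V.span (fil E i \<union> S)" for x
        using that
      proof (induction rule: V.span_induct_alt)
        case base show ?case using linear_functional(3)[OF l] .
      next
        case (step c x y)
        have "(v - q) x = 0"
        proof (cases "x \<in> fil E i")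
          case False
          then have "x \<in> S" using step by blast
          then show ?thesis using fun_cong[OF q(2), of x] by simp
        qed (use d in \<open>simp add: annih_def\<close>)
        then show ?case using step linear_functional(1,2)[OF l] by simp
      qed
      then show "v - q \<in> annih s (fil E j)" using l S(2) by (auto simp: annih_def)
    qed
    ultimately show "\<exists>R. transversal R (annih s (fil E j)) ?A" by (rule transversal_exists[OF annih_subgrp[OF V]])
  qed
  then show "\<forall>(i, j)\<in>(le E)\<inverse>. annih s (fil E i) \<subseteq> annih s (fil E j) \<and> (\<exists>R. transversal R (annih s (fil E i)) (annih s (fil E j)))"
    by blast
qed

text \<open>The conjugate is the one in \<open>fourier1\<close>: with it
  \<open>four (chi \<psi>)\<close> is \<open>fourier1\<close> and \<open>four (chi' \<psi>)\<close>
  is \<open>fourier1_back\<close>.\<close>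

definition chi :: "('k::field \<Rightarrow> complex) \<Rightarrow> 'v \<Rightarrow> ('v \<Rightarrow> 'k) \<Rightarrow> complex" where
  "chi \<psi> v w = cnj (\<psi> (w v))"

abbreviation "chi' \<psi> w v \<equiv> chi \<psi> v w"

lemma character_zero: "nontrivial_character \<psi> ==> \<psi> 0 = 1"
  unfolding nontrivial_character_def by (metis add.right_neutral mult_cancel_left1)

lemma character_nondegenerate:
  assumes "nontrivial_character \<psi>" "\<And>c. \<psi> (c * a) = 1"
  shows "a = 0"
proof (rule ccontr)
  assume a: "a \<noteq> 0"
  obtain x where "\<psi> x \<noteq> 1" using assms(1) by (auto simp: nontrivial_character_def)
  moreover have "\<psi> x = 1" using assms(2)[of "x / a"] a by simp
  ultimately show False by simp
qed

text \<open>Perfectness rests on one remark: the multiples of a nonzero scalar fill the field, on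
  which \<open>\<psi>\<close> is nontrivial. On the side of vectors it is applied to a functional
  separating \<open>v\<close> from F(i), on the side of functionals to the multiples of a vector of
  F(j).\<close>

lemma dual1_pairing:
  fixes s :: "'k::{field,finite} \<Rightarrow> _" and E :: "(_, _) filt"
  assumes \<psi>: "nontrivial_character \<psi>" and V: "vector_space s" and E: "C1_space s E"
  shows "pairing E (dual1 s E) (chi \<psi>)"
  unfolding pairing_def dual1_sel
proof (intro conjI)
  interpret V: vector_space s by (rule V)
  have F: "\<forall>i\<in>idx E. V.subspace (fil E i)" using E by (simp add: C1_space_def filtered_def)
  note T = C1_space_tower[OF V E]
  show "tower E" "tower (dual1 s E)" by (rule T, rule dual1_tower[OF V E])
  have add: "\<psi> (x + y) = \<psi> x * \<psi> y" for x y using \<psi> by (simp add: nontrivial_character_def)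
  show "\<forall>v\<in>carr E. \<forall>v'\<in>carr E. \<forall>w\<in>carr (dual1 s E). chi \<psi> (v + v') w = chi \<psi> v w * chi \<psi> v' w"
    using linear_functional(1) by (fastforce simp: chi_def dual1_carr add)
  show "\<forall>v\<in>carr E. \<forall>w\<in>carr (dual1 s E). \<forall>w'\<in>carr (dual1 s E). chi \<psi> v (w + w') = chi \<psi> v w * chi \<psi> v w'"
    by (simp add: chi_def add)
  show "\<forall>i\<in>idx E. \<forall>v\<in>fil E i. \<forall>w\<in>annih s (fil E i). chi \<psi> v w = 1"
    by (simp add: chi_def annih_def character_zero[OF \<psi>])
  have "v \<in> fil E i" if ij: "(i, j) \<in> le E" and a: "\<forall>w\<in>annih s (fil E i). chi \<psi> v w = 1" for i j v
  proof (rule ccontr)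
    have Fi: "V.subspace (fil E i)" using F tower_idx[OF T ij] by blast
    assume "v \<notin> fil E i"
    then obtain w where w: "functional s w" "\<forall>u\<in>fil E i. w u = 0" "w v = 1"
      using functional_separate[OF V Fi] by blast
    have "\<psi> (c * 1) = 1" for c
    proof -
      have "(\<lambda>x. c * w x) \<in> annih s (fil E i)" using w by (auto simp: annih_def Vector_Spaces.linear_iff algebra_simps)
      then show ?thesis using a w(3) by (fastforce simp: chi_def)
    qed
    from character_nondegenerate[OF \<psi> this] show False by simp
  qed
  then show "\<forall>(i, j)\<in>le E. \<forall>v\<in>fil E j. (\<forall>w\<in>annih s (fil E i). chi \<psi> v w = 1) \<longrightarrow> v \<in> fil E i" by blast
  have "w \<in> annih s (fil E j)" if ij: "(i, j) \<in> le E" and w: "w \<in> annih s (fil E i)" and a: "\<forall>v\<in>fil E j. chi \<psi> v w = 1" for i j w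
  proof -
    have Fj: "V.subspace (fil E j)" using F tower_idx[OF T ij] by blast
    have l: "functional s w" using w by (simp add: annih_def)
    have "w v = 0" if v: "v \<in> fil E j" for v
    proof (rule character_nondegenerate[OF \<psi>])
      fix c
      have "chi \<psi> (s c v) w = 1" using a V.subspace_scale[OF Fj v] by blast
      then show "\<psi> (c * w v) = 1" by (simp add: chi_def linear_functional(2)[OF l])
    qed
    then show ?thesis using l by (simp add: annih_def)
  qed
  then show "\<forall>(i, j)\<in>le E. \<forall>w\<in>annih s (fil E i). (\<forall>v\<in>fil E j. chi \<psi> v w = 1) \<longrightarrow> w \<in> annih s (fil E j)" by blast
qed simp_all

lemma fourier1_four: "fourier1 \<psi> s E m f = four (chi \<psi>) (dual1 s E) m f"
  by (simp add: fourier1_def four_def chi_def cong: if_cong)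

lemma fourier1_back_four: "fourier1_back \<psi> E n f = four (chi' \<psi>) E n f"
  by (simp add: fourier1_back_def four_def chi_def cong:)

lemma meas_inv_mdual:
  assumes P: "pairing E (dual1 s E) \<chi>" and d: "mdual E (dual1 s E) m m'"
  shows "meas_inv s E m = m'"
  unfolding meas_inv_def
proof (rule the_equality)
  have nz: "m (indicator (fil E i)) \<noteq> 0" if "i \<in> idx E" for i
    using d meas_indicator_nonzero[OF pairing_tower[OF P] _ mdual_nonzero(1)[OF P d] that] by (simp add: mdual_def)
  show "m' \<in> meas (dual1 s E) \<and> (\<forall>i\<in>idx E. m' (indicator (annih s (fil E i))) = inverse (m (indicator (fil E i))))"
    using d by (auto simp: mdual_def intro!: inverse_unique[symmetric])
  fix n assume n: "n \<in> meas (dual1 s E) \<and> (\<forall>i\<in>idx E. n (indicator (annih s (fil E i))) = inverse (m (indicator (fil E i))))"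
  then have "mdual E (dual1 s E) m n" using d nz by (simp add: mdual_def)
  then show "n = m'" by (rule mdual_unique[OF P d])
qed

subsection \<open>Duals of admissible triples\<close>

lemma admissible1_adm:
  fixes s1 :: "'k::{field,finite} \<Rightarrow> _" and s2 :: "'k \<Rightarrow> _"
    and s3 :: "'k \<Rightarrow> _"
  assumes V: "vector_space s1" "vector_space s2" "vector_space s3" and A: "admissible1 s1 s2 s3 t"
  shows "adm t"
proof -
  have T: "tower (sub t)" "tower (mid t)" "tower (quo t)"
    using A C1_space_tower V by (auto simp: admissible1_def)
  have lin: "Vector_Spaces.linear s1 s2 (emb t)" "Vector_Spaces.linear s2 s3 (epi t)" using A by (auto simp: admissible1_def)
  obtain \<phi> where \<phi>: "dominates_via \<phi> (sub t) (sub_filt (emb t) (sub t) (mid t))" using A by (auto simp: admissible1_def)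
  obtain \<theta> where \<theta>: "dominates_via \<theta> (quo t) (quot_filt (epi t) (mid t) (quo t))" using A by (auto simp: admissible1_def)
  have ix: "idx (sub_filt (emb t) (sub t) (mid t)) = idx (mid t)" "idx (quot_filt (epi t) (mid t) (quo t)) = idx (mid t)"
    by (simp_all add: sub_filt_def quot_filt_def)
  have \<phi>1: "\<phi> i \<in> idx (sub t) \<and> fil (sub t) (\<phi> i) = sfil t i" if "i \<in> idx (mid t)" for i
    using \<phi> that by (simp add: dominates_via_def ix sfil_sub_filt)
  have \<theta>1: "\<theta> i \<in> idx (quo t) \<and> fil (quo t) (\<theta> i) = qfil t i" if "i \<in> idx (mid t)" for i
    using \<theta> that by (simp add: dominates_via_def ix qfil_quot_filt)
  have \<phi>2: "\<exists>i\<in>idx (mid t). \<exists>j\<in>idx (mid t). (\<phi> i, a) \<in> le (sub t) \<and> (a, \<phi> j) \<in> le (sub t)" if "a \<in> idx (sub t)" for a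
    using \<phi> that by (simp add: dominates_via_def ix)
  have \<theta>2: "\<exists>i\<in>idx (mid t). \<exists>j\<in>idx (mid t). (\<theta> i, a) \<in> le (quo t) \<and> (a, \<theta> j) \<in> le (quo t)" if "a \<in> idx (quo t)" for a
    using \<theta> that by (simp add: dominates_via_def ix)
  show ?thesis
    unfolding adm_def
  proof (intro conjI ballI)
    show "exact_triple (emb t) (epi t) (carr (sub t)) (nul (sub t)) (carr (mid t)) (nul (mid t)) (carr (quo t)) (nul (quo t))"
      using A by (simp add: admissible1_def)
    show "\<forall>x y. emb t (x + y) = emb t x + emb t y" "\<forall>x y. epi t (x + y) = epi t x + epi t y"
      using lin by (auto simp: Vector_Spaces.linear_iff)
    show "\<exists>a\<in>idx (sub t). fil (sub t) a = sfil t i" if "i \<in> idx (mid t)" for i using \<phi>1[OF that] by blast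
    show "\<exists>a\<in>idx (quo t). fil (quo t) a = qfil t i" if "i \<in> idx (mid t)" for i using \<theta>1[OF that] by blast
    show "\<exists>i\<in>idx (mid t). sfil t i \<subseteq> fil (sub t) a" "\<exists>i\<in>idx (mid t). fil (sub t) a \<subseteq> sfil t i" if "a \<in> idx (sub t)" for a
      using \<phi>2[OF that] \<phi>1 tower_mono[OF T(1)] by metis+
    show "\<exists>i\<in>idx (mid t). qfil t i \<subseteq> fil (quo t) a" "\<exists>i\<in>idx (mid t). fil (quo t) a \<subseteq> qfil t i" if "a \<in> idx (quo t)" for a
      using \<theta>2[OF that] \<theta>1 tower_mono[OF T(3)] by metis+
  qed (use T in auto)
qed

definition "dual1_triple s1 s2 s3 t = \<lparr>emb = (\<lambda>w. w \<circ> epi t), epi = (\<lambda>w. w \<circ> emb t),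
     sub = dual1 s3 (quo t), mid = dual1 s2 (mid t), quo = dual1 s1 (sub t)\<rparr>"

lemma dual1_triple_sel [simp]:
  "emb (dual1_triple s1 s2 s3 t) = (\<lambda>w. w \<circ> epi t)" "epi (dual1_triple s1 s2 s3 t) = (\<lambda>w. w \<circ> emb t)"
  "sub (dual1_triple s1 s2 s3 t) = dual1 s3 (quo t)" "mid (dual1_triple s1 s2 s3 t) = dual1 s2 (mid t)"
  "quo (dual1_triple s1 s2 s3 t) = dual1 s1 (sub t)"
  by (simp_all add: dual1_triple_def)

lemma tower_union_subspace:
  assumes V: "vector_space s" and E: "C1_space s E"
  shows "module.subspace s (carr E)"
proof -
  interpret V: vector_space s by (rule V)
  have F: "filtered s E" using E by (simp add: C1_space_def)
  then have i0: "\<exists>i. i \<in> idx E" by (auto simp: filtered_def)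
  have sub: "V.subspace (fil E i)" if "i \<in> idx E" for i using F that by (simp add: filtered_def)
  show ?thesis
    unfolding V.subspace_def
  proof (intro conjI ballI allI)
    show "0 \<in> carr E" using i0 sub V.subspace_0 by (auto simp: carr_def)
    fix x assume "x \<in> carr E"
    then obtain i where i: "i \<in> idx E" "x \<in> fil E i" by (auto simp: carr_def)
    show "s c x \<in> carr E" for c using i sub[OF i(1)] V.subspace_scale by (auto simp: carr_def)
    fix y assume "y \<in> carr E"
    then obtain j where j: "j \<in> idx E" "y \<in> fil E j" by (auto simp: carr_def)
    obtain l where l: "(i, l) \<in> le E" "(j, l) \<in> le E" using F i(1) j(1) unfolding filtered_def by metis
    have mono: "fil E i \<subseteq> fil E l" "fil E j \<subseteq> fil E l" using F l by (auto simp: filtered_def)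
    have "l \<in> idx E" using F l by (auto simp: filtered_def partial_order_on_def preorder_on_def)
    then show "x + y \<in> carr E"
      using mono i(2) j(2) V.subspace_add[OF sub, of l x y] by (auto simp: carr_def)
  qed
qed

text \<open>Annihilators match the induced filtrations: that of \<open>sfil t i\<close> is the image
  of the annihilator in the middle (\<open>quo_fil\<close>), that of \<open>qfil t i\<close> is its
  intersection with the dual of the quotient (\<open>sub_fil\<close>). Domination then dualises,
  lower and upper bounds changing places.\<close>

lemma dual1_adm:
  fixes s1 :: "'k::{field,finite} \<Rightarrow> _" and s2 :: "'k \<Rightarrow> _"
    and s3 :: "'k \<Rightarrow> _"
  assumes V: "vector_space s1" "vector_space s2" "vector_space s3" and A: "admissible1 s1 s2 s3 t"
  shows "adm (dual1_triple s1 s2 s3 t)"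
proof -
  let ?d = "dual1_triple s1 s2 s3 t"
  note AD = admissible1_adm[OF V A]
  interpret V1: vector_space s1 by (rule V)
  interpret V2: vector_space s2 by (rule V)
  interpret V3: vector_space s3 by (rule V)
  have C: "C1_space s1 (sub t)" "C1_space s2 (mid t)" "C1_space s3 (quo t)" using A by (auto simp: admissible1_def)
  have al: "Vector_Spaces.linear s1 s2 (emb t)" and bl: "Vector_Spaces.linear s2 s3 (epi t)" using A by (auto simp: admissible1_def)
  note T = adm_towers[OF AD]
  have ne: "idx (sub t) \<noteq> {}" "idx (mid t) \<noteq> {}" "idx (quo t) \<noteq> {}" using T by (auto simp: tower_def)
  have a_scale: "emb t (s1 c x) = s2 c (emb t x)" and b_scale: "epi t (s2 c z) = s3 c (epi t z)" for c x z
    using al bl by (auto simp: Vector_Spaces.linear_iff)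
  note a_add = adm_emb_add[OF AD] and b_add = adm_epi_add[OF AD]
  have fsub: "V2.subspace (fil (mid t) i)" if "i \<in> idx (mid t)" for i using C(2) that by (simp add: C1_space_def filtered_def)
  have csub: "V1.subspace (carr (sub t))" "V2.subspace (carr (mid t))" "V3.subspace (carr (quo t))"
    using tower_union_subspace V C by auto
  have N: "subgrp (nul (quo t))" "subgrp (nul (mid t))" using tower_nul_subgrp T by auto
  have comp_a: "functional s1 (w \<circ> emb t)" if "functional s2 w" for w
    using Vector_Spaces.linear_compose[OF al that] .
  have comp_b: "functional s2 (w \<circ> epi t)" if "functional s3 w" for w
    using Vector_Spaces.linear_compose[OF bl that] .
  have b_nul: "w x = 0" if "w \<in> carr (dual1 s3 (quo t))" "x \<in> nul (quo t)" for w x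
    using that by (auto simp: dual1_carr nul_def)
  have b_congr: "w x = w y" if "w \<in> carr (dual1 s3 (quo t))" "x - y \<in> nul (quo t)" for w x y
    using b_nul[OF that] linear_functional(4)[of s3 w x y] that(1) by (simp add: dual1_carr)
  have bq: "epi t x \<in> qfil t i" if "x \<in> fil (mid t) i" "i \<in> idx (mid t)" for x i
    using that adm_epi_carr[OF AD] fil_carr[OF that(2)] subgrp_zero[OF N(1)] by (force simp: qfil_def)
  have annih_q: "w \<circ> epi t \<in> annih s2 (fil (mid t) i) \<longleftrightarrow> (\<forall>y\<in>qfil t i. w y = 0)"
    if w: "w \<in> carr (dual1 s3 (quo t))" and i: "i \<in> idx (mid t)" for w i
  proof -
    have l: "functional s3 w" using w by (simp add: dual1_carr)
    have "w y = 0" if "\<forall>x\<in>fil (mid t) i. w (epi t x) = 0" "y \<in> qfil t i" for y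
      using that b_congr[OF w, of y] by (auto simp: qfil_def)
    then show ?thesis using comp_b[OF l] bq[OF _ i] by (auto simp: annih_def)
  qed
  text \<open>The two extension arguments: a functional on \<open>E\<^sub>1\<close> extends to \<open>E\<^sub>2\<close>, and a functional on \<open>E\<^sub>2\<close>
    vanishing on \<open>E\<^sub>1\<close> descends to \<open>E\<^sub>3\<close>.\<close>
  have extend: "\<exists>x\<in>annih s2 (fil (mid t) i). \<forall>v\<in>carr (sub t). x (emb t v) = y v"
    if i: "i \<in> idx (mid t)" and y: "functional s1 y" "\<forall>v\<in>sfil t i. y v = 0" for y i
  proof -
    \<comment> \<open>The functional lives on the image of the sub plus F(i) and is zero on F(i). It
      is single valued because \<open>y\<close> vanishes on \<open>sfil t i\<close>, where the two
      summands overlap.\<close>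
    let ?R = "{(emb t v + n, y v) | v n. v \<in> carr (sub t) \<and> n \<in> fil (mid t) i}"
    have "\<exists>x. functional s2 x \<and> (\<forall>(u, a)\<in>?R. x u = a)"
    proof (rule functional_extend[OF V(2)])
      fix p a q b assume "(p, a) \<in> ?R" "(q, b) \<in> ?R"
      then obtain v n v' n' where a: "p = emb t v + n" "a = y v" "v \<in> carr (sub t)" "n \<in> fil (mid t) i"
        and b: "q = emb t v' + n'" "b = y v'" "v' \<in> carr (sub t)" "n' \<in> fil (mid t) i" by blast
      have "p + q = emb t (v + v') + (n + n')" "a + b = y (v + v')" by (simp_all add: a b a_add linear_functional(1)[OF y(1)])
      then show "(p + q, a + b) \<in> ?R" using V1.subspace_add[OF csub(1) a(3) b(3)] V2.subspace_add[OF fsub[OF i] a(4) b(4)] by blast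
    next
      fix c p a assume "(p, a) \<in> ?R"
      then obtain v n where a: "p = emb t v + n" "a = y v" "v \<in> carr (sub t)" "n \<in> fil (mid t) i" by blast
      have "s2 c p = emb t (s1 c v) + s2 c n" "c * a = y (s1 c v)"
        by (simp_all add: a a_scale V2.scale_right_distrib linear_functional(2)[OF y(1)])
      then show "(s2 c p, c * a) \<in> ?R" using V1.subspace_scale[OF csub(1) a(3)] V2.subspace_scale[OF fsub[OF i] a(4)] by blast
    next
      fix a assume "(0, a) \<in> ?R"
      then obtain v n where a: "0 = emb t v + n" "a = y v" "v \<in> carr (sub t)" "n \<in> fil (mid t) i" by blast
      have "emb t v = - n" using a(1) by (simp add: eq_neg_iff_add_eq_0)
      then show "a = 0" using a y(2) V2.subspace_neg[OF fsub[OF i] a(4)] by (simp add: sfil_def)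
    qed
    then obtain x where xl: "functional s2 x" "\<forall>(u, a)\<in>?R. x u = a" by auto
    have x: "x (emb t v + n) = y v" if "v \<in> carr (sub t)" "n \<in> fil (mid t) i" for v n using xl(2) that by auto
    have "x n = 0" if "n \<in> fil (mid t) i" for n
      using x[OF V1.subspace_0[OF csub(1)] that] adm_emb_zero[OF AD] linear_functional(3)[OF y(1)] by simp
    moreover have "x (emb t v) = y v" if "v \<in> carr (sub t)" for v
      using x[OF that V2.subspace_0[OF fsub[OF i]]] by simp
    ultimately show ?thesis using xl(1) by (intro bexI[of _ x]) (auto simp: annih_def)
  qed
  have descend: "\<exists>x\<in>carr (dual1 s3 (quo t)). \<forall>v\<in>carr (mid t). w v = x (epi t v)"
    if i: "i \<in> idx (mid t)" and w: "w \<in> annih s2 (fil (mid t) i)" "\<forall>v\<in>carr (sub t). w (emb t v) = 0" for w i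
  proof -
    have wl: "functional s2 w" using w(1) by (simp add: annih_def)
    have nsub: "s3 c u \<in> nul (quo t)" if "u \<in> nul (quo t)" for c u
      using that C(3) V3.subspace_scale by (auto simp: nul_def C1_space_def filtered_def)
    let ?R = "{(epi t x + u, w x) | x u. x \<in> carr (mid t) \<and> u \<in> nul (quo t)}"
    have "\<exists>x. functional s3 x \<and> (\<forall>(z, a)\<in>?R. x z = a)"
    proof (rule functional_extend[OF V(3)])
      fix p a q b assume "(p, a) \<in> ?R" "(q, b) \<in> ?R"
      then obtain x u x' u' where a: "p = epi t x + u" "a = w x" "x \<in> carr (mid t)" "u \<in> nul (quo t)"
        and b: "q = epi t x' + u'" "b = w x'" "x' \<in> carr (mid t)" "u' \<in> nul (quo t)" by blast
      have "p + q = epi t (x + x') + (u + u')" "a + b = w (x + x')" by (simp_all add: a b b_add linear_functional(1)[OF wl])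
      then show "(p + q, a + b) \<in> ?R" using V2.subspace_add[OF csub(2) a(3) b(3)] subgrp_add[OF N(1) a(4) b(4)] by blast
    next
      fix c p a assume "(p, a) \<in> ?R"
      then obtain x u where a: "p = epi t x + u" "a = w x" "x \<in> carr (mid t)" "u \<in> nul (quo t)" by blast
      have "s3 c p = epi t (s2 c x) + s3 c u" "c * a = w (s2 c x)"
        by (simp_all add: a b_scale V3.scale_right_distrib linear_functional(2)[OF wl])
      then show "(s3 c p, c * a) \<in> ?R" using V2.subspace_scale[OF csub(2) a(3)] nsub[OF a(4)] by blast
    next
      fix a assume "(0, a) \<in> ?R"
      then obtain x u where a: "0 = epi t x + u" "a = w x" "x \<in> carr (mid t)" "u \<in> nul (quo t)" by blast
      have "epi t x = - u" using a(1) by (simp add: eq_neg_iff_add_eq_0)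
      then have "epi t x \<in> nul (quo t)" using subgrp_uminus[OF N(1) a(4)] by simp
      then obtain v where v: "v \<in> carr (sub t)" "x - emb t v \<in> nul (mid t)" using adm_kernel[OF AD a(3)] by blast
      have "w (x - emb t v) = 0" using w(1) v(2) nul_fil[OF i] by (auto simp: annih_def)
      then show "a = 0" using w(2) v(1) linear_functional(4)[OF wl] by (simp add: a(2))
    qed
    then obtain x where xl: "functional s3 x" "\<forall>(z, a)\<in>?R. x z = a" by auto
    have x: "x (epi t z + u) = w z" if "z \<in> carr (mid t)" "u \<in> nul (quo t)" for z u using xl(2) that by auto
    \<comment> \<open>To belong to the dual of the quotient, the descended functional must vanish on
      a member of its filtration; \<open>qfil t i\<close> is one.\<close>
    obtain c where c: "c \<in> idx (quo t)" "fil (quo t) c = qfil t i" using adm_qfil[OF AD i] by blast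
    have "x y = 0" if y: "y \<in> qfil t i" for y
    proof -
      obtain p where p: "p \<in> fil (mid t) i" "y - epi t p \<in> nul (quo t)" using y by (auto simp: qfil_def)
      then show ?thesis using x[OF _ p(2), of p] fil_carr[OF i] w(1) by (auto simp: annih_def)
    qed
    then have "x \<in> carr (dual1 s3 (quo t))" using xl(1) c by (auto simp: dual1_carr)
    then show ?thesis using x[OF _ subgrp_zero[OF N(1)]] by force
  qed
  have linm: "functional s (\<lambda>x. v x - w x)" if "functional s v" "functional s w"
    for v w and s :: "'k \<Rightarrow> _"
    using that by (auto simp: Vector_Spaces.linear_iff algebra_simps)
  have quo_fil: "annih s1 (sfil t i) = qfil ?d i" if i: "i \<in> idx (mid t)" for i
  proof (intro equalityI subsetI)
    obtain a where a: "a \<in> idx (sub t)" "fil (sub t) a = sfil t i" using adm_sfil[OF AD i] by blast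
    fix y assume y: "y \<in> annih s1 (sfil t i)"
    then have yl: "functional s1 y" by (simp add: annih_def)
    obtain x where x: "x \<in> annih s2 (fil (mid t) i)" "\<forall>v\<in>carr (sub t). x (emb t v) = y v"
      using extend[OF i yl] y by (auto simp: annih_def)
    have xl: "functional s2 x" using x(1) by (simp add: annih_def)
    have "y - (x \<circ> emb t) \<in> nul (dual1 s1 (sub t))"
      using x(2) linm[OF yl comp_a[OF xl]] by (simp add: dual1_nul[OF ne(1)] fun_diff_def)
    moreover have "y \<in> carr (dual1 s1 (sub t))" using y a by (auto simp: dual1_carr annih_def)
    ultimately show "y \<in> qfil ?d i" using x(1) by (auto simp: qfil_def)
  next
    fix y assume "y \<in> qfil ?d i"
    then obtain x where x: "y \<in> carr (dual1 s1 (sub t))" "x \<in> annih s2 (fil (mid t) i)" "y - (x \<circ> emb t) \<in> nul (dual1 s1 (sub t))"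
      by (auto simp: qfil_def)
    then have "\<forall>v\<in>carr (sub t). y v = x (emb t v)" by (auto simp: dual1_nul[OF ne(1)])
    then show "y \<in> annih s1 (sfil t i)" using x by (auto simp: annih_def dual1_carr sfil_def)
  qed
  have sub_fil: "annih s3 (qfil t i) = sfil ?d i" if i: "i \<in> idx (mid t)" for i
  proof -
    obtain c where c: "c \<in> idx (quo t)" "fil (quo t) c = qfil t i" using adm_qfil[OF AD i] by blast
    have 1: "w \<in> carr (dual1 s3 (quo t))" if "w \<in> annih s3 (qfil t i)" for w
      using that c by (auto simp: dual1_carr annih_def)
    have 2: "w \<in> annih s3 (qfil t i) \<longleftrightarrow> w \<circ> epi t \<in> annih s2 (fil (mid t) i)" if w: "w \<in> carr (dual1 s3 (quo t))" for w
      unfolding annih_q[OF w i] using w by (simp add: annih_def dual1_carr)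
    show ?thesis using 1 2 unfolding sfil_def dual1_triple_sel dual1_sel by blast
  qed
  show ?thesis
    unfolding adm_def
  proof (intro conjI ballI)
    show "tower (sub ?d)" "tower (mid ?d)" "tower (quo ?d)"
      using dual1_tower V C by auto
    show "\<forall>x y. emb ?d (x + y) = emb ?d x + emb ?d y"
      "\<forall>x y. epi ?d (x + y) = epi ?d x + epi ?d y"
      by auto
    show "exact_triple (emb ?d) (epi ?d)
       (carr (sub ?d)) (nul (sub ?d))
       (carr (mid ?d)) (nul (mid ?d))
       (carr (quo ?d)) (nul (quo ?d))"
      unfolding exact_triple_def dual1_triple_sel
    proof (intro conjI ballI)
      show "(\<lambda>w. w \<circ> epi t) ` carr (dual1 s3 (quo t)) \<subseteq> carr (dual1 s2 (mid t))"
      proof clarify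
        fix w assume w: "w \<in> carr (dual1 s3 (quo t))"
        then obtain a where a: "a \<in> idx (quo t)" "\<forall>v\<in>fil (quo t) a. w v = 0" by (auto simp: dual1_carr)
        obtain i where i: "i \<in> idx (mid t)" "qfil t i \<subseteq> fil (quo t) a" using adm_qfil_lower[OF AD a(1)] by blast
        then have "w \<circ> epi t \<in> annih s2 (fil (mid t) i)" using annih_q[OF w i(1)] a(2) by blast
        then show "w \<circ> epi t \<in> carr (dual1 s2 (mid t))" using i(1) by (auto simp: carr_def)
      qed
      show "w \<circ> epi t \<in> nul (dual1 s2 (mid t)) \<longleftrightarrow> w \<in> nul (dual1 s3 (quo t))" if w: "w \<in> carr (dual1 s3 (quo t))" for w
      proof -
        have l: "functional s3 w" using w by (simp add: dual1_carr)
        have "w y = 0" if "\<forall>x\<in>carr (mid t). w (epi t x) = 0" "y \<in> carr (quo t)" for y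
          using adm_lift[OF AD that(2)] that(1) b_congr[OF w] by metis
        then show ?thesis
          using comp_b[OF l] l adm_epi_carr[OF AD] by (auto simp: dual1_nul[OF ne(2)] dual1_nul[OF ne(3)])
      qed
      show "(\<lambda>w. w \<circ> emb t) ` carr (dual1 s2 (mid t)) \<subseteq> carr (dual1 s1 (sub t))"
      proof clarify
        fix w assume w: "w \<in> carr (dual1 s2 (mid t))"
        then obtain i where i: "i \<in> idx (mid t)" "\<forall>v\<in>fil (mid t) i. w v = 0" and l: "functional s2 w" by (auto simp: dual1_carr)
        obtain a where a: "a \<in> idx (sub t)" "fil (sub t) a = sfil t i" using adm_sfil[OF AD i(1)] by blast
        show "w \<circ> emb t \<in> carr (dual1 s1 (sub t))" unfolding dual1_carr
          using comp_a[OF l] a i(2) by (intro conjI bexI[of _ a]) (auto simp: sfil_def)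
      qed
      show "(\<lambda>w. w \<circ> emb t) ` nul (dual1 s2 (mid t)) \<subseteq> nul (dual1 s1 (sub t))"
        using comp_a adm_emb_carr[OF AD] by (auto simp: dual1_nul[OF ne(2)] dual1_nul[OF ne(1)])
      show "\<exists>x\<in>carr (dual1 s2 (mid t)). y - (x \<circ> emb t) \<in> nul (dual1 s1 (sub t))" if y: "y \<in> carr (dual1 s1 (sub t))" for y
      proof -
        obtain a where a: "a \<in> idx (sub t)" "\<forall>v\<in>fil (sub t) a. y v = 0" and l: "functional s1 y" using y by (auto simp: dual1_carr)
        obtain i where i: "i \<in> idx (mid t)" "sfil t i \<subseteq> fil (sub t) a" using adm_sfil_lower[OF AD a(1)] by blast
        have "y \<in> qfil ?d i" using quo_fil[OF i(1)] l a(2) i(2) by (auto simp: annih_def)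
        then show ?thesis using i(1) by (auto simp: qfil_def carr_def)
      qed
      show "w \<circ> emb t \<in> nul (dual1 s1 (sub t)) \<longleftrightarrow> (\<exists>x1\<in>carr (dual1 s3 (quo t)). w - (x1 \<circ> epi t) \<in> nul (dual1 s2 (mid t)))"
        if w: "w \<in> carr (dual1 s2 (mid t))" for w
      proof
        have l: "functional s2 w" using w by (simp add: dual1_carr)
        obtain i where i: "i \<in> idx (mid t)" "w \<in> annih s2 (fil (mid t) i)" using w by (auto simp: carr_def)
        {
          assume "w \<circ> emb t \<in> nul (dual1 s1 (sub t))"
          then have "\<forall>v\<in>carr (sub t). w (emb t v) = 0" by (simp add: dual1_nul[OF ne(1)])
          then obtain x where x: "x \<in> carr (dual1 s3 (quo t))" "\<forall>v\<in>carr (mid t). w v = x (epi t v)" using descend[OF i] by blast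
          have xl: "functional s3 x" using x(1) by (simp add: dual1_carr)
          have "w - (x \<circ> epi t) \<in> nul (dual1 s2 (mid t))"
            using x(2) linm[OF l comp_b[OF xl]] by (simp add: dual1_nul[OF ne(2)] fun_diff_def)
          then show "\<exists>x1\<in>carr (dual1 s3 (quo t)). w - (x1 \<circ> epi t) \<in> nul (dual1 s2 (mid t))" using x(1) by blast
        }
        assume "\<exists>x1\<in>carr (dual1 s3 (quo t)). w - (x1 \<circ> epi t) \<in> nul (dual1 s2 (mid t))"
        then obtain x where x: "x \<in> carr (dual1 s3 (quo t))" "\<forall>v\<in>carr (mid t). w v - x (epi t v) = 0"
          by (auto simp: dual1_nul[OF ne(2)])
        then show "w \<circ> emb t \<in> nul (dual1 s1 (sub t))"
          using comp_a[OF l] adm_emb_carr[OF AD] b_nul[OF x(1) adm_epi_emb[OF AD]] by (simp add: dual1_nul[OF ne(1)])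
      qed
    qed
  next
    have anti: "annih s B \<subseteq> annih s A" if "A \<subseteq> B" for A B and s :: "'k \<Rightarrow> _"
      using that by (auto simp: annih_def)
    {
      fix i assume "i \<in> idx (mid ?d)"
      then have i: "i \<in> idx (mid t)" by simp
      show "\<exists>a\<in>idx (sub ?d). fil (sub ?d) a = sfil ?d i" "\<exists>a\<in>idx (quo ?d). fil (quo ?d) a = qfil ?d i"
        using adm_qfil[OF AD i] sub_fil[OF i] adm_sfil[OF AD i] quo_fil[OF i] by (metis dual1_triple_sel dual1_sel)+
    }
    {
      fix a assume "a \<in> idx (sub ?d)"
      then have a: "a \<in> idx (quo t)" by simp
      show "\<exists>i\<in>idx (mid ?d). sfil ?d i \<subseteq> fil (sub ?d) a" "\<exists>i\<in>idx (mid ?d). fil (sub ?d) a \<subseteq> sfil ?d i"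
        using adm_qfil_upper[OF AD a] adm_qfil_lower[OF AD a] sub_fil anti by (metis dual1_triple_sel dual1_sel)+
    }
    fix a assume "a \<in> idx (quo ?d)"
    then have a: "a \<in> idx (sub t)" by simp
    show "\<exists>i\<in>idx (mid ?d). qfil ?d i \<subseteq> fil (quo ?d) a" "\<exists>i\<in>idx (mid ?d). fil (quo ?d) a \<subseteq> qfil ?d i"
      using adm_sfil_upper[OF AD a] adm_sfil_lower[OF AD a] quo_fil anti by (metis dual1_triple_sel dual1_sel)+
  qed
qed

lemma dual1_tpair:
  fixes s1 :: "'k::{field,finite} \<Rightarrow> _" and s2 :: "'k \<Rightarrow> _"
    and s3 :: "'k \<Rightarrow> _"
  assumes \<psi>: "nontrivial_character \<psi>" and V: "vector_space s1" "vector_space s2" "vector_space s3"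
    and A: "admissible1 s1 s2 s3 t"
  shows "tpair t (dual1_triple s1 s2 s3 t) (chi \<psi>) (chi \<psi>) (chi \<psi>)"
proof -
  have "C1_space s1 (sub t)" "C1_space s2 (mid t)" "C1_space s3 (quo t)" using A by (auto simp: admissible1_def)
  then have "pairing (sub t) (dual1 s1 (sub t)) (chi \<psi>)" "pairing (mid t) (dual1 s2 (mid t)) (chi \<psi>)"
    "pairing (quo t) (dual1 s3 (quo t)) (chi \<psi>)" by (simp_all add: dual1_pairing[OF \<psi>] V)
  then show ?thesis using admissible1_adm[OF V A] dual1_adm[OF V A] by (simp add: tpair_def chi_def)
qed

section \<open>The dual of a \<open>C\<^sub>2\<close>-space\<close>

lemma dual2_sel [simp]:
  "idx (dual2 s E) = idx E" "le (dual2 s E) = (le E)\<inverse>" "lev (dual2 s E) i j = dual1 s (lev E j i)"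
  by (simp_all add: dual2_def)

lemma dual_triple_sel [simp]:
  "emb (dual_triple s1 s2 s3 T) = (\<lambda>w. w \<circ> epi T)" "epi (dual_triple s1 s2 s3 T) = (\<lambda>w. w \<circ> emb T)"
  "sub (dual_triple s1 s2 s3 T) = dual2 s3 (quo T)" "mid (dual_triple s1 s2 s3 T) = dual2 s2 (mid T)"
  "quo (dual_triple s1 s2 s3 T) = dual2 s1 (sub T)" "eps (dual_triple s1 s2 s3 T) = gam T"
  "gam (dual_triple s1 s2 s3 T) = eps T"
  by (simp_all add: dual_triple_def)

lemma lev_triple_dual2: "lev_triple (dual2 s E) i j l = dual1_triple s s s (lev_triple E l j i)"
  by (auto simp: lev_triple_def dual1_triple_def)

lemma level_dual_triple: "level (dual_triple s1 s2 s3 T) i j = dual1_triple s1 s2 s3 (level T j i)"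
  by simp

lemma filtered_dirset:
  assumes "filtered s E"
  shows "dirset (idx E) (le E)"
  using assms unfolding dirset_def filtered_def partial_order_on_def preorder_on_def by blast

lemma C2_space_dirset: "C2_space s E ==> dirset (idx E) (le E)"
  by (auto simp: C2_space_def intro: filtered_dirset)

lemma C2_space_admissible1: "C2_space s E ==> (i, j) \<in> le E ==> (j, k) \<in> le E ==> admissible1 s s s (lev_triple E i j k)"
  by (simp add: C2_space_def)

lemma C2_space_nice2:
  fixes s :: "'k::{field,finite} \<Rightarrow> _"
  assumes "vector_space s" "C2_space s E"
  shows "nice2 E" and "nice2 (dual2 s E)"
proof -
  note d = C2_space_dirset[OF assms(2)] and a = C2_space_admissible1[OF assms(2)]
  show "nice2 E" unfolding nice2_def using d admissible1_adm[OF assms(1,1,1) a] by blast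
  show "nice2 (dual2 s E)"
    unfolding nice2_def dual2_sel lev_triple_dual2 using dirset_converse[OF d] dual1_adm[OF assms(1,1,1) a] by blast
qed

section \<open>Systems of measures in duality for spaces and triples\<close>

lemma dual_sys_exists:
  assumes N: "nice2 E" "nice2 E'" "idx E' = idx E" "le E' = (le E)\<inverse>" and v: "msys E v"
    and tp: "\<And>l j i. (l, j) \<in> le E ==> (j, i) \<in> le E ==> tpair (lev_triple E l j i) (lev_triple E' i j l) \<chi> \<chi> \<chi>"
  shows "\<exists>v'. dual_sys E E' \<chi> v v'"
proof -
  have P: "pairing (lev E l i) (lev E' i l) \<chi>" if li: "(l, i) \<in> le E" for l i
    using tpair_pairing(1)[OF tp[OF li le_refl[OF N(1) le_idx(2)[OF N(1) li]]]] by simp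
  define v' where "v' i l = (SOME m'. mdual (lev E l i) (lev E' i l) (v l i) m')" for i l
  have d: "mdual (lev E l i) (lev E' i l) (v l i) (v' i l)" if li: "(l, i) \<in> le E" for l i
    unfolding v'_def using mdual_exists[OF P[OF li] msys_meas[OF v li] msys_nonzero[OF v li]] by (rule someI_ex)
  have "msys E' v'"
    unfolding msys_def
  proof (intro conjI allI impI)
    show "\<forall>(l, i)\<in>le E'. v' l i \<in> meas (lev E' l i) \<and> v' l i \<noteq> 0"
      using d mdual_nonzero(2)[OF P d] by (auto simp: N(4) mdual_def)
    fix l j i assume "(l, j) \<in> le E'" "(j, i) \<in> le E'"
    then have le: "(i, j) \<in> le E" "(j, l) \<in> le E" by (auto simp: N(4))
    note il = le_trans[OF N(1) le]
    \<comment> \<open>The product of the inverses is inverse to the product, by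
      \<open>mdual_meas_prod\<close>. Since inverses are unique, the system of inverses is
      multiplicative.\<close>
    have "mdual (lev E i l) (lev E' l i) (v i l) (meas_prod (lev_triple E' l j i) (v' l j) (v' j i))"
      using mdual_meas_prod[OF tp[OF le], of "v i j" "v' j i" "v j l" "v' l j"] d[OF le(1)] d[OF le(2)] msys_mult[OF v le] by simp
    then show "meas_prod (lev_triple E' l j i) (v' l j) (v' j i) = v' l i"
      by (rule mdual_unique[OF P[OF il] d[OF il]])
  qed
  then show ?thesis using N v tp d by (auto simp: dual_sys_def)
qed

lemma dual2_dual_sys:
  fixes s :: "'k::{field,finite} \<Rightarrow> _"
  assumes "nontrivial_character \<psi>" "vector_space s" "C2_space s E" "msys E v"
  shows "\<exists>v'. dual_sys E (dual2 s E) (chi \<psi>) v v'"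
  using dual_sys_exists[OF C2_space_nice2[OF assms(2,3)], where \<chi> = "chi \<psi>", OF _ _ assms(4)]
    dual1_tpair[OF assms(1) assms(2,2,2) C2_space_admissible1[OF assms(3)]] by (simp add: lev_triple_dual2)

lemma admissible2_nice3:
  fixes s1 :: "'k::{field,finite} \<Rightarrow> _" and s2 :: "'k \<Rightarrow> _"
    and s3 :: "'k \<Rightarrow> _"
  assumes V: "vector_space s1" "vector_space s2" "vector_space s3" and A: "admissible2 s1 s2 s3 T"
  shows "nice3 T" and "nice3 (dual_triple s1 s2 s3 T)" (is ?B)
proof -
  have C: "C2_space s1 (sub T)" "C2_space s2 (mid T)" "C2_space s3 (quo T)" using A by (auto simp: admissible2_def)
  have dv: "dominates_via (eps T) (sub T) (sub_filt (emb T) (sub T) (mid T))"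
    "dominates_via (gam T) (quo T) (quot_filt (epi T) (mid T) (quo T))" using A by (auto simp: admissible2_def)
  have ix: "idx (sub_filt (emb T) (sub T) (mid T)) = idx2 T" "le (sub_filt (emb T) (sub T) (mid T)) = le2 T"
    "idx (quot_filt (epi T) (mid T) (quo T)) = idx2 T" "le (quot_filt (epi T) (mid T) (quo T)) = le2 T"
    by (simp_all add: sub_filt_def quot_filt_def)
  have m: "\<forall>(i, j)\<in>le2 T. (eps T i, eps T j) \<in> le (sub T) \<and> (gam T i, gam T j) \<in> le (quo T)"
    using dv unfolding dominates_via_def ix by blast
  have c1: "\<forall>a\<in>idx (sub T). \<exists>i\<in>idx2 T. \<exists>j\<in>idx2 T. (eps T i, a) \<in> le (sub T) \<and> (a, eps T j) \<in> le (sub T)"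
    using dv(1) unfolding dominates_via_def ix by blast
  have c3: "\<forall>a\<in>idx (quo T). \<exists>i\<in>idx2 T. \<exists>j\<in>idx2 T. (gam T i, a) \<in> le (quo T) \<and> (a, gam T j) \<in> le (quo T)"
    using dv(2) unfolding dominates_via_def ix by blast
  have ad: "admissible1 s1 s2 s3 (level T j i)" if "(j, i) \<in> le2 T" for j i using A that by (auto simp: admissible2_def)
  show "nice3 T"
    unfolding nice3_def using C2_space_nice2(1)[OF V(1) C(1)] C2_space_nice2(1)[OF V(2) C(2)] C2_space_nice2(1)[OF V(3) C(3)]
      m c1 c3 admissible1_adm[OF V ad] by blast
  show ?B
    unfolding nice3_def dual_triple_sel dual2_sel
  proof (intro conjI)
    show "\<forall>(j, i)\<in>(le2 T)\<inverse>. adm (level (dual_triple s1 s2 s3 T) j i)"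
      using dual1_adm[OF V ad] by (auto simp: level_dual_triple)
    show "\<forall>(i, j)\<in>(le2 T)\<inverse>. (gam T i, gam T j) \<in> (le (quo T))\<inverse> \<and> (eps T i, eps T j) \<in> (le (sub T))\<inverse>"
      using m by blast
    show "\<forall>a\<in>idx (quo T). \<exists>i\<in>idx2 T. \<exists>j\<in>idx2 T. (gam T i, a) \<in> (le (quo T))\<inverse> \<and> (a, gam T j) \<in> (le (quo T))\<inverse>"
      using c3 unfolding converse_iff by blast
    show "\<forall>a\<in>idx (sub T). \<exists>i\<in>idx2 T. \<exists>j\<in>idx2 T. (eps T i, a) \<in> (le (sub T))\<inverse> \<and> (a, eps T j) \<in> (le (sub T))\<inverse>"
      using c1 unfolding converse_iff by blast
  qed (use C2_space_nice2(2) V C in auto)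
qed

lemma dual_triples_exist:
  fixes s1 :: "'k::{field,finite} \<Rightarrow> _" and s2 :: "'k \<Rightarrow> _"
    and s3 :: "'k \<Rightarrow> _"
  assumes \<psi>: "nontrivial_character \<psi>" and V: "vector_space s1" "vector_space s2" "vector_space s3"
    and A: "admissible2 s1 s2 s3 T" and v1: "msys (sub T) v1" and v3: "msys (quo T) v3"
  shows "\<exists>v1' v2 v2' v3'. dual_triples T (dual_triple s1 s2 s3 T) (chi \<psi>) (chi \<psi>) (chi \<psi>) v1 v1' v2 v2' v3 v3'"
proof -
  let ?T' = "dual_triple s1 s2 s3 T"
  have C: "C2_space s1 (sub T)" "C2_space s2 (mid T)" "C2_space s3 (quo T)" using A by (auto simp: admissible2_def)
  note N = admissible2_nice3[OF V A]
  have tp: "tpair (level T j i) (level ?T' i j) (chi \<psi>) (chi \<psi>) (chi \<psi>)" if "(j, i) \<in> le2 T" for j i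
    using dual1_tpair[OF \<psi> V, of "level T j i"] A that by (auto simp: admissible2_def level_dual_triple)
  define v2 where "v2 j i = meas_prod (level T j i) (v1 (eps T j) (eps T i)) (v3 (gam T j) (gam T i))" for j i
  have v2: "msys (mid T) v2" using msys_triple[OF N(1) v1 v3] by (simp add: v2_def[abs_def])
  obtain v1' where D1: "dual_sys (sub T) (dual2 s1 (sub T)) (chi \<psi>) v1 v1'" using dual2_dual_sys[OF \<psi> V(1) C(1) v1] ..
  obtain v2' where D2: "dual_sys (mid T) (dual2 s2 (mid T)) (chi \<psi>) v2 v2'" using dual2_dual_sys[OF \<psi> V(2) C(2) v2] ..
  obtain v3' where D3: "dual_sys (quo T) (dual2 s3 (quo T)) (chi \<psi>) v3 v3'" using dual2_dual_sys[OF \<psi> V(3) C(3) v3] ..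
  \<comment> \<open>\<open>v2'\<close> was obtained as inverse of \<open>v2\<close>, a product of
    measures, and the product of the inverses is such an inverse too.\<close>
  have "v2' i j = meas_prod (level ?T' i j) (v3' (gam T i) (gam T j)) (v1' (eps T i) (eps T j))" if ji: "(j, i) \<in> le2 T" for j i
  proof -
    have "mdual (lev2 T j i) (lev (mid ?T') i j) (v2 j i)
        (meas_prod (level ?T' i j) (v3' (gam T i) (gam T j)) (v1' (eps T i) (eps T j)))"
      unfolding v2_def
      using mdual_meas_prod[OF tp[OF ji], of "v1 (eps T j) (eps T i)" "v1' (eps T i) (eps T j)" "v3 (gam T j) (gam T i)" "v3' (gam T i) (gam T j)"]
        dual_sys_mdual[OF D1 nice3_eps[OF N(1) ji]] dual_sys_mdual[OF D3 nice3_gam[OF N(1) ji]] by simp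
    then show ?thesis
      using mdual_unique[OF dual_sys_pairing[OF D2 ji] _ dual_sys_mdual[OF D2 ji]] by simp
  qed
  then have "dual_triples T ?T' (chi \<psi>) (chi \<psi>) (chi \<psi>) v1 v1' v2 v2' v3 v3'"
    using N tp D1 D2 D3 by (simp add: dual_triples_def v2_def)
  then show ?thesis by blast
qed

section \<open>The Fourier transform in coordinates\<close>

text \<open>The transform exchanges \<open>rs\<close> and \<open>ps\<close>, so a restriction
  followed by a push-forward becomes a push-forward followed by a restriction; \<open>rs_ps\<close>
  restores the order used in \<open>tr\<close>.\<close>

lemma four_tr:
  assumes D: "dual_sys E E' \<chi> v v'" and s: "sublev E i l i' l'" and f: "f \<in> lfun E l i"
  shows "four \<chi> (lev E' i' l') (v l' i') (tr E v i l i' l' f) = tr E' v' l i l' i' (four \<chi> (lev E' i l) (v l i) f)"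
proof -
  note L = dual_sys_laws[OF D] and le = sublev_le[OF L s]
  note N = dual_sys_nice[OF D] and M = dual_sys_msys[OF D]
  note f' = rs_test_fun[OF N(1) le(2,6) f] and F = sys_four_test_fun[OF D le(1) f]
  have le': "(i, i') \<in> le E'" "(i', l') \<in> le E'" "(l', l) \<in> le E'" using le dual_sys_le[OF D] by auto
  show ?thesis
    unfolding tr_def four_ps[OF D le(4,5) f'] four_rs[OF D le(2,6) f] by (rule rs_ps[OF N(2) M(2) le' F])
qed

definition "ff E' \<chi> v g = (\<lambda>j i. four \<chi> (lev E' i j) (v j i) (g i j))"

lemma ff_fam:
  assumes D: "dual_sys E E' \<chi> v v'" and g: "fam E v g"
  shows "fam E' v' (ff E' \<chi> v g)"
  unfolding fam_def
proof (intro conjI allI impI)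
  note L = dual_sys_laws[OF D]
  show "ff E' \<chi> v g i l \<in> lfun E' l i" if "(l, i) \<in> le E'" for l i
    using that sys_four_test_fun[OF D _ fam_test_fun[OF L g]] dual_sys_le[OF D] by (simp add: ff_def)
  fix l j i assume "(l, j) \<in> le E'" "(j, i) \<in> le E'"
  then have le: "(i, j) \<in> le E" "(j, l) \<in> le E" using dual_sys_le[OF D] by auto
  note t = fam_test_fun[OF L g le_trans[OF dual_sys_nice(1)[OF D] le]]
  have "ps E v i j l (g l i) = g l j" "rs E i j (g l i) = g j i" using g le by (simp_all add: fam_def)
  then show "rs E' l j (ff E' \<chi> v g i l) = ff E' \<chi> v g j l" "ps E' v' l j i (ff E' \<chi> v g i l) = ff E' \<chi> v g i j"
    using four_ps[OF D le t] four_rs[OF D le t] by (simp_all add: ff_def)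
qed

context
  fixes \<psi> :: "'k::{field,finite} \<Rightarrow> complex" and s :: "'k \<Rightarrow> _" and E v v' b
  assumes D: "dual_sys E (dual2 s E) (chi \<psi>) v v'" and b: "b \<in> idx E"
begin

lemma meas_inv_coord:
  assumes li: "(l, i) \<in> le E" and r: "r \<noteq> 0"
  shows "meas_inv s (lev E l i) (\<lambda>f. r * v l i f) = (\<lambda>f. inverse r * v' i l f)"
  using meas_inv_mdual[of "lev E l i" s "chi \<psi>"] dual_sys_pairing[OF D li] mdual_scale[OF dual_sys_mdual[OF D li] r] by simp

text \<open>If \<open>\<rho>\<close> and \<open>\<sigma>\<close> have coordinates \<open>r\<close>
  and \<open>t\<close>, the element is a multiple of one with coordinate
  \<open>inverse r * t\<close> on both sides: on the dual \<open>meas_inv\<close> supplies the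
  inverse of \<open>r\<close>, while \<open>vm_inv\<close> undoes that of \<open>t\<close>.\<close>

lemma vm_dual_cvm:
  assumes ij: "i \<in> idx E" "j \<in> idx E"
  shows "vm_dual s E i j (cvm E v i j c) = cvm (dual2 s E) v' i j c"
proof -
  note N = dual_sys_nice[OF D] and M = dual_sys_msys[OF D]
  have ij': "i \<in> idx (dual2 s E)" "j \<in> idx (dual2 s E)" using ij by simp_all
  have inv: "vm_inv E l i (vm_of E l i (\<lambda>f. r * v l i f)) = cvm E v i l (inverse r)"
    and dinv: "vm_inv (dual2 s E) i l (vm_of (dual2 s E) i l (meas_inv s (lev E l i) (\<lambda>f. r * v l i f))) = cvm (dual2 s E) v' l i r"
    and dof: "vm_of (dual2 s E) i l (meas_inv s (lev E l i) (\<lambda>f. r * v l i f)) = cvm (dual2 s E) v' i l (inverse r)"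
    if "(l, i) \<in> le E" "r \<noteq> 0" for l i r
    using that le_idx[OF N(1) that(1)]
    by (simp_all add: vm_of_cvm[OF N(1) M(1)] vm_inv_cvm[OF N(1) M(1)] meas_inv_coord vm_of_cvm[OF N(2) M(2)] vm_inv_cvm[OF N(2) M(2)])
  obtain l where l: "(l, i) \<in> le E" "(l, j) \<in> le E" using le_lower[OF N(1) ij] .
  show ?thesis
    unfolding vm_dual_def
  proof (rule the_equality, goal_cases)
    case 1
    show ?case
      using l msys_meas[OF M(1) l(1)] msys_meas[OF M(1) l(2)] msys_nonzero[OF M(1) l(1)] msys_nonzero[OF M(1) l(2)]
        inv[OF l(1), of 1] dinv[OF l(2), of 1] dof[OF l(1), of 1] vm_of_cvm_one[OF N(1) M(1) l(2)] le_idx[OF N(1) l(1)] ij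
      by (intro exI[of _ l] exI[of _ "v l i"] exI[of _ "v l j"] exI[of _ c])
        (simp add: vm_comp_cvm[OF N(1) M(1)] vm_comp_cvm[OF N(2) M(2)] vm_scale_cvm[OF N(1) M(1)] vm_scale_cvm[OF N(2) M(2)])
  next
    case (2 \<nu>)
    then obtain l \<rho> \<sigma> d where 1: "(l, i) \<in> le E" "(l, j) \<in> le E"
        "\<rho> \<in> meas (lev E l i)" "\<rho> \<noteq> 0" "\<sigma> \<in> meas (lev E l j)" "\<sigma> \<noteq> 0"
        "cvm E v i j c = vm_scale d (vm_comp E i l j (vm_inv E l i (vm_of E l i \<rho>)) (vm_of E l j \<sigma>))"
        "\<nu> = vm_scale d (vm_comp (dual2 s E) i l j
              (vm_of (dual2 s E) i l (meas_inv s (lev E l i) \<rho>))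
              (vm_inv (dual2 s E) j l (vm_of (dual2 s E) j l (meas_inv s (lev E l j) \<sigma>))))" by blast
    obtain r where r: "\<rho> = (\<lambda>f. r * v l i f)" using msys_coord[OF N(1) M(1) 1(1,3)] .
    obtain t where t: "\<sigma> = (\<lambda>f. t * v l j f)" using msys_coord[OF N(1) M(1) 1(2,5)] .
    have rt: "r \<noteq> 0" "t \<noteq> 0" using 1(4,6) by (auto simp: r t)
    note l = le_idx(1)[OF N(1) 1(1)]
    have "c = d * (inverse r * t)"
      using 1(7) inv[OF 1(1) rt(1)] l ij
      by (simp add: r t vm_of_cvm[OF N(1) M(1) 1(2)] vm_comp_cvm[OF N(1) M(1)] vm_scale_cvm[OF N(1) M(1)] cvm_eq_iff[OF N(1) M(1)])
    moreover have "\<nu> = cvm (dual2 s E) v' i j (d * (inverse r * t))"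
      using 1(8) dof[OF 1(1) rt(1)] dinv[OF 1(2) rt(2)] l ij
      by (simp add: r t vm_comp_cvm[OF N(2) M(2)] vm_scale_cvm[OF N(2) M(2)])
    ultimately show ?case by simp
  qed
qed

lemma fourier_level_tf:
  assumes ji: "(j, i) \<in> le E" and f: "f \<in> lfun E j i"
  shows "fourier_level \<psi> s E b i j (tf E v b i j f) =
    tf (dual2 s E) v' b j i (four (chi \<psi>) (lev (dual2 s E) i j) (v j i) f)"
proof -
  note N = dual_sys_nice[OF D] and M = dual_sys_msys[OF D]
  note ix = le_idx[OF N(1) ji]
  have ix': "i \<in> idx (dual2 s E)" "b \<in> idx (dual2 s E)" using ix b by simp_all
  have F1: "fourier1 \<psi> s (lev E j i) (\<lambda>g. r * v j i g) f = (\<lambda>w. r * four (chi \<psi>) (lev (dual2 s E) i j) (v j i) f w)" for r f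
    by (simp add: fourier1_four four_meas_scale)
  show ?thesis
    unfolding fourier_level_def
  proof (rule the_equality, goal_cases)
    case 1
    show ?case
      using f msys_meas[OF M(1) ji] cvm_in_vmeas[OF N(1) M(1)] ix b F1[of 1]
      by (intro exI[of _ f] exI[of _ "v j i"] exI[of _ "cvm E v i b 1"])
        (simp add: vm_of_cvm_one[OF N(1) M(1) ji] vm_comp_cvm[OF N(1) M(1)] vm_dual_cvm tf_def)
  next
    case (2 y)
    then obtain f' \<rho> \<nu> where 1: "f' \<in> lfun E j i" "\<rho> \<in> meas (lev E j i)" "\<nu> \<in> vmeas E i b"
        "tf E v b i j f = fun_ten E b i j f' (vm_comp E j i b (vm_of E j i \<rho>) \<nu>)"
        "y = fun_ten (dual2 s E) b j i (fourier1 \<psi> s (lev E j i) \<rho> f') (vm_dual s E i b \<nu>)" by blast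
    obtain n where n: "\<nu> = cvm E v i b n" using 1(3) vmeas_cvm[OF N(1) M(1) ix(2) b] by blast
    obtain r where r: "\<rho> = (\<lambda>f. r * v j i f)" using msys_coord[OF N(1) M(1) ji 1(2)] .
    have "f = (\<lambda>x. r * n * f' x)"
      using tf_inj[OF N(1) M(1) ix(1) b f] 1(4) ix b
      by (simp add: n r vm_of_cvm[OF N(1) M(1) ji] vm_comp_cvm[OF N(1) M(1)] fun_ten_cvm[OF N(1) M(1)])
    then have "four (chi \<psi>) (lev (dual2 s E) i j) (v j i) f = (\<lambda>w. r * n * four (chi \<psi>) (lev (dual2 s E) i j) (v j i) f' w)"
      using lin_scale[OF lin_four[OF dual_sys_pairing[OF D ji] msys_meas[OF M(1) ji]] 1(1), of "r * n"] by simp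
    moreover have "y = tf (dual2 s E) v' b j i (\<lambda>w. n * (r * four (chi \<psi>) (lev (dual2 s E) i j) (v j i) f' w))"
      unfolding 1(5) n r F1 vm_dual_cvm[OF ix(2) b] by (rule fun_ten_cvm[OF N(2) M(2) ix'])
    ultimately show ?case
      by (simp add: algebra_simps)
  qed
qed

lemma fourier_xf:
  assumes g: "fam E v g"
  shows "fourier \<psi> s E b (xf E v b g) = xf (dual2 s E) v' b (ff (dual2 s E) (chi \<psi>) v g)"
proof (intro ext)
  fix j i
  show "fourier \<psi> s E b (xf E v b g) j i = xf (dual2 s E) v' b (ff (dual2 s E) (chi \<psi>) v g) j i"
    using fourier_level_tf[OF _ fam_test_fun[OF dual_sys_laws[OF D] g]] by (simp add: fourier_def xf_def ff_def)
qed

lemma fourier_dist_level_td: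
  assumes ji: "(j, i) \<in> le E" and G: "G \<in> distr (lev E j i)"
  shows "fourier_dist_level \<psi> s E b i j (td E v b i j G) =
    td (dual2 s E) v' b j i (pull (lev (dual2 s E) i j) (four (chi' \<psi>) (lev E j i) (v' i j)) G)"
proof -
  note N = dual_sys_nice[OF D] and M = dual_sys_msys[OF D]
  note ix = le_idx[OF N(1) ji]
  have ij: "(i, j) \<in> le (dual2 s E)" using ji by simp
  have ix': "i \<in> idx (dual2 s E)" "b \<in> idx (dual2 s E)" using ix b by simp_all
  let ?B = "four (chi' \<psi>) (lev E j i) (v' i j)"
  have t: "?B f \<in> lfun E j i" if "f \<in> test_fun (lev (dual2 s E) i j)" for f
    using sys_four_test_fun[OF dual_sys_sym[OF D] ij that] .
  have F1: "fourier1_dist \<psi> s (lev E j i) (meas_inv s (lev E j i) (\<lambda>g. r * v j i g)) G' =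
      (\<lambda>f. inverse r * pull (lev (dual2 s E) i j) ?B G' f)" if "r \<noteq> 0" "G' \<in> distr (lev E j i)" for r G'
    unfolding meas_inv_coord[OF ji that(1)] fourier1_dist_def fourier1_back_four four_meas_scale pull_def
    using distr_scale[OF that(2) t] by auto
  show ?thesis
    unfolding fourier_dist_level_def
  proof (rule the_equality, goal_cases)
    case 1
    show ?case
      using G msys_meas[OF M(1) ji] msys_nonzero[OF M(1) ji] cvm_in_vmeas[OF N(1) M(1)] ix b F1[of 1 G]
      by (intro exI[of _ G] exI[of _ "v j i"] exI[of _ "cvm E v b i 1"])
        (simp add: vm_of_cvm_one[OF N(1) M(1) ji] vm_inv_cvm[OF N(1) M(1)] vm_comp_cvm[OF N(1) M(1)] vm_dual_cvm td_def)
  next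
    case (2 y)
    then obtain G' \<rho> \<nu> where 1: "G' \<in> distr (lev E j i)" "\<rho> \<in> meas (lev E j i)" "\<rho> \<noteq> 0" "\<nu> \<in> vmeas E b i"
        "td E v b i j G = dist_ten E b i j G' (vm_comp E b i j \<nu> (vm_inv E j i (vm_of E j i \<rho>)))"
        "y = dist_ten (dual2 s E) b j i
              (fourier1_dist \<psi> s (lev E j i) (meas_inv s (lev E j i) \<rho>) G') (vm_dual s E b i \<nu>)" by blast
    obtain n where n: "\<nu> = cvm E v b i n" using 1(4) vmeas_cvm[OF N(1) M(1) b ix(2)] by blast
    obtain r where r: "\<rho> = (\<lambda>f. r * v j i f)" using msys_coord[OF N(1) M(1) ji 1(2)] .
    have r0: "r \<noteq> 0" using 1(3) by (auto simp: r)
    have "G = (\<lambda>x. n * inverse r * G' x)"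
      using td_inj[OF N(1) M(1) ix(1) b G] 1(5) ix b r0
      by (simp add: n r vm_of_cvm[OF N(1) M(1) ji] vm_inv_cvm[OF N(1) M(1)] vm_comp_cvm[OF N(1) M(1)] dist_ten_cvm[OF N(1) M(1)])
    then have "pull (lev (dual2 s E) i j) ?B G = (\<lambda>f. n * (inverse r * pull (lev (dual2 s E) i j) ?B G' f))"
      by (simp add: pull_def fun_eq_iff)
    moreover have "y = td (dual2 s E) v' b j i (\<lambda>f. n * (inverse r * pull (lev (dual2 s E) i j) ?B G' f))"
      unfolding 1(6) n r F1[OF r0 1(1)] vm_dual_cvm[OF b ix(2)] by (rule dist_ten_cvm[OF N(2) M(2) ix'])
    ultimately show ?case by simp
  qed
qed

lemma fourier_dist_cls:
  assumes ji: "(j, i) \<in> le E" and G: "G \<in> distr (lev E j i)"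
  shows "fourier_dist \<psi> s E b (cls E v b i j G) =
      cls (dual2 s E) v' b j i (pull (lev (dual2 s E) i j) (four (chi' \<psi>) (lev E j i) (v' i j)) G)" (is ?A)
    and "pull (lev (dual2 s E) i j) (four (chi' \<psi>) (lev E j i) (v' i j)) G \<in> distr (lev (dual2 s E) i j)" (is ?B)
proof -
  note N = dual_sys_nice[OF D] and M = dual_sys_msys[OF D]
  note D' = dual_sys_sym[OF D]
  note L = dual_sys_laws[OF D] and L' = dual_sys_laws[OF D']
  have J: "dirset (idx E) (le E)" using N(1) by (simp add: nice2_def)
  have cof: "cofin (idx E) (le E) (idx E) (le E) (\<lambda>i. i)" using le_refl[OF N(1)] by (auto simp: cofin_def)
  have b': "b \<in> idx (dual2 s E)" using b by simp
  have sub: "sublev (dual2 s E) j' i' j i" if "(j, i) \<in> le E" "(i, i') \<in> le E" "(j', j) \<in> le E" for i j i' j'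
    using that by (simp add: sublev_def)
  have 1: "\<And>i j i' j'. (j, i) \<in> le E ==> (i, i') \<in> le E ==> (j', j) \<in> le E ==> (j', i') \<in> le E"
    using le_trans[OF N(1)] by blast
  have 3: "four (chi' \<psi>) (lev E j i) (v' i j) f \<in> lfun E j i"
    if "(j, i) \<in> le E" "f \<in> test_fun (lev (dual2 s E) i j)" for i j f
    using sys_four_test_fun[OF D', of i j f] that by simp
  have 4: "lin (test_fun (lev (dual2 s E) i j)) (four (chi' \<psi>) (lev E j i) (v' i j))" if "(j, i) \<in> le E" for i j
    using lin_four[OF dual_sys_pairing[OF D', of i j] msys_meas[OF M(2), of i j]] that by simp
  have 5: "four (chi' \<psi>) (lev E j i) (v' i j) (tr (dual2 s E) v' j' i' j i f) =
      tr E v i' j' i j (four (chi' \<psi>) (lev E j' i') (v' i' j') f)"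
    if "(j, i) \<in> le E" "(i, i') \<in> le E" "(j', j) \<in> le E" "f \<in> test_fun (lev (dual2 s E) i' j')" for i j i' j' f
    using four_tr[OF D' sub[OF that(1-3)] that(4)] .
  \<comment> \<open>The level (i, j) goes to the level (j, i) of the dual, so \<open>U\<close> is
    the second index and \<open>D\<close> the first. Functionals are pulled back along the transform
    from the dual to \<open>E\<close>.\<close>
  note R = D'_the[where K = "\<lambda>i j. (j, i) \<in> le E" and U = "\<lambda>i j. j" and D = "\<lambda>i j. i" and s = "\<lambda>i. i"
      and \<phi> = "\<lambda>i j. four (chi' \<psi>) (lev E j i) (v' i j)" and \<Psi> = "fourier_dist_level \<psi> s E b",
      OF J L L' cof b b' _ 1 sub 3 4 5 fourier_dist_level_td ji G]
  show ?A
    unfolding fourier_dist_def by (rule R(1))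
  show ?B
    by (rule R(2))
qed

end

section \<open>Maps of projective and inductive limits\<close>

text \<open>
  A system \<open>\<phi>\<close> of maps from the levels of \<open>E\<close> to the levels of \<open>F\<close>, both indexed by \<open>J\<close> through the
  cofinal maps \<open>t\<close> and \<open>s\<close> and defined on the sufficiently large levels \<open>K\<close>, which gives the maps
  \<open>\<Lambda>\<close> in the coordinates defined by \<open>v\<close> and \<open>w\<close>.
\<close>

definition "imap J Q K E v b t F w c s \<phi> \<Lambda> \<longleftrightarrow>
     dirset J Q \<and> laws E v \<and> laws F w \<and> b \<in> idx E \<and> c \<in> idx F \<and> cofin J Q (idx E) (le E) t \<and> cofin J Q (idx F) (le F) s \<and>
     (\<forall>i j. K i j \<longrightarrow> (j, i) \<in> Q) \<and> (\<forall>i0\<in>J. \<forall>j0\<in>J. \<exists>i j. K i j \<and> (i0, i) \<in> Q \<and> (j, j0) \<in> Q) \<and>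
     (\<forall>i j i' j'. K i j \<longrightarrow> (i, i') \<in> Q \<longrightarrow> (j', j) \<in> Q \<longrightarrow> K i' j') \<and>
     (\<forall>i j. K i j \<longrightarrow> lin (test_fun (lev E (t j) (t i))) (\<phi> i j) \<and>
        (\<forall>f\<in>test_fun (lev E (t j) (t i)). \<phi> i j f \<in> test_fun (lev F (s j) (s i)) \<and>
           \<Lambda> i j (tf E v b (t i) (t j) f) = tf F w c (s i) (s j) (\<phi> i j f))) \<and>
     (\<forall>l j i. K j l \<longrightarrow> (j, i) \<in> Q \<longrightarrow> (\<forall>f\<in>test_fun (lev E (t l) (t i)).
        \<phi> j l (rs E (t l) (t j) f) = rs F (s l) (s j) (\<phi> i l f))) \<and>
     (\<forall>l j i. K i j \<longrightarrow> (l, j) \<in> Q \<longrightarrow> (\<forall>f\<in>test_fun (lev E (t l) (t i)).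
        \<phi> i j (ps E v (t l) (t j) (t i) f) = ps F w (s l) (s j) (s i) (\<phi> i l f)))"

context
  fixes J :: "'j set" and Q :: "'j rel" and K E v b t F w c s \<phi> \<Lambda>
  assumes M: "imap J Q K E v b t F w c s \<phi> \<Lambda>"
begin

lemma imap_base: "dirset J Q" "laws E v" "laws F w" "b \<in> idx E" "c \<in> idx F"
  "cofin J Q (idx E) (le E) t" "cofin J Q (idx F) (le F) s"
  using M by (simp_all add: imap_def)

lemma imap_K: "K i j ==> (j, i) \<in> Q"
  "i0 \<in> J ==> j0 \<in> J ==> \<exists>i j. K i j \<and> (i0, i) \<in> Q \<and> (j, j0) \<in> Q"
  "K i j ==> (i, i') \<in> Q ==> (j', j) \<in> Q ==> K i' j'"
  using M unfolding imap_def by blast+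

lemma imap_maps: "K i j ==> lin (test_fun (lev E (t j) (t i))) (\<phi> i j)"
  "K i j ==> f \<in> test_fun (lev E (t j) (t i)) ==> \<phi> i j f \<in> test_fun (lev F (s j) (s i))"
  "K i j ==> f \<in> test_fun (lev E (t j) (t i)) ==> \<Lambda> i j (tf E v b (t i) (t j) f) = tf F w c (s i) (s j) (\<phi> i j f)"
  using M unfolding imap_def by blast+

lemma imap_comm: "K j l ==> (j, i) \<in> Q ==> f \<in> test_fun (lev E (t l) (t i)) ==>
    \<phi> j l (rs E (t l) (t j) f) = rs F (s l) (s j) (\<phi> i l f)"
  "K i j ==> (l, j) \<in> Q ==> f \<in> test_fun (lev E (t l) (t i)) ==>
    \<phi> i j (ps E v (t l) (t j) (t i) f) = ps F w (s l) (s j) (s i) (\<phi> i l f)"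
  using M unfolding imap_def by blast+

lemma imap_sublev:
  assumes "K i j" "(i, i') \<in> Q" "(j', j) \<in> Q"
  shows "sublev E (t i') (t j') (t i) (t j)"
  using cofin_mono[OF imap_base(1,2,6)] imap_K(1)[OF assms(1)] assms(2,3) by (simp add: sublev_def)

lemma imap_tr:
  assumes ij: "K i j" and q: "(i, i') \<in> Q" "(j', j) \<in> Q" and f: "f \<in> test_fun (lev E (t j') (t i'))"
  shows "\<phi> i j (tr E v (t i') (t j') (t i) (t j) f) = tr F w (s i') (s j') (s i) (s j) (\<phi> i' j' f)"
proof -
  have i: "(i, i) \<in> Q"
    using imap_base(1) dirset_idx[OF imap_base(1,2,6) q(1)] by (simp add: dirset_def refl_on_def)
  note le = sublev_le[OF imap_base(2) imap_sublev[OF ij q]]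
  have "rs E (t j') (t i) f \<in> test_fun (lev E (t j') (t i))" by (rule rs_test_fun[OF laws_nice[OF imap_base(2)] le(2,6) f])
  then show ?thesis
    unfolding tr_def using imap_comm(1)[OF imap_K(3)[OF ij i q(2)] q(1) f] imap_comm(2)[OF ij q(2)] by simp
qed

lemma conj_image:
  assumes ij: "K i0 j0" and G: "G \<in> distr (lev F (s j0) (s i0))"
  shows "(THE Y. \<exists>i j y. K i j \<and> y \<in> dist_level F c (s i) (s j) \<and> cls F w c (s i0) (s j0) G = dist_cls F c (s i) (s j) y \<and>
      Y = dist_cls E b (t i) (t j) (conj_map E b (t i) (t j) F c (s i) (s j) (\<Lambda> i j) y)) =
    cls E v b (t i0) (t j0) (pull (lev E (t j0) (t i0)) (\<phi> i0 j0) G)" (is ?A)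
    and "pull (lev E (t j0) (t i0)) (\<phi> i0 j0) G \<in> distr (lev E (t j0) (t i0))" (is ?B)
proof -
  note B = imap_base
  note NE = laws_nice[OF B(2)] and NF = laws_nice[OF B(3)]
  have 1: "conj_map E b (t i) (t j) F c (s i) (s j) (\<Lambda> i j) (td F w c (s i) (s j) G') =
      td E v b (t i) (t j) (pull (lev E (t j) (t i)) (\<phi> i j) G')"
    if k: "K i j" and G': "G' \<in> distr (lev F (s j) (s i))" for i j G'
  proof -
    note le = cofin_mono[OF B(1,2,6) imap_K(1)[OF k]] cofin_mono[OF B(1,3,7) imap_K(1)[OF k]]
    show ?thesis
      by (rule conj_map_td[OF NE laws_msys[OF B(2)] NF laws_msys[OF B(3)] B(4) le_idx(1)[OF NE le(1)] B(5) le_idx(1)[OF NF le(2)]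
            imap_maps(3)[OF k] imap_maps(2)[OF k] G'
            pull_lin_distr[OF lev_tower[OF NE le(1)] G' imap_maps(2)[OF k] imap_maps(1)[OF k]]])
  qed
  note R = D'_the[where K = K and U = "\<lambda>i j. t i" and D = "\<lambda>i j. t j" and s = s and \<phi> = \<phi>
      and \<Psi> = "\<lambda>i j. conj_map E b (t i) (t j) F c (s i) (s j) (\<Lambda> i j)",
      OF B(1,3,2,7,5,4) imap_K(1,3) imap_sublev imap_maps(2,1) imap_tr 1 ij G]
  show ?A by (rule R(1))
  show ?B by (rule R(2))
qed

end

text \<open>Compatibility of the level maps with \<open>rs\<close> and \<open>ps\<close> makes the
  images a family on the levels around \<open>k\<close>, and \<open>fam_extend\<close> supplies the
  remaining levels.\<close>

lemma lim_image:
  assumes M: "imap J Q (\<lambda>i j. (j, k) \<in> Q \<and> (k, i) \<in> Q) E v b t F w c s \<phi> \<Lambda>" and k: "k \<in> J" and g: "fam E v g"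
  shows "\<exists>h. fam F w h \<and> (\<forall>i j. (j, k) \<in> Q \<longrightarrow> (k, i) \<in> Q \<longrightarrow> h (s i) (s j) = \<phi> i j (g (t i) (t j))) \<and>
    (THE y. y \<in> D_space F c \<and> (\<forall>i j. (j, k) \<in> Q \<and> (k, i) \<in> Q \<longrightarrow>
       y (s i) (s j) = \<Lambda> i j (xf E v b g (t i) (t j)))) = xf F w c h"
proof -
  note B = imap_base[OF M] and m = imap_maps[OF M] and C = imap_comm[OF M]
  note tra = dirset_trans[OF B(1,2,6)] and mono = cofin_mono[OF B(1,2,6)]
  have gt: "g (t i) (t j) \<in> test_fun (lev E (t j) (t i))" if "(j, i) \<in> Q" for i j
    by (rule fam_test_fun[OF B(2) g mono[OF that]])
  have "\<exists>h. fam F w h \<and> (\<forall>i j. (j, k) \<in> Q \<longrightarrow> (k, i) \<in> Q \<longrightarrow> h (s i) (s j) = \<phi> i j (g (t i) (t j)))"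
  proof (rule fam_extend[OF B(1,3,7) k])
    show "\<phi> i j (g (t i) (t j)) \<in> test_fun (lev F (s j) (s i))" if "(j, k) \<in> Q" "(k, i) \<in> Q" for i j
      using m(2) that gt[OF tra[OF that]] by blast
    show "rs F (s l) (s j) (\<phi> i l (g (t i) (t l))) = \<phi> j l (g (t j) (t l))" if q: "(l, k) \<in> Q" "(k, j) \<in> Q" "(j, i) \<in> Q" for l j i
    proof -
      have "(l, i) \<in> Q" "(l, j) \<in> Q" using q tra by blast+
      moreover have "rs E (t l) (t j) (g (t i) (t l)) = g (t j) (t l)"
        using g mono[OF \<open>(l, j) \<in> Q\<close>] mono[OF q(3)] by (simp add: fam_def)
      ultimately show ?thesis using C(1)[of l j i "g (t i) (t l)"] q gt[of l i] by simp
    qed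
    show "ps F w (s l) (s j) (s i) (\<phi> i l (g (t i) (t l))) = \<phi> i j (g (t i) (t j))" if q: "(l, j) \<in> Q" "(j, k) \<in> Q" "(k, i) \<in> Q" for l j i
    proof -
      have "(l, i) \<in> Q" "(j, i) \<in> Q" using q tra by blast+
      moreover have "ps E v (t l) (t j) (t i) (g (t i) (t l)) = g (t i) (t j)"
        using g mono[OF q(1)] mono[OF \<open>(j, i) \<in> Q\<close>] by (simp add: fam_def)
      ultimately show ?thesis using C(2)[of j i l "g (t i) (t l)"] q gt[of l i] by simp
    qed
  qed
  then obtain h where h: "fam F w h" "\<And>i j. (j, k) \<in> Q ==> (k, i) \<in> Q ==> h (s i) (s j) = \<phi> i j (g (t i) (t j))" by blast
  have "(THE y. y \<in> D_space F c \<and> (\<forall>i j. (j, k) \<in> Q \<and> (k, i) \<in> Q \<longrightarrow>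
       y (s i) (s j) = \<Lambda> i j (xf E v b g (t i) (t j)))) = xf F w c h"
  proof (rule D_space_the[OF B(1,3,7) k B(5) h(1)])
    fix i j assume q: "(j, k) \<in> Q" "(k, i) \<in> Q"
    note ji = tra[OF q]
    show "\<Lambda> i j (xf E v b g (t i) (t j)) = tf F w c (s i) (s j) (h (s i) (s j))"
      using m(3)[OF _ gt[OF ji]] q mono[OF ji] h(2)[OF q] by (simp add: xf_def)
  qed
  then show ?thesis using h by blast
qed

text \<open>Here the maps exist on all levels of \<open>F\<close>, so the limit is formed level by
  level and no extension is involved.\<close>

lemma direct_image:
  assumes M: "imap (idx F) (le F) (\<lambda>i j. (j, i) \<in> le F) E v b t F w c (\<lambda>i. i) \<phi> \<Lambda>" and g: "fam E v g"
  shows "fam F w (\<lambda>i j. \<phi> i j (g (t i) (t j)))" (is ?A)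
    and "(\<lambda>i j. if (j, i) \<in> le F then \<Lambda> i j (xf E v b g (t i) (t j)) else {}) = xf F w c (\<lambda>i j. \<phi> i j (g (t i) (t j)))" (is ?B)
proof -
  note B = imap_base[OF M] and m = imap_maps[OF M] and C = imap_comm[OF M]
  note tra = le_trans[OF laws_nice[OF B(3)]] and mono = cofin_mono[OF B(1,2,6)]
  have gt: "g (t i) (t j) \<in> test_fun (lev E (t j) (t i))" if "(j, i) \<in> le F" for i j
    by (rule fam_test_fun[OF B(2) g mono[OF that]])
  show ?A
    unfolding fam_def
  proof (intro conjI allI impI)
    show "\<phi> i l (g (t i) (t l)) \<in> lfun F l i" if "(l, i) \<in> le F" for l i
      using m(2)[OF that gt[OF that]] .
    fix l j i assume q: "(l, j) \<in> le F" "(j, i) \<in> le F"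
    have "rs E (t l) (t j) (g (t i) (t l)) = g (t j) (t l)" "ps E v (t l) (t j) (t i) (g (t i) (t l)) = g (t i) (t j)"
      using g mono[OF q(1)] mono[OF q(2)] by (simp_all add: fam_def)
    then show "rs F l j (\<phi> i l (g (t i) (t l))) = \<phi> j l (g (t j) (t l))" "ps F w l j i (\<phi> i l (g (t i) (t l))) = \<phi> i j (g (t i) (t j))"
      using C(1)[OF q gt[OF tra[OF q]]] C(2)[OF q(2,1) gt[OF tra[OF q]]] by simp_all
  qed
  show ?B
    by (intro ext) (simp add: xf_def mono m(3) gt)
qed

context
  fixes \<psi> :: "'k::{field,finite} \<Rightarrow> complex" and sE :: "'k \<Rightarrow> _" and sF :: "'k \<Rightarrow> _"
    and E F v v' w w' b c t s
    and J Q K J' Q' K' \<phi> \<phi>' \<Lambda> \<Lambda>'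
  assumes DE: "dual_sys E (dual2 sE E) (chi \<psi>) v v'" and DF: "dual_sys F (dual2 sF F) (chi \<psi>) w w'"
    and M: "imap J Q K E v b t F w c s \<phi> \<Lambda>" and M': "imap J' Q' K' (dual2 sE E) v' b t (dual2 sF F) w' c s \<phi>' \<Lambda>'"
    and JQ: "J' = J" "Q' = Q\<inverse>"
begin

text \<open>Both sides are families on the dual of \<open>F\<close>. They agree around
  \<open>k\<close> by \<open>four\<close>, and a family is determined by its values there
  (\<open>fam_unique\<close>). Reversing the order of \<open>J\<close> sends levels around
  \<open>k\<close> to levels around \<open>k\<close> with the two indices exchanged.\<close>

lemma fourier_lim_image:
  assumes K: "K = (\<lambda>i j. (j, k) \<in> Q \<and> (k, i) \<in> Q)" "K' = (\<lambda>i j. (j, k) \<in> Q' \<and> (k, i) \<in> Q')" and k: "k \<in> J"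
    and four: "\<And>i j f. K i j ==> f \<in> test_fun (lev E (t j) (t i)) ==>
      four (chi \<psi>) (lev (dual2 sF F) (s i) (s j)) (w (s j) (s i)) (\<phi> i j f) =
      \<phi>' j i (four (chi \<psi>) (lev (dual2 sE E) (t i) (t j)) (v (t j) (t i)) f)"
    and x: "x \<in> D_space E b"
  shows "fourier \<psi> sF F c (THE y. y \<in> D_space F c \<and> (\<forall>i j. (j, k) \<in> Q \<and> (k, i) \<in> Q \<longrightarrow>
      y (s i) (s j) = \<Lambda> i j (x (t i) (t j)))) =
    (THE y. y \<in> D_space (dual2 sF F) c \<and> (\<forall>i j. (j, k) \<in> Q' \<and> (k, i) \<in> Q' \<longrightarrow>
      y (s i) (s j) = \<Lambda>' i j (fourier \<psi> sE E b x (t i) (t j))))" (is "?L = ?R")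
    and "fourier \<psi> sF F c (THE y. y \<in> D_space F c \<and> (\<forall>i j. (j, k) \<in> Q \<and> (k, i) \<in> Q \<longrightarrow>
      y (s i) (s j) = \<Lambda> i j (x (t i) (t j)))) \<in> D_space (dual2 sF F) c"
proof -
  note B = imap_base[OF M] and B' = imap_base[OF M']
  obtain g where g: "fam E v g" "x = xf E v b g" using x by (auto simp: D_space_xf[OF B(2,4)])
  obtain h where h: "fam F w h" "\<And>i j. (j, k) \<in> Q ==> (k, i) \<in> Q ==> h (s i) (s j) = \<phi> i j (g (t i) (t j))"
    "(THE y. y \<in> D_space F c \<and> (\<forall>i j. (j, k) \<in> Q \<and> (k, i) \<in> Q \<longrightarrow>
       y (s i) (s j) = \<Lambda> i j (x (t i) (t j)))) = xf F w c h"
    using lim_image[OF M[unfolded K] k g(1)] g(2) by blast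
  let ?g = "ff (dual2 sE E) (chi \<psi>) v g" and ?h = "ff (dual2 sF F) (chi \<psi>) w h"
  have k': "k \<in> J'" using k JQ by simp
  obtain h' where h': "fam (dual2 sF F) w' h'" "\<And>i j. (j, k) \<in> Q' ==> (k, i) \<in> Q' ==> h' (s i) (s j) = \<phi>' i j (?g (t i) (t j))"
    "?R = xf (dual2 sF F) w' c h'"
    using lim_image[OF M'[unfolded K] k' ff_fam[OF DE g(1)]] unfolding g(2) fourier_xf[OF DE B(4) g(1)] by blast
  have L: "?L = xf (dual2 sF F) w' c ?h" unfolding h(3) by (rule fourier_xf[OF DF B(5) h(1)])
  have "?h i' j' = h' i' j'" if "(j', i') \<in> le (dual2 sF F)" for i' j'
  proof (rule fam_unique[OF B'(1,3,7) k' ff_fam[OF DF h(1)] h'(1) _ that])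
    fix i j assume q: "(j, k) \<in> Q'" "(k, i) \<in> Q'"
    then have q': "(i, k) \<in> Q" "(k, j) \<in> Q" using JQ by auto
    have "g (t j) (t i) \<in> test_fun (lev E (t i) (t j))"
      using fam_test_fun[OF B(2) g(1) cofin_mono[OF B(1,2,6) dirset_trans[OF B(1,2,6) q']]] .
    then show "?h (s i) (s j) = h' (s i) (s j)"
      using four[of j i "g (t j) (t i)"] q' h(2)[OF q'] h'(2)[OF q] by (simp add: K ff_def)
  qed
  then have "xf (dual2 sF F) w' c ?h = xf (dual2 sF F) w' c h'" by (intro xf_eqI[OF B'(3)])
  then show "?L = ?R" using L h'(3) by simp
  show "?L \<in> D_space (dual2 sF F) c" unfolding L using ff_fam[OF DF h(1)] by (auto simp: D_space_xf[OF B'(3,5)])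
qed

text \<open>Transposition reverses composition: the two sides transpose the two ways from functions
  on the dual of \<open>E\<close> to functions on \<open>F\<close>. The equation needed on test
  functions is therefore one that starts from the dual, \<open>four\<close>, and not the one for the
  transform of \<open>\<phi>\<close>.\<close>

lemma fourier_conj_image:
  assumes K: "\<And>i j. K' i j \<longleftrightarrow> K j i"
    and four: "\<And>i j h. K i j ==> h \<in> test_fun (lev (dual2 sE E) (t i) (t j)) ==>
      four (chi' \<psi>) (lev F (s j) (s i)) (w' (s i) (s j)) (\<phi>' j i h) =
      \<phi> i j (four (chi' \<psi>) (lev E (t j) (t i)) (v' (t i) (t j)) h)"
    and X: "X \<in> D'_space F c"
  shows "fourier_dist \<psi> sE E b (THE Y. \<exists>i j y. K i j \<and> y \<in> dist_level F c (s i) (s j) \<and> X = dist_cls F c (s i) (s j) y \<and>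
        Y = dist_cls E b (t i) (t j) (conj_map E b (t i) (t j) F c (s i) (s j) (\<Lambda> i j) y)) =
      (THE Y. \<exists>i j y. K' i j \<and> y \<in> dist_level (dual2 sF F) c (s i) (s j) \<and>
        fourier_dist \<psi> sF F c X = dist_cls (dual2 sF F) c (s i) (s j) y \<and>
        Y = dist_cls (dual2 sE E) b (t i) (t j)
          (conj_map (dual2 sE E) b (t i) (t j) (dual2 sF F) c (s i) (s j) (\<Lambda>' i j) y))" (is "?L = ?R")
    and "fourier_dist \<psi> sE E b (THE Y. \<exists>i j y. K i j \<and> y \<in> dist_level F c (s i) (s j) \<and> X = dist_cls F c (s i) (s j) y \<and>
        Y = dist_cls E b (t i) (t j) (conj_map E b (t i) (t j) F c (s i) (s j) (\<Lambda> i j) y)) \<in> D'_space (dual2 sE E) b"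
proof -
  note B = imap_base[OF M] and B' = imap_base[OF M']
  obtain i j G where ij: "K i j" and G: "G \<in> distr (lev F (s j) (s i))" and X: "X = cls F w c (s i) (s j) G"
    using D'_represent[where K = K, OF B(1,3,7,5) imap_K(2)[OF M] X] by blast
  have ji: "K' j i" using ij K by simp
  note le = cofin_mono[OF B(1,2,6) imap_K(1)[OF M ij]] cofin_mono[OF B(1,3,7) imap_K(1)[OF M ij]]
  note C = conj_image[OF M ij G] and FX = fourier_dist_cls[OF DF B(5) le(2) G]
  note C' = conj_image[OF M' ji FX(2)] and FC = fourier_dist_cls[OF DE B(4) le(1) C(2)]
  let ?e = "four (chi' \<psi>) (lev E (t j) (t i)) (v' (t i) (t j))"
  let ?f = "four (chi' \<psi>) (lev F (s j) (s i)) (w' (s i) (s j))"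
  have "pull (lev (dual2 sE E) (t i) (t j)) ?e (pull (lev E (t j) (t i)) (\<phi> i j) G) =
      pull (lev (dual2 sE E) (t i) (t j)) (\<lambda>h. \<phi> i j (?e h)) G"
    using sys_four_test_fun[OF dual_sys_sym[OF DE], of "t i" "t j"] le(1) by (intro pull_pull) simp
  also have "\<dots> = pull (lev (dual2 sE E) (t i) (t j)) (\<lambda>h. ?f (\<phi>' j i h)) G"
    using four[OF ij] by (intro pull_cong) simp
  also have "\<dots> = pull (lev (dual2 sE E) (t i) (t j)) (\<phi>' j i) (pull (lev (dual2 sF F) (s i) (s j)) ?f G)"
    using imap_maps(2)[OF M' ji] by (intro pull_pull[symmetric])
  finally have "pull (lev (dual2 sE E) (t i) (t j)) ?e (pull (lev E (t j) (t i)) (\<phi> i j) G) =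
      pull (lev (dual2 sE E) (t i) (t j)) (\<phi>' j i) (pull (lev (dual2 sF F) (s i) (s j)) ?f G)" .
  then show "?L = ?R" unfolding X C(1) FX(1) C'(1) FC(1) by simp
  show "?L \<in> D'_space (dual2 sE E) b"
    unfolding X C(1) FC(1) using FC(2) le(1) unfolding D'_space_cls[OF B'(2,4)] by (intro exI conjI) (auto simp del:)
qed

end

lemma fourier_direct_image:
  fixes \<psi> :: "'k::{field,finite} \<Rightarrow> complex" and sE :: "'k \<Rightarrow> _" and sF :: "'k \<Rightarrow> _"
  assumes DE: "dual_sys E (dual2 sE E) (chi \<psi>) v v'" and DF: "dual_sys F (dual2 sF F) (chi \<psi>) w w'"
    and M: "imap (idx F) (le F) (\<lambda>i j. (j, i) \<in> le F) E v b t F w c (\<lambda>i. i) \<phi> \<Lambda>"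
    and M': "imap (idx (dual2 sF F)) (le (dual2 sF F)) (\<lambda>i j. (j, i) \<in> le (dual2 sF F)) (dual2 sE E) v' b t (dual2 sF F) w' c (\<lambda>i. i) \<phi>' \<Lambda>'"
    and four: "\<And>i j f. (j, i) \<in> le F ==> f \<in> test_fun (lev E (t j) (t i)) ==>
      four (chi \<psi>) (lev (dual2 sF F) i j) (w j i) (\<phi> i j f) =
      \<phi>' j i (four (chi \<psi>) (lev (dual2 sE E) (t i) (t j)) (v (t j) (t i)) f)"
    and x: "x \<in> D_space E b"
  shows "fourier \<psi> sF F c (\<lambda>i j. if (j, i) \<in> le F then \<Lambda> i j (x (t i) (t j)) else {}) =
      (\<lambda>i j. if (j, i) \<in> le (dual2 sF F) then \<Lambda>' i j (fourier \<psi> sE E b x (t i) (t j)) else {})" (is "?L = ?R")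
    and "fourier \<psi> sF F c (\<lambda>i j. if (j, i) \<in> le F then \<Lambda> i j (x (t i) (t j)) else {}) \<in> D_space (dual2 sF F) c"
proof -
  note B = imap_base[OF M] and B' = imap_base[OF M']
  obtain g where g: "fam E v g" "x = xf E v b g" using x by (auto simp: D_space_xf[OF B(2,4)])
  let ?g = "ff (dual2 sE E) (chi \<psi>) v g" and ?h = "\<lambda>i j. \<phi> i j (g (t i) (t j))"
  note h = direct_image[OF M g(1)] and h' = direct_image[OF M' ff_fam[OF DE g(1)]]
  have L: "?L = xf (dual2 sF F) w' c (ff (dual2 sF F) (chi \<psi>) w ?h)"
    unfolding g(2) h(2) by (rule fourier_xf[OF DF B(5) h(1)])
  also have "\<dots> = xf (dual2 sF F) w' c (\<lambda>i j. \<phi>' i j (?g (t i) (t j)))"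
  proof (rule xf_eqI[OF B'(3)])
    fix i j assume "(i, j) \<in> le (dual2 sF F)"
    then have ij: "(j, i) \<in> le F" by simp
    have "g (t i) (t j) \<in> test_fun (lev E (t j) (t i))"
      using fam_test_fun[OF B(2) g(1) cofin_mono[OF B(1,2,6) ij]] .
    then show "ff (dual2 sF F) (chi \<psi>) w ?h j i = \<phi>' j i (?g (t j) (t i))" using four[OF ij] by (simp add: ff_def)
  qed
  also have "\<dots> = ?R" unfolding g(2) fourier_xf[OF DE B(4) g(1)] h'(2) ..
  finally show "?L = ?R" .
  show "?L \<in> D_space (dual2 sF F) c" unfolding L using ff_fam[OF DF h(1)] by (auto simp: D_space_xf[OF B'(3,5)])
qed

text \<open>The scalar \<open>\<mu>\<close> is the coordinate of the virtual measure that the images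
  for \<open>cC2\<close> and \<open>dC2\<close> take as second argument; the images for
  \<open>cfC2\<close> and \<open>dfC2\<close> are treated with the scalar \<open>1\<close>.\<close>

lemma imapI:
  assumes B: "dirset J Q" "laws E v" "laws F w" "b \<in> idx E" "c \<in> idx F" "cofin J Q (idx E) (le E) t" "cofin J Q (idx F) (le F) s"
    and K: "\<And>i j. K i j ==> (j, i) \<in> Q" "\<And>i0 j0. i0 \<in> J ==> j0 \<in> J ==> \<exists>i j. K i j \<and> (i0, i) \<in> Q \<and> (j, j0) \<in> Q"
      "\<And>i j i' j'. K i j ==> (i, i') \<in> Q ==> (j', j) \<in> Q ==> K i' j'"
    and \<phi>: "\<And>i j. K i j ==> lin (test_fun (lev E (t j) (t i))) (\<phi> i j)"
      "\<And>i j f. K i j ==> f \<in> test_fun (lev E (t j) (t i)) ==> \<phi> i j f \<in> test_fun (lev F (s j) (s i))"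
      "\<And>i j f. K i j ==> f \<in> test_fun (lev E (t j) (t i)) ==>
        \<Lambda> i j (tf E v b (t i) (t j) f) = tf F w c (s i) (s j) (\<lambda>x. \<mu> * \<phi> i j f x)"
      "\<And>l j i f. K j l ==> (l, j) \<in> Q ==> (j, i) \<in> Q ==> f \<in> test_fun (lev E (t l) (t i)) ==>
        \<phi> j l (rs E (t l) (t j) f) = rs F (s l) (s j) (\<phi> i l f)"
      "\<And>l j i f. K i j ==> (l, j) \<in> Q ==> (j, i) \<in> Q ==> f \<in> test_fun (lev E (t l) (t i)) ==>
        \<phi> i j (ps E v (t l) (t j) (t i) f) = ps F w (s l) (s j) (s i) (\<phi> i l f)"
  shows "imap J Q K E v b t F w c s (\<lambda>i j f x. \<mu> * \<phi> i j f x) \<Lambda>"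
  unfolding imap_def
proof (intro conjI allI impI ballI B)
  show "(j, i) \<in> Q" if "K i j" for i j using K(1) that .
  show "\<exists>i j. K i j \<and> (i0, i) \<in> Q \<and> (j, j0) \<in> Q" if "i0 \<in> J" "j0 \<in> J" for i0 j0 using K(2) that .
  show "K i' j'" if "K i j" "(i, i') \<in> Q" "(j', j) \<in> Q" for i j i' j' using K(3) that .
  show "lin (test_fun (lev E (t j) (t i))) (\<lambda>f x. \<mu> * \<phi> i j f x)" if "K i j" for i j using lin_times[OF \<phi>(1)[OF that]] .
  show "(\<lambda>x. \<mu> * \<phi> i j f x) \<in> test_fun (lev F (s j) (s i))"
    "\<Lambda> i j (tf E v b (t i) (t j) f) = tf F w c (s i) (s j) (\<lambda>x. \<mu> * \<phi> i j f x)"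
    if "K i j" "f \<in> test_fun (lev E (t j) (t i))" for i j f
    using test_fun_scale[OF \<phi>(2)[OF that]] \<phi>(3)[OF that] .
  fix l j i f assume f: "f \<in> test_fun (lev E (t l) (t i))"
  show "(\<lambda>x. \<mu> * \<phi> j l (rs E (t l) (t j) f) x) = rs F (s l) (s j) (\<lambda>x. \<mu> * \<phi> i l f x)" if k: "K j l" "(j, i) \<in> Q"
    using \<phi>(4)[OF k(1) K(1)[OF k(1)] k(2) f] lin_scale[OF lin_rs UNIV_I, of F "s l" "s j" \<mu> "\<phi> i l f"] by simp
  show "(\<lambda>x. \<mu> * \<phi> i j (ps E v (t l) (t j) (t i) f) x) = ps F w (s l) (s j) (s i) (\<lambda>x. \<mu> * \<phi> i l f x)" if k: "K i j" "(l, j) \<in> Q"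
  proof -
    have "(i, i) \<in> Q" using B(1) dirset_idx[OF B(1,2,6) K(1)[OF k(1)]] by (simp add: dirset_def refl_on_def)
    then have "K i l" using K(3)[OF k(1) _ k(2)] by blast
    note le = cofin_mono[OF B(1,3,7) k(2)] cofin_mono[OF B(1,3,7) K(1)[OF k(1)]]
    show ?thesis
      using \<phi>(5)[OF k K(1)[OF k(1)] f] lin_scale[OF lin_ps[OF laws_nice[OF B(3)] laws_msys[OF B(3)] le] \<phi>(2)[OF \<open>K i l\<close> f], of \<mu>]
      by simp
  qed
qed

section \<open>Direct and inverse images in coordinates\<close>

lemma lowtriv_unit_mass:
  assumes E: "nice2 E" and v: "msys E v" and z: "lowtriv E v k" and le: "(k, j) \<in> le E" "(j, i) \<in> le E"
  shows "unit_mass (lev E j i) (nul (lev E j i)) = v j i"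
proof -
  note t = lev_tower[OF E le(2)]
  obtain a where "a \<in> idx (lev E j i)" using tower_nonempty[OF t] by blast
  moreover have "carr (lev E j i) = nul (lev E j i)" "v j i (indicator (nul (lev E j i))) = 1"
    using z le by (simp_all add: lowtriv_def)
  ultimately show ?thesis using unit_mass_eq[OF t _ trivial_fil[OF t] msys_meas[OF v le(2)]] by simp
qed

lemma uptriv_unit_mass:
  assumes E: "nice2 E" and v: "msys E v" and z: "uptriv E v k" and le: "(i, j) \<in> le E" "(j, k) \<in> le E"
  shows "unit_mass (lev E i j) (nul (lev E i j)) = v i j"
proof -
  note t = lev_tower[OF E le(1)]
  obtain a where "a \<in> idx (lev E i j)" using tower_nonempty[OF t] by blast
  moreover have "carr (lev E i j) = nul (lev E i j)" "v i j (indicator (nul (lev E i j))) = 1"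
    using z le by (simp_all add: uptriv_def)
  ultimately show ?thesis using unit_mass_eq[OF t _ trivial_fil[OF t] msys_meas[OF v le(1)]] by simp
qed

lemma cfsys_unit_mass:
  assumes E: "nice2 E" and v: "msys E v" and z: "cfsys E v" and li: "(l, i) \<in> le E"
  shows "unit_mass (lev E l i) (carr (lev E l i)) = v l i"
proof -
  obtain a where "a \<in> idx (lev E l i)" "fil (lev E l i) a = carr (lev E l i)"
    using z li unfolding cfsys_def compact_filt_def by blast
  from unit_mass_eq[OF lev_tower[OF E li] this msys_meas[OF v li]] show ?thesis using z li by (simp add: cfsys_def)
qed

lemma dfsys_unit_mass:
  assumes E: "nice2 E" and v: "msys E v" and z: "dfsys E v" and li: "(l, i) \<in> le E"
  shows "unit_mass (lev E l i) (nul (lev E l i)) = v l i"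
proof -
  obtain a where "a \<in> idx (lev E l i)" "fil (lev E l i) a = nul (lev E l i)"
    using z li unfolding dfsys_def discrete_filt_def by blast
  from unit_mass_eq[OF lev_tower[OF E li] this msys_meas[OF v li]] show ?thesis using z li by (simp add: dfsys_def)
qed

context
  fixes T T' \<chi>1 \<chi>2 \<chi>3 v1 v1' v2 v2' v3 v3' b
  assumes D: "dual_triples T T' \<chi>1 \<chi>2 \<chi>3 v1 v1' v2 v2' v3 v3'" and b: "b \<in> idx2 T"
begin

private abbreviation "w1 j i \<equiv> v1 (eps T j) (eps T i)"
private abbreviation "w3 j i \<equiv> v3 (gam T j) (gam T i)"
private abbreviation "c1 j i \<equiv> cvm (sub T) v1 (eps T j) (eps T i)"
private abbreviation "c2 \<equiv> cvm (mid T) v2"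
private abbreviation "c3 j i \<equiv> cvm (quo T) v3 (gam T j) (gam T i)"
private abbreviation "t1 i j \<equiv> tf (sub T) v1 (eps T b) (eps T i) (eps T j)"
private abbreviation "t2 \<equiv> tf (mid T) v2 b"
private abbreviation "t3 i j \<equiv> tf (quo T) v3 (gam T b) (gam T i) (gam T j)"

private lemma N: "nice3 T" and N1: "nice2 (sub T)" and N2: "nice2 (mid T)" and N3: "nice2 (quo T)"
  and L1: "laws (sub T) v1" and L2: "laws (mid T) v2" and L3: "laws (quo T) v3"
  using dual_triples_nice[OF D] dual_sys_nice[OF dual_triples_sys(1)[OF D]] dual_sys_nice[OF dual_triples_sys(2)[OF D]]
    dual_sys_nice[OF dual_triples_sys(3)[OF D]] dual_triples_sys[OF D, THEN dual_sys_laws] by blast+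

private lemmas M1 = laws_msys[OF L1] and M2 = laws_msys[OF L2] and M3 = laws_msys[OF L3]

lemma eps_idx: "a \<in> idx2 T ==> eps T a \<in> idx (sub T)" and gam_idx: "a \<in> idx2 T ==> gam T a \<in> idx (quo T)"
  using le_refl[OF N2] nice3_eps[OF N] nice3_gam[OF N] le_idx[OF N1] le_idx[OF N3] by blast+

context
  fixes j i
  assumes ji: "(j, i) \<in> le2 T"
begin

private lemma ix: "j \<in> idx2 T" "i \<in> idx2 T"
  using le_idx[OF N2 ji] by auto

private lemma sub_vmeas: "\<kappa> \<in> vmeas (sub T) (eps T j) (eps T b) \<longleftrightarrow> (\<exists>c. \<kappa> = c1 j b c)"
  and quo_vmeas: "\<kappa>3 \<in> vmeas (quo T) (gam T j) (gam T b) \<longleftrightarrow> (\<exists>c. \<kappa>3 = c3 j b c)"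
  using vmeas_cvm[OF N1 M1 eps_idx[OF ix(1)] eps_idx[OF b]] vmeas_cvm[OF N3 M3 gam_idx[OF ix(1)] gam_idx[OF b]] by auto

private lemma ten:
  "fun_ten (sub T) (eps T b) (eps T i) (eps T j) h (c1 j b c) =
    t1 i j (\<lambda>x. c * h x)"
  "fun_ten (mid T) b i j f (c2 j b c) = t2 i j (\<lambda>x. c * f x)"
  "fun_ten (quo T) (gam T b) (gam T i) (gam T j) g (c3 j b c) =
    t3 i j (\<lambda>x. c * g x)"
  by (simp_all add: fun_ten_cvm[OF N1 M1] fun_ten_cvm[OF N2 M2] fun_ten_cvm[OF N3 M3] eps_idx gam_idx ix b)

private lemma prod: "vm_prod T j b (c1 j b c) (c3 j b d) = c2 j b (c * d)"
  by (rule vm_prod_cvm[OF D ix(1) b])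

text \<open>The description admits every way of writing the tensor with factors of coordinates
  \<open>c\<close> and \<open>d\<close>. By \<open>lowtriv\<close> the passage from \<open>k\<close>
  to \<open>i\<close> has coordinate \<open>1\<close>, so \<open>\<rho>\<close> gets
  \<open>c * \<mu>\<close>, while \<open>d\<close> stays with the result: the outcome depends on
  \<open>c * d\<close>, that is, on the tensor alone.\<close>

lemma epi_push_level_tf:
  assumes z: "lowtriv (sub T) v1 (eps T k)" and k: "(j, k) \<in> le2 T" "(k, i) \<in> le2 T"
    and f: "f \<in> test_fun (lev2 T j i)"
  shows "epi_push_level T k b (c1 b k \<mu>) i j (t2 i j f) =
    t3 i j (\<lambda>x. \<mu> * epi_push (level T j i) f (w1 j i) x)"
proof -
  note e = nice3_eps[OF N k(2)]
  have ke: "eps T k \<in> idx (sub T)" using le_idx(1)[OF N1 e] .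
  have u: "vm_of (sub T) (eps T k) (eps T i) (unit_mass (lev1 T k i) (nul (lev1 T k i))) =
      c1 k i 1"
    using lowtriv_unit_mass[OF N1 M1 z le_refl[OF N1 ke] e] vm_of_cvm_one[OF N1 M1 e] by simp
  have comp: "vm_comp (sub T) (eps T j) (eps T k) (eps T i)
      (vm_comp (sub T) (eps T j) (eps T b) (eps T k) (c1 j b c) (c1 b k \<mu>))
      (c1 k i 1) = c1 j i (c * \<mu>)" for c
    by (simp add: vm_comp_cvm[OF N1 M1] eps_idx ix b ke)
  note eji = nice3_eps[OF N ji]
  note of = vm_of_cvm[OF N1 M1 eji]
  show ?thesis
    unfolding epi_push_level_def u
  proof (rule the_equality, goal_cases)
    case 1
    show ?case
      using f meas_scale[OF msys_meas[OF M1 eji], of \<mu>]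
      by (intro exI[of _ f] exI[of _ "c1 j b 1"] exI[of _ "c3 j b 1"]
          exI[of _ "\<lambda>f. \<mu> * w1 j i f"]) (auto simp: sub_vmeas quo_vmeas ten prod comp of epi_push_meas_scale[OF nice3_adm[OF N ji]])
  next
    case (2 y)
    then obtain f' c d \<rho> where 1: "f' \<in> test_fun (lev2 T j i)"
        "t2 i j f = t2 i j (\<lambda>x. c * d * f' x)"
        "\<rho> \<in> meas (lev1 T j i)" "vm_of (sub T) (eps T j) (eps T i) \<rho> = c1 j i (c * \<mu>)"
        "y = t3 i j (\<lambda>x. d * epi_push (level T j i) f' \<rho> x)"
      unfolding sub_vmeas quo_vmeas by (force simp: ten prod comp)
    obtain r where r: "\<rho> = (\<lambda>f. r * w1 j i f)" using msys_coord[OF N1 M1 eji 1(3)] .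
    have "r = c * \<mu>" using 1(4) eps_idx ix by (simp add: r of cvm_eq_iff[OF N1 M1])
    moreover have "f = (\<lambda>x. c * d * f' x)" using tf_inj[OF N2 M2 ix(1) b f 1(2)] .
    then have "epi_push (level T j i) f (w1 j i) = (\<lambda>x. c * d * epi_push (level T j i) f' (w1 j i) x)"
      using epi_push_scale[OF nice3_adm[OF N ji], of f' _ "c * d"] 1(1) dual_triples_meas(1)[OF D ji] by simp
    ultimately show ?case
      by (simp add: 1(5) r epi_push_meas_scale[OF nice3_adm[OF N ji]] mult_ac)
  qed
qed

text \<open>By \<open>uptriv\<close> the measure of mass \<open>1\<close> between \<open>j\<close>
  and \<open>k\<close> has coordinate \<open>1\<close>, so the scalar in the definition is
  \<open>d * \<nu>\<close>. Again the coordinates of the two factors enter through their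
  product.\<close>

lemma mono_pull_level_tf:
  assumes z: "uptriv (quo T) v3 (gam T k)" and k: "(j, k) \<in> le2 T" and f: "f \<in> test_fun (lev2 T j i)"
  shows "mono_pull_level T k b (c3 b k \<nu>) i j (t2 i j f) =
    t1 i j (\<lambda>x. \<nu> * mono_pull (level T j i) f x)"
proof -
  note g = nice3_gam[OF N k]
  have kg: "gam T k \<in> idx (quo T)" using le_idx(2)[OF N3 g] .
  have u: "vm_of (quo T) (gam T j) (gam T k) (unit_mass (lev3 T j k) (nul (lev3 T j k))) =
      c3 j k 1"
    using uptriv_unit_mass[OF N3 M3 z g le_refl[OF N3 kg]] vm_of_cvm_one[OF N3 M3 g] by simp
  have comp: "vm_comp (quo T) (gam T j) (gam T b) (gam T k) (c3 j b d) (c3 b k \<nu>) =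
      c3 j k (d * \<nu>)" for d
    by (simp add: vm_comp_cvm[OF N3 M3] gam_idx ix b kg)
  have eq: "c3 j k (d * \<nu>) = c3 j k c \<longleftrightarrow> d * \<nu> = c" for c d
    by (simp add: cvm_eq_iff[OF N3 M3] gam_idx ix kg)
  show ?thesis
    unfolding mono_pull_level_def u
  proof (rule the_equality, goal_cases)
    case 1
    show ?case
      using f
      by (intro exI[of _ f] exI[of _ "c1 j b 1"] exI[of _ "c3 j b 1"]
          exI[of _ \<nu>]) (auto simp: sub_vmeas quo_vmeas ten prod comp vm_scale_cvm[OF N3 M3])
  next
    case (2 y)
    then obtain f' c d where 1: "f' \<in> test_fun (lev2 T j i)"
        "t2 i j f = t2 i j (\<lambda>x. c * d * f' x)"
        "y = t1 i j (\<lambda>x. c * (d * \<nu> * mono_pull (level T j i) f' x))"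
      unfolding sub_vmeas quo_vmeas by (force simp: ten prod comp vm_scale_cvm[OF N3 M3] eq)
    have "f = (\<lambda>x. c * d * f' x)" using tf_inj[OF N2 M2 ix(1) b f 1(2)] .
    then show ?case
      using lin_scale[OF lin_mono_pull 1(1), of "level T j i" "c * d"] by (simp add: 1(3) mult_ac)
  qed
qed

lemma epi_pull_level_tf:
  assumes z: "cfsys (sub T) v1" and g: "g \<in> test_fun (lev3 T j i)"
  shows "epi_pull_level T b i j (t3 i j g) = t2 i j (epi_pull (level T j i) g)"
proof -
  have u: "vm_triv carr (sub T) (eps T j) (eps T b) = c1 j b 1"
    by (rule vm_triv_cvm[OF N1 M1 eps_idx[OF ix(1)] eps_idx[OF b] cfsys_unit_mass[OF N1 M1 z]])
  show ?thesis
    unfolding epi_pull_level_def u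
  proof (rule the_equality, goal_cases)
    case 1
    show ?case
      using g by (intro exI[of _ g] exI[of _ "c3 j b 1"]) (auto simp: quo_vmeas ten prod)
  next
    case (2 y)
    then obtain g' d where 1: "g' \<in> test_fun (lev3 T j i)"
        "t3 i j g = t3 i j (\<lambda>x. d * g' x)"
        "y = t2 i j (\<lambda>x. d * epi_pull (level T j i) g' x)"
      unfolding quo_vmeas by (force simp: ten prod)
    have "g = (\<lambda>x. d * g' x)" using tf_inj[OF N3 M3 gam_idx[OF ix(1)] gam_idx[OF b] g 1(2)] .
    then show ?case
      using lin_scale[OF lin_epi_pull 1(1), of "level T j i" d] by (simp add: 1(3))
  qed
qed

lemma mono_push_level_tf:
  assumes z: "dfsys (quo T) v3" and f: "f \<in> test_fun (lev1 T j i)"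
  shows "mono_push_level T b i j (t1 i j f) = t2 i j (mono_push (level T j i) f)"
proof -
  have u: "vm_triv nul (quo T) (gam T j) (gam T b) = c3 j b 1"
    by (rule vm_triv_cvm[OF N3 M3 gam_idx[OF ix(1)] gam_idx[OF b] dfsys_unit_mass[OF N3 M3 z]])
  show ?thesis
    unfolding mono_push_level_def u
  proof (rule the_equality, goal_cases)
    case 1
    show ?case
      using f by (intro exI[of _ f] exI[of _ "c1 j b 1"]) (auto simp: sub_vmeas ten prod)
  next
    case (2 y)
    then obtain f' c where 1: "f' \<in> test_fun (lev1 T j i)"
        "t1 i j f = t1 i j (\<lambda>x. c * f' x)"
        "y = t2 i j (\<lambda>x. c * mono_push (level T j i) f' x)"
      unfolding sub_vmeas by (force simp: ten prod)
    have "f = (\<lambda>x. c * f' x)" using tf_inj[OF N1 M1 eps_idx[OF ix(1)] eps_idx[OF b] f 1(2)] .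
    then show ?case
      using lin_scale[OF lin_mono_push 1(1), of "level T j i" c] by (simp add: 1(3))
  qed
qed

end

private lemma dir: "dirset (idx2 T) (le2 T)"
  using N2 by (simp add: nice2_def)

private lemma cof: "cofin (idx2 T) (le2 T) (idx2 T) (le2 T) (\<lambda>i. i)"
    "cofin (idx2 T) (le2 T) (idx (sub T)) (le (sub T)) (eps T)"
    "cofin (idx2 T) (le2 T) (idx (quo T)) (le (quo T)) (gam T)"
  unfolding cofin_def using le_refl[OF N2] nice3_eps[OF N] nice3_gam[OF N] nice3_eps_cofinal[OF N] nice3_gam_cofinal[OF N] by blast+

private lemma betw:
  assumes k: "k \<in> idx2 T"
  shows "\<And>i j. (j, k) \<in> le2 T \<and> (k, i) \<in> le2 T ==> (j, i) \<in> le2 T"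
    "\<And>i0 j0. i0 \<in> idx2 T ==> j0 \<in> idx2 T ==>
      \<exists>i j. ((j, k) \<in> le2 T \<and> (k, i) \<in> le2 T) \<and> (i0, i) \<in> le2 T \<and> (j, j0) \<in> le2 T"
    "\<And>i j i' j'. (j, k) \<in> le2 T \<and> (k, i) \<in> le2 T ==> (i, i') \<in> le2 T ==> (j', j) \<in> le2 T ==>
      (j', k) \<in> le2 T \<and> (k, i') \<in> le2 T"
proof -
  show "\<exists>i j. ((j, k) \<in> le2 T \<and> (k, i) \<in> le2 T) \<and> (i0, i) \<in> le2 T \<and> (j, j0) \<in> le2 T"
    if "i0 \<in> idx2 T" "j0 \<in> idx2 T" for i0 j0
    using le_upper[OF N2 k that(1)] le_lower[OF N2 k that(2)] by metis
qed (use le_trans[OF N2] in blast)+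

private lemma all_le:
  "\<And>i0 j0. i0 \<in> idx2 T ==> j0 \<in> idx2 T ==> \<exists>i j. (j, i) \<in> le2 T \<and> (i0, i) \<in> le2 T \<and> (j, j0) \<in> le2 T"
  "\<And>i j i' j'. (j, i) \<in> le2 T ==> (i, i') \<in> le2 T ==> (j', j) \<in> le2 T ==> (j', i') \<in> le2 T"
  using le_lower[OF N2] le_refl[OF N2] apply metis
  using le_trans[OF N2] by blast

lemma imap_epi_push:
  assumes k: "k \<in> idx2 T" and z: "lowtriv (sub T) v1 (eps T k)"
  shows "imap (idx2 T) (le2 T) (\<lambda>i j. (j, k) \<in> le2 T \<and> (k, i) \<in> le2 T)
    (mid T) v2 b (\<lambda>i. i) (quo T) v3 (gam T b) (gam T) (\<lambda>i j f x. \<mu> * epi_push (level T j i) f (w1 j i) x)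
    (epi_push_level T k b (c1 b k \<mu>))"
proof (rule imapI[OF dir L2 L3 b gam_idx[OF b] cof(1,3) betw[OF k]])
  show "lin (test_fun (lev2 T j i)) (\<lambda>f. epi_push (level T j i) f (w1 j i))"
    if "(j, k) \<in> le2 T \<and> (k, i) \<in> le2 T" for i j
    using lin_epi_push[OF nice3_adm[OF N betw(1)[OF k that]], of "w1 j i"] dual_triples_meas(1)[OF D betw(1)[OF k that]] by simp
  show "epi_push (level T j i) f (w1 j i) \<in> test_fun (lev3 T j i)"
    "epi_push_level T k b (c1 b k \<mu>) i j (t2 i j f) =
      t3 i j (\<lambda>x. \<mu> * epi_push (level T j i) f (w1 j i) x)"
    if "(j, k) \<in> le2 T \<and> (k, i) \<in> le2 T" "f \<in> test_fun (lev2 T j i)" for i j f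
    using lev_epi_push_test_fun[OF D betw(1)[OF k that(1)] that(2)]
      epi_push_level_tf[OF betw(1)[OF k that(1)] z conjunct1[OF that(1)] conjunct2[OF that(1)] that(2)] .
  fix l j i f assume le: "(l, j) \<in> le2 T" "(j, i) \<in> le2 T" and f: "f \<in> test_fun (lev2 T l i)"
  show "epi_push (level T l j) (rs (mid T) l j f) (w1 l j) =
      rs (quo T) (gam T l) (gam T j) (epi_push (level T l i) f (w1 l i))"
    if "(l, k) \<in> le2 T \<and> (k, j) \<in> le2 T"
    using epi_push_rs_comm[OF N le M1 z conjunct1[OF that] conjunct2[OF that] f] by simp
  show "epi_push (level T j i) (ps (mid T) v2 l j i f) (w1 j i) =
      ps (quo T) v3 (gam T l) (gam T j) (gam T i) (epi_push (level T l i) f (w1 l i))"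
    using epi_push_ps_comm[OF D le f] by simp
qed

lemma imap_mono_pull:
  assumes k: "k \<in> idx2 T" and z: "uptriv (quo T) v3 (gam T k)"
  shows "imap (idx2 T) (le2 T) (\<lambda>i j. (j, k) \<in> le2 T \<and> (k, i) \<in> le2 T)
    (mid T) v2 b (\<lambda>i. i) (sub T) v1 (eps T b) (eps T) (\<lambda>i j f x. \<nu> * mono_pull (level T j i) f x)
    (mono_pull_level T k b (c3 b k \<nu>))"
proof (rule imapI[OF dir L2 L1 b eps_idx[OF b] cof(1,2) betw[OF k]])
  show "mono_pull (level T j i) f \<in> test_fun (lev1 T j i)"
    "mono_pull_level T k b (c3 b k \<nu>) i j (t2 i j f) =
      t1 i j (\<lambda>x. \<nu> * mono_pull (level T j i) f x)"
    if "(j, k) \<in> le2 T \<and> (k, i) \<in> le2 T" "f \<in> test_fun (lev2 T j i)" for i j f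
    using lev_mono_pull_test_fun[OF D betw(1)[OF k that(1)] that(2)]
      mono_pull_level_tf[OF betw(1)[OF k that(1)] z conjunct1[OF that(1)] that(2)] .
  fix l j i f assume le: "(l, j) \<in> le2 T" "(j, i) \<in> le2 T" and f: "f \<in> test_fun (lev2 T l i)"
  show "mono_pull (level T l j) (rs (mid T) l j f) = rs (sub T) (eps T l) (eps T j) (mono_pull (level T l i) f)"
    by (rule mono_pull_rs_comm[OF N le])
  show "mono_pull (level T j i) (ps (mid T) v2 l j i f) = ps (sub T) v1 (eps T l) (eps T j) (eps T i) (mono_pull (level T l i) f)"
    if "(j, k) \<in> le2 T \<and> (k, i) \<in> le2 T"
    using mono_pull_ps_comm[OF D le z conjunct1[OF that] conjunct2[OF that] f] by simp
qed (assumption | rule lin_mono_pull)+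

lemma imap_epi_pull:
  assumes z: "cfsys (sub T) v1"
  shows "imap (idx2 T) (le2 T) (\<lambda>i j. (j, i) \<in> le2 T)
    (quo T) v3 (gam T b) (gam T) (mid T) v2 b (\<lambda>i. i) (\<lambda>i j. epi_pull (level T j i)) (epi_pull_level T b)"
proof -
  have "imap (idx2 T) (le2 T) (\<lambda>i j. (j, i) \<in> le2 T)
    (quo T) v3 (gam T b) (gam T) (mid T) v2 b (\<lambda>i. i) (\<lambda>i j f x. 1 * epi_pull (level T j i) f x) (epi_pull_level T b)"
  proof (rule imapI[OF dir L3 L2 gam_idx[OF b] b cof(3,1) _ all_le])
    show "epi_pull (level T j i) f \<in> test_fun (lev2 T j i)"
      "epi_pull_level T b i j (t3 i j f) = t2 i j (\<lambda>x. 1 * epi_pull (level T j i) f x)"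
      if "(j, i) \<in> le2 T" "f \<in> test_fun (lev3 T j i)" for i j f
      using lev_epi_pull_test_fun[OF D z that] epi_pull_level_tf[OF that(1) z that(2)] by simp_all
    fix l j i f assume le: "(l, j) \<in> le2 T" "(j, i) \<in> le2 T" and f: "f \<in> test_fun (lev3 T l i)"
    show "epi_pull (level T l j) (rs (quo T) (gam T l) (gam T j) f) = rs (mid T) l j (epi_pull (level T l i) f)"
      using epi_pull_rs_comm[OF N le] by simp
    show "epi_pull (level T j i) (ps (quo T) v3 (gam T l) (gam T j) (gam T i) f) = ps (mid T) v2 l j i (epi_pull (level T l i) f)"
      using epi_pull_ps_comm[OF D le z f] by simp
  qed (assumption | rule lin_epi_pull)+
  then show ?thesis by simp
qed

lemma imap_mono_push:
  assumes z: "dfsys (quo T) v3"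
  shows "imap (idx2 T) (le2 T) (\<lambda>i j. (j, i) \<in> le2 T)
    (sub T) v1 (eps T b) (eps T) (mid T) v2 b (\<lambda>i. i) (\<lambda>i j. mono_push (level T j i)) (mono_push_level T b)"
proof -
  have "imap (idx2 T) (le2 T) (\<lambda>i j. (j, i) \<in> le2 T)
    (sub T) v1 (eps T b) (eps T) (mid T) v2 b (\<lambda>i. i) (\<lambda>i j f x. 1 * mono_push (level T j i) f x) (mono_push_level T b)"
  proof (rule imapI[OF dir L1 L2 eps_idx[OF b] b cof(2,1) _ all_le])
    show "mono_push (level T j i) f \<in> test_fun (lev2 T j i)"
      "mono_push_level T b i j (t1 i j f) = t2 i j (\<lambda>x. 1 * mono_push (level T j i) f x)"
      if "(j, i) \<in> le2 T" "f \<in> test_fun (lev1 T j i)" for i j f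
      using lev_mono_push_test_fun[OF D z that] mono_push_level_tf[OF that(1) z that(2)] by simp_all
    fix l j i f assume le: "(l, j) \<in> le2 T" "(j, i) \<in> le2 T" and f: "f \<in> test_fun (lev1 T l i)"
    show "mono_push (level T l j) (rs (sub T) (eps T l) (eps T j) f) = rs (mid T) l j (mono_push (level T l i) f)"
      using mono_push_rs_comm[OF N le f] by simp
    show "mono_push (level T j i) (ps (sub T) v1 (eps T l) (eps T j) (eps T i) f) = ps (mid T) v2 l j i (mono_push (level T l i) f)"
      using mono_push_ps_comm[OF D le z f] by simp
  qed (assumption | rule lin_mono_push)+
  then show ?thesis by simp
qed

end

context
  fixes T T' \<chi>1 \<chi>2 \<chi>3 v1 v1' v2 v2' v3 v3' j i f
  assumes D: "dual_triples T T' \<chi>1 \<chi>2 \<chi>3 v1 v1' v2 v2' v3 v3'" and ji: "(j, i) \<in> le2 T"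
    and f: "f \<in> test_fun (lev2 T j i)"
begin

lemma four_scaled_epi_push:
  "four \<chi>3 (lev (sub T') (gam T i) (gam T j)) (v3 (gam T j) (gam T i)) (\<lambda>x. \<mu> * epi_push (level T j i) f (v1 (eps T j) (eps T i)) x) =
    (\<lambda>x. \<mu> * mono_pull (level T' i j) (four \<chi>2 (lev2 T' i j) (v2 j i) f) x)"
  using lin_scale[OF lin_four[OF dual_sys_pairing[OF dual_triples_sys(3)[OF D] nice3_gam[OF dual_triples_nice(1)[OF D] ji]]
        dual_triples_meas(3)[OF D ji]] lev_epi_push_test_fun[OF D ji f], of \<mu>] lev_four_epi_push[OF D ji f] by simp

lemma four_scaled_mono_pull:
  "four \<chi>1 (lev (quo T') (eps T i) (eps T j)) (v1 (eps T j) (eps T i)) (\<lambda>x. \<nu> * mono_pull (level T j i) f x) =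
    (\<lambda>x. \<nu> * epi_push (level T' i j) (four \<chi>2 (lev2 T' i j) (v2 j i) f) (v3' (gam T i) (gam T j)) x)"
  using lin_scale[OF lin_four[OF dual_sys_pairing[OF dual_triples_sys(1)[OF D] nice3_eps[OF dual_triples_nice(1)[OF D] ji]]
        dual_triples_meas(1)[OF D ji]] lev_mono_pull_test_fun[OF D ji f], of \<nu>] lev_four_mono_pull[OF D ji f] by simp

end

section \<open>Fourier transform and direct and inverse images\<close>

context
  fixes \<psi> :: "'k::{field,finite} \<Rightarrow> complex"
    and s1 :: "'k \<Rightarrow> _" and s2 :: "'k \<Rightarrow> _" and s3 :: "'k \<Rightarrow> _"
    and T T' v1 v1' v2 v2' v3 v3' b
  assumes T': "T' = dual_triple s1 s2 s3 T"
    and D: "dual_triples T T' (chi \<psi>) (chi \<psi>) (chi \<psi>) v1 v1' v2 v2' v3 v3'" and b: "b \<in> idx2 T"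
begin

private lemma sel: "sub T' = dual2 s3 (quo T)" "mid T' = dual2 s2 (mid T)" "quo T' = dual2 s1 (sub T)" "eps T' = gam T" "gam T' = eps T"
  by (simp_all add: T')

private lemma D': "dual_triples T' T (chi' \<psi>) (chi' \<psi>) (chi' \<psi>) v3' v3 v2' v2 v1' v1"
  by (rule dual_triples_sym[OF D])

private lemma S: "dual_sys (sub T) (dual2 s1 (sub T)) (chi \<psi>) v1 v1'" "dual_sys (mid T) (dual2 s2 (mid T)) (chi \<psi>) v2 v2'"
  "dual_sys (quo T) (dual2 s3 (quo T)) (chi \<psi>) v3 v3'"
  using dual_triples_sys[OF D] by (simp_all add: sel)

private lemma b': "b \<in> idx2 T'"
  using b by (simp add: sel)

private lemma betw_le: "(j, k) \<in> le2 T \<and> (k, i) \<in> le2 T ==> (j, i) \<in> le2 T"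
  using le_trans[OF nice3_nice2(2)[OF dual_triples_nice(1)[OF D]]] by blast

private lemma idx_le: "idx (dual2 s2 (mid T)) = idx2 T" "le (dual2 s2 (mid T)) = (le2 T)\<inverse>"
  by simp_all

lemma vm_dual_sub: "k \<in> idx2 T ==> vm_dual s1 (sub T) (eps T b) (eps T k) (cvm (sub T) v1 (eps T b) (eps T k) c) =
    cvm (dual2 s1 (sub T)) v1' (eps T b) (eps T k) c"
  and vm_dual_quo: "k \<in> idx2 T ==> vm_dual s3 (quo T) (gam T b) (gam T k) (cvm (quo T) v3 (gam T b) (gam T k) c) =
    cvm (dual2 s3 (quo T)) v3' (gam T b) (gam T k) c"
  using vm_dual_cvm[OF S(1) eps_idx[OF D b b] eps_idx[OF D b b] eps_idx[OF D b]]
    vm_dual_cvm[OF S(3) gam_idx[OF D b b] gam_idx[OF D b b] gam_idx[OF D b]] by simp_all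

context
  fixes k
  assumes k: "k \<in> idx2 T"
begin

private lemma k': "k \<in> idx2 T'"
  using k by (simp add: sel)

context
  assumes z: "lowtriv (sub T) v1 (eps T k)"
begin

private lemma dual_up: "uptriv (quo T') v1' (gam T' k)"
  using dual_lowtriv[OF S(1) z] by (simp add: sel)

private lemmas low_map = imap_epi_push[OF D b k z] and low_dual_map = imap_mono_pull[OF D' b' k' dual_up, unfolded sel]

lemma fourier_epi_push2:
  assumes x: "x \<in> D_space (mid T) b"
  shows "fourier \<psi> s3 (quo T) (gam T b) (epi_push2 T k b x (cvm (sub T) v1 (eps T b) (eps T k) \<mu>)) =
      mono_pull2 T' k b (fourier \<psi> s2 (mid T) b x) (cvm (dual2 s1 (sub T)) v1' (eps T b) (eps T k) \<mu>)"
    and "fourier \<psi> s3 (quo T) (gam T b) (epi_push2 T k b x (cvm (sub T) v1 (eps T b) (eps T k) \<mu>)) \<in> D_space (dual2 s3 (quo T)) (gam T b)"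
  unfolding epi_push2_def mono_pull2_def sel
  by (rule fourier_lim_image[OF S(2,3) low_map low_dual_map idx_le refl refl k _ x],
      rule four_scaled_epi_push[OF D betw_le, unfolded sel], assumption, assumption)+

private lemma low_level: "(j, k) \<in> le2 T \<and> (k, i) \<in> le2 T ==> h \<in> test_fun (lev (dual2 s2 (mid T)) i j) ==>
    four (chi' \<psi>) (lev3 T j i) (v3' (gam T i) (gam T j)) (\<lambda>x. \<mu> * mono_pull (level T' i j) h x) =
        (\<lambda>x. \<mu> * epi_push (level T j i) (four (chi' \<psi>) (lev2 T j i) (v2' i j) h) (v1 (eps T j) (eps T i)) x)"
  using four_scaled_mono_pull[OF D', unfolded sel, of i j h \<mu>] betw_le[of j k i] by simp

lemma fourier_epi_pull2_dist:
  assumes X: "X \<in> D'_space (quo T) (gam T b)"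
  shows "fourier_dist \<psi> s2 (mid T) b (epi_pull2_dist T k b X (cvm (sub T) v1 (eps T b) (eps T k) \<mu>)) =
      mono_push2_dist T' k b (fourier_dist \<psi> s3 (quo T) (gam T b) X) (cvm (dual2 s1 (sub T)) v1' (eps T b) (eps T k) \<mu>)"
    and "fourier_dist \<psi> s2 (mid T) b (epi_pull2_dist T k b X (cvm (sub T) v1 (eps T b) (eps T k) \<mu>)) \<in> D'_space (dual2 s2 (mid T)) b"
  unfolding epi_pull2_dist_def mono_push2_dist_def sel
  \<comment> \<open>\<open>force\<close> checks that being a level around \<open>k\<close>, read on
    the dual with the reversed order, is the original condition with the two indices
    exchanged.\<close>
  by (rule fourier_conj_image[OF S(2,3) low_map[of \<mu>] low_dual_map[of \<mu>] idx_le _ low_level X, unfolded conj_assoc], force, assumption, assumption)+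

end

context
  assumes z: "uptriv (quo T) v3 (gam T k)"
begin

private lemma dual_low: "lowtriv (sub T') v3' (eps T' k)"
  using dual_uptriv[OF S(3) z] by (simp add: sel)

private lemmas up_map = imap_mono_pull[OF D b k z] and up_dual_map = imap_epi_push[OF D' b' k' dual_low, unfolded sel]

lemma fourier_mono_pull2:
  assumes x: "x \<in> D_space (mid T) b"
  shows "fourier \<psi> s1 (sub T) (eps T b) (mono_pull2 T k b x (cvm (quo T) v3 (gam T b) (gam T k) \<nu>)) =
      epi_push2 T' k b (fourier \<psi> s2 (mid T) b x) (cvm (dual2 s3 (quo T)) v3' (gam T b) (gam T k) \<nu>)"
    and "fourier \<psi> s1 (sub T) (eps T b) (mono_pull2 T k b x (cvm (quo T) v3 (gam T b) (gam T k) \<nu>)) \<in> D_space (dual2 s1 (sub T)) (eps T b)"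
  unfolding epi_push2_def mono_pull2_def sel
  by (rule fourier_lim_image[OF S(2,1) up_map up_dual_map idx_le refl refl k _ x],
      rule four_scaled_mono_pull[OF D betw_le, unfolded sel], assumption, assumption)+

private lemma up_level: "(j, k) \<in> le2 T \<and> (k, i) \<in> le2 T ==> h \<in> test_fun (lev (dual2 s2 (mid T)) i j) ==>
    four (chi' \<psi>) (lev1 T j i) (v1' (eps T i) (eps T j))
        (\<lambda>x. \<nu> * epi_push (level T' i j) h (v3' (gam T i) (gam T j)) x) =
        (\<lambda>x. \<nu> * mono_pull (level T j i) (four (chi' \<psi>) (lev2 T j i) (v2' i j) h) x)"
  using four_scaled_epi_push[OF D', unfolded sel, of i j h \<nu>] betw_le[of j k i] by simp

lemma fourier_mono_push2_dist:
  assumes X: "X \<in> D'_space (sub T) (eps T b)"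
  shows "fourier_dist \<psi> s2 (mid T) b (mono_push2_dist T k b X (cvm (quo T) v3 (gam T b) (gam T k) \<nu>)) =
      epi_pull2_dist T' k b (fourier_dist \<psi> s1 (sub T) (eps T b) X) (cvm (dual2 s3 (quo T)) v3' (gam T b) (gam T k) \<nu>)"
    and "fourier_dist \<psi> s2 (mid T) b (mono_push2_dist T k b X (cvm (quo T) v3 (gam T b) (gam T k) \<nu>)) \<in> D'_space (dual2 s2 (mid T)) b"
  unfolding epi_pull2_dist_def mono_push2_dist_def sel
  by (rule fourier_conj_image[OF S(2,1) up_map[of \<nu>] up_dual_map[of \<nu>] idx_le _ up_level X, unfolded conj_assoc], force, assumption, assumption)+

end

end

context
  assumes z: "cfsys (sub T) v1"
begin

private lemma dual_df: "dfsys (quo T') v1'"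
  using dual_cfsys[OF S(1) z] by (simp add: sel)

private lemmas cf_map = imap_epi_pull[OF D b z] and cf_dual_map = imap_mono_push[OF D' b' dual_df, unfolded sel]

lemma fourier_epi_pull2:
  assumes x: "x \<in> D_space (quo T) (gam T b)"
  shows "fourier \<psi> s2 (mid T) b (epi_pull2 T b x) = mono_push2 T' b (fourier \<psi> s3 (quo T) (gam T b) x)"
    and "fourier \<psi> s2 (mid T) b (epi_pull2 T b x) \<in> D_space (dual2 s2 (mid T)) b"
  unfolding epi_pull2_def mono_push2_def sel
  by (rule fourier_direct_image[OF S(3,2) cf_map cf_dual_map _ x], rule lev_four_epi_pull[OF D z, unfolded sel], assumption, assumption)+

private lemma cf_level: "(j, i) \<in> le2 T ==> h \<in> test_fun (lev (dual2 s3 (quo T)) (gam T i) (gam T j)) ==>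
    four (chi' \<psi>) (lev2 T j i) (v2' i j) (mono_push (level T' i j) h) =
        epi_pull (level T j i) (four (chi' \<psi>) (lev3 T j i) (v3' (gam T i) (gam T j)) h)"
  using lev_four_mono_push[OF D' dual_df, unfolded sel, of i j h] by simp

lemma fourier_epi_push2_dist:
  assumes X: "X \<in> D'_space (mid T) b"
  shows "fourier_dist \<psi> s3 (quo T) (gam T b) (epi_push2_dist T b X) = mono_pull2_dist T' b (fourier_dist \<psi> s2 (mid T) b X)"
    and "fourier_dist \<psi> s3 (quo T) (gam T b) (epi_push2_dist T b X) \<in> D'_space (dual2 s3 (quo T)) (gam T b)"
  unfolding epi_push2_dist_def mono_pull2_dist_def sel
  by (rule fourier_conj_image[OF S(3,2) cf_map cf_dual_map idx_le _ cf_level X], force, assumption, assumption)+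

end

context
  assumes z: "dfsys (quo T) v3"
begin

private lemma dual_cf: "cfsys (sub T') v3'"
  using dual_dfsys[OF S(3) z] by (simp add: sel)

private lemmas df_map = imap_mono_push[OF D b z] and df_dual_map = imap_epi_pull[OF D' b' dual_cf, unfolded sel]

lemma fourier_mono_push2:
  assumes x: "x \<in> D_space (sub T) (eps T b)"
  shows "fourier \<psi> s2 (mid T) b (mono_push2 T b x) = epi_pull2 T' b (fourier \<psi> s1 (sub T) (eps T b) x)"
    and "fourier \<psi> s2 (mid T) b (mono_push2 T b x) \<in> D_space (dual2 s2 (mid T)) b"
  unfolding epi_pull2_def mono_push2_def sel
  by (rule fourier_direct_image[OF S(1,2) df_map df_dual_map _ x], rule lev_four_mono_push[OF D z, unfolded sel], assumption, assumption)+

private lemma df_level: "(j, i) \<in> le2 T ==> h \<in> test_fun (lev (dual2 s1 (sub T)) (eps T i) (eps T j)) ==>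
    four (chi' \<psi>) (lev2 T j i) (v2' i j) (epi_pull (level T' i j) h) =
        mono_push (level T j i) (four (chi' \<psi>) (lev1 T j i) (v1' (eps T i) (eps T j)) h)"
  using lev_four_epi_pull[OF D' dual_cf, unfolded sel, of i j h] by simp

lemma fourier_mono_pull2_dist:
  assumes X: "X \<in> D'_space (mid T) b"
  shows "fourier_dist \<psi> s1 (sub T) (eps T b) (mono_pull2_dist T b X) = epi_push2_dist T' b (fourier_dist \<psi> s2 (mid T) b X)"
    and "fourier_dist \<psi> s1 (sub T) (eps T b) (mono_pull2_dist T b X) \<in> D'_space (dual2 s1 (sub T)) (eps T b)"
  unfolding epi_push2_dist_def mono_pull2_dist_def sel
  by (rule fourier_conj_image[OF S(1,2) df_map df_dual_map idx_le _ df_level X], force, assumption, assumption)+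

end

end

section \<open>Systems adapted to each case, and the eight assertions\<close>

lemma C2_space_lev:
  assumes "C2_space s E" "(i, j) \<in> le E"
  shows "carr (lev E i j) = fil E j" (is ?A) "nul (lev E i j) = fil E i" "fil E i \<subseteq> fil E j" "0 \<in> fil E i"
proof -
  show ?A "nul (lev E i j) = fil E i" "fil E i \<subseteq> fil E j"
    using assms by (auto simp: C2_space_def filtered_def)
  have "i \<in> idx E" using assms unfolding C2_space_def filtered_def partial_order_on_def preorder_on_def refl_on_def by blast
  then have "nul E \<subseteq> fil E i" unfolding nul_def by blast
  then show "0 \<in> fil E i" using assms(1) by (auto simp: C2_space_def)
qed

lemma lowtriv_exists:
  assumes E: "nice2 E" and C: "C2_space s E" and k: "fil E k = UNIV"
  shows "\<exists>v. msys E v \<and> lowtriv E v k"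
proof -
  have z: "carr (lev E j i) = nul (lev E j i)" if "(k, j) \<in> le E" "(j, i) \<in> le E" for j i
  proof -
    have "fil E j = UNIV" using C2_space_lev(3)[OF C that(1)] k by blast
    then have "fil E i = UNIV" using C2_space_lev(3)[OF C that(2)] by blast
    then show ?thesis using C2_space_lev(1,2)[OF C that(2)] \<open>fil E j = UNIV\<close> by simp
  qed
  have zk: "carr (lev E k i) = nul (lev E k i)" if "(k, i) \<in> le E" for i using z[OF le_refl[OF E le_idx(1)[OF E that]] that] .
  obtain v where "msys E v" "\<forall>i j. (k, j) \<in> le E \<longrightarrow> (j, i) \<in> le E \<longrightarrow> v j i (indicator (nul (lev E j i))) = 1"
    using msys_normalised_lower[OF E zk] by blast
  then show ?thesis using z unfolding lowtriv_def by blast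
qed

lemma uptriv_exists:
  assumes E: "nice2 E" and C: "C2_space s E" and k: "fil E k = {0}"
  shows "\<exists>v. msys E v \<and> uptriv E v k"
proof -
  have z: "carr (lev E i j) = nul (lev E i j)" if "(i, j) \<in> le E" "(j, k) \<in> le E" for i j
  proof -
    have "fil E j = {0}" using C2_space_lev(3,4)[OF C that(2)] k by blast
    then have "fil E i = {0}" using C2_space_lev(3,4)[OF C that(1)] by blast
    then show ?thesis using C2_space_lev(1,2)[OF C that(1)] \<open>fil E j = {0}\<close> by simp
  qed
  have zk: "carr (lev E i k) = nul (lev E i k)" if "(i, k) \<in> le E" for i using z[OF that le_refl[OF E le_idx(2)[OF E that]]] .
  obtain v where "msys E v" "\<forall>i j. (i, j) \<in> le E \<longrightarrow> (j, k) \<in> le E \<longrightarrow> v i j (indicator (nul (lev E i j))) = 1"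
    using msys_normalised_upper[OF E zk] by blast
  then show ?thesis using z unfolding uptriv_def by blast
qed

text \<open>The system of measures is chosen after the case is known, in the first four assertions
  even after \<open>k\<close> and the virtual measure, and it does not occur in the conclusion. Each
  equation comes with membership in the target space, so that the values of \<open>THE\<close> on
  its two sides are genuine elements.\<close>

theorem proposition38:
  fixes \<psi> :: "'k::{field,finite} \<Rightarrow> complex"
    and s1 :: "'k \<Rightarrow> 'v1::ab_group_add \<Rightarrow> 'v1"
    and s2 :: "'k \<Rightarrow> 'v2::ab_group_add \<Rightarrow> 'v2"
    and s3 :: "'k \<Rightarrow> 'v3::ab_group_add \<Rightarrow> 'v3"
    and E1 :: "('i1, 'a1, 'v1) c2" and E2 :: "('i2, 'a2, 'v2) c2" and E3 :: "('i3, 'a3, 'v3) c2"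
    and \<alpha> :: "'v1 \<Rightarrow> 'v2" and \<beta> :: "'v2 \<Rightarrow> 'v3" and \<epsilon> :: "'i2 \<Rightarrow> 'i1" and \<gamma> :: "'i2 \<Rightarrow> 'i3"
    and T :: "('i1, 'a1, 'v1, 'i2, 'a2, 'v2, 'i3, 'a3, 'v3) c2_triple"
    and T' :: "('i3, 'a3, 'v3 \<Rightarrow> 'k, 'i2, 'a2, 'v2 \<Rightarrow> 'k, 'i1, 'a1, 'v1 \<Rightarrow> 'k) c2_triple"
    and b :: 'i2
  assumes "nontrivial_character \<psi>"
    and "vector_space s1" and "vector_space s2" and "vector_space s3"
    and "T = \<lparr>emb = \<alpha>, epi = \<beta>, sub = E1, mid = E2, quo = E3, eps = \<epsilon>, gam = \<gamma>\<rparr>"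
    and "admissible2 s1 s2 s3 T"
    and "complete_C2 E1" and "complete_C2 E2" and "complete_C2 E3"
    and "T' = dual_triple s1 s2 s3 T"
    and "b \<in> idx E2"
  shows
    "(cC2 E1 \<longrightarrow> (\<forall>k\<in>idx E2. fil E1 (\<epsilon> k) = UNIV \<longrightarrow>
       (\<forall>f\<in>D_space E2 b. \<forall>m\<in>vmeas E1 (\<epsilon> b) (\<epsilon> k).
          fourier \<psi> s3 E3 (\<gamma> b) (epi_push2 T k b f m) =
            mono_pull2 T' k b (fourier \<psi> s2 E2 b f) (vm_dual s1 E1 (\<epsilon> b) (\<epsilon> k) m) \<and>
          fourier \<psi> s3 E3 (\<gamma> b) (epi_push2 T k b f m) \<in> D_space (dual2 s3 E3) (\<gamma> b))))
     \<and>
     (dC2 E3 \<longrightarrow> (\<forall>k\<in>idx E2. fil E3 (\<gamma> k) = {0} \<longrightarrow>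
       (\<forall>f\<in>D_space E2 b. \<forall>n\<in>vmeas E3 (\<gamma> b) (\<gamma> k).
          fourier \<psi> s1 E1 (\<epsilon> b) (mono_pull2 T k b f n) =
            epi_push2 T' k b (fourier \<psi> s2 E2 b f) (vm_dual s3 E3 (\<gamma> b) (\<gamma> k) n) \<and>
          fourier \<psi> s1 E1 (\<epsilon> b) (mono_pull2 T k b f n) \<in> D_space (dual2 s1 E1) (\<epsilon> b))))
     \<and>
     (cC2 E1 \<longrightarrow> (\<forall>k\<in>idx E2. fil E1 (\<epsilon> k) = UNIV \<longrightarrow>
       (\<forall>G\<in>D'_space E3 (\<gamma> b). \<forall>m\<in>vmeas E1 (\<epsilon> b) (\<epsilon> k).
          fourier_dist \<psi> s2 E2 b (epi_pull2_dist T k b G m) =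
            mono_push2_dist T' k b (fourier_dist \<psi> s3 E3 (\<gamma> b) G) (vm_dual s1 E1 (\<epsilon> b) (\<epsilon> k) m) \<and>
          fourier_dist \<psi> s2 E2 b (epi_pull2_dist T k b G m) \<in> D'_space (dual2 s2 E2) b)))
     \<and>
     (dC2 E3 \<longrightarrow> (\<forall>k\<in>idx E2. fil E3 (\<gamma> k) = {0} \<longrightarrow>
       (\<forall>G\<in>D'_space E1 (\<epsilon> b). \<forall>n\<in>vmeas E3 (\<gamma> b) (\<gamma> k).
          fourier_dist \<psi> s2 E2 b (mono_push2_dist T k b G n) =
            epi_pull2_dist T' k b (fourier_dist \<psi> s1 E1 (\<epsilon> b) G) (vm_dual s3 E3 (\<gamma> b) (\<gamma> k) n) \<and>
          fourier_dist \<psi> s2 E2 b (mono_push2_dist T k b G n) \<in> D'_space (dual2 s2 E2) b)))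
     \<and>
     (cfC2 E1 \<longrightarrow> (\<forall>g\<in>D_space E3 (\<gamma> b).
       fourier \<psi> s2 E2 b (epi_pull2 T b g) = mono_push2 T' b (fourier \<psi> s3 E3 (\<gamma> b) g) \<and>
       fourier \<psi> s2 E2 b (epi_pull2 T b g) \<in> D_space (dual2 s2 E2) b))
     \<and>
     (dfC2 E3 \<longrightarrow> (\<forall>g\<in>D_space E1 (\<epsilon> b).
       fourier \<psi> s2 E2 b (mono_push2 T b g) = epi_pull2 T' b (fourier \<psi> s1 E1 (\<epsilon> b) g) \<and>
       fourier \<psi> s2 E2 b (mono_push2 T b g) \<in> D_space (dual2 s2 E2) b))
     \<and>
     (cfC2 E1 \<longrightarrow> (\<forall>G\<in>D'_space E2 b.
       fourier_dist \<psi> s3 E3 (\<gamma> b) (epi_push2_dist T b G) =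
         mono_pull2_dist T' b (fourier_dist \<psi> s2 E2 b G) \<and>
       fourier_dist \<psi> s3 E3 (\<gamma> b) (epi_push2_dist T b G) \<in> D'_space (dual2 s3 E3) (\<gamma> b)))
     \<and>
     (dfC2 E3 \<longrightarrow> (\<forall>G\<in>D'_space E2 b.
       fourier_dist \<psi> s1 E1 (\<epsilon> b) (mono_pull2_dist T b G) =
         epi_push2_dist T' b (fourier_dist \<psi> s2 E2 b G) \<and>
       fourier_dist \<psi> s1 E1 (\<epsilon> b) (mono_pull2_dist T b G) \<in> D'_space (dual2 s1 E1) (\<epsilon> b)))"
proof -
  note \<psi> = assms(1) and V = assms(2-4) and A = assms(6) and T' = assms(10)
  have sel: "sub T = E1" "mid T = E2" "quo T = E3" "eps T = \<epsilon>" "gam T = \<gamma>" by (simp_all add: assms(5))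
  have b: "b \<in> idx (mid T)" using assms(11) by (simp add: sel)
  have C: "C2_space s1 E1" "C2_space s3 E3" using A by (auto simp: admissible2_def sel)
  have N1: "nice2 E1" and N3: "nice2 E3"
    using C2_space_nice2(1)[OF V(1) C(1)] C2_space_nice2(1)[OF V(3) C(2)] .
  \<comment> \<open>Arbitrary systems, used on the one of \<open>E1\<close> and \<open>E3\<close> on
    which the case at hand prescribes no normalisation.\<close>
  obtain u1 u3 where u: "msys E1 u1" "msys E3 u3" using msys_exists[OF N1] msys_exists[OF N3] by blast
  define DT where "DT = dual_triples T T' (chi \<psi>) (chi \<psi>) (chi \<psi>)"
  have ex: "\<exists>v1' v2 v2' v3'. DT v1 v1' v2 v2' v3 v3'" if "msys E1 v1" "msys E3 v3" for v1 v3
    using dual_triples_exist[OF \<psi> V A, of v1 v3] that by (simp add: sel T' DT_def)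
  have low: "\<exists>v1 v1' v2 v2' v3 v3' \<mu>. DT v1 v1' v2 v2' v3 v3' \<and> k \<in> idx (mid T) \<and> lowtriv E1 v1 (\<epsilon> k) \<and> m = cvm E1 v1 (\<epsilon> b) (\<epsilon> k) \<mu>"
    if k: "k \<in> idx E2" "fil E1 (\<epsilon> k) = UNIV" and m: "m \<in> vmeas E1 (\<epsilon> b) (\<epsilon> k)" for k m
  proof -
    obtain v1 where v1: "msys E1 v1" "lowtriv E1 v1 (\<epsilon> k)" using lowtriv_exists[OF N1 C(1) k(2)] by blast
    obtain v1' v2 v2' v3' where D: "DT v1 v1' v2 v2' u3 v3'" using ex[OF v1(1) u(2)] by blast
    note e = eps_idx[OF D[unfolded DT_def] b, unfolded sel]
    obtain \<mu> where "m = cvm E1 v1 (\<epsilon> b) (\<epsilon> k) \<mu>" using vmeas_cvm[OF N1 v1(1) e e[OF k(1)], of b] assms(11) m by auto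
    then show ?thesis using D v1(2) k(1) unfolding sel by blast
  qed
  have up: "\<exists>v1 v1' v2 v2' v3 v3' \<nu>. DT v1 v1' v2 v2' v3 v3' \<and> k \<in> idx (mid T) \<and> uptriv E3 v3 (\<gamma> k) \<and> n = cvm E3 v3 (\<gamma> b) (\<gamma> k) \<nu>"
    if k: "k \<in> idx E2" "fil E3 (\<gamma> k) = {0}" and n: "n \<in> vmeas E3 (\<gamma> b) (\<gamma> k)" for k n
  proof -
    obtain v3 where v3: "msys E3 v3" "uptriv E3 v3 (\<gamma> k)" using uptriv_exists[OF N3 C(2) k(2)] by blast
    obtain v1' v2 v2' v3' where D: "DT u1 v1' v2 v2' v3 v3'" using ex[OF u(1) v3(1)] by blast
    note g = gam_idx[OF D[unfolded DT_def] b, unfolded sel]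
    obtain \<nu> where "n = cvm E3 v3 (\<gamma> b) (\<gamma> k) \<nu>" using vmeas_cvm[OF N3 v3(1) g g[OF k(1)], of b] assms(11) n by auto
    then show ?thesis using D v3(2) k(1) unfolding sel by blast
  qed
  have cf: "\<exists>v1 v1' v2 v2' v3 v3'. DT v1 v1' v2 v2' v3 v3' \<and> cfsys E1 v1" if "cfC2 E1"
    using msys_compact[OF N1] that ex[OF _ u(2)] unfolding cfC2_def cfsys_def by fast
  have df: "\<exists>v1 v1' v2 v2' v3 v3'. DT v1 v1' v2 v2' v3 v3' \<and> dfsys E3 v3" if "dfC2 E3"
    using msys_discrete[OF N3] that ex[OF u(1)] unfolding dfC2_def dfsys_def by fast
  show ?thesis
  proof (intro conjI[OF impI] impI ballI, goal_cases)
    case (1 k f m) then show ?case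
      using low[of k m] fourier_epi_push2[OF T' _ b] vm_dual_sub[OF T' _ b] unfolding DT_def sel by metis
  next
    case (2 k f n) then show ?case
      using up[of k n] fourier_mono_pull2[OF T' _ b] vm_dual_quo[OF T' _ b] unfolding DT_def sel by metis
  next
    case (3 k G m) then show ?case
      using low[of k m] fourier_epi_pull2_dist[OF T' _ b] vm_dual_sub[OF T' _ b] unfolding DT_def sel by metis
  next
    case (4 k G n) then show ?case
      using up[of k n] fourier_mono_push2_dist[OF T' _ b] vm_dual_quo[OF T' _ b] unfolding DT_def sel by metis
  next
    case 5 then show ?case using cf fourier_epi_pull2[OF T' _ b] unfolding DT_def sel by blast
  next
    case 6 then show ?case using df fourier_mono_push2[OF T' _ b] unfolding DT_def sel by blast
  next
    case 7 then show ?case using cf fourier_epi_push2_dist[OF T' _ b] unfolding DT_def sel by blast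
  next
    case 8 then show ?case using df fourier_mono_pull2_dist[OF T' _ b] unfolding DT_def sel by blast
  qed
qed

end
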